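(* Let $p=3$, $\lambda\ge 0$, $\beta>\frac32$, and fix $\sigma\in(\frac12,\frac32)$. There exist constants $C_{1,\beta}, C_{2,\beta}$ such that the following holds. Let $u$ be a real-valued solution of $\partial_t^2 u+H_p u=0$ on $\mathfrak M$ with $u(t)\in D(H_p,\gamma_\sigma)$ for all $t$ in its interval of existence, with initial data $u|_{t=0}=f$, $\partial_t u|_{t=0}=h$, and let $\sqrt E=\|u\|_{\mathcal H}$, i.e. $E$ is the conserved energy of $u$. Then for every $T\ge 0$ in the interval of existence of $u$, $$\int_0^T \Big\|\Big(1+\big(\tfrac{r_*-\alpha_*}{2M}\big)^2\Big)^{-\beta/2}u\Big\|^2dt \le C_{1,\beta}\,\sqrt{E}\,\big(\sqrt{E}+\|f\|_{L^2}\big),$$ $$\int_0^T \int_{\mathfrak M} \lambda\Big(1-\frac{2M}{r}\Big) r^{-1-p}|u|^{p+1}\, d^3\mu\, dt \le C_{2,\beta}\,\sqrt{E}\,\big(\sqrt{E}+\|f\|_{L^2}\big).$$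
   Context: Fix $M>0$. The coordinate $r_*\in\mathbb R$ is related to $r\in(2M,\infty)$ by $r_*=r+2M\log\frac{r-2M}{2M}$, so $r$ is an increasing function of $r_*$ with $\frac{dr}{dr_*}=1-\frac{2M}{r}$. Let $\mathfrak M=\mathbb R\times S^2$ with metric $dr_*^2+ds_{S^2}^2$ and measure $d^3\mu=dr_*\,d^2\omega$; $\|\cdot\|=\|\cdot\|_{L^2}$ and $\langle\cdot,\cdot\rangle$ are the norm and inner product of $L^2(\mathfrak M,d^3\mu)$. Let $V=\frac{2M}{r^3}(1-\frac{2M}{r})$ and $H=-\partial_{r_*}^2+V-\frac1{r^2}(1-\frac{2M}{r})\Delta_{S^2}$, a self-adjoint operator on its natural domain $D(H)\subset L^2(\mathfrak M)$, and $H_p=H+\lambda(1-\frac{2M}{r})r^{1-p}|u|^{p-1}$. The conserved energy is $\|u\|_{\mathcal H}^2=\|\dot u\|^2+\|\partial_{r_*}u\|^2+\langle u,Vu\rangle+\langle u,-\frac1{r^2}(1-\frac{2M}{r})\Delta_{S^2}u\rangle+\frac{2}{p+1}\langle u,\lambda r^{1-p}(1-\frac{2M}{r})|u|^{p-1}u\rangle$, constant in $t$ along solutions. Let $\alpha_*=3M+2M\log\frac12$ (the value of $r_*$ at $r=3M$), $g_\sigma(r_* )=\int_0^{(r_*-\alpha_* )/2M}(1+\tau^2)^{-\sigma}d\tau$, and $\gamma_\sigma=-\frac i2(g_\sigma\partial_{r_*}+\partial_{r_*}g_\sigma)$. $D(A)$ is the domain of an operator $A$, and $D(H_p,\gamma_\sigma)=\{u: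 u,H_pu\in D(\gamma_\sigma),\ u,\gamma_\sigma u\in D(H),\ u^p\in L^2\}$. *)

theory Defs
  imports "HOL-Analysis.Analysis"
begin

section \<open>The manifold \<open>\<real> \<times> S\<^sup>2\<close> and its \<open>L\<^sup>2\<close> space\<close>

text \<open>
  A point of \<open>\<real> \<times> S\<^sup>2\<close> is a pair \<open>(s, \<omega>)\<close> with \<open>s\<close> the coordinate \<open>r\<^sub>*\<close> and \<open>\<omega>\<close> a unit vector of
  \<open>\<real>\<^sup>3\<close>. Functions are total on \<open>\<real> \<times> \<real>\<^sup>3\<close>; since the measure below is carried by \<open>\<real> \<times> S\<^sup>2\<close>, their
  values elsewhere are irrelevant.
\<close>

type_synonym point = "real \<times> (real ^ 3)"
type_synonym field = "point \<Rightarrow> complex"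

text \<open>
  The surface measure of the unit sphere in cone form, \<open>\<omega>(A) = 3 \<cdot> vol {t x | 0 < t < 1, x \<in> A}\<close>
  (total mass \<open>4 \<pi>\<close>).
\<close>

definition sphere_measure :: "(real ^ 3) measure" where
  "sphere_measure =
     distr (density lborel (\<lambda>x. 3 * indicator (ball 0 1) x)) borel (\<lambda>x. x /\<^sub>R norm x)"

definition mu :: "point measure" where
  "mu = lborel \<Otimes>\<^sub>M sphere_measure"

definition L2 :: "field set" where
  "L2 = {u \<in> borel_measurable mu. integrable mu (\<lambda>x. (norm (u x))\<^sup>2)}"

definition L2_norm :: "field \<Rightarrow> real" where
  "L2_norm u = sqrt (\<integral>x. (norm (u x))\<^sup>2 \<partial>mu)"

definition L2_inner :: "field \<Rightarrow> field \<Rightarrow> complex" where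
  "L2_inner u v = (\<integral>x. cnj (u x) * v x \<partial>mu)"

definition loc_integrable :: "field \<Rightarrow> bool" where
  "loc_integrable u \<longleftrightarrow>
     u \<in> borel_measurable mu \<and> (\<forall>R. set_integrable mu ({-R..R} \<times> UNIV) u)"

section \<open>Differential expressions on test functions\<close>

definition dir_deriv :: "point \<Rightarrow> field \<Rightarrow> field" where
  "dir_deriv w f = (\<lambda>x. frechet_derivative f (at x) w)"

text \<open>\<open>C\<^sup>\<infinity>\<close>: every iterated directional derivative exists and is Frechet differentiable everywhere.\<close>

definition smooth :: "field \<Rightarrow> bool" where
  "smooth f \<longleftrightarrow> (\<forall>ws. foldr dir_deriv ws f differentiable_on UNIV)"

text \<open>
  Restricted to \<open>\<real> \<times> S\<^sup>2\<close> these are exactly the smooth compactly supported functions there: a smooth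
  function on this closed submanifold extends smoothly to \<open>\<real> \<times> \<real>\<^sup>3\<close>, and \<open>S\<^sup>2\<close> is compact.
\<close>

definition test_functions :: "field set" where
  "test_functions = {f. smooth f \<and> (\<exists>R. \<forall>s y. R \<le> \<bar>s\<bar> \<longrightarrow> f (s, y) = 0)}"

definition d_rs :: "field \<Rightarrow> field" where
  "d_rs f = dir_deriv (1, 0) f"

text \<open>
  The derivative along the field \<open>y \<mapsto> e \<times> y\<close> generating the rotations about \<open>e\<close>. It is tangent to
  \<open>S\<^sup>2\<close>, so on \<open>S\<^sup>2\<close> the result depends only on the restriction of \<open>f\<close> to the sphere.
\<close>

definition rot_deriv :: "real ^ 3 \<Rightarrow> field \<Rightarrow> field" where
  "rot_deriv e f = (\<lambda>(s, y). dir_deriv (0, cross3 e y) f (s, y))"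

text \<open>
  The Laplace-Beltrami operator of the round unit sphere, as the sum of the squares of the three
  rotation fields (the Casimir operator of \<open>SO(3)\<close>).
\<close>

definition lap_S2 :: "field \<Rightarrow> field" where
  "lap_S2 f = (\<lambda>x. \<Sum>e\<in>Basis. rot_deriv e (rot_deriv e f) x)"

section \<open>The Schwarzschild quantities\<close>

definition r_of :: "real \<Rightarrow> real \<Rightarrow> real" where
  "r_of M s = (THE r. 2 * M < r \<and> s = r + 2 * M * ln ((r - 2 * M) / (2 * M)))"

definition lapse :: "real \<Rightarrow> real \<Rightarrow> real" where
  "lapse M s = 1 - 2 * M / r_of M s"

definition potV :: "real \<Rightarrow> real \<Rightarrow> real" where
  "potV M s = 2 * M / r_of M s ^ 3 * lapse M s"

definition potL :: "real \<Rightarrow> real \<Rightarrow> real" where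
  "potL M s = 1 / r_of M s ^ 2 * lapse M s"

definition alpha_star :: "real \<Rightarrow> real" where
  "alpha_star M = 3 * M + 2 * M * ln (1 / 2)"

definition g :: "real \<Rightarrow> real \<Rightarrow> real \<Rightarrow> real" where
  "g M \<sigma> s = (LBINT \<tau>=0..ereal ((s - alpha_star M) / (2 * M)). (1 + \<tau>\<^sup>2) powr (-\<sigma>))"

section \<open>Operators\<close>

definition H_expr :: "real \<Rightarrow> field \<Rightarrow> field" where
  "H_expr M f = (\<lambda>x. - d_rs (d_rs f) x + of_real (potV M (fst x)) * f x
                      - of_real (potL M (fst x)) * lap_S2 f x)"

definition gamma_expr :: "real \<Rightarrow> real \<Rightarrow> field \<Rightarrow> field" where
  "gamma_expr M \<sigma> f =
     (\<lambda>x. - (\<i> / 2) * (of_real (g M \<sigma> (fst x)) * d_rs f x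
                        + d_rs (\<lambda>y. of_real (g M \<sigma> (fst y)) * f y) x))"

text \<open>
  \<open>weak_rel B u v\<close> says that \<open>v\<close> is, in the sense of distributions, the formal adjoint of \<open>B\<close>
  applied to \<open>u\<close>.
\<close>

definition weak_rel :: "(field \<Rightarrow> field) \<Rightarrow> field \<Rightarrow> field \<Rightarrow> bool" where
  "weak_rel B u v \<longleftrightarrow> (\<forall>\<phi>\<in>test_functions. L2_inner (B \<phi>) u = L2_inner \<phi> v)"

text \<open>
  For a formally symmetric expression \<open>B\<close>, its realisation in \<open>L\<^sup>2\<close> on the natural (maximal) domain
  of those \<open>u \<in> L\<^sup>2\<close> whose distributional image is in \<open>L\<^sup>2\<close>; equivalently, the Hilbert space adjoint of
  \<open>B\<close> on test functions. The chosen representative is unique almost everywhere. Both \<open>H_expr\<close>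
  and \<open>gamma_expr\<close> are formally symmetric.
\<close>

definition op_dom :: "(field \<Rightarrow> field) \<Rightarrow> field set" where
  "op_dom B = {u \<in> L2. \<exists>v\<in>L2. weak_rel B u v}"

definition op_app :: "(field \<Rightarrow> field) \<Rightarrow> field \<Rightarrow> field" where
  "op_app B u = (SOME v. v \<in> L2 \<and> weak_rel B u v)"

definition H :: "real \<Rightarrow> field \<Rightarrow> field" where
  "H M = op_app (H_expr M)"

definition dom_H :: "real \<Rightarrow> field set" where
  "dom_H M = op_dom (H_expr M)"

definition gamma_op :: "real \<Rightarrow> real \<Rightarrow> field \<Rightarrow> field" where
  "gamma_op M \<sigma> = op_app (gamma_expr M \<sigma>)"

definition dom_gamma :: "real \<Rightarrow> real \<Rightarrow> field set" where
  "dom_gamma M \<sigma> = op_dom (gamma_expr M \<sigma>)"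

definition nonlin :: "real \<Rightarrow> real \<Rightarrow> nat \<Rightarrow> field \<Rightarrow> field" where
  "nonlin M lam p u =
     (\<lambda>x. of_real (lam * lapse M (fst x) * r_of M (fst x) powr (1 - real p) * norm (u x) ^ (p - 1)) * u x)"

definition Hp :: "real \<Rightarrow> real \<Rightarrow> nat \<Rightarrow> field \<Rightarrow> field" where
  "Hp M lam p u = (\<lambda>x. H M u x + nonlin M lam p u x)"

definition dom_Hp_gamma :: "real \<Rightarrow> real \<Rightarrow> nat \<Rightarrow> real \<Rightarrow> field set" where
  "dom_Hp_gamma M lam p \<sigma> =
     {u. u \<in> dom_gamma M \<sigma> \<and> Hp M lam p u \<in> dom_gamma M \<sigma> \<and>
         u \<in> dom_H M \<and> gamma_op M \<sigma> u \<in> dom_H M \<and> (\<lambda>x. u x ^ p) \<in> L2}"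

section \<open>Energy and solutions\<close>

text \<open>
  Weak derivatives; the formal adjoint of \<open>d_rs\<close> is \<open>- d_rs\<close>, and \<open>lap_S2\<close> is formally symmetric.
\<close>

definition weak_d_rs :: "field \<Rightarrow> field" where
  "weak_d_rs u = (SOME v. loc_integrable v \<and> weak_rel (\<lambda>\<phi> x. - d_rs \<phi> x) u v)"

definition weak_lap_S2 :: "field \<Rightarrow> field" where
  "weak_lap_S2 u = (SOME v. loc_integrable v \<and> weak_rel lap_S2 u v)"

text \<open>The square of the energy norm of a state \<open>u\<close> with time derivative \<open>v\<close>.\<close>

definition energy :: "real \<Rightarrow> real \<Rightarrow> nat \<Rightarrow> field \<Rightarrow> field \<Rightarrow> real" where
  "energy M lam p u v =
     (L2_norm v)\<^sup>2 + (L2_norm (weak_d_rs u))\<^sup>2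
     + Re (L2_inner u (\<lambda>x. of_real (potV M (fst x)) * u x))
     + Re (L2_inner u (\<lambda>x. - of_real (potL M (fst x)) * weak_lap_S2 u x))
     + 2 / (real p + 1) * Re (L2_inner u (nonlin M lam p u))"

definition L2_deriv :: "real set \<Rightarrow> (real \<Rightarrow> field) \<Rightarrow> field \<Rightarrow> real \<Rightarrow> bool" where
  "L2_deriv I u v t \<longleftrightarrow>
     ((\<lambda>s. L2_norm (\<lambda>x. (u s x - u t x) / of_real (s - t) - v x)) \<longlongrightarrow> 0) (at t within I)"

definition L2_continuous :: "real set \<Rightarrow> (real \<Rightarrow> field) \<Rightarrow> bool" where
  "L2_continuous I u \<longleftrightarrow>
     (\<forall>t\<in>I. ((\<lambda>s. L2_norm (\<lambda>x. u s x - u t x)) \<longlongrightarrow> 0) (at t within I))"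

text \<open>
  \<open>u\<close> is a solution of \<open>\<partial>\<^sub>t\<^sup>2 u + H\<^sub>p u = 0\<close> on the time interval \<open>I\<close>, with \<open>\<partial>\<^sub>t u = v\<close>: a twice
  continuously differentiable curve in \<open>L\<^sup>2\<close> satisfying the equation in \<open>L\<^sup>2\<close> at every time.
\<close>

definition wave_solution ::
    "real \<Rightarrow> real \<Rightarrow> nat \<Rightarrow> real set \<Rightarrow> (real \<Rightarrow> field) \<Rightarrow> (real \<Rightarrow> field) \<Rightarrow> bool" where
  "wave_solution M lam p I u v \<longleftrightarrow>
     (\<forall>t\<in>I. u t \<in> dom_H M \<and> Hp M lam p (u t) \<in> L2 \<and> v t \<in> L2 \<and>
        L2_deriv I u (v t) t \<and> L2_deriv I v (\<lambda>x. - Hp M lam p (u t) x) t) \<and>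
     L2_continuous I (\<lambda>t. Hp M lam p (u t))"

end

theory Submission
  imports Defs
begin

text \<open>
  Let \<open>G = g \<partial>\<^sub>s + g' / 2\<close>, where \<open>s\<close> is the coordinate \<open>r\<^sub>*\<close> and \<open>g\<close> is bounded, increasing and changes
  sign at the photon sphere \<open>r = 3 M\<close>. Since \<open>G\<close> is antisymmetric, the derivative of \<open>\<langle>u', G u\<rangle>\<close> along a
  solution is \<open>- \<langle>H\<^sub>p u, G u\<rangle>\<close>. Integration by parts writes \<open>\<langle>H u, G u\<rangle>\<close> as the integral of
  \<open>g' (\<partial>\<^sub>s u)\<^sup>2 - (g''' / 4 + V' g / 2) u\<^sup>2\<close> plus an angular term that is nonnegative because \<open>L' g \<le> 0\<close>. The
  zeroth order coefficient has no sign, and a Hardy inequality makes up for it by the derivative term.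
  For \<open>g = (1 - 3 M / r) + \<epsilon> Y\<close>, with \<open>Y\<close> a bounded primitive of \<open>(1 + x\<^sup>2) powr (1 - \<beta>)\<close>, what remains
  dominates \<open>(1 + x\<^sup>2) powr (- \<beta>) u\<^sup>2\<close>, and the cubic term contributes a positive multiple of
  \<open>(1 - 2 M / r) u\<^sup>4 / r\<^sup>4\<close>. As \<open>\<parallel>G u\<parallel>\<^sup>2\<close> is bounded by the energy, integrating in time bounds both
  space-time integrals by a multiple of the energy alone.

  The integrations by parts need a core: \<open>H\<close> is essentially self-adjoint on the span of the products
  of a test function of \<open>s\<close> and a homogeneous polynomial on the sphere. Solutions are only
  differentiable in \<open>L\<^sup>2\<close>; monotonicity of \<open>H\<^sub>p\<close> replaces the missing regularity of \<open>G u\<close> in time.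
\<close>

section \<open>Smooth functions of one variable\<close>

text \<open>The bound \<beta> > 3/2 has the following origin. A primitive of (1 + x^2)^(-a) is
  bounded for a > 1/2. After the Hardy step such a multiplier leaves a zeroth order coefficient of
  size (1 + x^2)^(-a - 1) at infinity, and this is (1 + x^2)^(-\<beta>) for a = \<beta> - 1. That
  coefficient is negative for |x| < 1, and the V' term is negative in a narrow window beside the
  photon sphere. The coefficient left by 1 - 3 M / r is positive everywhere, so a small \<epsilon>
  lets it absorb both. Bounding G u by the energy takes a second Hardy inequality: for a close to
  1/2 the square of g' decays hardly faster than x^(-2), whereas V decays like x^(-3) towards
  infinity. The energy is made of weak derivatives picked by a choice operator on complex fields.
  They are identified, almost everywhere, with limits along the core, and the analysis itself takes
  place in a real Hilbert space of classes of functions. No expansion in spherical harmonics is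
  required: that the spherical Laplacian is triangular with respect to the degree of a polynomial
  suffices.\<close>

primrec Ck :: "nat \<Rightarrow> (real \<Rightarrow> real) \<Rightarrow> bool" where
  "Ck 0 f \<longleftrightarrow> True"
| "Ck (Suc n) f \<longleftrightarrow> (\<exists>f'. (\<forall>x. (f has_real_derivative f' x) (at x)) \<and> Ck n f')"

text \<open>\<open>Ck n\<close> asks for n derivatives and not for continuity of the last one; for
  all n together this makes no difference. The derivative is an existential witness instead of
  \<open>deriv f\<close>, so that a closure rule only has to name a formula for it.\<close>

definition smooth1 :: "(real \<Rightarrow> real) \<Rightarrow> bool" where
  "smooth1 f \<longleftrightarrow> (\<forall>n. Ck n f)"

definition test1 :: "(real \<Rightarrow> real) \<Rightarrow> bool" where
  "test1 f \<longleftrightarrow> smooth1 f \<and> (\<exists>R. \<forall>x. R \<le> \<bar>x\<bar> \<longrightarrow> f x = 0)"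

lemma Ck_SucD: "Ck (Suc n) f \<Longrightarrow> Ck n f"
proof (induction n arbitrary: f)
  case (Suc n)
  then obtain f' where "\<forall>x. (f has_real_derivative f' x) (at x)" "Ck (Suc n) f'" by auto
  then show ?case using Suc.IH by fastforce
qed simp

lemma Ck_const: "Ck n (\<lambda>x. c)"
  by (induction n arbitrary: c) (auto intro!: exI[of _ "\<lambda>x. 0"])

lemma Ck_ident: "Ck n (\<lambda>x. x)"
  by (cases n) (auto intro!: exI[of _ "\<lambda>x. 1"] Ck_const)

lemma Ck_add: "Ck n f \<Longrightarrow> Ck n k \<Longrightarrow> Ck n (\<lambda>x. f x + k x)"
proof (induction n arbitrary: f k)
  case (Suc n)
  then obtain f' k' where "\<forall>x. (f has_real_derivative f' x) (at x)" "Ck n f'"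
    "\<forall>x. (k has_real_derivative k' x) (at x)" "Ck n k'" by auto
  then show ?case using Suc.IH
    by (auto intro!: exI[of _ "\<lambda>x. f' x + k' x"] derivative_intros)
qed simp

lemma Ck_mult: "Ck n f \<Longrightarrow> Ck n k \<Longrightarrow> Ck n (\<lambda>x. f x * k x)"
proof (induction n arbitrary: f k)
  case (Suc n)
  then obtain f' k' where d: "\<forall>x. (f has_real_derivative f' x) (at x)" "Ck n f'"
    "\<forall>x. (k has_real_derivative k' x) (at x)" "Ck n k'" by auto
  have "Ck n (\<lambda>x. f' x * k x + f x * k' x)"
    using Suc d Ck_SucD by (intro Ck_add Suc.IH) auto
  moreover have "\<forall>x. ((\<lambda>x. f x * k x) has_real_derivative f' x * k x + f x * k' x) (at x)"
    using d by (auto intro!: derivative_eq_intros)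
  ultimately show ?case by (auto intro!: exI[of _ "\<lambda>x. f' x * k x + f x * k' x"])
qed simp

lemma Ck_exp: "Ck n f \<Longrightarrow> Ck n (\<lambda>x. exp (f x))"
proof (induction n arbitrary: f)
  case (Suc n)
  then obtain f' where d: "\<forall>x. (f has_real_derivative f' x) (at x)" "Ck n f'" by auto
  have "Ck n (\<lambda>x. exp (f x) * f' x)"
    using Suc d Ck_SucD by (intro Ck_mult Suc.IH) auto
  moreover have "\<forall>x. ((\<lambda>x. exp (f x)) has_real_derivative exp (f x) * f' x) (at x)"
    using d by (auto intro!: derivative_eq_intros)
  ultimately show ?case by (auto intro!: exI[of _ "\<lambda>x. exp (f x) * f' x"])
qed simp

lemma Ck_affine: "Ck n f \<Longrightarrow> Ck n (\<lambda>x. f (a * x + b))"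
proof (induction n arbitrary: f)
  case (Suc n)
  then obtain f' where d: "\<forall>x. (f has_real_derivative f' x) (at x)" "Ck n f'" by auto
  have "Ck n (\<lambda>x. f' (a * x + b) * a)"
    using Suc.IH[OF d(2)] by (intro Ck_mult Ck_const)
  moreover have "((\<lambda>x. f (a * x + b)) has_real_derivative f' (a * x + b) * a) (at x)" for x
    using d(1) by (intro DERIV_chain2[where f = f]) (auto intro!: derivative_eq_intros)
  ultimately show ?case by (auto intro!: exI[of _ "\<lambda>x. f' (a * x + b) * a"])
qed simp

lemma smooth1_const: "smooth1 (\<lambda>x. c)" and smooth1_ident: "smooth1 (\<lambda>x. x)"
  and smooth1_add: "smooth1 f \<Longrightarrow> smooth1 k \<Longrightarrow> smooth1 (\<lambda>x. f x + k x)"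
  and smooth1_mult: "smooth1 f \<Longrightarrow> smooth1 k \<Longrightarrow> smooth1 (\<lambda>x. f x * k x)"
  and smooth1_exp: "smooth1 f \<Longrightarrow> smooth1 (\<lambda>x. exp (f x))"
  and smooth1_affine: "smooth1 f \<Longrightarrow> smooth1 (\<lambda>x. f (a * x + b))"
  by (simp_all add: smooth1_def Ck_const Ck_ident Ck_add Ck_mult Ck_exp Ck_affine)

lemma smooth1_scale: "smooth1 f \<Longrightarrow> smooth1 (\<lambda>x. c * f x)"
  by (intro smooth1_mult smooth1_const)

lemma smooth1_diff: "smooth1 f \<Longrightarrow> smooth1 k \<Longrightarrow> smooth1 (\<lambda>x. f x - k x)"
  using smooth1_add[of f "\<lambda>x. (-1) * k x"] smooth1_scale[of k "-1"] by simp

lemma smooth1_has_deriv: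
  assumes "smooth1 f" shows "(f has_real_derivative deriv f x) (at x)"
proof -
  have "Ck (Suc 0) f" using assms by (simp add: smooth1_def)
  then show ?thesis by (metis Ck.simps(2) DERIV_imp_deriv)
qed

lemma smooth1_deriv:
  assumes "smooth1 f" shows "smooth1 (deriv f)"
  unfolding smooth1_def
proof
  fix n
  have "Ck (Suc n) f" using assms by (simp add: smooth1_def)
  then obtain f' where f': "\<forall>x. (f has_real_derivative f' x) (at x)" "Ck n f'" by auto
  then have "f' = deriv f" by (metis DERIV_imp_deriv ext)
  then show "Ck n (deriv f)" using f' by simp
qed

lemma smooth1I:
  assumes "\<And>x. (f has_real_derivative f' x) (at x)" "smooth1 f'" shows "smooth1 f"
  unfolding smooth1_def
proof
  fix n show "Ck n f" using assms by (cases n) (auto simp: smooth1_def)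
qed

lemma smooth1_continuous: "smooth1 f \<Longrightarrow> continuous_on A f"
  by (meson DERIV_continuous_on smooth1_has_deriv has_field_derivative_at_within)

lemma test1_smooth: "test1 f \<Longrightarrow> smooth1 f"
  by (simp add: test1_def)

lemma test1_continuous: "test1 f \<Longrightarrow> continuous_on A f"
  by (simp add: test1_def smooth1_continuous)

lemma test1_add: assumes "test1 f" "test1 k" shows "test1 (\<lambda>x. f x + k x)"
proof -
  obtain R S where "\<forall>x. R \<le> \<bar>x\<bar> \<longrightarrow> f x = 0" "\<forall>x. S \<le> \<bar>x\<bar> \<longrightarrow> k x = 0"
    using assms by (auto simp: test1_def)
  then have "\<exists>R. \<forall>x. R \<le> \<bar>x\<bar> \<longrightarrow> f x + k x = 0" by (intro exI[of _ "max R S"]) auto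
  then show ?thesis using assms smooth1_add by (simp add: test1_def)
qed

lemma test1_mult: "test1 f \<Longrightarrow> smooth1 k \<Longrightarrow> test1 (\<lambda>x. k x * f x)"
  unfolding test1_def using smooth1_mult by fastforce

lemma test1_scale: "test1 f \<Longrightarrow> test1 (\<lambda>x. c * f x)"
  by (intro test1_mult smooth1_const)

lemma test1_diff: "test1 f \<Longrightarrow> test1 k \<Longrightarrow> test1 (\<lambda>x. f x - k x)"
  using test1_add[of f "\<lambda>x. (-1) * k x"] test1_scale[of k "-1"] by simp

lemma test1_deriv: assumes "test1 f" shows "test1 (deriv f)"
proof -
  obtain R where R: "\<forall>x. R \<le> \<bar>x\<bar> \<longrightarrow> f x = 0" using assms by (auto simp: test1_def)
  have "deriv f x = 0" if "R + 1 \<le> \<bar>x\<bar>" for x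
  proof -
    have "(f has_real_derivative 0) (at x)"
    proof (rule has_field_derivative_transform_within[of "\<lambda>x. 0" _ _ _ 1])
      fix y assume "dist y x < 1"
      then have "R \<le> \<bar>y\<bar>" using that by (auto simp: dist_real_def)
      then show "0 = f y" using R by simp
    qed auto
    then show ?thesis by (rule DERIV_imp_deriv)
  qed
  then show ?thesis using assms smooth1_deriv by (auto simp: test1_def)
qed

section \<open>Flat functions, bump functions and primitives\<close>

definition flat_fun :: "nat \<Rightarrow> real \<Rightarrow> real" where
  "flat_fun n x = (if x > 0 then (1 / x) ^ n * exp (- 1 / x) else 0)"

lemma flat_fun_tendsto_0: "(flat_fun n \<longlongrightarrow> 0) (at_right 0)"
proof -
  have "((\<lambda>x. inverse x ^ n / exp (inverse x)) \<longlongrightarrow> (0::real)) (at_right 0)"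
    using tendsto_power_div_exp_0 filterlim_inverse_at_top_right by (rule filterlim_compose)
  then show ?thesis
  proof (rule Lim_transform_eventually)
    show "\<forall>\<^sub>F x in at_right 0. inverse x ^ n / exp (inverse x) = flat_fun n x"
      by (auto simp: flat_fun_def eventually_at_filter exp_minus field_simps)
  qed
qed

text \<open>In the family x^(-n) exp(-1/x), extended by 0, the derivative of a member is a
  combination of the next two. Treating the whole family at once turns smoothness into an induction
  on the number of derivatives.\<close>

lemma flat_fun_deriv:
  "(flat_fun n has_real_derivative - real n * flat_fun (Suc n) x + flat_fun (Suc (Suc n)) x) (at x)"
proof -
  consider "x > 0" | "x < 0" | "x = 0" by linarith
  then show ?thesis
  proof cases
    case 1
    have "((\<lambda>x. (1 / x) ^ n * exp (- 1 / x)) has_real_derivative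
        - real n * (1 / x) ^ Suc n * exp (- 1 / x) + (1 / x) ^ Suc (Suc n) * exp (- 1 / x)) (at x)"
    proof -
      have *: "x \<noteq> 0" "real n * x ^ (n - Suc 0) * x = real n * x ^ n"
        using 1 by (cases n; simp)+
      have "((\<lambda>x. (1 / x) ^ n * exp (- 1 / x)) has_real_derivative
        real n * (1 / x) ^ (n - 1) * (- 1 / x\<^sup>2) * exp (- 1 / x)
          + (1 / x) ^ n * (exp (- 1 / x) * (1 / x\<^sup>2))) (at x)"
      proof -
        have d1: "((\<lambda>x. 1 / x) has_real_derivative - 1 / x\<^sup>2) (at x)"
          and d2: "((\<lambda>x. exp (- 1 / x)) has_real_derivative exp (- 1 / x) * (1 / x\<^sup>2)) (at x)"
          using *(1) by (auto intro!: derivative_eq_intros simp: field_simps power2_eq_square)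
        show ?thesis
          by (rule DERIV_cong[OF DERIV_mult[OF DERIV_power[OF d1] d2]]) (simp add: algebra_simps)
      qed
      moreover have eq: "real n * (1 / x) ^ (n - 1) * (- 1 / x\<^sup>2) = - real n * (1 / x) ^ Suc n"
        using 1 by (cases n) (simp_all add: field_simps power2_eq_square)
      ultimately show ?thesis
        by (elim DERIV_cong) (simp only: eq, simp add: field_simps power2_eq_square)
    qed
    then have "((\<lambda>x. (1 / x) ^ n * exp (- 1 / x)) has_real_derivative
        - real n * flat_fun (Suc n) x + flat_fun (Suc (Suc n)) x) (at x)"
      using 1 by (simp add: flat_fun_def mult.assoc)
    then show ?thesis
      by (rule has_field_derivative_transform_within[of _ _ _ _ x]) (use 1 in \<open>auto simp: flat_fun_def dist_real_def\<close>)
  next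
    case 2
    have "((\<lambda>x. 0) has_real_derivative
        - real n * flat_fun (Suc n) x + flat_fun (Suc (Suc n)) x) (at x)"
      using 2 by (simp add: flat_fun_def)
    then show ?thesis
      by (rule has_field_derivative_transform_within[of _ _ _ _ "-x"]) (use 2 in \<open>auto simp: flat_fun_def dist_real_def\<close>)
  next
    case 3
    \<comment> \<open>Dividing by h > 0 raises the power of 1/h by one, so the right difference
      quotient at 0 is \<open>flat_fun (Suc n)\<close>, which tends to 0.\<close>
    have "((\<lambda>h. (flat_fun n h - flat_fun n 0) / h) \<longlongrightarrow> 0) (at 0)"
    proof (subst filterlim_at_split, intro conjI)
      show "((\<lambda>h. (flat_fun n h - flat_fun n 0) / h) \<longlongrightarrow> 0) (at_left 0)"
        by (rule Lim_transform_eventually[of "\<lambda>_. 0"])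
          (auto simp: flat_fun_def eventually_at_filter)
      show "((\<lambda>h. (flat_fun n h - flat_fun n 0) / h) \<longlongrightarrow> 0) (at_right 0)"
        by (rule Lim_transform_eventually[OF flat_fun_tendsto_0[of "Suc n"]])
          (auto simp: flat_fun_def eventually_at_filter)
    qed
    then show ?thesis using 3 by (simp add: has_field_derivative_iff flat_fun_def)
  qed
qed

lemma smooth1_flat_fun: "smooth1 (flat_fun n)"
proof -
  have "Ck k (flat_fun n)" for k n
  proof (induction k arbitrary: n)
    case (Suc k)
    have "Ck k (\<lambda>x. - real n * flat_fun (Suc n) x + flat_fun (Suc (Suc n)) x)"
      using Suc by (intro Ck_add Ck_mult Ck_const)
    then show ?case
      unfolding Ck.simps by (intro exI conjI allI) (rule flat_fun_deriv)
  qed simp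
  then show ?thesis by (simp add: smooth1_def)
qed

text \<open>A product q of two flat functions is positive exactly on the open interval, and 1 -
  exp(-n q) is a smooth function of q with values in [0, 1] that vanishes with q and tends to 1
  where q > 0.\<close>

lemma test1_approx_indicator:
  fixes a b :: real
  obtains \<eta> :: "nat \<Rightarrow> real \<Rightarrow> real" where "\<And>n. test1 (\<eta> n)" "\<And>n x. 0 \<le> \<eta> n x" "\<And>n x. \<eta> n x \<le> 1"
    "\<And>n x. x \<notin> {a<..<b} \<Longrightarrow> \<eta> n x = 0" "\<And>n x. x \<in> {a<..<b} \<Longrightarrow> \<eta> (Suc n) x > 0"
    "\<And>x. (\<lambda>n. \<eta> n x) \<longlonglongrightarrow> indicator {a<..<b} x"
proof
  define q where "q x = flat_fun 0 (1 * x + (- a)) * flat_fun 0 ((-1) * x + b)" for x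
  define \<eta> where "\<eta> n x = 1 - exp (- real n * q x)" for n :: nat and x
  have q: "q x > 0" if "x \<in> {a<..<b}" for x using that by (auto simp: q_def flat_fun_def)
  have q0: "q x = 0" if "x \<notin> {a<..<b}" for x using that by (auto simp: q_def flat_fun_def)
  have qn: "q x \<ge> 0" for x using q[of x] q0[of x] by (cases "x \<in> {a<..<b}") auto
  have "smooth1 q" unfolding q_def by (intro smooth1_mult smooth1_affine smooth1_flat_fun)
  then have s: "smooth1 (\<eta> n)" for n
    unfolding \<eta>_def by (intro smooth1_diff smooth1_const smooth1_exp smooth1_scale)
  show z: "\<eta> n x = 0" if "x \<notin> {a<..<b}" for n x using q0[OF that] by (simp add: \<eta>_def)
  show "test1 (\<eta> n)" for n
    unfolding test1_def
  proof (intro conjI exI allI impI)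
    fix x assume "\<bar>a\<bar> + \<bar>b\<bar> + 1 \<le> \<bar>x\<bar>"
    then have "x \<notin> {a<..<b}" by auto
    then show "\<eta> n x = 0" by (rule z)
  qed (rule s)
  show "0 \<le> \<eta> n x" "\<eta> n x \<le> 1" for n x using qn[of x] by (auto simp: \<eta>_def)
  show "\<eta> (Suc n) x > 0" if "x \<in> {a<..<b}" for n x
    using mult_pos_pos[OF _ q[OF that], of "real (Suc n)"] by (simp add: \<eta>_def del: of_nat_Suc)
  show "(\<lambda>n. \<eta> n x) \<longlonglongrightarrow> indicator {a<..<b} x" for x
  proof (cases "x \<in> {a<..<b}")
    case True
    have "(\<lambda>n. 1 - exp (- q x) ^ n) \<longlonglongrightarrow> 1 - 0"
      using q[OF True] by (intro tendsto_intros LIMSEQ_realpow_zero) auto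
    moreover have "exp (- q x) ^ n = exp (- real n * q x)" for n
      using exp_of_nat_mult[of n "- q x"] by simp
    ultimately show ?thesis using True by (simp add: \<eta>_def)
  qed (use z in auto)
qed

lemma test1_support: "test1 f \<Longrightarrow> \<exists>R>0. \<forall>x. R \<le> \<bar>x\<bar> \<longrightarrow> f x = 0"
  unfolding test1_def by (metis abs_ge_self abs_ge_zero dual_order.trans less_add_one
      linorder_not_less nle_le order.strict_trans1 zero_less_one)

lemma integrable_lborel_compact_support:
  fixes f :: "real \<Rightarrow> real"
  assumes "continuous_on UNIV f" "\<forall>x. R \<le> \<bar>x\<bar> \<longrightarrow> f x = 0"
  shows "integrable lborel f" "(f has_integral (integral\<^sup>L lborel f)) {-R..R}"
proof -
  have i: "set_integrable lborel {-R..R} f"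
    unfolding set_integrable_def by (rule borel_integrable_compact) (use assms continuous_on_subset in blast)+
  moreover have e: "(\<lambda>x. indicator {-R..R} x *\<^sub>R f x) = f"
  proof
    fix x show "indicator {-R..R} x *\<^sub>R f x = f x"
      using assms(2)[rule_format, of x] by (cases "\<bar>x\<bar> \<le> R") (auto simp: indicator_def)
  qed
  ultimately show "integrable lborel f" by (simp add: set_integrable_def)
  show "(f has_integral (integral\<^sup>L lborel f)) {-R..R}"
    using has_integral_set_lebesgue[of "{-R..R}" f] set_borel_integral_eq_integral[OF i] e
    by (simp add: set_lebesgue_integral_def has_integral_iff)
qed

lemma test1_integrable: "test1 f \<Longrightarrow> integrable lborel f"
  using integrable_lborel_compact_support test1_support test1_continuous by metis

lemma integral_deriv_compact_support:
  fixes f :: "real \<Rightarrow> real"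
  assumes d: "\<And>x. (f has_real_derivative f' x) (at x)" and "continuous_on UNIV f'"
    "\<forall>x. R \<le> \<bar>x\<bar> \<longrightarrow> f x = 0" "\<forall>x. R \<le> \<bar>x\<bar> \<longrightarrow> f' x = 0"
  shows "integral\<^sup>L lborel f' = 0"
proof (cases "R \<ge> 0")
  case True
  have "(f' has_integral (f R - f (-R))) {-R..R}"
    using True d by (intro fundamental_theorem_of_calculus)
      (auto intro: has_field_derivative_at_within simp flip: has_real_derivative_iff_has_vector_derivative)
  then show ?thesis using integrable_lborel_compact_support(2)[of f' R] assms True
    by (metis abs_ge_self abs_minus_cancel diff_self has_integral_unique)
next
  case False
  then have "f' = (\<lambda>x. 0)" using assms(4) by (auto simp: fun_eq_iff)
  then show ?thesis by simp
qed

lemma antiderivative_exists: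
  fixes f :: "real \<Rightarrow> real"
  assumes "continuous_on UNIV f"
  shows "\<exists>F. \<forall>x. (F has_real_derivative f x) (at x)"
  using einterval_antiderivative[of "-\<infinity>" \<infinity> f] assms
  by (simp add: continuous_on_eq_continuous_at has_real_derivative_iff_has_vector_derivative)

text \<open>The primitive that vanishes to the left of the support is constant to its right, and
  that constant is the integral. Mean zero is thus what makes a test function the derivative of a
  test function.\<close>

lemma test1_antiderivative:
  assumes f: "test1 f" and "integral\<^sup>L lborel f = 0"
  obtains F where "test1 F" "\<And>x. (F has_real_derivative f x) (at x)"
proof -
  obtain R where R: "R > 0" "\<forall>x. R \<le> \<bar>x\<bar> \<longrightarrow> f x = 0" using test1_support[OF f] by auto
  obtain G where G: "\<And>x. (G has_real_derivative f x) (at x)"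
    using antiderivative_exists[of f] test1_continuous[OF f] by blast
  define F where "F x = G x - G (-R)" for x
  have d: "(F has_real_derivative f x) (at x)" for x
    unfolding F_def by (auto intro!: derivative_eq_intros G)
  have *: "F y - F x = integral {x..y} f" if "x \<le> y" for x y
  proof -
    have "(f has_integral (F y - F x)) {x..y}"
      using that d by (intro fundamental_theorem_of_calculus)
        (auto intro: has_field_derivative_at_within simp flip: has_real_derivative_iff_has_vector_derivative)
    then show ?thesis by (simp add: integral_unique)
  qed
  have "integral {-R..R} f = 0"
    using integral_unique[OF integrable_lborel_compact_support(2)[OF test1_continuous[OF f] R(2)]]
      assms(2) by simp
  then have "F R - F (-R) = 0" using *[of "-R" R] R(1) by simp
  then have FR: "F R = 0" "F (-R) = 0" by (auto simp: F_def)
  have "F x = 0" if "R \<le> \<bar>x\<bar>" for x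
  proof (cases "x > 0")
    case True
    have "integral {R..x} f = integral {R..x} (\<lambda>_. 0)"
      using R by (intro integral_cong) auto
    then show ?thesis using *[of R x] FR True that by simp
  next
    case False
    have "integral {x..-R} f = integral {x..-R} (\<lambda>_. 0)"
      using R by (intro integral_cong) auto
    then show ?thesis using *[of x "-R"] FR False that by simp
  qed
  then have "test1 F" using d f smooth1I[of F f] by (auto simp: test1_def)
  then show ?thesis using that d by blast
qed

section \<open>The measure on the cylinder\<close>

lemma sets_sphere_measure [simp, measurable_cong]: "sets sphere_measure = sets borel"
  by (simp add: sphere_measure_def)

lemma space_sphere_measure [simp]: "space sphere_measure = UNIV"
  by (simp add: sphere_measure_def)

lemma ball_borel [measurable]: "ball x r \<in> sets borel"
  by (intro borel_open open_ball)

lemma nn_integral_sphere_measure: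
  assumes [measurable]: "f \<in> borel_measurable borel"
  shows "(\<integral>\<^sup>+y. f y \<partial>sphere_measure)
    = (\<integral>\<^sup>+y. 3 * indicator (ball 0 1) y * f (y /\<^sub>R norm y) \<partial>lborel)"
  unfolding sphere_measure_def
  by (subst nn_integral_distr; (subst nn_integral_density)?) auto

lemma finite_measure_sphere: "finite_measure sphere_measure"
proof (rule finite_measureI)
  have "emeasure sphere_measure (space sphere_measure) = (\<integral>\<^sup>+y. 1 \<partial>sphere_measure)"
    by simp
  also have "\<dots> = 3 * emeasure lborel (ball 0 1 :: (real^3) set)"
    by (subst nn_integral_sphere_measure) (simp_all add: nn_integral_cmult_indicator)
  also have "\<dots> < \<infinity>"
    using emeasure_bounded_finite[of "ball 0 1 :: (real^3) set"] by (simp add: ennreal_mult_less_top)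
  finally show "emeasure sphere_measure (space sphere_measure) \<noteq> \<infinity>" by simp
qed

text \<open>The radial projection in the definition sends the origin to 0, off the sphere; a single
  point is Lebesgue null.\<close>

lemma AE_sphere_measure: "AE y in sphere_measure. norm y = 1"
proof -
  have "AE y :: real^3 in lborel. y \<noteq> 0" by (rule AE_lborel_singleton)
  then show ?thesis
    unfolding sphere_measure_def
    by (subst AE_distr_iff; (subst AE_density)?) (auto elim!: AE_mp)
qed

lemma distr_lborel_orthogonal:
  fixes R :: "real^3 \<Rightarrow> real^3"
  assumes R: "orthogonal_transformation R"
  shows "distr lborel borel R = lborel"
proof (rule lborel_eqI[symmetric])
  fix l u :: "real^3" assume lu: "\<And>b. b \<in> Basis \<Longrightarrow> l \<bullet> b \<le> u \<bullet> b"
  have [measurable]: "R \<in> borel_measurable borel"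
    using orthogonal_transformation_linear[OF R]
    by (simp add: borel_measurable_continuous_onI linear_continuous_on linear_conv_bounded_linear)
  have i: "orthogonal_transformation (inv R)" using R by (rule orthogonal_transformation_inv)
  have e: "R -` box l u = inv R ` box l u"
    using R by (simp add: bij_vimage_eq_inv_image orthogonal_transformation_bij)
  have "emeasure (distr lborel borel R) (box l u) = emeasure lborel (R -` box l u)"
    by (simp add: emeasure_distr)
  also have "\<dots> = emeasure lebesgue (R -` box l u)"
    using measurable_sets_borel[of R borel "box l u"] by (simp add: emeasure_completion)
  also have "\<dots> = ennreal (measure lebesgue (inv R ` box l u))"
    unfolding e using measurable_orthogonal_image[OF i, of "box l u"]
    by (simp add: emeasure_eq_measure2 lmeasurable_box)
  also have "\<dots> = ennreal (measure lebesgue (box l u))"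
    by (subst measure_orthogonal_image[OF i]) auto
  also have "\<dots> = (\<Prod>b\<in>Basis. (u - l) \<bullet> b)"
    using lu by (simp add: measure_lborel_box_eq inner_diff_left)
  finally show "emeasure (distr lborel borel R) (box l u) = (\<Prod>b\<in>Basis. (u - l) \<bullet> b)" .
qed simp

text \<open>In cone form the invariance is inherited from Lebesgue measure: an orthogonal map
  preserves the unit ball and commutes with the radial projection. All angular integration by parts
  rests on this.\<close>

lemma distr_sphere_measure_orthogonal:
  assumes R: "orthogonal_transformation R"
  shows "distr sphere_measure borel R = sphere_measure"
proof (rule measure_eqI)
  have [measurable]: "R \<in> borel_measurable borel"
    using orthogonal_transformation_linear[OF R]
    by (simp add: borel_measurable_continuous_onI linear_continuous_on linear_conv_bounded_linear)
  have nR: "norm (R y) = norm y" and sR: "R (c *\<^sub>R y) = c *\<^sub>R R y" for c y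
    using R by (simp_all add: orthogonal_transformation_norm linear_cmul orthogonal_transformation_linear)
  fix A assume "A \<in> sets (distr sphere_measure borel R)"
  then have [measurable]: "A \<in> sets borel" by simp
  have "emeasure (distr sphere_measure borel R) A = (\<integral>\<^sup>+y. indicator A (R y) \<partial>sphere_measure)"
    by (subst nn_integral_indicator[symmetric]; (subst nn_integral_distr)?) auto
  also have "\<dots> = (\<integral>\<^sup>+y. 3 * indicator (ball 0 1) y * indicator A (R (y /\<^sub>R norm y)) \<partial>lborel)"
    by (rule nn_integral_sphere_measure) measurable
  also have "\<dots> = (\<integral>\<^sup>+y. 3 * indicator (ball 0 1) (R y) * indicator A (R y /\<^sub>R norm (R y)) \<partial>lborel)"
    by (simp add: nR sR indicator_def)
  also have "\<dots> = (\<integral>\<^sup>+y. 3 * indicator (ball 0 1) y * indicator A (y /\<^sub>R norm y) \<partial>distr lborel borel R)"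
    by (subst nn_integral_distr) auto
  also have "\<dots> = (\<integral>\<^sup>+y. indicator A y \<partial>sphere_measure)"
    unfolding distr_lborel_orthogonal[OF R] by (rule nn_integral_sphere_measure[symmetric]) measurable
  finally show "emeasure (distr sphere_measure borel R) A = emeasure sphere_measure A"
    by simp
qed simp

interpretation sphere: finite_measure sphere_measure
  by (rule finite_measure_sphere)

interpretation cyl: pair_sigma_finite lborel sphere_measure ..

lemma sets_mu [simp, measurable_cong]: "sets mu = sets borel"
  unfolding mu_def borel_prod[symmetric] by (intro sets_pair_measure_cong) auto

lemma space_mu [simp]: "space mu = UNIV"
  by (simp add: mu_def space_pair_measure)

lemma sigma_finite_mu: "sigma_finite_measure mu"
  unfolding mu_def by (rule cyl.sigma_finite_measure_axioms)

interpretation mu: sigma_finite_measure mu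
  by (rule sigma_finite_mu)

lemma AE_mu_sphere: "AE x in mu. norm (snd x) = 1"
proof -
  have "AE x :: point in lborel \<Otimes>\<^sub>M sphere_measure. norm (snd x) = 1"
  proof (rule cyl.AE_pair_measure)
    show "{x \<in> space (lborel \<Otimes>\<^sub>M sphere_measure). norm (snd x) = 1}
        \<in> sets (lborel \<Otimes>\<^sub>M sphere_measure)" by measurable
  qed (simp add: AE_sphere_measure)
  then show ?thesis unfolding mu_def .
qed

lemma integral_mu_snd:
  fixes f :: "point \<Rightarrow> real"
  assumes "integrable mu f"
  shows "integral\<^sup>L mu f = (\<integral>y. (\<integral>s. f (s, y) \<partial>lborel) \<partial>sphere_measure)"
  using cyl.integral_snd[of "\<lambda>s y. f (s, y)"] assms by (simp add: mu_def)

lemma integral_mu_fst: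
  fixes f :: "point \<Rightarrow> real"
  assumes "integrable mu f"
  shows "integral\<^sup>L mu f = (\<integral>s. (\<integral>y. f (s, y) \<partial>sphere_measure) \<partial>lborel)"
  using cyl.integral_fst'[of f] assms by (simp add: mu_def)

lemma integrable_mu_swap:
  fixes f :: "point \<Rightarrow> real"
  assumes "integrable mu f"
  shows "AE s in lborel. integrable sphere_measure (\<lambda>y. f (s, y))"
    and "integrable lborel (\<lambda>s. \<integral>y. f (s, y) \<partial>sphere_measure)"
  using cyl.AE_integrable_fst'[of f] cyl.integrable_fst'[of f] assms by (simp_all add: mu_def)

lemma emeasure_mu_slab: "emeasure mu ({a..b} \<times> UNIV) < \<infinity>"
proof -
  have "emeasure mu ({a..b} \<times> space sphere_measure)
      = emeasure lborel {a..b} * emeasure sphere_measure (space sphere_measure)"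
    unfolding mu_def by (rule sphere.emeasure_pair_measure_Times) auto
  also have "\<dots> < \<infinity>"
    using sphere.emeasure_finite[of "space sphere_measure"]
    by (simp add: ennreal_mult_less_top less_top[symmetric] emeasure_lborel_Icc_eq ennreal_mult_eq_top_iff)
  finally show ?thesis by simp
qed

lemma slab_borel [measurable]: "({a..b} \<times> UNIV :: point set) \<in> sets borel"
  by (intro borel_closed closed_Times) auto

section \<open>Functions supported in a slab\<close>

definition slab_supp :: "(point \<Rightarrow> real) \<Rightarrow> bool" where
  "slab_supp f \<longleftrightarrow> (\<exists>R. \<forall>s y. R \<le> \<bar>s\<bar> \<longrightarrow> f (s, y) = 0)"

lemma slab_supp_add: assumes "slab_supp f" "slab_supp k" shows "slab_supp (\<lambda>x. f x + k x)"
proof -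
  obtain R S where "\<forall>s y. R \<le> \<bar>s\<bar> \<longrightarrow> f (s, y) = 0" "\<forall>s y. S \<le> \<bar>s\<bar> \<longrightarrow> k (s, y) = 0"
    using assms by (auto simp: slab_supp_def)
  then show ?thesis unfolding slab_supp_def by (intro exI[of _ "max R S"]) auto
qed

lemma slab_supp_mult1: "slab_supp f \<Longrightarrow> slab_supp (\<lambda>x. f x * k x)"
  and slab_supp_mult2: "slab_supp f \<Longrightarrow> slab_supp (\<lambda>x. k x * f x)"
  unfolding slab_supp_def by fastforce+

lemma slab_supp_0: "slab_supp (\<lambda>x. 0)"
  by (simp add: slab_supp_def)

lemma slab_supp_minus: "slab_supp f \<Longrightarrow> slab_supp (\<lambda>x. - f x)"
  using slab_supp_mult2[of f "\<lambda>_. - 1"] by simp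

lemma slab_supp_diff: "slab_supp f \<Longrightarrow> slab_supp k \<Longrightarrow> slab_supp (\<lambda>x. f x - k x)"
  using slab_supp_add[of f "\<lambda>x. - k x"] slab_supp_minus[of k] by simp

lemma slab_supp_sum: "(\<And>i. i \<in> I \<Longrightarrow> slab_supp (f i)) \<Longrightarrow> slab_supp (\<lambda>x. \<Sum>i\<in>I. f i x)"
  by (induction I rule: infinite_finite_induct) (auto intro: slab_supp_add slab_supp_0)

lemma slab_supp_power: "slab_supp f \<Longrightarrow> slab_supp (\<lambda>x. (f x)\<^sup>2)"
  unfolding power2_eq_square by (rule slab_supp_mult1)

lemmas slab_supp_intros = slab_supp_add slab_supp_mult1 slab_supp_mult2 slab_supp_diff
  slab_supp_minus slab_supp_sum slab_supp_power

text \<open>A continuous function on \<real> x \<real>^3 may grow in y, but \<open>mu\<close> only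
  sees unit vectors y, and the slab over the compact sphere is compact. Support in s alone therefore
  takes the place of compact support.\<close>

lemma slab_bounded:
  fixes f :: "point \<Rightarrow> real"
  assumes "continuous_on UNIV f"
  shows "\<exists>B\<ge>0. \<forall>s y. \<bar>s\<bar> \<le> R \<longrightarrow> norm y = 1 \<longrightarrow> \<bar>f (s, y)\<bar> \<le> B"
proof -
  have "compact ({-R..R} \<times> sphere (0 :: real^3) 1)"
    by (intro compact_Times compact_sphere compact_Icc)
  then have "compact (f ` ({-R..R} \<times> sphere 0 1))"
    using assms continuous_on_subset by (intro compact_continuous_image) auto
  then obtain B where "\<forall>z \<in> f ` ({-R..R} \<times> sphere 0 1). norm z \<le> B"
    using bounded_iff compact_imp_bounded by blast
  then show ?thesis by (intro exI[of _ "max B 0"]) (auto simp: le_max_iff_disj abs_le_iff)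
qed

lemma slab_supp_bound:
  fixes f :: "point \<Rightarrow> real"
  assumes "continuous_on UNIV f" "slab_supp f"
  shows "\<exists>R B. B \<ge> 0 \<and> (\<forall>s y. norm y = 1 \<longrightarrow> \<bar>f (s, y)\<bar> \<le> B * indicator ({-R..R} \<times> UNIV) (s, y))"
proof -
  obtain R where R: "\<And>s y. R \<le> \<bar>s\<bar> \<Longrightarrow> f (s, y) = 0" using assms(2) by (auto simp: slab_supp_def)
  obtain B where B: "B \<ge> 0" "\<And>s y. \<bar>s\<bar> \<le> R \<Longrightarrow> norm y = 1 \<Longrightarrow> \<bar>f (s, y)\<bar> \<le> B"
    using slab_bounded[OF assms(1), of R] by auto
  show ?thesis
  proof (rule exI[of _ R], rule exI[of _ B], intro conjI allI impI)
    show "B \<ge> 0" by (rule B(1))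
  next
    fix s and y :: "real^3" assume y: "norm y = 1"
    show "\<bar>f (s, y)\<bar> \<le> B * indicator ({-R..R} \<times> UNIV) (s, y)"
      using R[of s y] B(2)[OF _ y, of s] by (cases "\<bar>s\<bar> \<le> R") (auto simp: indicator_def)
  qed
qed

lemma integrable_mu_slab_indicator: "integrable mu (indicator ({a..b} \<times> UNIV) :: point \<Rightarrow> real)"
  using emeasure_mu_slab[of a b] by (intro integrable_real_indicator) auto

lemma integrable_mu_slab_supp:
  assumes c: "continuous_on UNIV f" and "slab_supp f"
  shows "integrable mu f"
proof -
  obtain R B where B: "B \<ge> 0" "\<And>s y. norm y = 1 \<Longrightarrow> \<bar>f (s, y)\<bar> \<le> B * indicator ({-R..R} \<times> UNIV) (s, y)"
    using slab_supp_bound[OF assms] by auto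
  show ?thesis
  proof (rule Bochner_Integration.integrable_bound)
    show "integrable mu (\<lambda>x. B * indicator ({-R..R} \<times> UNIV) x)"
      using integrable_mu_slab_indicator by (rule integrable_mult_right)
    show "f \<in> borel_measurable mu" using borel_measurable_continuous_onI[OF c] by simp
    show "AE x in mu. norm (f x) \<le> norm (B * indicator ({- R..R} \<times> UNIV) x :: real)"
      using AE_mu_sphere by eventually_elim (use B in \<open>auto simp: abs_mult\<close>)
  qed
qed

text \<open>Rodrigues' formula for the rotation by the angle t about a unit vector e, that is, the
  flow of the field y \<mapsto> e \<times> y behind \<open>rot_deriv\<close>.\<close>

definition rotation :: "real^3 \<Rightarrow> real \<Rightarrow> real^3 \<Rightarrow> real^3" where
  "rotation e t y = y + sin t *\<^sub>R cross3 e y + (1 - cos t) *\<^sub>R cross3 e (cross3 e y)"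

lemma rotate_deriv:
  assumes "norm e = 1"
  shows "((\<lambda>t. rotation e t y) has_vector_derivative cross3 e (rotation e t y)) (at t)"
proof -
  have e: "cross3 e (cross3 e (cross3 e y)) = - cross3 e y"
    using assms by (simp add: Lagrange dot_cross_self norm_eq_1 Cross3.right_diff_distrib cross_mult_right)
  have "((\<lambda>t. rotation e t y) has_vector_derivative
      cos t *\<^sub>R cross3 e y + sin t *\<^sub>R cross3 e (cross3 e y)) (at t)"
    unfolding rotation_def
    by (auto intro!: derivative_eq_intros)
  also have "cos t *\<^sub>R cross3 e y + sin t *\<^sub>R cross3 e (cross3 e y) = cross3 e (rotation e t y)"
    by (simp add: rotation_def cross_add_right cross_mult_right Cross3.right_diff_distrib e algebra_simps)
  finally show ?thesis .
qed

lemma norm_rotate: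
  assumes "norm e = 1"
  shows "norm (rotation e t y) = norm y"
proof -
  have "((\<lambda>t. rotation e t y \<bullet> rotation e t y) has_real_derivative 0) (at t)" for t
    using bounded_bilinear.has_vector_derivative[OF bounded_bilinear_inner rotate_deriv[OF assms, of y t] rotate_deriv[OF assms, of y t]]
    by (simp add: has_real_derivative_iff_has_vector_derivative dot_cross_self)
  then have "rotation e t y \<bullet> rotation e t y = rotation e 0 y \<bullet> rotation e 0 y"
    using DERIV_isconst_all by blast
  then show ?thesis by (simp add: norm_eq_sqrt_inner rotation_def)
qed

lemma orthogonal_rotate:
  assumes "norm e = 1"
  shows "orthogonal_transformation (rotation e t)"
proof -
  have "linear (rotation e t)"
    by (rule linearI) (simp_all add: rotation_def cross_add_right cross_mult_right algebra_simps)
  then show ?thesis using norm_rotate[OF assms] by (simp add: orthogonal_transformation)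
qed

lemma rotate_0 [simp]: "rotation e 0 y = y"
  by (simp add: rotation_def)

lemma integral_mu_rotate:
  fixes f :: "point \<Rightarrow> real"
  assumes [measurable]: "f \<in> borel_measurable borel" and e: "norm e = 1"
  shows "(\<integral>x. f (fst x, rotation e t (snd x)) \<partial>mu) = (\<integral>x. f x \<partial>mu)"
proof -
  let ?R = "rotation e t"
  have R: "orthogonal_transformation ?R" using e by (rule orthogonal_rotate)
  have [measurable]: "?R \<in> borel_measurable borel"
    using orthogonal_transformation_linear[OF R]
    by (simp add: borel_measurable_continuous_onI linear_continuous_on linear_conv_bounded_linear)
  have d: "distr sphere_measure borel ?R = sphere_measure"
    by (rule distr_sphere_measure_orthogonal[OF R])
  have "mu = distr lborel borel (\<lambda>s. s) \<Otimes>\<^sub>M distr sphere_measure borel ?R"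
    unfolding mu_def d by (simp add: distr_id2)
  also have "\<dots> = distr mu (borel \<Otimes>\<^sub>M borel) (\<lambda>(s, y). (s, ?R y))"
    unfolding mu_def by (rule pair_measure_distr) (auto simp: d sphere.sigma_finite_measure_axioms)
  finally have m: "mu = distr mu borel (\<lambda>(s, y). (s, ?R y))"
    unfolding borel_prod .
  have [measurable]: "(\<lambda>(s :: real, y). (s, ?R y)) \<in> borel_measurable borel"
    unfolding borel_prod[symmetric] by measurable
  then have m2: "(\<lambda>x :: point. (fst x, ?R (snd x))) \<in> borel_measurable borel"
    unfolding case_prod_beta' .
  have "(\<integral>x. f x \<partial>mu) = (\<integral>x. f x \<partial>distr mu borel (\<lambda>(s, y). (s, ?R y)))"
    using m by simp
  also have "\<dots> = (\<integral>x. f (fst x, ?R (snd x)) \<partial>mu)"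
    by (subst integral_distr) (use m2 in \<open>auto simp: case_prod_beta'\<close>)
  finally show ?thesis by simp
qed

section \<open>Continuously differentiable functions and integration by parts\<close>

text \<open>Real counterparts of \<open>dir_deriv\<close> and \<open>rot_deriv\<close>; complex
  fields are split into real and imaginary part only when the solution enters.\<close>

definition Dd :: "point \<Rightarrow> (point \<Rightarrow> real) \<Rightarrow> point \<Rightarrow> real" where
  "Dd w f x = frechet_derivative f (at x) w"

definition Xe :: "real^3 \<Rightarrow> (point \<Rightarrow> real) \<Rightarrow> point \<Rightarrow> real" where
  "Xe e f x = frechet_derivative f (at x) (0, cross3 e (snd x))"

abbreviation Ds :: "(point \<Rightarrow> real) \<Rightarrow> point \<Rightarrow> real" where
  "Ds \<equiv> Dd (1, 0)"

definition C1 :: "(point \<Rightarrow> real) \<Rightarrow> bool" where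
  "C1 f \<longleftrightarrow> f differentiable_on UNIV \<and> (\<forall>w. continuous_on UNIV (Dd w f))"

lemma C1_has_derivative: "C1 f \<Longrightarrow> (f has_derivative (\<lambda>w. Dd w f x)) (at x)"
  unfolding C1_def Dd_def using frechet_derivative_works
  by (metis UNIV_I differentiable_on_def eta_contract_eq)

lemma C1_continuous: "C1 f \<Longrightarrow> continuous_on A f"
  by (meson C1_has_derivative has_derivative_at_withinI has_derivative_continuous_on)

lemma C1_Dd_continuous: "C1 f \<Longrightarrow> continuous_on A (Dd w f)"
  unfolding C1_def using continuous_on_subset by blast

lemma Dd_eq: "(f has_derivative f') (at x) \<Longrightarrow> Dd w f x = f' w"
  unfolding Dd_def using frechet_derivative_at by metis

lemma Xe_eq: "(f has_derivative f') (at x) \<Longrightarrow> Xe e f x = f' (0, cross3 e (snd x))"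
  unfolding Xe_def using frechet_derivative_at by metis

lemma Xe_Dd: "Xe e f x = Dd (0, cross3 e (snd x)) f x"
  by (simp add: Xe_def Dd_def)

text \<open>Writing the rotation field in constant directions with polynomial coefficients carries
  continuity, differentiability and support from \<open>Dd\<close> to \<open>Xe\<close>.\<close>

lemma Xe_sum_Dd:
  assumes "C1 f"
  shows "Xe e f x = (\<Sum>i\<in>UNIV. cross3 e (snd x) $ i * Dd (0, axis i 1) f x)"
proof -
  have l: "linear (\<lambda>w. Dd w f x)"
    using C1_has_derivative[OF assms] has_derivative_linear by blast
  have "(0, cross3 e (snd x)) = (\<Sum>i\<in>UNIV. cross3 e (snd x) $ i *\<^sub>R ((0::real), axis i (1::real)))"
    using basis_expansion[of "cross3 e (snd x)"]
    by (simp add: sum_prod scalar_mult_eq_scaleR prod_eq_iff fst_sum snd_sum del: scaleR_Pair)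
  then show ?thesis
    unfolding Xe_Dd by (simp only: linear_sum[OF l] linear_cmul[OF l] real_scaleR_def)
qed

lemma continuous_on_cross3_snd [continuous_intros]:
  "continuous_on A (\<lambda>x :: point. cross3 e (snd x))"
  by (rule continuous_on_cross[OF continuous_on_const continuous_on_snd[OF continuous_on_id]])

lemma C1_Xe_continuous: "C1 f \<Longrightarrow> continuous_on A (Xe e f)"
  using Xe_sum_Dd[of f e] C1_Dd_continuous[of f]
  by (simp add: continuous_intros cong: continuous_on_cong)

lemma C1I:
  assumes "\<And>x. (f has_derivative (\<lambda>w. f' w x)) (at x)" "\<And>w. continuous_on UNIV (f' w)"
  shows "C1 f"
proof -
  have "Dd w f = f' w" for w using Dd_eq[OF assms(1)] by (auto simp: fun_eq_iff)
  moreover have "f differentiable_on UNIV"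
    using assms(1) differentiableI by (fastforce simp: differentiable_on_def)
  ultimately show ?thesis using assms(2) by (simp add: C1_def)
qed

lemma C1_const: "C1 (\<lambda>x. c)"
  by (rule C1I[of _ "\<lambda>_ _. 0"]) (auto intro!: derivative_eq_intros)

lemma Dd_add: "C1 f \<Longrightarrow> C1 k \<Longrightarrow> Dd w (\<lambda>x. f x + k x) x = Dd w f x + Dd w k x"
  by (rule Dd_eq) (auto intro!: derivative_eq_intros C1_has_derivative)

lemma C1_add: "C1 f \<Longrightarrow> C1 k \<Longrightarrow> C1 (\<lambda>x. f x + k x)"
  by (rule C1I[of _ "\<lambda>w x. Dd w f x + Dd w k x"])
    (auto intro!: derivative_eq_intros C1_has_derivative continuous_intros C1_Dd_continuous)

lemma Dd_mult: "C1 f \<Longrightarrow> C1 k \<Longrightarrow> Dd w (\<lambda>x. f x * k x) x = f x * Dd w k x + Dd w f x * k x"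
  by (rule Dd_eq) (auto intro!: derivative_eq_intros C1_has_derivative)

lemma C1_mult: "C1 f \<Longrightarrow> C1 k \<Longrightarrow> C1 (\<lambda>x. f x * k x)"
  by (rule C1I[of _ "\<lambda>w x. f x * Dd w k x + Dd w f x * k x"])
    (auto intro!: derivative_eq_intros C1_has_derivative continuous_on_add continuous_on_mult
      C1_Dd_continuous dest: C1_continuous)

lemma Xe_add: "C1 f \<Longrightarrow> C1 k \<Longrightarrow> Xe e (\<lambda>x. f x + k x) x = Xe e f x + Xe e k x"
  by (simp add: Xe_Dd Dd_add)

lemma Xe_mult: "C1 f \<Longrightarrow> C1 k \<Longrightarrow> Xe e (\<lambda>x. f x * k x) x = f x * Xe e k x + Xe e f x * k x"
  by (simp add: Xe_Dd Dd_mult)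

lemma fst_has_derivative:
  assumes "(c has_real_derivative c') (at (fst x))"
  shows "((\<lambda>x::point. c (fst x)) has_derivative (\<lambda>w. fst w * c')) (at x)"
proof -
  have "((c \<circ> fst) has_derivative ((*) c' \<circ> fst)) (at x)"
    using assms unfolding has_field_derivative_def
    by (intro diff_chain_at has_derivative_fst has_derivative_ident) auto
  then show ?thesis by (simp add: o_def mult.commute)
qed

lemma C1_fst:
  assumes "\<And>s. (c has_real_derivative c' s) (at s)" "continuous_on UNIV c'"
  shows "C1 (\<lambda>x. c (fst x))"
  by (rule C1I[of _ "\<lambda>w x. fst w * c' (fst x)"])
    (auto intro!: fst_has_derivative assms continuous_intros continuous_on_compose2[OF assms(2)])

lemma Xe_fst:
  assumes "(c has_real_derivative c') (at (fst x))"
  shows "Xe e (\<lambda>x. c (fst x)) x = 0"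
  using Xe_eq[OF fst_has_derivative[OF assms]] by simp

lemma C1_slice:
  assumes "C1 f"
  shows "((\<lambda>s. f (s, y)) has_real_derivative Ds f (s, y)) (at s)"
proof -
  have "((\<lambda>s. (s, y)) has_derivative (\<lambda>h. (h, 0))) (at s)"
    by (auto intro!: derivative_eq_intros)
  from has_derivative_compose[OF this C1_has_derivative[OF assms]]
  have "((\<lambda>s. f (s, y)) has_derivative (\<lambda>h. Dd (h, 0) f (s, y))) (at s)" by simp
  moreover have "(\<lambda>h. Dd (h, 0) f (s, y)) = (*) (Ds f (s, y))"
  proof
    fix h
    have "Dd (h *\<^sub>R (1, 0)) f (s, y) = h *\<^sub>R Ds f (s, y)"
      by (rule linear_cmul[OF has_derivative_linear[OF C1_has_derivative[OF assms, of "(s, y)"]]])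
    then show "Dd (h, 0) f (s, y) = Ds f (s, y) * h" by (simp add: mult.commute)
  qed
  ultimately show ?thesis unfolding has_field_derivative_def by simp
qed

lemma C1_rotate:
  assumes f: "C1 f" and e: "norm e = 1"
  shows "((\<lambda>t. f (s, rotation e t y)) has_real_derivative Xe e f (s, rotation e t y)) (at t)"
proof -
  have "((\<lambda>t. (s, rotation e t y)) has_derivative (\<lambda>h. (0, h *\<^sub>R cross3 e (rotation e t y)))) (at t)"
    using rotate_deriv[OF e, of y t] unfolding has_vector_derivative_def
    by (auto intro!: derivative_eq_intros)
  from has_derivative_compose[OF this C1_has_derivative[OF f]]
  have "((\<lambda>t. f (s, rotation e t y)) has_derivative
      (\<lambda>h. Dd (0, h *\<^sub>R cross3 e (rotation e t y)) f (s, rotation e t y))) (at t)" by simp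
  moreover have "(\<lambda>h. Dd (0, h *\<^sub>R v) f x) = (*) (Dd (0, v) f x)" for v x
  proof
    fix h
    have "Dd (h *\<^sub>R (0, v)) f x = h *\<^sub>R Dd (0, v) f x"
      by (rule linear_cmul[OF has_derivative_linear[OF C1_has_derivative[OF f, of x]]])
    then show "Dd (0, h *\<^sub>R v) f x = Dd (0, v) f x * h" by (simp add: mult.commute)
  qed
  ultimately show ?thesis unfolding has_field_derivative_def Xe_Dd by simp
qed

lemma slab_supp_Dd:
  assumes f: "C1 f" and "slab_supp f"
  shows "slab_supp (Dd w f)"
proof -
  obtain R where R: "\<And>s y. R \<le> \<bar>s\<bar> \<Longrightarrow> f (s, y) = 0" using assms(2) by (auto simp: slab_supp_def)
  have "Dd w f (s, y) = 0" if "R < \<bar>s\<bar>" for s y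
  proof -
    have "open ({t. R < \<bar>t\<bar>} \<times> (UNIV :: (real^3) set))"
      by (intro open_Times open_Collect_less continuous_intros) auto
    then have "(f has_derivative (\<lambda>w. 0)) (at (s, y))"
      using R that
      by (intro has_derivative_transform_within_open[of "\<lambda>x. 0" "\<lambda>w. 0" _ _ _ f]) auto
    then show ?thesis using Dd_eq by metis
  qed
  then show ?thesis unfolding slab_supp_def
    by (intro exI[of _ "R + 1"]) auto
qed

lemma slab_supp_Xe:
  assumes "C1 f" "slab_supp f"
  shows "slab_supp (Xe e f)"
proof -
  have "slab_supp (\<lambda>x. \<Sum>i\<in>UNIV. cross3 e (snd x) $ i * Dd (0, axis i 1) f x)"
    using assms by (intro slab_supp_intros slab_supp_Dd)
  then show ?thesis using Xe_sum_Dd[OF assms(1)] by (simp add: slab_supp_def)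
qed

section \<open>Integration by parts along s and along the rotations\<close>

lemma integral_Ds_zero:
  assumes f: "C1 f" "slab_supp f"
  shows "(\<integral>x. Ds f x \<partial>mu) = 0"
proof -
  have s: "slab_supp (Ds f)" by (rule slab_supp_Dd[OF assms])
  have c: "continuous_on UNIV (Ds f)" by (rule C1_Dd_continuous[OF f(1)])
  obtain R where R: "\<And>s y. R \<le> \<bar>s\<bar> \<Longrightarrow> f (s, y) = 0" "\<And>s y. R \<le> \<bar>s\<bar> \<Longrightarrow> Ds f (s, y) = 0"
  proof -
    obtain R1 R2 where "\<And>s y. R1 \<le> \<bar>s\<bar> \<Longrightarrow> f (s, y) = 0" "\<And>s y. R2 \<le> \<bar>s\<bar> \<Longrightarrow> Ds f (s, y) = 0"
      using s f(2) unfolding slab_supp_def by metis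
    then show ?thesis by (intro that[of "max R1 R2"]) auto
  qed
  have "(\<integral>x. Ds f x \<partial>mu) = (\<integral>y. (\<integral>s. Ds f (s, y) \<partial>lborel) \<partial>sphere_measure)"
    by (rule integral_mu_snd[OF integrable_mu_slab_supp[OF c s]])
  moreover have "(\<integral>s. Ds f (s, y) \<partial>lborel) = 0" for y
  proof (rule integral_deriv_compact_support[of "\<lambda>s. f (s, y)" _ R])
    show "continuous_on UNIV (\<lambda>s. Ds f (s, y))"
      by (rule continuous_on_compose2[OF c]) (auto intro!: continuous_intros)
  qed (use R C1_slice[OF f(1)] in auto)
  ultimately show ?thesis by simp
qed

text \<open>Rotating the argument does not change the integral, so the difference quotients along
  the flow integrate to 0, and dominated convergence passes to the derivative. The weight c depends
  on s only, which rotations fix, so its continuity is enough.\<close>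

lemma integral_Xe_zero:
  assumes f: "C1 f" "slab_supp f" and e: "norm e = 1" and c: "continuous_on UNIV c"
  shows "(\<integral>x. c (fst x) * Xe e f x \<partial>mu) = 0"
proof -
  define t where "t n = 1 / real (Suc n)" for n
  have t0: "t n > 0" for n by (simp add: t_def)
  have tl: "t \<longlonglongrightarrow> 0"
    unfolding t_def using LIMSEQ_inverse_real_of_nat by (simp add: inverse_eq_divide)
  define q where "q n x = c (fst x) * ((f (fst x, rotation e (t n) (snd x)) - f x) / t n)" for n x
  have cc: "continuous_on A (\<lambda>x::point. c (fst x))" for A
    by (rule continuous_on_compose2[OF c]) (auto intro!: continuous_intros)
  have cr: "continuous_on A (\<lambda>x::point. (fst x, rotation e r (snd x)))" for A r
    unfolding rotation_def by (intro continuous_intros continuous_on_cross)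
  have fc: "continuous_on UNIV f" by (rule C1_continuous[OF f(1)])
  have frc: "continuous_on UNIV (\<lambda>x. f (fst x, rotation e r (snd x)))" for r
    by (rule continuous_on_compose2[OF fc cr]) auto
  have fi: "integrable mu (\<lambda>x. c (fst x) * f x)"
    using f cc fc by (intro integrable_mu_slab_supp continuous_intros slab_supp_intros) auto
  have fri: "integrable mu (\<lambda>x. c (fst x) * f (fst x, rotation e r (snd x)))" for r
  proof (intro integrable_mu_slab_supp continuous_intros cc frc slab_supp_mult2)
    show "slab_supp (\<lambda>x. f (fst x, rotation e r (snd x)))" using f(2) unfolding slab_supp_def by fastforce
  qed
  have q0: "(\<integral>x. q n x \<partial>mu) = 0" for n
  proof -
    have "(\<integral>x. q n x \<partial>mu) = (\<integral>x. (c (fst x) * f (fst x, rotation e (t n) (snd x))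
        - c (fst x) * f x) / t n \<partial>mu)"
      by (simp add: q_def algebra_simps diff_divide_distrib)
    also have "\<dots> = ((\<integral>x. c (fst x) * f (fst x, rotation e (t n) (snd x)) \<partial>mu)
        - (\<integral>x. c (fst x) * f x \<partial>mu)) / t n"
      using fi fri by simp
    also have "(\<integral>x. c (fst x) * f (fst x, rotation e (t n) (snd x)) \<partial>mu) = (\<integral>x. c (fst x) * f x \<partial>mu)"
      using integral_mu_rotate[of "\<lambda>x. c (fst x) * f x" e "t n"] e cc fc
      by (simp add: borel_measurable_continuous_onI continuous_on_mult)
    finally show ?thesis by simp
  qed
  let ?k = "\<lambda>x. c (fst x) * Xe e f x"
  have kc: "continuous_on UNIV ?k" using cc C1_Xe_continuous[OF f(1)] by (intro continuous_intros)
  have ks: "slab_supp ?k" using slab_supp_Xe[OF f] by (rule slab_supp_mult2)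
  obtain R B where B: "B \<ge> 0" "\<And>s y. norm y = 1 \<Longrightarrow> \<bar>?k (s, y)\<bar> \<le> B * indicator ({-R..R} \<times> UNIV) (s, y)"
    using slab_supp_bound[OF kc ks] by auto
  have "(\<lambda>n. \<integral>x. q n x \<partial>mu) \<longlonglongrightarrow> (\<integral>x. ?k x \<partial>mu)"
  proof (rule integral_dominated_convergence)
    show "?k \<in> borel_measurable mu" using borel_measurable_continuous_onI[OF kc] by simp
    show "q n \<in> borel_measurable mu" for n
      unfolding q_def using cc fc frc t0
      by (intro borel_measurable_continuous_onI[THEN measurable_cong_sets[THEN equalityD1, THEN subsetD, rotated -1]]
          continuous_intros) (auto simp: less_imp_neq[symmetric])
    show "integrable mu (\<lambda>x. B * indicator ({-R..R} \<times> UNIV) x)"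
      using integrable_mu_slab_indicator by (rule integrable_mult_right)
    show "AE x in mu. (\<lambda>n. q n x) \<longlonglongrightarrow> ?k x"
    proof (rule AE_I2)
      fix x :: point
      have "((\<lambda>t. f (fst x, rotation e t (snd x))) has_real_derivative Xe e f x) (at 0)"
        using C1_rotate[OF f(1) e, of "fst x" "snd x" 0] by simp
      then have "(\<lambda>n. (f (fst x, rotation e (0 + t n) (snd x)) - f (fst x, rotation e 0 (snd x))) / t n)
          \<longlonglongrightarrow> Xe e f x"
        unfolding DERIV_def using tl t0 by (elim filterlim_compose)
          (auto simp: filterlim_at less_imp_neq[symmetric])
      then show "(\<lambda>n. q n x) \<longlonglongrightarrow> ?k x" unfolding q_def by (intro tendsto_intros) simp
    qed
    show "AE x in mu. norm (q n x) \<le> B * indicator ({-R..R} \<times> UNIV) x" for n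
      using AE_mu_sphere
    proof eventually_elim
      fix x :: point assume x: "norm (snd x) = 1"
      \<comment> \<open>By the mean value theorem the quotient is a value of the limit function at
        another point of the same orbit; that point has the same s and the same norm, so the slab
        bound holds for it too.\<close>
      obtain z where "f (fst x, rotation e (t n) (snd x)) - f (fst x, rotation e 0 (snd x))
          = (t n - 0) * Xe e f (fst x, rotation e z (snd x))"
        using MVT2[OF t0[of n], of "\<lambda>t. f (fst x, rotation e t (snd x))"
            "\<lambda>t. Xe e f (fst x, rotation e t (snd x))"] C1_rotate[OF f(1) e] by blast
      then have "q n x = ?k (fst x, rotation e z (snd x))"
        using t0[of n] by (simp add: q_def)
      then show "norm (q n x) \<le> B * indicator ({-R..R} \<times> UNIV) x"
        using B(2)[of "rotation e z (snd x)" "fst x"] norm_rotate[OF e, of z "snd x"] x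
        by (cases x) (simp add: indicator_times)
    qed
  qed
  then show ?thesis using q0 by (simp add: LIMSEQ_const_iff)
qed

lemma integral_Ds_by_parts:
  assumes "C1 f" "C1 k" "slab_supp f \<or> slab_supp k"
  shows "(\<integral>x. Ds f x * k x \<partial>mu) = - (\<integral>x. f x * Ds k x \<partial>mu)"
proof -
  have cs: "continuous_on UNIV f" "continuous_on UNIV k" "continuous_on UNIV (Ds f)" "continuous_on UNIV (Ds k)"
    using assms by (auto intro: C1_continuous C1_Dd_continuous)
  have s: "slab_supp (\<lambda>x. f x * k x)" "slab_supp (\<lambda>x. f x * Ds k x)" "slab_supp (\<lambda>x. Ds f x * k x)"
    using assms slab_supp_Dd by (auto intro: slab_supp_mult1 slab_supp_mult2)
  have "integrable mu (\<lambda>x. Ds f x * k x)" "integrable mu (\<lambda>x. f x * Ds k x)"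
    using s cs by (auto intro!: integrable_mu_slab_supp continuous_on_mult)
  moreover have "(\<integral>x. f x * Ds k x + Ds f x * k x \<partial>mu) = 0"
    using integral_Ds_zero[OF C1_mult[OF assms(1,2)] s(1)] assms by (simp add: Dd_mult)
  ultimately show ?thesis by simp
qed

lemma integral_Xe_by_parts:
  assumes "C1 f" "C1 k" "slab_supp f \<or> slab_supp k" "norm e = 1" and c: "continuous_on UNIV c"
  shows "(\<integral>x. c (fst x) * (Xe e f x * k x) \<partial>mu) = - (\<integral>x. c (fst x) * (f x * Xe e k x) \<partial>mu)"
proof -
  have cc: "continuous_on UNIV (\<lambda>x::point. c (fst x))"
    by (rule continuous_on_compose2[OF c]) (auto intro!: continuous_intros)
  have cs: "continuous_on UNIV f" "continuous_on UNIV k" "continuous_on UNIV (Xe e f)" "continuous_on UNIV (Xe e k)"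
    using assms by (auto intro: C1_continuous C1_Xe_continuous)
  have s: "slab_supp (\<lambda>x. f x * k x)" "slab_supp (\<lambda>x. f x * Xe e k x)" "slab_supp (\<lambda>x. Xe e f x * k x)"
    using assms slab_supp_Xe by (auto intro: slab_supp_mult1 slab_supp_mult2)
  have "integrable mu (\<lambda>x. c (fst x) * (Xe e f x * k x))" "integrable mu (\<lambda>x. c (fst x) * (f x * Xe e k x))"
    using s cs cc by (auto intro!: integrable_mu_slab_supp continuous_on_mult slab_supp_mult2)
  moreover have "(\<integral>x. c (fst x) * (f x * Xe e k x) + c (fst x) * (Xe e f x * k x) \<partial>mu) = 0"
    using integral_Xe_zero[OF C1_mult[OF assms(1,2)] s(1) assms(4) c] assms
    by (simp add: Xe_mult distrib_left)
  ultimately show ?thesis by simp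
qed

section \<open>Square-integrable functions modulo null sets\<close>

definition sq_int :: "(point \<Rightarrow> real) \<Rightarrow> bool" where
  "sq_int f \<longleftrightarrow> f \<in> borel_measurable borel \<and> integrable mu (\<lambda>x. (f x)\<^sup>2)"

lemma sq_int_measurable [measurable_dest]: "sq_int f \<Longrightarrow> f \<in> borel_measurable borel"
  by (simp add: sq_int_def)

lemma sq_int_integrable: "sq_int f \<Longrightarrow> integrable mu (\<lambda>x. (f x)\<^sup>2)"
  by (simp add: sq_int_def)

lemma sq_int_mult_integrable:
  assumes "sq_int f" "sq_int k"
  shows "integrable mu (\<lambda>x. f x * k x)"
proof (rule Bochner_Integration.integrable_bound)
  show "integrable mu (\<lambda>x. (f x)\<^sup>2 + (k x)\<^sup>2)" using assms by (simp add: sq_int_def)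
  show "(\<lambda>x. f x * k x) \<in> borel_measurable mu" 
    using assms[THEN sq_int_measurable] by measurable
  show "AE x in mu. norm (f x * k x) \<le> norm ((f x)\<^sup>2 + (k x)\<^sup>2)"
  proof (rule AE_I2)
    fix x
    have "0 \<le> (\<bar>f x\<bar> - \<bar>k x\<bar>)\<^sup>2" by simp
    then have "2 * (\<bar>f x\<bar> * \<bar>k x\<bar>) \<le> (f x)\<^sup>2 + (k x)\<^sup>2" by (simp add: power2_diff)
    moreover have "0 \<le> \<bar>f x\<bar> * \<bar>k x\<bar>" by simp
    ultimately have "\<bar>f x * k x\<bar> \<le> (f x)\<^sup>2 + (k x)\<^sup>2" unfolding abs_mult by linarith
    then show "norm (f x * k x) \<le> norm ((f x)\<^sup>2 + (k x)\<^sup>2)" by simp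
  qed
qed

lemma sq_int_zero: "sq_int (\<lambda>x. 0)"
  by (simp add: sq_int_def)

lemma sq_int_add: "sq_int f \<Longrightarrow> sq_int k \<Longrightarrow> sq_int (\<lambda>x. f x + k x)"
  using sq_int_mult_integrable[of f k]
  by (auto simp: sq_int_def power2_sum mult.assoc intro!: borel_measurable_add)

lemma sq_int_scale: "sq_int f \<Longrightarrow> sq_int (\<lambda>x. c * f x)"
  by (auto simp: sq_int_def power_mult_distrib intro!: borel_measurable_times)

lemma sq_int_minus: "sq_int f \<Longrightarrow> sq_int (\<lambda>x. - f x)"
  by (simp add: sq_int_def)

lemma sq_int_diff: "sq_int f \<Longrightarrow> sq_int k \<Longrightarrow> sq_int (\<lambda>x. f x - k x)"
  using sq_int_add[of f "\<lambda>x. - k x"] sq_int_minus[of k] by simp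

lemma sq_int_bound:
  assumes f: "sq_int f" and [measurable]: "k \<in> borel_measurable borel"
    and le: "\<And>x. \<bar>k x\<bar> \<le> K * \<bar>f x\<bar>"
  shows "sq_int k"
  unfolding sq_int_def
proof
  show "integrable mu (\<lambda>x. (k x)\<^sup>2)"
  proof (rule Bochner_Integration.integrable_bound)
    show "integrable mu (\<lambda>x. K\<^sup>2 * (f x)\<^sup>2)" using f by (simp add: sq_int_def)
    show "AE x in mu. norm ((k x)\<^sup>2) \<le> norm (K\<^sup>2 * (f x)\<^sup>2)"
    proof (rule AE_I2)
      fix x
      have "\<bar>k x\<bar>\<^sup>2 \<le> (K * \<bar>f x\<bar>)\<^sup>2" using le[of x] by (intro power_mono) auto
      then show "norm ((k x)\<^sup>2) \<le> norm (K\<^sup>2 * (f x)\<^sup>2)" by (simp add: power_mult_distrib)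
    qed
  qed measurable
qed measurable

lemma sq_int_slab_supp: "continuous_on UNIV f \<Longrightarrow> slab_supp f \<Longrightarrow> sq_int f"
  unfolding sq_int_def
  by (auto intro!: borel_measurable_continuous_onI integrable_mu_slab_supp slab_supp_power continuous_intros)

lemma integral_square_eq_0_iff: "sq_int f \<Longrightarrow> (\<integral>x. (f x)\<^sup>2 \<partial>mu) = 0 \<longleftrightarrow> (AE x in mu. f x = 0)"
  by (subst integral_nonneg_eq_0_iff_AE) (auto simp: sq_int_def)

text \<open>The relation is partial: functions that are not square integrable belong to no class.
  Real values make the quotient an instance of \<open>real_inner\<close>, for which the abstract
  Hilbert space lemmas are stated.\<close>

definition l2_rel :: "(point \<Rightarrow> real) \<Rightarrow> (point \<Rightarrow> real) \<Rightarrow> bool" where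
  "l2_rel f k \<longleftrightarrow> sq_int f \<and> sq_int k \<and> (AE x in mu. f x = k x)"

quotient_type l2 = "point \<Rightarrow> real" / partial: l2_rel
proof (rule part_equivpI)
  show "\<exists>f. l2_rel f f" by (rule exI[of _ "\<lambda>_. 0"]) (simp add: l2_rel_def sq_int_zero)
  show "symp l2_rel" by (auto simp: symp_def l2_rel_def)
  show "transp l2_rel" unfolding transp_def l2_rel_def by (auto elim: AE_mp)
qed

lemma l2_rel_integral:
  assumes "l2_rel f f'" "l2_rel k k'"
  shows "(\<integral>x. f x * k x \<partial>mu) = (\<integral>x. f' x * k' x \<partial>mu)"
proof (rule integral_cong_AE)
  have "AE x in mu. f x = f' x" "AE x in mu. k x = k' x" using assms by (auto simp: l2_rel_def)
  then show "AE x in mu. f x * k x = f' x * k' x" by eventually_elim simp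
qed (use assms in \<open>auto simp: l2_rel_def sq_int_def\<close>)

instantiation l2 :: real_inner
begin

lift_definition zero_l2 :: l2 is "\<lambda>x. 0" by (simp add: l2_rel_def sq_int_zero)

lift_definition plus_l2 :: "l2 \<Rightarrow> l2 \<Rightarrow> l2" is "\<lambda>f k x. f x + k x"
  by (auto simp: l2_rel_def sq_int_add elim!: AE_mp)

lift_definition uminus_l2 :: "l2 \<Rightarrow> l2" is "\<lambda>f x. - f x"
  by (auto simp: l2_rel_def sq_int_minus)

lift_definition minus_l2 :: "l2 \<Rightarrow> l2 \<Rightarrow> l2" is "\<lambda>f k x. f x - k x"
  by (auto simp: l2_rel_def sq_int_diff elim!: AE_mp)

lift_definition scaleR_l2 :: "real \<Rightarrow> l2 \<Rightarrow> l2" is "\<lambda>c f x. c * f x"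
  by (auto simp: l2_rel_def sq_int_scale)

lift_definition inner_l2 :: "l2 \<Rightarrow> l2 \<Rightarrow> real" is "\<lambda>f k. \<integral>x. f x * k x \<partial>mu"
  by (rule l2_rel_integral)

definition norm_l2 :: "l2 \<Rightarrow> real" where "norm_l2 u = sqrt (inner u u)"
definition dist_l2 :: "l2 \<Rightarrow> l2 \<Rightarrow> real" where "dist_l2 u v = norm (u - v)"
definition sgn_l2 :: "l2 \<Rightarrow> l2" where "sgn_l2 u = inverse (norm u) *\<^sub>R u"
definition uniformity_l2 :: "(l2 \<times> l2) filter" where
  "uniformity_l2 = (INF e\<in>{0<..}. principal {(x, y). dist x y < e})"
definition open_l2 :: "l2 set \<Rightarrow> bool" where
  "open_l2 U \<longleftrightarrow> (\<forall>x\<in>U. \<forall>\<^sub>F (x', y) in uniformity. x' = x \<longrightarrow> y \<in> U)"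

instance
proof
  fix a b c :: l2 and r s :: real
  show "a + b + c = a + (b + c)" by transfer (auto simp: l2_rel_def sq_int_add algebra_simps)
  show "a + b = b + a" by transfer (auto simp: l2_rel_def sq_int_add algebra_simps)
  show "0 + a = a" by transfer (auto simp: l2_rel_def)
  show "- a + a = 0" by transfer (auto simp: l2_rel_def sq_int_zero)
  show "a - b = a + - b" by transfer (auto simp: l2_rel_def sq_int_diff)
  show "r *\<^sub>R (a + b) = r *\<^sub>R a + r *\<^sub>R b"
    by transfer (auto simp: l2_rel_def sq_int_add sq_int_scale distrib_left)
  show "(r + s) *\<^sub>R a = r *\<^sub>R a + s *\<^sub>R a"
    by transfer (auto simp: l2_rel_def sq_int_add sq_int_scale distrib_right)
  show "r *\<^sub>R s *\<^sub>R a = (r * s) *\<^sub>R a" by transfer (auto simp: l2_rel_def sq_int_scale mult.assoc)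
  show "1 *\<^sub>R a = a" by transfer (auto simp: l2_rel_def)
  show "dist a b = norm (a - b)" by (rule dist_l2_def)
  show "sgn a = inverse (norm a) *\<^sub>R a" by (rule sgn_l2_def)
  show "uniformity = (INF e\<in>{0<..}. principal {(x :: l2, y). dist x y < e})"
    by (rule uniformity_l2_def)
  show "open U \<longleftrightarrow> (\<forall>x\<in>U. \<forall>\<^sub>F (x', y) in uniformity. x' = x \<longrightarrow> y \<in> U)" for U :: "l2 set"
    by (rule open_l2_def)
  show "inner a b = inner b a" by transfer (simp add: mult.commute)
  show "inner (a + b) c = inner a c + inner b c"
    by transfer (auto simp: l2_rel_def sq_int_mult_integrable distrib_right)
  show "inner (r *\<^sub>R a) b = r * inner a b" by transfer (simp add: mult.assoc)
  show "0 \<le> inner a a" by transfer simp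
  show "inner a a = 0 \<longleftrightarrow> a = 0"
    by transfer (auto simp: l2_rel_def sq_int_zero integral_square_eq_0_iff simp flip: power2_eq_square)
  show "norm a = sqrt (inner a a)" by (rule norm_l2_def)
qed

end

text \<open>Lifting needs a total map, so functions outside L2 are sent to the class of 0; the rules
  for sums, multiples and inner products carry \<open>sq_int\<close> as a premise.\<close>

lift_definition cls0 :: "(point \<Rightarrow> real) \<Rightarrow> l2" is "\<lambda>f. if sq_int f then f else (\<lambda>_. 0)"
  by (auto simp: l2_rel_def sq_int_zero)

abbreviation cls :: "(point \<Rightarrow> real) \<Rightarrow> l2" where "cls \<equiv> cls0"

text \<open>Products and cubes are taken pointwise and not on classes; a fixed Borel representative
  makes them available.\<close>

definition rep :: "l2 \<Rightarrow> point \<Rightarrow> real" where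
  "rep u = (SOME f. sq_int f \<and> cls f = u)"

lemma cls_surj: "\<exists>f. sq_int f \<and> cls f = u"
proof transfer
  fix f assume "l2_rel f f"
  then show "\<exists>k. sq_int k \<and> l2_rel (if sq_int k then k else (\<lambda>_. 0)) f"
    by (intro exI[of _ f]) (auto simp: l2_rel_def)
qed

lemma rep_sq_int: "sq_int (rep u)" and cls_rep [simp]: "cls (rep u) = u"
  unfolding rep_def using someI_ex[OF cls_surj[of u]] by auto

lemma cls_eq_iff: "sq_int f \<Longrightarrow> sq_int k \<Longrightarrow> cls f = cls k \<longleftrightarrow> (AE x in mu. f x = k x)"
  by transfer (auto simp: l2_rel_def)

lemma rep_cls: "sq_int f \<Longrightarrow> AE x in mu. rep (cls f) x = f x"
  using cls_eq_iff[OF rep_sq_int, of f "cls f"] by simp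

lemma inner_cls: "sq_int f \<Longrightarrow> sq_int k \<Longrightarrow> inner (cls f) (cls k) = (\<integral>x. f x * k x \<partial>mu)"
  by transfer simp

lemma cls_add: "sq_int f \<Longrightarrow> sq_int k \<Longrightarrow> cls (\<lambda>x. f x + k x) = cls f + cls k"
  by transfer (auto simp: l2_rel_def sq_int_add)

lemma cls_diff: "sq_int f \<Longrightarrow> sq_int k \<Longrightarrow> cls (\<lambda>x. f x - k x) = cls f - cls k"
  by transfer (auto simp: l2_rel_def sq_int_diff)

lemma cls_minus: "sq_int f \<Longrightarrow> cls (\<lambda>x. - f x) = - cls f"
  by transfer (auto simp: l2_rel_def sq_int_minus)

lemma cls_scale: "sq_int f \<Longrightarrow> cls (\<lambda>x. c * f x) = c *\<^sub>R cls f"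
  by transfer (auto simp: l2_rel_def sq_int_scale)

lemma cls_zero: "cls (\<lambda>x. 0) = 0"
  by transfer (auto simp: l2_rel_def sq_int_zero)

lemma norm_cls: "sq_int f \<Longrightarrow> (norm (cls f))\<^sup>2 = (\<integral>x. (f x)\<^sup>2 \<partial>mu)"
  using inner_cls[of f f] by (simp only: power2_norm_eq_inner) (simp add: power2_eq_square)

lemma inner_rep: "inner u v = (\<integral>x. rep u x * rep v x \<partial>mu)"
  using inner_cls[OF rep_sq_int rep_sq_int, of u v] by simp

lemma norm_rep: "(norm u)\<^sup>2 = (\<integral>x. (rep u x)\<^sup>2 \<partial>mu)"
  using norm_cls[OF rep_sq_int, of u] by simp

lemma Cauchy_fast_subseq:
  fixes X :: "nat \<Rightarrow> 'a::metric_space"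
  assumes "Cauchy X" "\<And>n. e n > 0"
  obtains r :: "nat \<Rightarrow> nat" where "strict_mono r" "\<And>n m. n \<le> m \<Longrightarrow> dist (X (r n)) (X (r m)) < e n"
proof -
  have "\<exists>N. \<forall>m\<ge>N. \<forall>n\<ge>N. dist (X m) (X n) < e k" for k
    using assms unfolding Cauchy_def by auto
  then obtain N where N: "\<And>k m n. m \<ge> N k \<Longrightarrow> n \<ge> N k \<Longrightarrow> dist (X m) (X n) < e k" by metis
  define r where "r n = (\<Sum>k\<le>n. N k) + n" for n
  have "strict_mono r" unfolding strict_mono_Suc_iff r_def by simp
  moreover have "r n \<ge> N n" for n
  proof -
    have "N n \<le> (\<Sum>k\<le>n. N k)" by (rule member_le_sum) auto
    then show ?thesis by (simp add: r_def)
  qed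
  moreover have "r m \<ge> N n" if "n \<le> m" for n m
    using that calculation by (meson le_trans strict_mono_less_eq)
  ultimately show ?thesis using N by (intro that[of r]) simp_all
qed

text \<open>Riesz-Fischer. Along a fast subsequence the squared distances are at most 16^(-n). With
  the weights 4^n their sum is still finite, so almost everywhere the successive differences are at
  most a multiple of 2^(-n); this gives pointwise convergence without Minkowski's inequality for
  series.\<close>

instance l2 :: complete_space
proof
  fix X :: "nat \<Rightarrow> l2" assume X: "Cauchy X"
  obtain r :: "nat \<Rightarrow> nat" where r: "strict_mono r"
    and fast: "\<And>n m. n \<le> m \<Longrightarrow> dist (X (r n)) (X (r m)) < (1/4)^n"
    by (rule Cauchy_fast_subseq[OF X, of "\<lambda>n. (1/4)^n"]) auto
  define f where "f n = rep (X (r n))" for n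
  have sf: "sq_int (f n)" for n by (simp add: f_def rep_sq_int)
  have [measurable]: "f n \<in> borel_measurable borel" for n using sf by (rule sq_int_measurable)
  have nn: "(\<integral>\<^sup>+x. ennreal ((f n x - f m x)\<^sup>2) \<partial>mu) = ennreal ((norm (X (r n) - X (r m)))\<^sup>2)" for n m
  proof -
    have "sq_int (\<lambda>x. f n x - f m x)" by (intro sq_int_diff sf)
    then show ?thesis
      using norm_cls[of "\<lambda>x. f n x - f m x"] cls_diff[OF sf sf, of n m]
      by (subst nn_integral_eq_integral) (auto simp: sq_int_def f_def)
  qed
  have fast2: "(\<integral>\<^sup>+x. ennreal ((f n x - f m x)\<^sup>2) \<partial>mu) \<le> ennreal ((1/16)^n)" if "n \<le> m" for n m
  proof -
    have "(norm (X (r n) - X (r m)))\<^sup>2 \<le> ((1/4)^n)\<^sup>2"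
      using fast[OF that] by (intro power_mono) (auto simp: dist_norm)
    also have "((1/4)^n)\<^sup>2 = (1/16 :: real)^n"
      by (simp add: power2_eq_square flip: power_mult_distrib)
    finally show ?thesis unfolding nn by (rule ennreal_leI)
  qed
  have "(\<integral>\<^sup>+x. (\<Sum>n. ennreal (4^n * (f n x - f (Suc n) x)\<^sup>2)) \<partial>mu)
      = (\<Sum>n. \<integral>\<^sup>+x. ennreal (4^n * (f n x - f (Suc n) x)\<^sup>2) \<partial>mu)"
    by (rule nn_integral_suminf) measurable
  also have "\<dots> = (\<Sum>n. ennreal (4^n) * (\<integral>\<^sup>+x. ennreal ((f n x - f (Suc n) x)\<^sup>2) \<partial>mu))"
    by (simp add: ennreal_mult nn_integral_cmult)
  also have "\<dots> \<le> (\<Sum>n. ennreal (4^n) * ennreal ((1/16)^n))"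
    by (intro suminf_le mult_left_mono fast2) auto
  also have "\<dots> = (\<Sum>n. ennreal ((1/4)^n))"
  proof (rule arg_cong[where f = suminf], rule ext)
    show "ennreal (4^n) * ennreal ((1/16)^n) = ennreal ((1/4)^n)" for n
      by (simp flip: ennreal_mult power_mult_distrib)
  qed
  also have "\<dots> < \<infinity>"
    by (subst suminf_ennreal_eq[OF _ geometric_sums]) auto
  finally have "AE x in mu. (\<Sum>n. ennreal (4^n * (f n x - f (Suc n) x)\<^sup>2)) \<noteq> \<infinity>"
    by (intro nn_integral_noteq_infinite) auto
  then have conv: "AE x in mu. convergent (\<lambda>n. f n x)"
  proof eventually_elim
    fix x assume "(\<Sum>n. ennreal (4^n * (f n x - f (Suc n) x)\<^sup>2)) \<noteq> \<infinity>"
    then have "summable (\<lambda>n. 4^n * (f n x - f (Suc n) x)\<^sup>2)"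
      by (intro summable_suminf_not_top) auto
    then have "Bseq (\<lambda>n. 4^n * (f n x - f (Suc n) x)\<^sup>2)"
      by (intro convergent_imp_Bseq convergentI[of _ 0] summable_LIMSEQ_zero)
    then obtain K where K: "K > 0" "\<And>n. \<bar>4^n * (f n x - f (Suc n) x)\<^sup>2\<bar> \<le> K"
      by (auto simp: Bseq_def)
    have "\<bar>f (Suc n) x - f n x\<bar> \<le> sqrt K * (1/2)^n" for n
    proof -
      have "(2^n * \<bar>f (Suc n) x - f n x\<bar>)\<^sup>2 = 4^n * (f n x - f (Suc n) x)\<^sup>2"
      proof -
        have "(2^n)\<^sup>2 = (4::real)^n" by (simp add: power2_eq_square flip: power_mult_distrib)
        then show ?thesis by (simp add: power_mult_distrib power2_commute[of "f n x"])
      qed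
      also have "\<dots> \<le> K" using K(2)[of n] by simp
      finally have "2^n * \<bar>f (Suc n) x - f n x\<bar> \<le> sqrt K" by (rule real_le_rsqrt)
      then show ?thesis by (simp add: field_simps power_one_over)
    qed
    then have "summable (\<lambda>n. f (Suc n) x - f n x)"
      by (intro summable_comparison_test'[OF summable_mult[OF summable_geometric], of "1/2" 0 _ "sqrt K"])
        auto
    then show "convergent (\<lambda>n. f n x)"
      unfolding summable_iff_convergent sum_lessThan_telescope[of "\<lambda>n. f n x"]
      using convergent_add_const_iff[of "- f 0 x" "\<lambda>n. f n x"] by simp
  qed
  define F where "F x = lim (\<lambda>n. f n x)" for x
  have [measurable]: "F \<in> borel_measurable borel"
    unfolding F_def by (rule borel_measurable_lim_metric) measurable
  have lim: "AE x in mu. (\<lambda>n. f n x) \<longlonglongrightarrow> F x"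
    using conv by eventually_elim (simp add: F_def convergent_LIMSEQ_iff)
  \<comment> \<open>Fatou's lemma in the second index: the bound for \<open>f n - f m\<close>
    survives as m tends to infinity, which shows at once that F is square integrable and how fast
    \<open>f n\<close> approaches it.\<close>
  have le: "(\<integral>\<^sup>+x. ennreal ((F x - f n x)\<^sup>2) \<partial>mu) \<le> ennreal ((1/16)^n)" for n
  proof -
    have "(\<integral>\<^sup>+x. ennreal ((F x - f n x)\<^sup>2) \<partial>mu)
        = (\<integral>\<^sup>+x. liminf (\<lambda>m. ennreal ((f n x - f m x)\<^sup>2)) \<partial>mu)"
    proof (rule nn_integral_cong_AE)
      show "AE x in mu. ennreal ((F x - f n x)\<^sup>2) = liminf (\<lambda>m. ennreal ((f n x - f m x)\<^sup>2))"
        using lim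
      proof eventually_elim
        fix x assume "(\<lambda>m. f m x) \<longlonglongrightarrow> F x"
        then have "(\<lambda>m. ennreal ((f n x - f m x)\<^sup>2)) \<longlonglongrightarrow> ennreal ((f n x - F x)\<^sup>2)"
          by (intro tendsto_intros tendsto_ennrealI)
        from lim_imp_Liminf[OF trivial_limit_sequentially this]
        show "ennreal ((F x - f n x)\<^sup>2) = liminf (\<lambda>m. ennreal ((f n x - f m x)\<^sup>2))"
          by (simp add: power2_commute[of "F x"])
      qed
    qed
    also have "\<dots> \<le> liminf (\<lambda>m. \<integral>\<^sup>+x. ennreal ((f n x - f m x)\<^sup>2) \<partial>mu)"
      by (rule nn_integral_liminf) measurable
    also have "\<dots> \<le> ennreal ((1/16)^n)"
      using fast2 by (intro Liminf_le) (auto simp: eventually_sequentially)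
    finally show ?thesis .
  qed
  have sFf: "sq_int (\<lambda>x. F x - f n x)" for n
    unfolding sq_int_def
    using le[of n] by (auto intro!: integrableI_bounded simp: less_top[symmetric] top_unique)
  have sF: "sq_int F" using sq_int_add[OF sFf[of 0] sf[of 0]] by simp
  have "norm (X (r n) - cls F) \<le> (1/4)^n" for n
  proof -
    have "(norm (cls F - X (r n)))\<^sup>2 = (\<integral>x. (F x - f n x)\<^sup>2 \<partial>mu)"
      using norm_cls[OF sFf[of n]] cls_diff[OF sF sf, of n] by (simp add: f_def)
    also have "ennreal \<dots> = (\<integral>\<^sup>+x. ennreal ((F x - f n x)\<^sup>2) \<partial>mu)"
      using sFf[of n] by (intro nn_integral_eq_integral[symmetric]) (auto simp: sq_int_def)
    finally have "ennreal ((norm (cls F - X (r n)))\<^sup>2) \<le> ennreal ((1/16)^n)" using le[of n] by (simp only:)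
    then have "(norm (cls F - X (r n)))\<^sup>2 \<le> (1/16)^n" by (subst (asm) ennreal_le_iff) auto
    also have "(1/16 :: real)^n = ((1/4)^n)\<^sup>2"
      by (simp add: power2_eq_square flip: power_mult_distrib)
    finally show ?thesis by (simp add: norm_minus_commute power_mono_iff)
  qed
  moreover have "(\<lambda>n. (1/4 :: real)^n) \<longlonglongrightarrow> 0" by (rule LIMSEQ_realpow_zero) auto
  ultimately have "(\<lambda>n. X (r n)) \<longlonglongrightarrow> cls F"
    by (subst Lim_null) (rule Lim_null_comparison[OF always_eventually], auto)
  then have "X \<longlonglongrightarrow> cls F"
    using X r Cauchy_converges_subseq by (auto simp: o_def)
  then show "convergent X" by (rule convergentI)
qed

section \<open>Hilbert space lemmas\<close>

lemma parallelogram: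
  fixes a b :: "'a::real_inner"
  shows "(norm (a - b))\<^sup>2 = 2 * (norm a)\<^sup>2 + 2 * (norm b)\<^sup>2 - 4 * (norm ((1/2) *\<^sub>R (a + b)))\<^sup>2"
  by (simp add: power2_norm_eq_inner inner_diff inner_add inner_commute[of b a] power_mult_distrib algebra_simps)

lemma norm_diff_scale:
  fixes a s :: "'a::real_inner"
  shows "(norm (a - t *\<^sub>R s))\<^sup>2 = (norm a)\<^sup>2 - 2 * t * inner a s + t\<^sup>2 * (norm s)\<^sup>2"
  unfolding power2_norm_eq_inner
  by (simp add: inner_diff_left inner_diff_right inner_commute[of s a] power2_eq_square algebra_simps)

text \<open>The argument of the projection theorem: a minimising sequence for the distance from x to
  S converges to a point z of the closure, and the residual x - z is orthogonal to S, hence 0 by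
  assumption.\<close>

lemma dense_if_orthogonal_trivial:
  fixes S :: "'a::{real_inner,complete_space} set"
  assumes S: "subspace S" and orth: "\<And>w. (\<And>s. s \<in> S \<Longrightarrow> inner w s = 0) \<Longrightarrow> w = 0"
  shows "closure S = UNIV"
proof -
  have "x \<in> closure S" for x
  proof -
    define d where "d = infdist x S"
    have ne: "S \<noteq> {}" using S subspace_0 by blast
    have ex: "\<exists>y\<in>S. (norm (x - y))\<^sup>2 < d\<^sup>2 + 1 / real (Suc n)" for n
    proof -
      have "d < sqrt (d\<^sup>2 + 1 / real (Suc n))"
        by (rule real_less_rsqrt) simp
      then obtain y where "y \<in> S" "dist x y < sqrt (d\<^sup>2 + 1 / real (Suc n))"
        using ne unfolding d_def infdist_def by (auto simp: cINF_less_iff)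
      then have "(norm (x - y))\<^sup>2 < (sqrt (d\<^sup>2 + 1 / real (Suc n)))\<^sup>2"
        by (intro power_strict_mono) (auto simp: dist_norm)
      then show ?thesis using \<open>y \<in> S\<close> by (intro bexI[of _ y]) auto
    qed
    then obtain y where y: "\<And>n. y n \<in> S" "\<And>n. (norm (x - y n))\<^sup>2 < d\<^sup>2 + 1 / real (Suc n)"
      by metis
    have dle: "d \<le> norm (x - s)" if "s \<in> S" for s
      using infdist_le[OF that, of x] by (simp add: d_def dist_norm)
    have d0: "d \<ge> 0" by (simp add: d_def infdist_nonneg)
    \<comment> \<open>Parallelogram identity. The midpoint of two almost minimisers lies in S and
      cannot be closer to x than d, which forces the two to be close to each other.\<close>
    have close: "(norm (y m - y n))\<^sup>2 \<le> 2 / real (Suc m) + 2 / real (Suc n)" for m n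
    proof -
      have "(1/2) *\<^sub>R (y m + y n) \<in> S" using S y by (simp add: subspace_add subspace_scale)
      from dle[OF this] have "d\<^sup>2 \<le> (norm (x - (1/2) *\<^sub>R (y m + y n)))\<^sup>2" using d0 by (intro power_mono)
      also have "x - (1/2) *\<^sub>R (y m + y n) = (1/2) *\<^sub>R ((x - y m) + (x - y n))"
        by (simp add: algebra_simps scaleR_2[symmetric])
      finally have "d\<^sup>2 \<le> (norm ((1/2) *\<^sub>R ((x - y m) + (x - y n))))\<^sup>2" .
      moreover have "(norm (y m - y n))\<^sup>2 = (norm ((x - y m) - (x - y n)))\<^sup>2"
        by (simp add: norm_minus_commute)
      ultimately show ?thesis
        using parallelogram[of "x - y m" "x - y n"] y(2)[of m] y(2)[of n]
          times_divide_eq_right[of 2 1 "real (Suc m)"] times_divide_eq_right[of 2 1 "real (Suc n)"]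
        unfolding mult_1_right by linarith
    qed
    have "Cauchy y"
    proof (rule metric_CauchyI)
      fix e :: real assume e: "e > 0"
      obtain N where N: "4 / e\<^sup>2 < real N" using reals_Archimedean2 by blast
      have N0: "real N > 0" using N e by (meson divide_pos_pos order.strict_trans zero_less_numeral zero_less_power)
      show "\<exists>M. \<forall>m\<ge>M. \<forall>n\<ge>M. dist (y m) (y n) < e"
      proof (intro exI[of _ N] allI impI)
        fix m n assume mn: "m \<ge> N" "n \<ge> N"
        have "2 / real (Suc m) \<le> 2 / real N" "2 / real (Suc n) \<le> 2 / real N"
          using mn N0 by (auto intro!: divide_left_mono)
        then have "(norm (y m - y n))\<^sup>2 \<le> 4 / real N" using close[of m n] by simp
        also have "\<dots> < e\<^sup>2" using N N0 e by (simp add: field_simps)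
        finally show "dist (y m) (y n) < e" using e by (simp add: dist_norm power_less_imp_less_base)
      qed
    qed
    then obtain z where z: "y \<longlonglongrightarrow> z" using Cauchy_convergent convergent_def by blast
    have zc: "z \<in> closure S" using y(1) z closure_sequential by blast
    have "(norm (x - z))\<^sup>2 \<le> d\<^sup>2 + 0"
    proof (rule LIMSEQ_le)
      show "(\<lambda>n. (norm (x - y n))\<^sup>2) \<longlonglongrightarrow> (norm (x - z))\<^sup>2" by (intro tendsto_intros z)
      show "(\<lambda>n. d\<^sup>2 + 1 / real (Suc n)) \<longlonglongrightarrow> d\<^sup>2 + 0"
        using LIMSEQ_inverse_real_of_nat by (intro tendsto_intros) (simp add: inverse_eq_divide)
      show "\<exists>N. \<forall>n\<ge>N. (norm (x - y n))\<^sup>2 \<le> d\<^sup>2 + 1 / real (Suc n)" using y(2) less_imp_le by blast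
    qed
    then have xz: "(norm (x - z))\<^sup>2 \<le> d\<^sup>2" by simp
    have "inner (x - z) s = 0" if s: "s \<in> S" for s
    proof (cases "s = 0")
      case False
      \<comment> \<open>The step that minimises the distance to x along the line z + t s; a nonzero
        inner product would bring it below d.\<close>
      define t where "t = inner (x - z) s / (norm s)\<^sup>2"
      have "d \<le> norm (x - (z + t *\<^sub>R s))"
      proof (rule LIMSEQ_le_const)
        show "(\<lambda>n. norm (x - (y n + t *\<^sub>R s))) \<longlonglongrightarrow> norm (x - (z + t *\<^sub>R s))" by (intro tendsto_intros z)
        show "\<exists>N. \<forall>n\<ge>N. d \<le> norm (x - (y n + t *\<^sub>R s))"
          using dle y(1) s S by (meson subspace_add subspace_scale)
      qed
      then have "d\<^sup>2 \<le> (norm ((x - z) - t *\<^sub>R s))\<^sup>2" using d0 by (intro power_mono) (auto simp: algebra_simps)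
      also have "\<dots> = (norm (x - z))\<^sup>2 - 2 * t * inner (x - z) s + t\<^sup>2 * (norm s)\<^sup>2"
        by (rule norm_diff_scale)
      also have "t\<^sup>2 * (norm s)\<^sup>2 = t * inner (x - z) s" using False by (simp add: t_def power2_eq_square)
      finally have "t * inner (x - z) s \<le> 0" using xz by simp
      then have "(inner (x - z) s)\<^sup>2 / (norm s)\<^sup>2 \<le> 0" by (simp add: t_def power2_eq_square)
      then show ?thesis using False by (simp add: divide_le_0_iff)
    qed simp
    then have "x - z = 0" by (rule orth)
    then show ?thesis using zc by simp
  qed
  then show ?thesis by auto
qed

text \<open>A nonnegative symmetric operator \<open>T\<close> such that \<open>T + 1\<close> has dense range is essentially
  self-adjoint: its weak (adjoint) extension is the closure of its graph.\<close>

lemma weak_extension_eq_closure: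
  fixes Gr :: "('a::{real_inner,complete_space} \<times> 'a) set"
  assumes Gr: "subspace Gr"
    and sym: "\<And>a b c d. (a, b) \<in> Gr \<Longrightarrow> (c, d) \<in> Gr \<Longrightarrow> inner b c = inner a d"
    and pos: "\<And>a b. (a, b) \<in> Gr \<Longrightarrow> inner b a \<ge> 0"
    and orth: "\<And>w. (\<And>a b. (a, b) \<in> Gr \<Longrightarrow> inner w (a + b) = 0) \<Longrightarrow> w = 0"
    and weak: "\<And>a b. (a, b) \<in> Gr \<Longrightarrow> inner b u = inner a w"
  obtains a b where "\<And>n. (a n, b n) \<in> Gr" "a \<longlonglongrightarrow> u" "b \<longlonglongrightarrow> w"
proof -
  define S where "S = (\<lambda>(a, b). a + b) ` Gr"
  have "linear (\<lambda>(a, b). a + b :: 'a)" by (rule linearI) (auto simp: algebra_simps)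
  then have "subspace S" unfolding S_def using Gr linear_subspace_image by blast
  then have "closure S = UNIV"
  proof (rule dense_if_orthogonal_trivial)
    fix w assume h: "\<And>s. s \<in> S \<Longrightarrow> inner w s = 0"
    show "w = 0" by (rule orth, rule h) (force simp: S_def)
  qed
  then have "u + w \<in> closure S" by simp
  then obtain c where c: "\<And>n. c n \<in> S" "c \<longlonglongrightarrow> u + w" unfolding closure_sequential by auto
  then have "\<exists>a b. (a, b) \<in> Gr \<and> c n = a + b" for n unfolding S_def by fast
  then obtain a b where ab: "\<And>n. (a n, b n) \<in> Gr" "\<And>n. c n = a n + b n" by metis
  \<comment> \<open>Nonnegativity makes p + q \<mapsto> p a contraction, so convergence of the sums
    a n + b n forces convergence of both components.\<close>
  have contr: "norm p \<le> norm (p + q)" if "(p, q) \<in> Gr" for p q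
  proof -
    have "(norm p)\<^sup>2 \<le> (norm (p + q))\<^sup>2"
      using pos[OF that] by (simp add: power2_norm_eq_inner inner_add inner_commute[of q p])
    then show ?thesis by (rule power2_le_imp_le) simp
  qed
  have "Cauchy a"
  proof (rule metric_CauchyI)
    fix e :: real assume "e > 0"
    then obtain M where M: "\<forall>m\<ge>M. \<forall>n\<ge>M. dist (c m) (c n) < e"
      using metric_CauchyD[OF LIMSEQ_imp_Cauchy[OF c(2)]] by blast
    have "dist (a m) (a n) \<le> dist (c m) (c n)" for m n
    proof -
      have "(a m - a n, b m - b n) \<in> Gr" using subspace_diff[OF Gr ab(1) ab(1), of m n] by simp
      from contr[OF this] show ?thesis by (simp add: dist_norm ab(2) algebra_simps)
    qed
    then show "\<exists>M. \<forall>m\<ge>M. \<forall>n\<ge>M. dist (a m) (a n) < e" using M by (meson le_less_trans)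
  qed
  then obtain u' where u': "a \<longlonglongrightarrow> u'" using Cauchy_convergent convergent_def by blast
  have b: "b \<longlonglongrightarrow> u + w - u'"
    using tendsto_diff[OF c(2) u'] by (simp add: ab(2))
  \<comment> \<open>Both (u, w) and the limit pair satisfy the weak relation, and their components
    have the same sum; subtracting, u - u' is orthogonal to the range of T + 1.\<close>
  have "inner (u - u') (p + q) = 0" if pq: "(p, q) \<in> Gr" for p q
  proof -
    have "(\<lambda>n. inner q (a n)) \<longlonglongrightarrow> inner q u'" "(\<lambda>n. inner p (b n)) \<longlonglongrightarrow> inner p (u + w - u')"
      by (intro tendsto_intros u' b)+
    moreover have "inner q (a n) = inner p (b n)" for n using sym[OF pq ab(1)] .
    ultimately have "inner q u' = inner p (u + w - u')" using LIMSEQ_unique by simp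
    then show ?thesis using weak[OF pq]
      by (simp add: inner_diff inner_add inner_commute[of _ p] inner_commute[of _ q])
  qed
  then have "u - u' = 0" by (rule orth)
  then show ?thesis using that[of a b] ab(1) u' b by simp
qed

section \<open>Polynomials on the sphere\<close>

text \<open>Homogeneous polynomials, generated by multiplication with coordinates so that closure
  under derivatives is a rule induction. The degree is not a function of p: the zero polynomial has
  every degree.\<close>

inductive homog :: "nat \<Rightarrow> (real^3 \<Rightarrow> real) \<Rightarrow> bool" where
  homog_const: "homog 0 (\<lambda>y. c)"
| homog_coord: "homog l p \<Longrightarrow> homog (Suc l) (\<lambda>y. y $ i * p y)"
| homog_add: "homog l p \<Longrightarrow> homog l q \<Longrightarrow> homog l (\<lambda>y. p y + q y)"

lemma homog_zero: "homog l (\<lambda>y. 0)"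
proof (induction l)
  case (Suc l)
  from homog_coord[OF this] show ?case by simp
qed (rule homog_const)

lemma homog_scale: "homog l p \<Longrightarrow> homog l (\<lambda>y. c * p y)"
proof (induction rule: homog.induct)
  case (homog_coord l p i)
  from homog.homog_coord[OF homog_coord.IH, of i] show ?case by (simp add: mult.left_commute)
next
  case (homog_add l p q)
  from homog.homog_add[OF homog_add.IH] show ?case by (simp add: distrib_left)
qed (rule homog_const)

lemma homog_sum: "(\<And>i. i \<in> I \<Longrightarrow> homog l (p i)) \<Longrightarrow> homog l (\<lambda>y. \<Sum>i\<in>I. p i y)"
  by (induction I rule: infinite_finite_induct) (auto intro: homog_add homog_zero)

definition pd :: "(real^3 \<Rightarrow> real) \<Rightarrow> real^3 \<Rightarrow> real^3 \<Rightarrow> real" where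
  "pd p v y = frechet_derivative p (at y) v"

lemma homog_has_derivative: "homog l p \<Longrightarrow> (p has_derivative (\<lambda>v. pd p v y)) (at y)"
proof -
  assume "homog l p"
  then have "p differentiable at y"
  proof (induction rule: homog.induct)
    case (homog_coord l p i)
    have "(\<lambda>y::real^3. y $ i) differentiable at y"
      by (intro bounded_linear_imp_differentiable bounded_linear_vec_nth)
    then show ?case using homog_coord by (intro differentiable_mult)
  qed (auto intro: differentiable_add)
  then show ?thesis unfolding pd_def by (simp add: frechet_derivative_works[symmetric] eta_contract_eq)
qed

lemma pd_eq: "(p has_derivative p') (at y) \<Longrightarrow> pd p v y = p' v"
  unfolding pd_def using frechet_derivative_at by metis

lemma pd_const: "pd (\<lambda>y. c) v y = 0"
  by (rule pd_eq[where p' = "\<lambda>_. 0", simplified]) simp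

lemma pd_coord:
  assumes "homog l p"
  shows "pd (\<lambda>y. y $ i * p y) v y = y $ i * pd p v y + v $ i * p y"
  by (rule pd_eq) (auto intro!: derivative_eq_intros bounded_linear_imp_has_derivative
      bounded_linear_vec_nth homog_has_derivative[OF assms])

lemma pd_add:
  assumes "homog l p" "homog l q"
  shows "pd (\<lambda>y. p y + q y) v y = pd p v y + pd q v y"
  by (rule pd_eq) (auto intro!: derivative_eq_intros homog_has_derivative assms[THEN homog_has_derivative])

lemma homog_degree_0: "homog 0 p \<Longrightarrow> pd p v y = 0"
proof (induction "0::nat" p rule: homog.induct)
  case (homog_add p q)
  then show ?case by (simp add: pd_add)
qed (auto simp: pd_const)

text \<open>The truncated l - 1 is correct at l = 0, where the derivative is the zero polynomial. In
  the product rule the case l = 0 has to be separated, since there l - 1 + 1 is not l.\<close>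

lemma homog_pd: "homog l p \<Longrightarrow> homog (l - 1) (pd p v)"
proof (induction rule: homog.induct)
  case (homog_const c)
  then show ?case by (simp add: pd_const[abs_def] homog.homog_const)
next
  case (homog_coord l p i)
  have "homog l (\<lambda>y. y $ i * pd p v y)"
  proof (cases l)
    case 0
    then have "pd p v = (\<lambda>y. 0)"
      using homog_degree_0[of p] homog_coord(1) by blast
    then show ?thesis by (simp add: homog_zero)
  next
    case (Suc k)
    then show ?thesis using homog.homog_coord[OF homog_coord.IH, of i] by simp
  qed
  from homog.homog_add[OF this homog_scale[OF homog_coord(1), of "v $ i"]] show ?case
    by (simp add: pd_coord[OF homog_coord(1), abs_def])
next
  case (homog_add l p q)
  then show ?case by (simp add: pd_add[OF homog_add(1,2), abs_def] homog.homog_add)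
qed

lemma pd_linear: "homog l p \<Longrightarrow> linear (\<lambda>v. pd p v y)"
  using homog_has_derivative has_derivative_linear by blast

definition ang :: "real^3 \<Rightarrow> (real^3 \<Rightarrow> real) \<Rightarrow> real^3 \<Rightarrow> real" where
  "ang e p y = pd p (cross3 e y) y"

lemma ang_const: "ang e (\<lambda>y. c) y = 0"
  by (simp add: ang_def pd_const)

lemma ang_coord: "homog l p \<Longrightarrow> ang e (\<lambda>y. y $ i * p y) y = y $ i * ang e p y + cross3 e y $ i * p y"
  by (simp add: ang_def pd_coord)

lemma ang_add: "homog l p \<Longrightarrow> homog l q \<Longrightarrow> ang e (\<lambda>y. p y + q y) y = ang e p y + ang e q y"
  by (simp add: ang_def pd_add)

lemma cross3_sum: "cross3 e y $ i = (\<Sum>j\<in>UNIV. cross3 e (axis j 1) $ i * y $ j)"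
  using exhaust_3[of i] by (auto simp: cross3_simps sum_3 axis_def)

lemma homog_cross3:
  assumes "homog l p"
  shows "homog (Suc l) (\<lambda>y. cross3 e y $ i * p y)"
proof -
  have eq: "(\<lambda>y. cross3 e y $ i * p y) = (\<lambda>y. \<Sum>j\<in>UNIV. cross3 e (axis j 1) $ i * (y $ j * p y))"
    by (rule ext, subst cross3_sum) (simp add: sum_distrib_right mult.assoc)
  show ?thesis unfolding eq by (rule homog_sum, rule homog_scale, rule homog_coord, rule assms)
qed

lemma homog_ang: "homog l p \<Longrightarrow> homog l (ang e p)"
proof (induction rule: homog.induct)
  case (homog_const c)
  show ?case by (simp add: ang_const[abs_def] homog.homog_const)
next
  case (homog_coord l p i)
  from homog.homog_add[OF homog.homog_coord[OF homog_coord.IH, of i] homog_cross3[OF homog_coord(1), of e i]]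
  show ?case by (simp add: ang_coord[OF homog_coord(1), abs_def])
next
  case (homog_add l p q)
  then show ?case by (simp add: ang_add[OF homog_add(1,2), abs_def] homog.homog_add)
qed

definition sph_lap :: "(real^3 \<Rightarrow> real) \<Rightarrow> real^3 \<Rightarrow> real" where
  "sph_lap p y = (\<Sum>e\<in>Basis. ang e (ang e p) y)"

lemma homog_euler: "homog l p \<Longrightarrow> pd p y y = real l * p y"
proof (induction arbitrary: y rule: homog.induct)
  case (homog_coord l p i)
  then show ?case unfolding pd_coord[OF homog_coord(1)] by (simp add: algebra_simps)
next
  case (homog_add l p q)
  then show ?case by (simp add: pd_add[OF homog_add(1,2)] algebra_simps)
qed (simp add: pd_const)

lemma sum_Basis_vec3: "(\<Sum>e\<in>(Basis :: (real^3) set). F e) = (\<Sum>i\<in>UNIV. F (axis i 1))"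
proof -
  have B: "(Basis :: (real^3) set) = range (\<lambda>i. axis i 1)"
    by (auto simp: Basis_vec_def)
  have "inj (\<lambda>i. axis i (1::real) :: real^3)" by (auto simp: inj_def axis_eq_axis)
  from sum.reindex[OF this, of F] show ?thesis unfolding B o_def .
qed

lemma pd_expand:
  assumes "homog l p"
  shows "pd p v y = (\<Sum>j\<in>UNIV. v $ j * pd p (axis j 1) y)"
proof -
  have "pd p v y = pd p (\<Sum>j\<in>UNIV. v $ j *\<^sub>R axis j 1) y"
    using basis_expansion[of v] by (simp add: scalar_mult_eq_scaleR)
  also have "\<dots> = (\<Sum>j\<in>UNIV. v $ j * pd p (axis j 1) y)"
    by (simp only: linear_sum[OF pd_linear[OF assms]] linear_cmul[OF pd_linear[OF assms]] real_scaleR_def)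
  finally show ?thesis .
qed

text \<open>Product rule for a sum of squares of fields. The coordinates are eigenfunctions with
  eigenvalue -2, and the mixed term comes from the identity that the sum over e of (e \<times> y)_i
  (e \<times> y) . grad p is |y|^2 times the i-th derivative of p, minus y_i y . grad p; Euler's
  identity evaluates the last product.\<close>

lemma sph_lap_coord:
  assumes p: "homog l p"
  shows "sph_lap (\<lambda>y. y $ i * p y) y = y $ i * sph_lap p y
    + 2 * ((y \<bullet> y) * pd p (axis i 1) y - real l * (y $ i * p y)) - 2 * (y $ i * p y)"
proof -
  have cc: "ang e (\<lambda>y. cross3 e y $ i * p y) y = cross3 e y $ i * ang e p y + cross3 e (cross3 e y) $ i * p y" for e
  proof -
    have "((\<lambda>y. cross3 e y $ i * p y) has_derivative
        (\<lambda>v. cross3 e y $ i * pd p v y + cross3 e v $ i * p y)) (at y)"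
    proof -
      have "linear (\<lambda>y. cross3 e y $ i)"
        by (rule linearI) (simp_all add: cross_add_right cross_mult_right)
      then have "((\<lambda>y. cross3 e y $ i) has_derivative (\<lambda>v. cross3 e v $ i)) (at y)"
        by (simp add: linear_imp_has_derivative)
      then show ?thesis using homog_has_derivative[OF p] by (auto intro!: derivative_eq_intros)
    qed
    then show ?thesis unfolding ang_def[of e "\<lambda>y. cross3 e y $ i * p y"] by (simp add: pd_eq ang_def)
  qed
  have "ang e (ang e (\<lambda>y. y $ i * p y)) y = y $ i * ang e (ang e p) y
      + 2 * (cross3 e y $ i * pd p (cross3 e y) y) + cross3 e (cross3 e y) $ i * p y" for e
  proof -
    have "ang e (\<lambda>y. y $ i * p y) = (\<lambda>y. y $ i * ang e p y + cross3 e y $ i * p y)"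
      using ang_coord[OF p] by blast
    then have "ang e (ang e (\<lambda>y. y $ i * p y)) y
        = ang e (\<lambda>y. y $ i * ang e p y) y + ang e (\<lambda>y. cross3 e y $ i * p y) y"
      using ang_add[OF homog_coord[OF homog_ang[OF p]] homog_cross3[OF p]] by simp
    then show ?thesis
      unfolding cc ang_coord[OF homog_ang[OF p]] by (simp add: ang_def)
  qed
  then have "sph_lap (\<lambda>y. y $ i * p y) y = y $ i * sph_lap p y
      + 2 * (\<Sum>e\<in>Basis. cross3 e y $ i * pd p (cross3 e y) y)
      + (\<Sum>e\<in>Basis. cross3 e (cross3 e y) $ i) * p y"
    by (simp add: sph_lap_def sum.distrib sum_distrib_left sum_distrib_right)
  moreover have "(\<Sum>e\<in>Basis. cross3 e (cross3 e y) $ i) = - 2 * y $ i"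
    unfolding sum_Basis_vec3 using exhaust_3[of i] by (auto simp: cross3_simps sum_3 axis_def)
  moreover have "(\<Sum>e\<in>Basis. cross3 e y $ i * pd p (cross3 e y) y)
      = (y \<bullet> y) * pd p (axis i 1) y - y $ i * pd p y y"
    unfolding sum_Basis_vec3 pd_expand[OF p, of "cross3 _ y"] pd_expand[OF p, of y]
    using exhaust_3[of i] by (auto simp: cross3_simps sum_3 axis_def)
  ultimately show ?thesis using homog_euler[OF p, of y] by (simp add: algebra_simps)
qed

text \<open>The polynomial q is the Euclidean Laplacian of p, built by its own product rule. On the
  unit sphere the factor y . y is 1, so q has effectively lower degree and the operator is
  triangular. The clause for l < 2 covers the degrees where l - 2 is truncated.\<close>

lemma sph_lap_homog:
  "homog l p \<Longrightarrow> \<exists>q. homog (l - 2) q \<and> (l < 2 \<longrightarrow> q = (\<lambda>y. 0)) \<and>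
    (\<forall>y. sph_lap p y = (y \<bullet> y) * q y - real l * (real l + 1) * p y)"
proof (induction rule: homog.induct)
  case (homog_const c)
  show ?case by (rule exI[of _ "\<lambda>y. 0"])
      (auto simp: sph_lap_def ang_const[abs_def] homog_zero)
next
  case (homog_coord l p i)
  then obtain q where q: "homog (l - 2) q" "l < 2 \<longrightarrow> q = (\<lambda>y. 0)"
    "\<And>y. sph_lap p y = (y \<bullet> y) * q y - real l * (real l + 1) * p y" by auto
  have 1: "homog (Suc l - 2) (\<lambda>y. y $ i * q y)"
  proof (cases "l < 2")
    case True
    then show ?thesis using q(2) by (simp add: homog_zero)
  next
    case False
    then have "Suc l - 2 = Suc (l - 2)" by simp
    then show ?thesis using homog.homog_coord[OF q(1)] by simp
  qed
  have 2: "homog (Suc l - 2) (\<lambda>y. 2 * pd p (axis i 1) y)"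
    using homog_scale[OF homog_pd[OF homog_coord(1)], of 2 "axis i 1"] by (simp add: numeral_2_eq_2)
  show ?case
  proof (intro exI[of _ "\<lambda>y. y $ i * q y + 2 * pd p (axis i 1) y"] conjI allI impI)
    show "homog (Suc l - 2) (\<lambda>y. y $ i * q y + 2 * pd p (axis i 1) y)"
      using 1 2 by (rule homog_add)
    show "(\<lambda>y. y $ i * q y + 2 * pd p (axis i 1) y) = (\<lambda>y. 0)" if "Suc l < 2"
      using that q(2) homog_degree_0[of p] homog_coord(1) by auto
    show "sph_lap (\<lambda>y. y $ i * p y) y = (y \<bullet> y) * (y $ i * q y + 2 * pd p (axis i 1) y)
        - real (Suc l) * (real (Suc l) + 1) * (y $ i * p y)" for y
      unfolding sph_lap_coord[OF homog_coord(1)] q(3) by (simp add: algebra_simps)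
  qed
next
  case (homog_add l p q)
  then obtain a b where a: "homog (l - 2) a" "l < 2 \<longrightarrow> a = (\<lambda>y. 0)"
    "\<And>y. sph_lap p y = (y \<bullet> y) * a y - real l * (real l + 1) * p y"
    and b: "homog (l - 2) b" "l < 2 \<longrightarrow> b = (\<lambda>y. 0)"
    "\<And>y. sph_lap q y = (y \<bullet> y) * b y - real l * (real l + 1) * q y" by auto
  have "ang e (\<lambda>y. p y + q y) = (\<lambda>y. ang e p y + ang e q y)" for e
    using ang_add[OF homog_add(1,2)] by blast
  then have "sph_lap (\<lambda>y. p y + q y) y = sph_lap p y + sph_lap q y" for y
    by (simp add: sph_lap_def ang_add[OF homog_ang[OF homog_add(1)] homog_ang[OF homog_add(2)]] sum.distrib)
  then show ?case using a b homog.homog_add[OF a(1) b(1)]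
    by (intro exI[of _ "\<lambda>y. a y + b y"]) (auto simp: algebra_simps)
qed

lemma homog_continuous: "homog l p \<Longrightarrow> continuous_on A p"
  by (meson homog_has_derivative has_derivative_at_withinI has_derivative_continuous_on)

section \<open>The core of product functions\<close>

text \<open>Finite sums of separated products: rich enough that orthogonality to all of them forces
  a locally integrable function to vanish, and still reducible to functions of s alone. Scalars are
  absorbed into c.\<close>

inductive DD :: "(point \<Rightarrow> real) \<Rightarrow> bool" where
  DD_base: "test1 c \<Longrightarrow> homog l p \<Longrightarrow> DD (\<lambda>x. c (fst x) * p (snd x))"
| DD_add: "DD f \<Longrightarrow> DD k \<Longrightarrow> DD (\<lambda>x. f x + k x)"

lemma test1_zero: "test1 (\<lambda>s. 0)"
  by (simp add: test1_def smooth1_const)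

lemma DD_zero: "DD (\<lambda>x. 0)"
  using DD_base[OF test1_zero homog_const[of 0]] by simp

lemma DD_smooth_mult: "DD f \<Longrightarrow> smooth1 c \<Longrightarrow> DD (\<lambda>x. c (fst x) * f x)"
proof (induction rule: DD.induct)
  case (DD_base a l p)
  from DD.DD_base[OF test1_mult[OF DD_base(1,3)] DD_base(2)] show ?case
    by (simp add: mult.assoc)
next
  case (DD_add f k)
  then show ?case using DD.DD_add by (simp add: distrib_left)
qed

lemma DD_scale: "DD f \<Longrightarrow> DD (\<lambda>x. c * f x)"
  using DD_smooth_mult[OF _ smooth1_const] .

lemma DD_diff: "DD f \<Longrightarrow> DD k \<Longrightarrow> DD (\<lambda>x. f x - k x)"
  using DD_add[of f "\<lambda>x. (-1) * k x"] DD_scale[of k "-1"] by simp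

lemma DD_coord_mult: "DD f \<Longrightarrow> DD (\<lambda>x. snd x $ i * f x)"
proof (induction rule: DD.induct)
  case (DD_base a l p)
  from DD.DD_base[OF DD_base(1) homog_coord[OF DD_base(2)]] show ?case
    by (simp add: mult.left_commute)
next
  case (DD_add f k)
  then show ?case using DD.DD_add by (simp add: distrib_left)
qed

text \<open>A polynomial on \<real> x \<real>^3 is generated by s and the coordinates of y, and both
  act on the factors of a product. This makes Stone-Weierstrass applicable to the core.\<close>

lemma DD_polynomial_mult:
  assumes "real_polynomial_function P" "DD f"
  shows "DD (\<lambda>x. P x * f x)"
  using assms
proof (induction arbitrary: f rule: real_polynomial_function.induct)
  case (linear h)
  have h: "h x = fst x * h (1, 0) + (\<Sum>i\<in>UNIV. snd x $ i * h (0, axis i 1))" for x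
  proof -
    have l: "linear h" using linear(1) by (rule bounded_linear.linear)
    have "x = fst x *\<^sub>R (1, 0) + (\<Sum>i\<in>UNIV. snd x $ i *\<^sub>R ((0::real), axis i (1::real)))"
      using basis_expansion[of "snd x"]
      by (simp add: sum_prod scalar_mult_eq_scaleR prod_eq_iff fst_sum snd_sum)
    then have "h x = h (fst x *\<^sub>R (1, 0) + (\<Sum>i\<in>UNIV. snd x $ i *\<^sub>R ((0::real), axis i (1::real))))" by simp
    then show ?thesis
      by (simp only: linear_add[OF l] linear_sum[OF l] linear_cmul[OF l] real_scaleR_def)
  qed
  have sm: "DD (\<lambda>x. \<Sum>i\<in>I. snd x $ i * (h (0, axis i 1) * f x))" if "finite I" for I
    using that
  proof (induction I rule: finite_induct)
    case (insert i I)
    from DD_add[OF DD_coord_mult[OF DD_scale[OF linear(2)], of i] insert.IH] insert(1,2)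
    show ?case by simp
  qed (simp add: DD_zero)
  have "(\<lambda>x. h x * f x)
      = (\<lambda>x. fst x * (h (1, 0) * f x) + (\<Sum>i\<in>UNIV. snd x $ i * (h (0, axis i 1) * f x)))"
    by (rule ext, subst h) (simp add: distrib_right sum_distrib_right mult.assoc)
  then show ?case
    using DD_add[OF DD_smooth_mult[OF DD_scale[OF linear(2), of "h (1, 0)"] smooth1_ident] sm[OF finite]]
    by (simp only:)
next
  case (const c)
  then show ?case by (simp add: DD_scale)
next
  case (add P Q)
  then show ?case using DD_add by (simp add: distrib_right)
next
  case (mult P Q)
  then show ?case by (simp add: mult.assoc)
qed

lemma DD_base_has_derivative:
  assumes c: "test1 c" and p: "homog l p"
  shows "((\<lambda>x::point. c (fst x) * p (snd x)) has_derivative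
    (\<lambda>w. c (fst x) * pd p (snd w) (snd x) + fst w * deriv c (fst x) * p (snd x))) (at x)"
proof -
  have 1: "((\<lambda>x::point. c (fst x)) has_derivative (\<lambda>w. fst w * deriv c (fst x))) (at x)"
    by (rule fst_has_derivative[OF smooth1_has_deriv[OF test1_smooth[OF c]]])
  have 2: "((\<lambda>x::point. p (snd x)) has_derivative (\<lambda>w. pd p (snd w) (snd x))) (at x)"
    by (rule has_derivative_compose[OF bounded_linear_imp_has_derivative[OF bounded_linear_snd]
          homog_has_derivative[OF p]])
  show ?thesis using has_derivative_mult[OF 1 2] by simp
qed

lemma DD_base_Dd:
  assumes c: "test1 c" and p: "homog l p"
  shows "Dd w (\<lambda>x. c (fst x) * p (snd x)) x
    = c (fst x) * pd p (snd w) (snd x) + fst w * (deriv c (fst x) * p (snd x))"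
  using Dd_eq[OF DD_base_has_derivative[OF assms]] by (simp add: mult.assoc)

lemma DD_base_C1:
  assumes c: "test1 c" and p: "homog l p"
  shows "C1 (\<lambda>x. c (fst x) * p (snd x))"
proof (rule C1I[OF DD_base_has_derivative[OF assms]])
  show "continuous_on UNIV (\<lambda>x::point. c (fst x) * pd p (snd w) (snd x)
      + fst w * deriv c (fst x) * p (snd x))" for w :: point
    by (intro continuous_on_add continuous_on_mult continuous_on_const
        continuous_on_compose2[OF test1_continuous[OF c] continuous_on_fst[OF continuous_on_id]]
        continuous_on_compose2[OF test1_continuous[OF test1_deriv[OF c]] continuous_on_fst[OF continuous_on_id]]
        continuous_on_compose2[OF homog_continuous[OF p] continuous_on_snd[OF continuous_on_id]]
        continuous_on_compose2[OF homog_continuous[OF homog_pd[OF p]] continuous_on_snd[OF continuous_on_id]])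
      auto
qed

lemma DD_C1: "DD f \<Longrightarrow> C1 f"
  by (induction rule: DD.induct) (auto intro: DD_base_C1 C1_add)

lemma DD_slab_supp: "DD f \<Longrightarrow> slab_supp f"
proof (induction rule: DD.induct)
  case (DD_base c l p)
  then obtain R where "\<forall>x. R \<le> \<bar>x\<bar> \<longrightarrow> c x = 0" by (auto simp: test1_def)
  then show ?case unfolding slab_supp_def by (intro exI[of _ R]) auto
qed (rule slab_supp_add)

lemma DD_Dd: "DD f \<Longrightarrow> DD (Dd w f)"
proof (induction rule: DD.induct)
  case (DD_base c l p)
  have "Dd w (\<lambda>x. c (fst x) * p (snd x))
      = (\<lambda>x. c (fst x) * pd p (snd w) (snd x) + fst w * (deriv c (fst x) * p (snd x)))"
    using DD_base_Dd[OF DD_base] by blast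
  then show ?case
    using DD_add[OF DD.DD_base[OF DD_base(1) homog_pd[OF DD_base(2)], of "snd w"]
        DD_scale[OF DD.DD_base[OF test1_deriv[OF DD_base(1)] DD_base(2)], of "fst w"]] by simp
next
  case (DD_add f k)
  then have "Dd w (\<lambda>x. f x + k x) = (\<lambda>x. Dd w f x + Dd w k x)"
    using Dd_add DD_C1 by blast
  then show ?case using DD.DD_add[OF DD_add.IH] by simp
qed

lemma DD_base_Xe:
  assumes "test1 c" "homog l p"
  shows "Xe e (\<lambda>x. c (fst x) * p (snd x)) = (\<lambda>x. c (fst x) * ang e p (snd x))"
  by (rule ext) (simp add: Xe_Dd DD_base_Dd[OF assms] ang_def)

lemma DD_Xe: "DD f \<Longrightarrow> DD (Xe e f)"
proof (induction rule: DD.induct)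
  case (DD_base c l p)
  show ?case
    unfolding DD_base_Xe[OF DD_base] by (rule DD.DD_base[OF DD_base(1) homog_ang[OF DD_base(2)]])
next
  case (DD_add f k)
  then have "Xe e (\<lambda>x. f x + k x) = (\<lambda>x. Xe e f x + Xe e k x)"
    using Xe_add DD_C1 by blast
  then show ?case using DD.DD_add[OF DD_add.IH] by simp
qed

text \<open>On a product the two fields act on different factors, so they commute by inspection,
  without symmetry of second derivatives.\<close>

lemma DD_Xe_Ds: "DD f \<Longrightarrow> Xe e (Ds f) x = Ds (Xe e f) x"
proof (induction arbitrary: x rule: DD.induct)
  case (DD_base c l p)
  have D: "Ds (\<lambda>x. a (fst x) * q (snd x)) = (\<lambda>x. deriv a (fst x) * q (snd x))" 
    if "test1 a" "homog k q" for a k q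
    using DD_base_Dd[OF that] linear_0[OF pd_linear[OF that(2)]] by (auto simp: fun_eq_iff)
  show ?case
    by (simp add: D[OF DD_base] D[OF DD_base(1) homog_ang[OF DD_base(2)]] DD_base_Xe[OF DD_base]
        DD_base_Xe[OF test1_deriv[OF DD_base(1)] DD_base(2)])
next
  case (DD_add f k)
  have "Xe e (\<lambda>x. f x + k x) = (\<lambda>x. Xe e f x + Xe e k x)" "Ds (\<lambda>x. f x + k x) = (\<lambda>x. Ds f x + Ds k x)"
    using Xe_add Dd_add DD_C1 DD_add(1,2) by blast+
  then show ?case using DD_add
    by (simp add: Xe_add Dd_add DD_C1 DD_Dd DD_Xe)
qed

lemma DD_continuous: "DD f \<Longrightarrow> continuous_on A f"
  by (rule C1_continuous[OF DD_C1])

lemma DD_sq_int: "DD f \<Longrightarrow> sq_int f"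
  by (rule sq_int_slab_supp[OF DD_continuous DD_slab_supp])

text \<open>\<open>DD\<close> is closed under directional derivatives, so each iterated derivative
  is the complexification of a \<open>DD\<close> function and hence differentiable.\<close>

lemma smooth_of_DD:
  assumes "DD f"
  shows "(\<lambda>x. of_real (f x)) \<in> test_functions"
proof -
  have dd: "dir_deriv w (\<lambda>x. of_real (k x)) = (\<lambda>x. complex_of_real (Dd w k x))" if "DD k" for w k
  proof
    fix x
    have "((\<lambda>x. complex_of_real (k x)) has_derivative (\<lambda>w. of_real (Dd w k x))) (at x)"
      by (rule has_derivative_of_real[OF C1_has_derivative[OF DD_C1[OF that]]])
    then show "dir_deriv w (\<lambda>x. of_real (k x)) x = complex_of_real (Dd w k x)"
      unfolding dir_deriv_def by (metis frechet_derivative_at)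
  qed
  have "\<exists>k. DD k \<and> foldr dir_deriv ws (\<lambda>x. of_real (f x)) = (\<lambda>x. complex_of_real (k x))" for ws
  proof (induction ws)
    case Nil
    then show ?case using assms by auto
  next
    case (Cons w ws)
    then obtain k where k: "DD k" "foldr dir_deriv ws (\<lambda>x. of_real (f x)) = (\<lambda>x. complex_of_real (k x))"
      by blast
    show ?case
      by (rule exI[of _ "Dd w k"]) (simp add: k(2) dd[OF k(1)] DD_Dd[OF k(1)])
  qed
  moreover have "(\<lambda>x. complex_of_real (k x)) differentiable_on UNIV" if "DD k" for k
    using has_derivative_of_real[OF C1_has_derivative[OF DD_C1[OF that]]]
    by (metis differentiableI differentiable_on_def differentiable_at_withinI)
  ultimately have "smooth (\<lambda>x. of_real (f x))" unfolding smooth_def by metis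
  moreover obtain R where "\<forall>s y. R \<le> \<bar>s\<bar> \<longrightarrow> f (s, y) = 0" using DD_slab_supp[OF assms] by (auto simp: slab_supp_def)
  ultimately show ?thesis by (auto simp: test_functions_def)
qed

section \<open>Local integrability and the fundamental lemma of the calculus of variations\<close>

definition slab_int :: "(point \<Rightarrow> real) \<Rightarrow> bool" where
  "slab_int v \<longleftrightarrow> v \<in> borel_measurable borel \<and> (\<forall>R. integrable mu (\<lambda>x. indicator ({-R..R} \<times> UNIV) x * v x))"

lemma slab_int_bounded_mult:
  assumes v: "slab_int v" and m: "k \<in> borel_measurable borel"
    and B: "\<And>s y. norm y = 1 \<Longrightarrow> \<bar>k (s, y)\<bar> \<le> B * indicator ({-R..R} \<times> UNIV) (s, y)"
  shows "integrable mu (\<lambda>x. k x * v x)"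
proof (rule Bochner_Integration.integrable_bound)
  show "integrable mu (\<lambda>x. B * (indicator ({-R..R} \<times> UNIV) x * v x))"
    using v by (simp add: slab_int_def)
  show "(\<lambda>x. k x * v x) \<in> borel_measurable mu"
    using v m by (intro borel_measurable_times) (auto simp: slab_int_def)
  show "AE x in mu. norm (k x * v x) \<le> norm (B * (indicator ({-R..R} \<times> UNIV) x * v x))"
    using AE_mu_sphere
  proof eventually_elim
    fix x :: point assume "norm (snd x) = 1"
    then have "\<bar>k x\<bar> \<le> B * indicator ({-R..R} \<times> UNIV) x" using B[of "snd x" "fst x"] by simp
    also have "\<dots> \<le> \<bar>B * indicator ({-R..R} \<times> UNIV) x\<bar>" by simp
    finally have "\<bar>k x\<bar> * \<bar>v x\<bar> \<le> \<bar>B * indicator ({-R..R} \<times> UNIV) x\<bar> * \<bar>v x\<bar>" by (rule mult_right_mono) simp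
    then show "norm (k x * v x) \<le> norm (B * (indicator ({-R..R} \<times> UNIV) x * v x))"
      by (simp add: abs_mult)
  qed
qed

lemma slab_int_cont_mult:
  assumes "slab_int v" "continuous_on UNIV k" "slab_supp k"
  shows "integrable mu (\<lambda>x. k x * v x)"
proof -
  obtain R B where B: "\<And>s y. norm y = 1 \<Longrightarrow> \<bar>k (s, y)\<bar> \<le> B * indicator ({-R..R} \<times> UNIV) (s, y)"
    using slab_supp_bound[OF assms(2,3)] by auto
  show ?thesis
    by (rule slab_int_bounded_mult[OF assms(1) borel_measurable_continuous_onI[OF assms(2)] B])
qed

lemma slab_int_sq_int: assumes "sq_int f" shows "slab_int f"
proof -
  have "sq_int (indicator ({-R..R} \<times> UNIV))" for R
  proof -
    have "(\<lambda>x::point. (indicator ({-R..R} \<times> UNIV) x :: real)\<^sup>2) = indicator ({-R..R} \<times> UNIV)"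
      by (auto simp: fun_eq_iff indicator_def)
    then show ?thesis
      unfolding sq_int_def using integrable_mu_slab_indicator[of "-R" R] by simp
  qed
  then show ?thesis
    using sq_int_mult_integrable[OF _ assms] sq_int_measurable[OF assms] by (simp add: slab_int_def)
qed

text \<open>With a cutoff c the function c v is integrable and orthogonal to all polynomials.
  Stone-Weierstrass on the compact slab extends this to continuous functions, a monotone limit to
  indicators of open sets, and a Dynkin argument to all Borel sets.\<close>

lemma AE_zero_if_orthogonal_DD:
  assumes v: "slab_int v" and orth: "\<And>f. DD f \<Longrightarrow> (\<integral>x. f x * v x \<partial>mu) = 0"
  shows "AE x in mu. v x = 0"
proof -
  have vm [measurable]: "v \<in> borel_measurable borel" using v by (simp add: slab_int_def)
  have step: "AE x in mu. c (fst x) * v x = 0" if c: "test1 c" for c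
  proof -
    obtain R where R: "R > 0" "\<And>s. R \<le> \<bar>s\<bar> \<Longrightarrow> c s = 0" using test1_support[OF c] by auto
    have cc: "continuous_on A (\<lambda>x::point. c (fst x))" for A
      by (rule continuous_on_compose2[OF test1_continuous[OF c, of UNIV]]) (auto intro!: continuous_intros)
    have cs: "slab_supp (\<lambda>x. c (fst x))" using R by (auto simp: slab_supp_def)
    have Dc: "DD (\<lambda>x. c (fst x))" using DD_base[OF c homog_const[of 1]] by simp
    let ?w = "\<lambda>x. c (fst x) * v x"
    have wi: "integrable mu ?w" by (rule slab_int_cont_mult[OF v cc cs])
    have w_outside: "?w x = 0" if "R \<le> \<bar>fst x\<bar>" for x using R(2)[OF that] by simp
    have poly: "(\<integral>x. P x * ?w x \<partial>mu) = 0" if "real_polynomial_function P" for P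
      using orth[OF DD_polynomial_mult[OF that Dc]] by (simp add: mult.assoc)
    have cont: "(\<integral>x. k x * ?w x \<partial>mu) = 0" if k: "continuous_on UNIV k" for k :: "point \<Rightarrow> real"
    proof -
      let ?K = "{-R..R} \<times> sphere (0::real^3) 1"
      have K: "compact ?K" by (intro compact_Times compact_sphere compact_Icc)
      have ki: "integrable mu (\<lambda>x. k x * ?w x)"
        using slab_int_cont_mult[OF v, of "\<lambda>x. k x * c (fst x)"] k cc cs
        by (simp add: continuous_on_mult slab_supp_mult2 mult.assoc)
      have "\<bar>\<integral>x. k x * ?w x \<partial>mu\<bar> \<le> e * (\<integral>x. \<bar>?w x\<bar> \<partial>mu)" if e: "e > 0" for e
      proof -
        obtain P where P: "real_polynomial_function P" "\<And>x. x \<in> ?K \<Longrightarrow> \<bar>k x - P x\<bar> < e"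
          using Stone_Weierstrass_real_polynomial_function[OF K continuous_on_subset[OF k] e] by blast
        have Pc: "continuous_on UNIV P"
          using P(1) continuous_on_polymonial_function real_polynomial_function_eq by blast
        have Pi: "integrable mu (\<lambda>x. P x * ?w x)"
          using slab_int_cont_mult[OF v, of "\<lambda>x. P x * c (fst x)"] Pc cc cs
          by (simp add: continuous_on_mult slab_supp_mult2 mult.assoc)
        have "(\<integral>x. k x * ?w x \<partial>mu) = (\<integral>x. (k x - P x) * ?w x \<partial>mu)"
          using ki Pi poly[OF P(1)] by (simp add: left_diff_distrib)
        also have "\<bar>\<dots>\<bar> \<le> (\<integral>x. \<bar>(k x - P x) * ?w x\<bar> \<partial>mu)" by (rule integral_abs_bound)
        also have "\<dots> \<le> (\<integral>x. e * \<bar>?w x\<bar> \<partial>mu)"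
        proof (rule integral_mono_AE)
          have "integrable mu (\<lambda>x. k x * ?w x - P x * ?w x)"
            by (rule Bochner_Integration.integrable_diff[OF ki Pi])
          then show "integrable mu (\<lambda>x. \<bar>(k x - P x) * ?w x\<bar>)"
            by (intro integrable_abs) (simp only: left_diff_distrib)
          show "integrable mu (\<lambda>x. e * \<bar>?w x\<bar>)" using wi by simp
          show "AE x in mu. \<bar>(k x - P x) * ?w x\<bar> \<le> e * \<bar>?w x\<bar>"
            using AE_mu_sphere
          proof eventually_elim
            fix x :: point assume x: "norm (snd x) = 1"
            show "\<bar>(k x - P x) * ?w x\<bar> \<le> e * \<bar>?w x\<bar>"
            proof (cases "R \<le> \<bar>fst x\<bar>")
              case True
              show ?thesis using w_outside[OF True] by (simp only: mult_zero_right abs_zero)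
            next
              case False
              then have "x \<in> ?K" using x by (cases x) auto
              then have "\<bar>k x - P x\<bar> \<le> e" using P(2) less_imp_le by blast
              then show ?thesis unfolding abs_mult[of "k x - P x"] by (rule mult_right_mono) simp
            qed
          qed
        qed
        also have "\<dots> = e * (\<integral>x. \<bar>?w x\<bar> \<partial>mu)" by simp
        finally show ?thesis .
      qed
      note est = this
      show ?thesis
      proof (rule ccontr)
        assume "(\<integral>x. k x * ?w x \<partial>mu) \<noteq> 0"
        then have p: "0 < \<bar>\<integral>x. k x * ?w x \<partial>mu\<bar>" by simp
        have W: "(\<integral>x. \<bar>?w x\<bar> \<partial>mu) \<ge> 0" by simp
        define I where "I = \<bar>\<integral>x. k x * ?w x \<partial>mu\<bar>"
        define J where "J = (\<integral>x. \<bar>?w x\<bar> \<partial>mu)"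
        have J: "J \<ge> 0" unfolding J_def by (rule W)
        have I: "I > 0" unfolding I_def by (rule p)
        \<comment> \<open>An admissible error e with e J < I; the summand 1 keeps the denominator
          positive when J = 0.\<close>
        have "I / (2 * (J + 1)) > 0" using I J by (intro divide_pos_pos) auto
        from est[OF this] have "I \<le> I / (2 * (J + 1)) * J" unfolding I_def[symmetric] J_def[symmetric] .
        moreover have "I / (2 * (J + 1)) * J < I"
        proof -
          have "I * (J / (2 * (J + 1))) < I * 1"
            using I J by (intro mult_strict_left_mono) (simp_all add: divide_less_eq)
          then show ?thesis by simp
        qed
        ultimately show False by simp
      qed
    qed
    have opn: "(\<integral>x. indicator U x * ?w x \<partial>mu) = 0" if U: "open U" for U :: "point set"
    proof (cases "U = UNIV")
      case True
      then show ?thesis using cont[of "\<lambda>x. 1"] by simp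
    next
      case False
      \<comment> \<open>Continuous functions increasing to the indicator of U. The distance to the
        complement needs a nonempty complement, hence the separate case of the whole space.\<close>
      define k where "k n x = min 1 (real n * infdist x (- U))" for n :: nat and x :: point
      have "(\<lambda>n. \<integral>x. k n x * ?w x \<partial>mu) \<longlonglongrightarrow> (\<integral>x. indicator U x * ?w x \<partial>mu)"
      proof (rule integral_dominated_convergence)
        show "integrable mu (\<lambda>x. \<bar>?w x\<bar>)" using wi by simp
        show "AE x in mu. norm (k n x * ?w x) \<le> \<bar>?w x\<bar>" for n
          by (rule AE_I2) (auto simp: k_def abs_mult infdist_nonneg intro!: mult_left_le_one_le)
        show "AE x in mu. (\<lambda>n. k n x * ?w x) \<longlonglongrightarrow> indicator U x * ?w x"
        proof (rule AE_I2)
          fix x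
          have "(\<lambda>n. k n x) \<longlonglongrightarrow> indicator U x"
          proof (cases "x \<in> U")
            case True
            then have "infdist x (- U) > 0"
              using U False by (intro infdist_pos_not_in_closed closed_Compl) auto
            then obtain N where N: "1 < real N * infdist x (- U)"
              using reals_Archimedean3 by blast
            have "k n x = 1" if "n \<ge> N" for n
            proof -
              have "real N * infdist x (- U) \<le> real n * infdist x (- U)"
                using that by (intro mult_right_mono infdist_nonneg) auto
              then show ?thesis using N by (simp add: k_def)
            qed
            then show ?thesis using True
              by (intro tendsto_eventually) (auto simp: eventually_sequentially)
          next
            case False
            then show ?thesis by (simp add: k_def)
          qed
          then show "(\<lambda>n. k n x * ?w x) \<longlonglongrightarrow> indicator U x * ?w x" by (intro tendsto_intros)
        qed
        have "k n \<in> borel_measurable borel" for n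
          unfolding k_def by (intro borel_measurable_continuous_onI continuous_intros)
        then show "(\<lambda>x. k n x * ?w x) \<in> borel_measurable mu" for n
          using wi by (intro borel_measurable_times[of _ _ ?w]) auto
        show "(\<lambda>x. indicator U x * ?w x) \<in> borel_measurable mu"
          using wi U by (intro borel_measurable_times[of _ _ ?w] borel_measurable_indicator) auto
      qed
      moreover have "(\<integral>x. k n x * ?w x \<partial>mu) = 0" for n
        by (rule cont) (auto simp: k_def intro!: continuous_intros)
      ultimately show ?thesis by (simp add: LIMSEQ_const_iff)
    qed
    show "AE x in mu. ?w x = 0"
    proof (rule mu.density_zero[OF wi])
      fix A assume "A \<in> sets mu"
      then have A: "A \<in> sigma_sets UNIV {U. open U}" by (simp add: borel_def)
      have bs: "B \<in> sets mu" if "B \<in> sigma_sets UNIV {U. open U}" for B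
        using that by (simp add: borel_def)
      have i: "integrable mu (\<lambda>x. indicator B x * ?w x)" if "B \<in> sigma_sets UNIV {U. open U}" for B
        using integrable_mult_indicator[OF bs[OF that] wi] by simp
      have I: "Int_stable {U::point set. open U}" by (auto simp: Int_stable_def)
      have Pw: "{U::point set. open U} \<subseteq> Pow UNIV" by simp
      show "set_lebesgue_integral mu A ?w = 0"
        using I Pw A
      proof (induction rule: sigma_sets_induct_disjoint)
        case (basic A)
        then show ?case by (simp add: opn set_lebesgue_integral_def)
      next
        case empty
        then show ?case by (simp add: set_lebesgue_integral_def)
      next
        case (compl A)
        have "(\<integral>x. indicator (UNIV - A) x * ?w x \<partial>mu) = (\<integral>x. ?w x - indicator A x * ?w x \<partial>mu)"
          by (rule Bochner_Integration.integral_cong) (auto simp: indicator_def)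
        also have "\<dots> = (\<integral>x. ?w x \<partial>mu) - (\<integral>x. indicator A x * ?w x \<partial>mu)"
          by (rule Bochner_Integration.integral_diff[OF wi i[OF compl(1)]])
        finally show ?case using compl opn[of UNIV] by (simp add: set_lebesgue_integral_def)
      next
        case (union B)
        have Bs: "B i \<in> sets mu" for i by (rule bs) (use union in blast)
        have "set_lebesgue_integral mu (\<Union>i. B i) ?w = (\<Sum>i. set_lebesgue_integral mu (B i) ?w)"
        proof (rule lebesgue_integral_countable_add[OF Bs])
          show "\<And>i j. i \<noteq> j \<Longrightarrow> B i \<inter> B j = {}"
            using union(1) by (auto simp: disjoint_family_on_def)
          show "set_integrable mu (\<Union>i. B i) ?w"
            unfolding set_integrable_def using Bs wi by (intro integrable_mult_indicator) auto
        qed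
        then show ?case using union by simp
      qed
    qed
  qed
  \<comment> \<open>Cutoffs that are positive on growing intervals: countably many of them suffice
    to divide c out almost everywhere.\<close>
  have "\<exists>c. test1 c \<and> (\<forall>s. \<bar>s\<bar> < real n \<longrightarrow> c s > 0)" for n :: nat
  proof -
    obtain c :: "nat \<Rightarrow> real \<Rightarrow> real" where c: "\<And>n. test1 (c n)"
      "\<And>m x. x \<in> {-real n<..<real n} \<Longrightarrow> c (Suc m) x > 0"
      by (rule test1_approx_indicator[of "-real n" "real n"]) blast
    have "c (Suc 0) s > 0" if "\<bar>s\<bar> < real n" for s
      by (rule c(2)) (use that in auto)
    then show ?thesis using c(1) by blast
  qed
  then obtain c where c: "\<And>n. test1 (c n)" "\<And>n s. \<bar>s\<bar> < real n \<Longrightarrow> c n s > 0" by metis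
  have "AE x in mu. \<forall>n. c n (fst x) * v x = 0" unfolding AE_all_countable using step[OF c(1)] by blast
  then show ?thesis
  proof eventually_elim
    fix x assume x: "\<forall>n. c n (fst x) * v x = 0"
    obtain n where "\<bar>fst x\<bar> < real n" using reals_Archimedean2 by blast
    from c(2)[OF this] show "v x = 0" using x by (metis less_irrefl mult_eq_0_iff)
  qed
qed

section \<open>Weak solutions of an ordinary differential equation\<close>

definition loc_int :: "(real \<Rightarrow> real) \<Rightarrow> bool" where
  "loc_int k \<longleftrightarrow> k \<in> borel_measurable borel \<and> (\<forall>R. integrable lborel (\<lambda>s. indicator {-R..R} s * k s))"

lemma loc_int_measurable: "loc_int k \<Longrightarrow> k \<in> borel_measurable borel"
  by (simp add: loc_int_def)

lemma loc_int_diff: "loc_int f \<Longrightarrow> loc_int k \<Longrightarrow> loc_int (\<lambda>s. f s - k s)"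
  by (auto simp: loc_int_def right_diff_distrib intro!: borel_measurable_diff)

lemma loc_int_continuous:
  assumes "continuous_on UNIV k" shows "loc_int k"
proof -
  have "integrable lborel (\<lambda>s. indicator {-R..R} s *\<^sub>R k s)" for R
    using borel_integrable_compact[of "{-R..R}" k] continuous_on_subset[OF assms] by auto
  then show ?thesis using assms by (simp add: loc_int_def borel_measurable_continuous_onI)
qed

lemma loc_int_continuous_mult:
  assumes k: "loc_int k" and c: "continuous_on UNIV c"
  shows "loc_int (\<lambda>s. c s * k s)"
  unfolding loc_int_def
proof (intro conjI allI)
  have [measurable]: "c \<in> borel_measurable borel" "k \<in> borel_measurable borel"
    using borel_measurable_continuous_onI[OF c] k by (auto simp: loc_int_def)
  show "(\<lambda>s. c s * k s) \<in> borel_measurable borel" by measurable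
  fix R
  have "bounded (c ` {-R..R})"
    using c continuous_on_subset by (intro compact_imp_bounded compact_continuous_image) auto
  then obtain B where "\<forall>z \<in> c ` {-R..R}. norm z \<le> B" unfolding bounded_iff by blast
  then have B: "\<bar>c s\<bar> \<le> B" if "s \<in> {-R..R}" for s using that by auto
  show "integrable lborel (\<lambda>s. indicator {-R..R} s * (c s * k s))"
  proof (rule Bochner_Integration.integrable_bound)
    show "integrable lborel (\<lambda>s. B * (indicator {-R..R} s * k s))" using k by (simp add: loc_int_def)
    show "AE s in lborel. norm (indicator {-R..R} s * (c s * k s)) \<le> norm (B * (indicator {-R..R} s * k s))"
    proof (rule AE_I2)
      fix s
      have "\<bar>c s\<bar> \<le> \<bar>B\<bar>" if "s \<in> {-R..R}" using B[OF that] by simp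
      then show "norm (indicator {-R..R} s * (c s * k s)) \<le> norm (B * (indicator {-R..R} s * k s))"
        by (auto simp: indicator_def abs_mult intro!: mult_right_mono)
    qed
  qed measurable
qed

lemma loc_int_test1:
  assumes k: "loc_int k" and c: "test1 c"
  shows "integrable lborel (\<lambda>s. c s * k s)"
proof -
  obtain R where R: "\<And>s. R \<le> \<bar>s\<bar> \<Longrightarrow> c s = 0" using test1_support[OF c] by auto
  have "(\<lambda>s. indicator {-R..R} s * (c s * k s)) = (\<lambda>s. c s * k s)"
  proof
    fix s show "indicator {-R..R} s * (c s * k s) = c s * k s"
      using R[of s] by (cases "\<bar>s\<bar> < R") (auto simp: indicator_def)
  qed
  then show ?thesis
    using loc_int_continuous_mult[OF k test1_continuous[OF c]] unfolding loc_int_def by metis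
qed

lemma emeasure_sphere_pos: "emeasure sphere_measure UNIV \<noteq> 0"
proof -
  have "emeasure sphere_measure UNIV = (\<integral>\<^sup>+y. 1 \<partial>sphere_measure)"
    by simp
  also have "\<dots> = 3 * emeasure lborel (ball 0 1 :: (real^3) set)"
    by (subst nn_integral_sphere_measure) (simp_all add: nn_integral_cmult_indicator)
  also have "\<dots> \<noteq> 0"
    using content_ball_pos[of 1 "0 :: real^3"] by (auto simp: measure_def)
  finally show ?thesis .
qed

lemma loc_int_slab_int:
  assumes "loc_int k" shows "slab_int (\<lambda>x. k (fst x))"
  unfolding slab_int_def
proof (intro conjI allI)
  have [measurable]: "k \<in> borel_measurable borel" using assms by (rule loc_int_measurable)
  have m: "(\<lambda>x::point. k (fst x)) \<in> borel_measurable (borel \<Otimes>\<^sub>M borel)" by measurable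
  then show "(\<lambda>x::point. k (fst x)) \<in> borel_measurable borel" unfolding borel_prod .
  fix R
  have "integrable (lborel \<Otimes>\<^sub>M sphere_measure) (\<lambda>x. indicator {-R..R} (fst x) * k (fst x))"
  proof (rule cyl.Fubini_integrable)
    show "(\<lambda>x. indicator {-R..R} (fst x) * k (fst x)) \<in> borel_measurable (lborel \<Otimes>\<^sub>M sphere_measure)"
      by measurable
    have "integrable lborel (\<lambda>s. \<bar>indicator {-R..R} s * k s\<bar>)"
      using assms unfolding loc_int_def by (intro integrable_abs) auto
    then show "integrable lborel (\<lambda>s. \<integral>y. norm (indicator {-R..R} (fst (s, y)) * k (fst (s, y))) \<partial>sphere_measure)"
      by simp
  qed simp
  then show "integrable mu (\<lambda>x. indicator ({-R..R} \<times> UNIV) x * k (fst x))"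
    by (simp add: mu_def indicator_times case_prod_beta')
qed

text \<open>The one-dimensional statement is read off from the cylinder: k is regarded as a function
  of (s, y), the polynomial factor integrates to a constant, and the positive mass of the sphere
  brings the conclusion back to almost every s.\<close>

lemma AE_zero_if_orthogonal_test1:
  assumes k: "loc_int k" and orth: "\<And>c. test1 c \<Longrightarrow> (\<integral>s. c s * k s \<partial>lborel) = 0"
  shows "AE s in lborel. k s = 0"
proof -
  have v: "slab_int (\<lambda>x. k (fst x))" by (rule loc_int_slab_int[OF k])
  have "(\<integral>x. f x * k (fst x) \<partial>mu) = 0" if "DD f" for f
    using that
  proof (induction rule: DD.induct)
    case (DD_base c l p)
    have i: "integrable mu (\<lambda>x. c (fst x) * p (snd x) * k (fst x))"
      by (rule slab_int_cont_mult[OF v DD_continuous DD_slab_supp]) (rule DD.DD_base[OF DD_base])+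
    have "(\<integral>x. c (fst x) * p (snd x) * k (fst x) \<partial>mu)
        = (\<integral>s. (\<integral>y. p y * (c s * k s) \<partial>sphere_measure) \<partial>lborel)"
      using integral_mu_fst[OF i] by (simp add: mult_ac)
    also have "\<dots> = (\<integral>s. (\<integral>y. p y \<partial>sphere_measure) * (c s * k s) \<partial>lborel)" by simp
    also have "\<dots> = 0" using orth[OF DD_base(1)] by simp
    finally show ?case .
  next
    case (DD_add f h)
    have "integrable mu (\<lambda>x. f x * k (fst x))" "integrable mu (\<lambda>x. h x * k (fst x))"
      using DD_add slab_int_cont_mult[OF v DD_continuous DD_slab_supp] by auto
    then show ?case using DD_add by (simp add: distrib_right)
  qed
  then have "AE x in mu. k (fst x) = 0" by (rule AE_zero_if_orthogonal_DD[OF v])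
  then have "AE s in lborel. AE y in sphere_measure. k s = 0"
    unfolding mu_def using cyl.AE_pair by fastforce
  then show ?thesis
  proof eventually_elim
    fix s assume s: "AE y in sphere_measure. k s = 0"
    show "k s = 0"
    proof (rule ccontr)
      assume "k s \<noteq> 0"
      then have "AE y in sphere_measure. False" using s by simp
      then have "emeasure sphere_measure UNIV = 0"
        by (subst (asm) AE_iff_measurable[of UNIV]) auto
      then show False using emeasure_sphere_pos by simp
    qed
  qed
qed

lemma test1_unit: obtains c where "test1 c" "(\<integral>s. c s \<partial>lborel) = 1"
proof -
  obtain c :: "nat \<Rightarrow> real \<Rightarrow> real" where c: "\<And>n. test1 (c n)" "\<And>n x. 0 \<le> c n x"
    "\<And>n x. x \<in> {0<..<1} \<Longrightarrow> c (Suc n) x > 0"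
    by (rule test1_approx_indicator[of 0 1]) blast
  let ?c = "c (Suc 0)"
  have "(\<integral>s. ?c s \<partial>lborel) \<noteq> 0"
  proof
    assume "(\<integral>s. ?c s \<partial>lborel) = 0"
    then have "AE s in lborel. ?c s = 0"
      using integral_nonneg_eq_0_iff_AE[OF test1_integrable[OF c(1)], of "Suc 0"] c(2) by simp
    then have "AE s in lborel. s \<notin> {0<..<1 :: real}"
      by eventually_elim (use c(3)[of _ 0] in force)
    then have "emeasure lborel {0<..<1 :: real} = 0"
      by (subst (asm) AE_iff_measurable[of "{0<..<1}"]) auto
    then show False by simp
  qed
  then show ?thesis
    by (intro that[of "\<lambda>s. (1 / (\<integral>s. ?c s \<partial>lborel)) * ?c s"] test1_scale c(1)) simp
qed

text \<open>The lemma of du Bois-Reymond: c minus its integral times a fixed unit test function has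
  mean zero, so it is the derivative of a test function.\<close>

lemma weak_deriv_zero_imp_const:
  assumes k: "loc_int k" and orth: "\<And>c. test1 c \<Longrightarrow> (\<integral>s. deriv c s * k s \<partial>lborel) = 0"
  obtains C where "AE s in lborel. k s = C"
proof -
  obtain c0 where c0: "test1 c0" "(\<integral>s. c0 s \<partial>lborel) = 1" by (rule test1_unit)
  define C where "C = (\<integral>s. c0 s * k s \<partial>lborel)"
  have "AE s in lborel. k s - C = 0"
  proof (rule AE_zero_if_orthogonal_test1)
    show "loc_int (\<lambda>s. k s - C)" by (intro loc_int_diff k loc_int_continuous continuous_intros)
    fix c assume c: "test1 c"
    define I where "I = (\<integral>s. c s \<partial>lborel)"
    have t: "test1 (\<lambda>s. c s - I * c0 s)" by (intro test1_diff test1_scale c c0)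
    have "(\<integral>s. c s - I * c0 s \<partial>lborel) = 0"
      using c c0 by (simp add: test1_integrable I_def)
    then obtain F where F: "test1 F" "\<And>s. (F has_real_derivative (c s - I * c0 s)) (at s)"
      using test1_antiderivative[OF t] by blast
    have "deriv F s = c s - I * c0 s" for s using F(2) by (rule DERIV_imp_deriv)
    then have e: "c s * k s - I * (c0 s * k s) = deriv F s * k s" for s
      by (simp only: left_diff_distrib mult.assoc)
    have "(\<integral>s. c s * k s - I * (c0 s * k s) \<partial>lborel) = 0"
      unfolding e by (rule orth[OF F(1)])
    then have "(\<integral>s. c s * k s \<partial>lborel) - I * C = 0"
      using loc_int_test1[OF k c] loc_int_test1[OF k c0(1)] by (simp add: C_def)
    then show "(\<integral>s. c s * (k s - C) \<partial>lborel) = 0"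
      using loc_int_test1[OF k c] test1_integrable[OF c] by (simp add: right_diff_distrib I_def)
  qed
  then show ?thesis using that[of C] by auto
qed

lemma integral_by_parts_test1:
  assumes c: "test1 c" and F: "\<And>s. (F has_real_derivative F' s) (at s)" "continuous_on UNIV F'"
  shows "(\<integral>s. deriv c s * F s \<partial>lborel) = - (\<integral>s. c s * F' s \<partial>lborel)"
proof -
  have Fc: "continuous_on UNIV F"
    using F(1) by (meson DERIV_continuous_on has_field_derivative_at_within)
  obtain R S where R: "\<And>s. R \<le> \<bar>s\<bar> \<Longrightarrow> c s = 0" "\<And>s. S \<le> \<bar>s\<bar> \<Longrightarrow> deriv c s = 0"
    using test1_support[OF c] test1_support[OF test1_deriv[OF c]] by auto
  have "(\<integral>s. deriv c s * F s + c s * F' s \<partial>lborel) = 0"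
  proof (rule integral_deriv_compact_support[of "\<lambda>s. c s * F s" _ "max R S"])
    show "((\<lambda>s. c s * F s) has_real_derivative deriv c s * F s + c s * F' s) (at s)" for s
      using smooth1_has_deriv[OF test1_smooth[OF c]] F(1) by (auto intro!: derivative_eq_intros)
    show "continuous_on UNIV (\<lambda>s. deriv c s * F s + c s * F' s)"
      by (intro continuous_intros test1_continuous test1_deriv c Fc F(2))
  qed (use R in auto)
  then show ?thesis
    using loc_int_test1[OF loc_int_continuous[OF Fc] test1_deriv[OF c]]
      loc_int_test1[OF loc_int_continuous[OF F(2)] c] by simp
qed

text \<open>The number D is the weak derivative of k tested against a unit test function;
  subtracting D s leaves a function with vanishing weak derivative.\<close>

lemma weak_deriv2_zero_imp_affine:
  assumes k: "loc_int k" and orth: "\<And>c. test1 c \<Longrightarrow> (\<integral>s. deriv (deriv c) s * k s \<partial>lborel) = 0"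
  obtains C D where "AE s in lborel. k s = C + D * s"
proof -
  obtain c0 where c0: "test1 c0" "(\<integral>s. c0 s \<partial>lborel) = 1" by (rule test1_unit)
  define D where "D = - (\<integral>s. deriv c0 s * k s \<partial>lborel)"
  obtain C where "AE s in lborel. k s - D * s = C"
  proof (rule weak_deriv_zero_imp_const)
    have D: "loc_int (\<lambda>s. D * s)" by (intro loc_int_continuous continuous_intros)
    show "loc_int (\<lambda>s. k s - D * s)" by (intro loc_int_diff k D)
    fix c assume c: "test1 c"
    define I where "I = (\<integral>s. c s \<partial>lborel)"
    have t: "test1 (\<lambda>s. c s - I * c0 s)" by (intro test1_diff test1_scale c c0)
    have "(\<integral>s. c s - I * c0 s \<partial>lborel) = 0"
      using c c0 by (simp add: test1_integrable I_def)
    then obtain F where F: "test1 F" "\<And>s. (F has_real_derivative (c s - I * c0 s)) (at s)"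
      using test1_antiderivative[OF t] by blast
    have "deriv F = (\<lambda>s. c s - I * c0 s)" using F(2) DERIV_imp_deriv by blast
    moreover have "((\<lambda>s. c s - I * c0 s) has_real_derivative (deriv c s - I * deriv c0 s)) (at s)" for s
      using smooth1_has_deriv[OF test1_smooth] c c0 by (auto intro!: derivative_eq_intros)
    ultimately have "deriv (deriv F) s = deriv c s - I * deriv c0 s" for s
      using DERIV_imp_deriv by fastforce
    then have e: "deriv c s * k s - I * (deriv c0 s * k s) = deriv (deriv F) s * k s" for s
      by (simp only: left_diff_distrib mult.assoc)
    have "(\<integral>s. deriv c s * k s - I * (deriv c0 s * k s) \<partial>lborel) = 0"
      unfolding e by (rule orth[OF F(1)])
    then have "(\<integral>s. deriv c s * k s \<partial>lborel) + I * D = 0"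
      using loc_int_test1[OF k test1_deriv[OF c]] loc_int_test1[OF k test1_deriv[OF c0(1)]] by (simp add: D_def)
    moreover have "(\<integral>s. deriv c s * (D * s) \<partial>lborel) = - (\<integral>s. c s * D \<partial>lborel)"
      by (rule integral_by_parts_test1[OF c]) (auto intro!: derivative_eq_intros)
    ultimately show "(\<integral>s. deriv c s * (k s - D * s) \<partial>lborel) = 0"
      using loc_int_test1[OF k test1_deriv[OF c]] loc_int_test1[OF D test1_deriv[OF c]]
      by (simp add: right_diff_distrib I_def mult.commute)
  qed
  then show ?thesis by (intro that[of C D]) (auto elim: AE_mp)
qed

text \<open>The oriented indicator of the interval between 0 and x, equal to 1 for 0 <= t < x and to
  -1 for x <= t < 0. Integration against it is the primitive from 0 to x for either sign of x, in a
  form to which Fubini applies.\<close>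

definition prim_ker :: "real \<Rightarrow> real \<Rightarrow> real" where
  "prim_ker x t = (if t < x then 1 else 0) - (if t < 0 then 1 else 0)"

text \<open>For q only locally integrable the primitive need not be differentiable everywhere. It is
  continuous by dominated convergence, and its weak derivative is found by exchanging the order of
  integration.\<close>

lemma loc_int_primitive:
  assumes q: "loc_int q"
  obtains P where "continuous_on UNIV P"
    "\<And>c. test1 c \<Longrightarrow> (\<integral>s. deriv c s * P s \<partial>lborel) = - (\<integral>s. c s * q s \<partial>lborel)"
proof
  have [measurable]: "q \<in> borel_measurable borel" using q by (rule loc_int_measurable)
  define P where "P x = (\<integral>t. prim_ker x t * q t \<partial>lborel)" for x
  have ker_le: "\<bar>prim_ker x t * q t\<bar> \<le> \<bar>indicator {-R..R} t * q t\<bar>" if "\<bar>x\<bar> \<le> R" for x t R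
    using that by (auto simp: prim_ker_def indicator_def)
  have qi: "integrable lborel (\<lambda>t. \<bar>indicator {-R..R} t * q t\<bar>)" for R
    using q unfolding loc_int_def by (intro integrable_abs) auto
  show "continuous_on UNIV P"
  proof (rule continuous_on_sequentiallyI)
    fix u :: "nat \<Rightarrow> real" and x assume u: "u \<longlonglongrightarrow> x"
    then obtain R where R: "\<And>n. \<bar>u n\<bar> \<le> R"
      using convergent_imp_bounded[OF u] unfolding bounded_iff by auto
    show "(\<lambda>n. P (u n)) \<longlonglongrightarrow> P x" unfolding P_def
    proof (rule integral_dominated_convergence[OF _ _ qi[of R]])
      show "AE t in lborel. (\<lambda>n. prim_ker (u n) t * q t) \<longlonglongrightarrow> prim_ker x t * q t"
        using AE_lborel_singleton[of x]
      proof eventually_elim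
        fix t assume "t \<noteq> x"
        have "\<forall>\<^sub>F n in sequentially. prim_ker (u n) t = prim_ker x t"
        proof (cases "t < x")
          case True
          show ?thesis using order_tendstoD(1)[OF u True]
            by eventually_elim (use True in \<open>simp add: prim_ker_def\<close>)
        next
          case False
          then have "x < t" using \<open>t \<noteq> x\<close> by simp
          show ?thesis using order_tendstoD(2)[OF u \<open>x < t\<close>]
            by eventually_elim (use False in \<open>simp add: prim_ker_def\<close>)
        qed
        then show "(\<lambda>n. prim_ker (u n) t * q t) \<longlonglongrightarrow> prim_ker x t * q t"
          by (intro tendsto_intros tendsto_eventually)
      qed
      show "AE t in lborel. norm (prim_ker (u n) t * q t) \<le> \<bar>indicator {-R..R} t * q t\<bar>" for n
        using ker_le[OF R] by simp
    qed (simp_all add: prim_ker_def)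
  qed
  fix c assume c: "test1 c"
  obtain R0 S where R0: "\<And>s. R0 \<le> \<bar>s\<bar> \<Longrightarrow> c s = 0" "\<And>s. S \<le> \<bar>s\<bar> \<Longrightarrow> deriv c s = 0"
    using test1_support[OF c] test1_support[OF test1_deriv[OF c]] by auto
  define R where "R = max 0 (max R0 S)"
  have R: "\<And>s. R \<le> \<bar>s\<bar> \<Longrightarrow> c s = 0" "\<And>s. R \<le> \<bar>s\<bar> \<Longrightarrow> deriv c s = 0" "R \<ge> 0"
    using R0 by (auto simp: R_def)
  let ?F = "\<lambda>(x, t). deriv c x * (prim_ker x t * q t)"
  have [measurable]: "deriv c \<in> borel_measurable borel"
    by (intro borel_measurable_continuous_onI test1_continuous test1_deriv c)
  have Fm: "?F \<in> borel_measurable (lborel \<Otimes>\<^sub>M lborel)"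
    unfolding prim_ker_def by measurable
  have F: "integrable (lborel \<Otimes>\<^sub>M lborel) ?F"
  proof (rule Bochner_Integration.integrable_bound[OF _ Fm])
    show "integrable (lborel \<Otimes>\<^sub>M lborel) (\<lambda>(x, t). deriv c x * (indicator {-R..R} t * q t))"
    proof (rule lborel_pair.Fubini_integrable)
      have "integrable lborel (\<lambda>x. \<bar>deriv c x\<bar> * (\<integral>t. \<bar>indicator {-R..R} t * q t\<bar> \<partial>lborel))"
        using test1_integrable[OF test1_deriv[OF c]] by (intro integrable_mult_left integrable_abs)
      then show "integrable lborel (\<lambda>x. \<integral>t. norm (case (x, t) of (x, t) \<Rightarrow>
          deriv c x * (indicator {-R..R} t * q t)) \<partial>lborel)"
        by (simp add: abs_mult)
      show "AE x in lborel. integrable lborel (\<lambda>t. case (x, t) of (x, t) \<Rightarrow>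
          deriv c x * (indicator {-R..R} t * q t))"
        using q by (auto simp: loc_int_def)
    qed measurable
    show "AE z in lborel \<Otimes>\<^sub>M lborel. norm (?F z)
        \<le> norm (case z of (x, t) \<Rightarrow> deriv c x * (indicator {-R..R} t * q t))"
    proof (rule AE_I2)
      fix z :: "real \<times> real"
      obtain x t where z: "z = (x, t)" by (cases z)
      show "norm (?F z) \<le> norm (case z of (x, t) \<Rightarrow> deriv c x * (indicator {-R..R} t * q t))"
        using ker_le[of x R t] R(2)[of x] unfolding z
        by (cases "\<bar>x\<bar> \<le> R") (auto simp: abs_mult intro!: mult_left_mono)
    qed
  qed
  \<comment> \<open>The part of the kernel anchored at 0 does not depend on x and drops out, because
    the derivative of c has integral 0; the rest is the integral of that derivative from t
    on.\<close>
  have tail: "(\<integral>x. deriv c x * prim_ker x t \<partial>lborel) = - c t" for t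
  proof -
    let ?k = "\<lambda>x. deriv c x * (if t < x then 1 else 0)"
    have i: "integrable lborel ?k"
      by (rule Bochner_Integration.integrable_bound[OF test1_integrable[OF test1_deriv[OF c]]]) auto
    have "(\<integral>x. deriv c x \<partial>lborel) = 0"
      using integral_deriv_compact_support[of c "deriv c" R] smooth1_has_deriv[OF test1_smooth[OF c]]
        test1_continuous[OF test1_deriv[OF c]] R by blast
    then have "(\<integral>x. deriv c x * prim_ker x t \<partial>lborel) = (\<integral>x. ?k x \<partial>lborel)"
      using i test1_integrable[OF test1_deriv[OF c]]
      by (simp add: prim_ker_def right_diff_distrib)
    also have "\<dots> = (\<integral>x. indicator {t..max t R} x *\<^sub>R deriv c x \<partial>lborel)"
    proof (rule integral_cong_AE)
      show "AE x in lborel. ?k x = indicator {t..max t R} x *\<^sub>R deriv c x"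
        using AE_lborel_singleton[of t]
      proof eventually_elim
        fix x assume "x \<noteq> t"
        then show "?k x = indicator {t..max t R} x *\<^sub>R deriv c x"
          using R(2)[of x] by (auto simp: indicator_def)
      qed
    qed measurable
    also have "\<dots> = c (max t R) - c t"
      by (rule integral_FTC_Icc) (auto intro: smooth1_has_deriv[OF test1_smooth[OF c]]
          has_field_derivative_at_within test1_continuous test1_deriv c
          simp flip: has_real_derivative_iff_has_vector_derivative)
    also have "c (max t R) = 0" using R(1)[of "max t R"] R(3) by simp
    finally show ?thesis by simp
  qed
  have "(\<integral>s. deriv c s * P s \<partial>lborel) = (\<integral>x. (\<integral>t. ?F (x, t) \<partial>lborel) \<partial>lborel)"
    unfolding P_def by simp
  also have "\<dots> = (\<integral>t. (\<integral>x. ?F (x, t) \<partial>lborel) \<partial>lborel)"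
    using lborel_pair.Fubini_integral[of "\<lambda>x t. ?F (x, t)"] F by simp
  also have "\<dots> = (\<integral>t. q t * (\<integral>x. deriv c x * prim_ker x t \<partial>lborel) \<partial>lborel)"
    by (simp add: mult_ac flip: integral_mult_right_zero)
  also have "\<dots> = - (\<integral>t. c t * q t \<partial>lborel)"
    unfolding tail by (simp add: mult.commute)
  finally show "(\<integral>s. deriv c s * P s \<partial>lborel) = - (\<integral>s. c s * q s \<partial>lborel)" .
qed

lemma deriv_continuous_on:
  fixes f :: "real \<Rightarrow> real"
  assumes "\<And>s. (f has_real_derivative f' s) (at s)"
  shows "continuous_on A f"
  using assms by (auto intro!: continuous_at_imp_continuous_on DERIV_isCont)

lemma integrable_indicator_Icc: "integrable lborel (indicator {a..b} :: real \<Rightarrow> real)"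
  by (rule integrable_real_indicator) (simp_all add: emeasure_lborel_Icc_eq)

lemma abs_mult_le_squares: "\<bar>a * b\<bar> \<le> a\<^sup>2 + b\<^sup>2" for a b :: real
proof -
  have "2 * (\<bar>a\<bar> * \<bar>b\<bar>) \<le> a\<^sup>2 + b\<^sup>2" using sum_squares_bound[of "\<bar>a\<bar>" "\<bar>b\<bar>"] by simp
  moreover have "0 \<le> \<bar>a\<bar> * \<bar>b\<bar>" by simp
  ultimately show ?thesis unfolding abs_mult by linarith
qed

lemma continuous_AE_zero:
  fixes f :: "real \<Rightarrow> real"
  assumes "continuous_on UNIV f" "AE s in lborel. f s = 0"
  shows "f s = 0"
proof (rule ccontr)
  assume n: "f s \<noteq> 0"
  have o: "open {s. f s \<noteq> 0}"
    using open_Collect_neq[OF assms(1) continuous_on_const[of UNIV 0]] by simp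
  have "{s. f s \<noteq> 0} \<in> null_sets lborel"
    using assms(2) borel_open[OF o] AE_iff_null[of lborel "\<lambda>s. f s = 0"] by simp
  then have "negligible {s. f s \<noteq> 0}"
    by (simp add: negligible_iff_null_sets null_sets_completionI)
  then show False using open_not_negligible[OF o] n by blast
qed

lemma nonneg_integrable_not_bounded_below:
  fixes u :: "real \<Rightarrow> real"
  assumes u: "integrable lborel u" "\<And>s. u s \<ge> 0" and c: "c > 0"
    and low: "(\<forall>s\<ge>x. u s \<ge> c) \<or> (\<forall>s\<le>x. u s \<ge> c)"
  shows False
proof -
  obtain n :: nat where n: "(\<integral>s. u s \<partial>lborel) < real n * c"
    using reals_Archimedean3[OF c] by blast
  have est: "(\<integral>s. u s \<partial>lborel) \<ge> real n * c" if "\<And>s. s \<in> {a..a + real n} \<Longrightarrow> u s \<ge> c" for a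
  proof -
    have "(\<integral>s. indicator {a..a + real n} s * c \<partial>lborel) \<le> (\<integral>s. u s \<partial>lborel)"
    proof (rule integral_mono)
      show "integrable lborel (\<lambda>s. indicator {a..a + real n} s * c)"
        by (rule integrable_mult_left[OF integrable_indicator_Icc])
    qed (use u that in \<open>auto simp: indicator_def\<close>)
    then show ?thesis by simp
  qed
  from low show False
  proof
    assume "\<forall>s\<ge>x. u s \<ge> c"
    then show False using est[of x] n by simp
  next
    assume "\<forall>s\<le>x. u s \<ge> c"
    then show False using est[of "x - real n"] n by simp
  qed
qed

text \<open>Where u is positive, convexity keeps it at least as large on one of the two half lines,
  according to the sign of u', which contradicts integrability.\<close>

lemma convex_integrable_zero:
  fixes u :: "real \<Rightarrow> real"
  assumes u: "integrable lborel u" "\<And>s. u s \<ge> 0"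
    and d: "\<And>s. (u has_real_derivative u' s) (at s)" "\<And>s. (u' has_real_derivative u'' s) (at s)"
    and c: "\<And>s. u'' s \<ge> 0"
  shows "u s = 0"
proof (rule ccontr)
  assume "u s \<noteq> 0"
  then have s: "u s > 0" using u(2)[of s] by simp
  have mono: "u' a \<le> u' b" if "a \<le> b" for a b
    by (rule DERIV_nonneg_imp_nondecreasing[OF that]) (use d(2) c in blast)
  show False
  proof (cases "u' s \<ge> 0")
    case True
    have "u t \<ge> u s" if "t \<ge> s" for t
    proof (rule DERIV_nonneg_imp_nondecreasing[OF that])
      fix x assume "s \<le> x" "x \<le> t"
      then have "u' x \<ge> 0" using mono[of s x] True by simp
      then show "\<exists>y. (u has_real_derivative y) (at x) \<and> 0 \<le> y" using d(1) by blast
    qed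
    then show False using nonneg_integrable_not_bounded_below[OF u s] by blast
  next
    case False
    have "u t \<ge> u s" if "t \<le> s" for t
    proof (rule DERIV_nonpos_imp_nonincreasing[OF that])
      fix x assume "t \<le> x" "x \<le> s"
      then have "u' x \<le> 0" using mono[of x s] False by simp
      then show "\<exists>y. (u has_real_derivative y) (at x) \<and> y \<le> 0" using d(1) by blast
    qed
    then show False using nonneg_integrable_not_bounded_below[OF u s] by blast
  qed
qed

lemma loc_int_sq:
  assumes [measurable]: "a \<in> borel_measurable borel" and "integrable lborel (\<lambda>s. (a s)\<^sup>2)"
  shows "loc_int a"
  unfolding loc_int_def
proof (intro conjI allI assms(1))
  fix R :: real
  show "integrable lborel (\<lambda>s. indicator {-R..R} s * a s)"
  proof (rule Bochner_Integration.integrable_bound)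
    show "integrable lborel (\<lambda>s. indicator {-R..R} s + (a s)\<^sup>2)"
      by (rule Bochner_Integration.integrable_add[OF integrable_indicator_Icc assms(2)])
    show "AE s in lborel. norm (indicator {-R..R} s * a s) \<le> norm (indicator {-R..R} s + (a s)\<^sup>2)"
    proof (rule AE_I2)
      fix s
      have "0 \<le> (\<bar>a s\<bar> - 1)\<^sup>2" by simp
      then have "2 * \<bar>a s\<bar> \<le> 1 + (a s)\<^sup>2" by (simp add: power2_diff)
      then have "\<bar>a s\<bar> \<le> 1 + (a s)\<^sup>2" by simp
      then show "norm (indicator {-R..R} s * a s) \<le> norm (indicator {-R..R} s + (a s)\<^sup>2)"
        by (simp add: indicator_def)
    qed
  qed measurable
qed

text \<open>Up to an affine function a is the double primitive of Q a, hence a.e. equal to a twice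
  differentiable A with A'' = Q A. Then the second derivative of A^2 is 2 A'^2 + 2 Q A^2 >= 0, so
  A^2 is convex, nonnegative and integrable. No decay of A has to be known.\<close>

lemma weak_ode_zero:
  assumes am: "a \<in> borel_measurable borel" and a2: "integrable lborel (\<lambda>s. (a s)\<^sup>2)"
    and Q: "continuous_on UNIV Q" "\<And>s. Q s \<ge> 0"
    and weak: "\<And>c. test1 c \<Longrightarrow> (\<integral>s. (- deriv (deriv c) s + Q s * c s) * a s \<partial>lborel) = 0"
  shows "AE s in lborel. a s = 0"
proof -
  have [measurable]: "a \<in> borel_measurable borel" "Q \<in> borel_measurable borel"
    using am borel_measurable_continuous_onI[OF Q(1)] by auto
  have a: "loc_int a" by (rule loc_int_sq[OF am a2])
  have Qa: "loc_int (\<lambda>s. Q s * a s)" by (rule loc_int_continuous_mult[OF a Q(1)])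
  obtain P where P: "continuous_on UNIV P"
    "\<And>c. test1 c \<Longrightarrow> (\<integral>s. deriv c s * P s \<partial>lborel) = - (\<integral>s. c s * (Q s * a s) \<partial>lborel)"
    by (rule loc_int_primitive[OF Qa]) blast
  obtain B where B: "\<And>s. (B has_real_derivative P s) (at s)"
    using antiderivative_exists[OF P(1)] by blast
  have Bc: "continuous_on UNIV B"
    by (rule deriv_continuous_on[OF B])
  obtain C D where CD: "AE s in lborel. a s - B s = C + D * s"
  proof (rule weak_deriv2_zero_imp_affine)
    show "loc_int (\<lambda>s. a s - B s)" by (intro loc_int_diff a loc_int_continuous Bc)
    fix c assume c: "test1 c"
    have i1: "integrable lborel (\<lambda>s. deriv (deriv c) s * a s)" by (intro loc_int_test1 a test1_deriv c)
    have i2: "integrable lborel (\<lambda>s. deriv (deriv c) s * B s)"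
      by (intro loc_int_test1 loc_int_continuous Bc test1_deriv c)
    have i3: "integrable lborel (\<lambda>s. c s * (Q s * a s))" by (intro loc_int_test1 Qa c)
    have "(\<integral>s. c s * (Q s * a s) - deriv (deriv c) s * a s \<partial>lborel) = 0"
      using weak[OF c] by (simp add: algebra_simps)
    then have "(\<integral>s. deriv (deriv c) s * a s \<partial>lborel) = (\<integral>s. c s * (Q s * a s) \<partial>lborel)"
      using i1 i3 by simp
    moreover have "(\<integral>s. deriv (deriv c) s * B s \<partial>lborel) = (\<integral>s. c s * (Q s * a s) \<partial>lborel)"
      using integral_by_parts_test1[OF test1_deriv[OF c] B P(1)] P(2)[OF c] by simp
    ultimately show "(\<integral>s. deriv (deriv c) s * (a s - B s) \<partial>lborel) = 0"
      using i1 i2 by (simp add: right_diff_distrib)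
  qed
  define A where "A s = B s + (C + D * s)" for s
  have AE: "AE s in lborel. a s = A s" using CD by eventually_elim (simp add: A_def)
  have dA: "(A has_real_derivative P s + D) (at s)" for s
    unfolding A_def by (auto intro!: derivative_eq_intros B)
  have Ac: "continuous_on UNIV A"
    by (rule deriv_continuous_on[OF dA])
  then have [measurable]: "A \<in> borel_measurable borel" by (rule borel_measurable_continuous_onI)
  have QAc: "continuous_on UNIV (\<lambda>s. Q s * A s)" by (intro continuous_intros Q Ac)
  \<comment> \<open>P is a primitive of Q a in the weak sense only. A classical primitive of the
    continuous function Q A has the same weak derivative, so P differs from it by a constant and
    becomes differentiable.\<close>
  obtain Y where Y: "\<And>s. (Y has_real_derivative Q s * A s) (at s)"
    using antiderivative_exists[OF QAc] by blast
  have Yc: "continuous_on UNIV Y"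
    by (rule deriv_continuous_on[OF Y])
  obtain K where K: "AE s in lborel. P s - Y s = K"
  proof (rule weak_deriv_zero_imp_const)
    show "loc_int (\<lambda>s. P s - Y s)" by (intro loc_int_continuous continuous_intros P Yc)
    fix c assume c: "test1 c"
    have [measurable]: "c \<in> borel_measurable borel"
      by (intro borel_measurable_continuous_onI test1_continuous c)
    have "(\<integral>s. c s * (Q s * a s) \<partial>lborel) = (\<integral>s. c s * (Q s * A s) \<partial>lborel)"
      by (rule integral_cong_AE) (use AE in \<open>auto elim: AE_mp\<close>)
    then have "(\<integral>s. deriv c s * P s \<partial>lborel) = (\<integral>s. deriv c s * Y s \<partial>lborel)"
      using P(2)[OF c] integral_by_parts_test1[OF c Y QAc] by simp
    then show "(\<integral>s. deriv c s * (P s - Y s) \<partial>lborel) = 0"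
      using loc_int_test1[OF loc_int_continuous test1_deriv[OF c]] P(1) Yc
      by (simp add: right_diff_distrib)
  qed
  have PY: "P s - Y s - K = 0" for s
    by (rule continuous_AE_zero) (use K P(1) Yc in \<open>auto intro!: continuous_intros\<close>)
  have dP: "(P has_real_derivative Q s * A s) (at s)" for s
  proof -
    have "P = (\<lambda>s. Y s + K)" using PY by (auto simp: fun_eq_iff algebra_simps)
    then show ?thesis by (auto intro!: derivative_eq_intros Y)
  qed
  have "(A s)\<^sup>2 = 0" for s
  proof (rule convex_integrable_zero[where u = "\<lambda>s. (A s)\<^sup>2" and u' = "\<lambda>s. 2 * A s * (P s + D)"
        and u'' = "\<lambda>s. 2 * (P s + D)\<^sup>2 + 2 * (Q s * (A s)\<^sup>2)"])
    show "integrable lborel (\<lambda>s. (A s)\<^sup>2)"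
      by (rule integrable_cong_AE_imp[OF a2]) (use AE in \<open>auto elim: AE_mp\<close>)
    show "((\<lambda>s. (A s)\<^sup>2) has_real_derivative 2 * A s * (P s + D)) (at s)" for s
      using dA by (auto intro!: derivative_eq_intros)
    show "((\<lambda>s. 2 * A s * (P s + D)) has_real_derivative
        2 * (P s + D)\<^sup>2 + 2 * (Q s * (A s)\<^sup>2)) (at s)" for s
      using dA dP by (auto intro!: derivative_eq_intros simp: power2_eq_square algebra_simps)
    show "0 \<le> 2 * (P s + D)\<^sup>2 + 2 * (Q s * (A s)\<^sup>2)" for s
      using Q(2) by (intro add_nonneg_nonneg mult_nonneg_nonneg) auto
  qed simp
  then show ?thesis using AE by simp
qed

lemma Cauchy_Schwarz_integral:
  fixes f k :: "'a \<Rightarrow> real"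
  assumes f: "integrable N (\<lambda>x. (f x)\<^sup>2)" and k: "integrable N (\<lambda>x. (k x)\<^sup>2)"
    and fk: "integrable N (\<lambda>x. f x * k x)" and m: "f \<in> borel_measurable N"
  shows "(\<integral>x. f x * k x \<partial>N)\<^sup>2 \<le> (\<integral>x. (f x)\<^sup>2 \<partial>N) * (\<integral>x. (k x)\<^sup>2 \<partial>N)"
proof -
  define I J K where "I = (\<integral>x. (f x)\<^sup>2 \<partial>N)" and "J = (\<integral>x. (k x)\<^sup>2 \<partial>N)" and "K = (\<integral>x. f x * k x \<partial>N)"
  have I0: "I \<ge> 0" by (simp add: I_def)
  have "0 \<le> (\<integral>x. (K * f x - I * k x)\<^sup>2 \<partial>N)" by simp
  also have "\<dots> = (\<integral>x. K\<^sup>2 * (f x)\<^sup>2 - 2 * K * I * (f x * k x) + I\<^sup>2 * (k x)\<^sup>2 \<partial>N)"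
    by (simp add: power2_diff power_mult_distrib algebra_simps)
  also have "\<dots> = K\<^sup>2 * I - 2 * K * I * K + I\<^sup>2 * J"
    using f k fk by (simp add: I_def J_def K_def)
  finally have *: "0 \<le> I * (I * J - K\<^sup>2)" by (simp add: power2_eq_square algebra_simps)
  show ?thesis
  proof (cases "I = 0")
    case True
    then have "AE x in N. f x = 0"
      using integral_nonneg_eq_0_iff_AE[OF f] by (simp add: I_def)
    then have "K = (\<integral>x. 0 \<partial>N)" unfolding K_def
      using fk by (intro integral_cong_AE) (auto elim: AE_mp)
    then show ?thesis using True by (simp add: I_def K_def)
  next
    case False
    then have "K\<^sup>2 \<le> I * J" using * I0 by (simp add: zero_le_mult_iff)
    then show ?thesis by (simp add: I_def J_def K_def)
  qed
qed

section \<open>Essential self-adjointness on the core\<close>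

definition lapX :: "(point \<Rightarrow> real) \<Rightarrow> point \<Rightarrow> real" where
  "lapX f x = (\<Sum>e\<in>Basis. Xe e (Xe e f) x)"

text \<open>V and L play different roles: V only enters the radial equation as a continuous
  coefficient, while L multiplies the lower degree terms of the angular recursion and must turn test
  functions into test functions.\<close>

locale wave_op =
  fixes V L :: "real \<Rightarrow> real"
  assumes V_cont: "continuous_on UNIV V" and V_nonneg: "V s \<ge> 0"
    and L_smooth: "smooth1 L" and L_nonneg: "L s \<ge> 0"
begin

definition Hop :: "(point \<Rightarrow> real) \<Rightarrow> point \<Rightarrow> real" where
  "Hop f x = - Ds (Ds f) x + V (fst x) * f x - L (fst x) * lapX f x"

lemma L_cont: "continuous_on A L" by (rule smooth1_continuous[OF L_smooth])

lemma V_fst_cont: "continuous_on A (\<lambda>x::point. V (fst x))"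
  by (rule continuous_on_compose2[OF V_cont]) (auto intro!: continuous_intros)

lemma L_fst_cont: "continuous_on A (\<lambda>x::point. L (fst x))"
  by (rule continuous_on_compose2[OF L_cont[of UNIV]]) (auto intro!: continuous_intros)

lemma lapX_continuous: "DD f \<Longrightarrow> continuous_on A (lapX f)"
  unfolding lapX_def[abs_def] by (intro continuous_on_sum DD_continuous DD_Xe)

lemma DD_lapX: "DD f \<Longrightarrow> DD (lapX f)"
proof -
  assume f: "DD f"
  have "finite B \<Longrightarrow> DD (\<lambda>x. \<Sum>e\<in>B. Xe e (Xe e f) x)" for B
  proof (induction B rule: finite_induct)
    case (insert e B)
    from DD_add[OF DD_Xe[OF DD_Xe[OF f]] insert(3), of e e] insert(1,2) show ?case by simp
  qed (simp add: DD_zero)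
  then show ?thesis unfolding lapX_def[abs_def] by simp
qed

lemma Hop_continuous: "DD f \<Longrightarrow> continuous_on A (Hop f)"
  unfolding Hop_def[abs_def]
  by (intro continuous_on_diff continuous_on_add continuous_on_minus continuous_on_mult
      V_fst_cont L_fst_cont lapX_continuous DD_continuous DD_Dd)

lemma Hop_slab_supp: "DD f \<Longrightarrow> slab_supp (Hop f)"
  unfolding Hop_def[abs_def]
  by (intro slab_supp_intros DD_slab_supp DD_Dd DD_lapX)

lemma Hop_sq_int: "DD f \<Longrightarrow> sq_int (Hop f)"
  by (intro sq_int_slab_supp Hop_continuous Hop_slab_supp)

lemma lapX_add: "DD f \<Longrightarrow> DD k \<Longrightarrow> lapX (\<lambda>x. f x + k x) x = lapX f x + lapX k x"
proof -
  assume d: "DD f" "DD k"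
  then have "Xe e (\<lambda>x. f x + k x) = (\<lambda>x. Xe e f x + Xe e k x)" for e
    using Xe_add DD_C1 by blast
  then show ?thesis
    using d by (simp add: lapX_def Xe_add DD_C1 DD_Xe sum.distrib)
qed

lemma Hop_add: "DD f \<Longrightarrow> DD k \<Longrightarrow> Hop (\<lambda>x. f x + k x) x = Hop f x + Hop k x"
proof -
  assume d: "DD f" "DD k"
  then have "Ds (\<lambda>x. f x + k x) = (\<lambda>x. Ds f x + Ds k x)" using Dd_add DD_C1 by blast
  then show ?thesis
    using d by (simp add: Hop_def Dd_add DD_C1 DD_Dd lapX_add algebra_simps)
qed

lemma Hop_scale: "DD f \<Longrightarrow> Hop (\<lambda>x. c * f x) x = c * Hop f x"
proof -
  assume d: "DD f"
  have D: "Dd w (\<lambda>x. c * k x) = (\<lambda>x. c * Dd w k x)" if "DD k" for w k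
  proof
    fix x
    show "Dd w (\<lambda>x. c * k x) x = c * Dd w k x"
      by (rule Dd_eq) (auto intro!: derivative_eq_intros C1_has_derivative DD_C1 that)
  qed
  then have X: "Xe e (\<lambda>x. c * k x) = (\<lambda>x. c * Xe e k x)" if "DD k" for e k
    using that by (auto simp: Xe_Dd fun_eq_iff)
  have "lapX (\<lambda>x. c * f x) x = c * lapX f x"
    using d by (simp add: lapX_def X DD_Xe sum_distrib_left)
  then show ?thesis using d by (simp add: Hop_def D DD_Dd algebra_simps)
qed

lemma Hop_form:
  assumes f: "DD f" and k: "C1 k"
  shows "(\<integral>x. Hop f x * k x \<partial>mu)
    = (\<integral>x. Ds f x * Ds k x + V (fst x) * (f x * k x)
        + L (fst x) * (\<Sum>e\<in>Basis. Xe e f x * Xe e k x) \<partial>mu)"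
proof -
  note kc = C1_continuous[OF k] C1_Dd_continuous[OF k] C1_Xe_continuous[OF k]
  note i = integrable_mu_slab_supp slab_supp_mult1 slab_supp_mult2 DD_slab_supp DD_continuous DD_Dd DD_Xe
    continuous_on_mult continuous_on_minus f kc V_fst_cont L_fst_cont
  have i1: "integrable mu (\<lambda>x. Ds (Ds f) x * k x)" "integrable mu (\<lambda>x. Ds f x * Ds k x)"
    "integrable mu (\<lambda>x. V (fst x) * (f x * k x))" by (intro i)+
  have i2: "integrable mu (\<lambda>x. L (fst x) * (Xe e (Xe e f) x * k x))"
    "integrable mu (\<lambda>x. L (fst x) * (Xe e f x * Xe e k x))" for e by (intro i)+
  have "(\<integral>x. Hop f x * k x \<partial>mu) = (\<integral>x. - (Ds (Ds f) x * k x) + V (fst x) * (f x * k x)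
      - (\<Sum>e\<in>Basis. L (fst x) * (Xe e (Xe e f) x * k x)) \<partial>mu)"
    by (rule Bochner_Integration.integral_cong)
      (simp_all add: Hop_def lapX_def algebra_simps sum_distrib_left sum_distrib_right)
  also have "\<dots> = - (\<integral>x. Ds (Ds f) x * k x \<partial>mu) + (\<integral>x. V (fst x) * (f x * k x) \<partial>mu)
      - (\<Sum>e\<in>Basis. \<integral>x. L (fst x) * (Xe e (Xe e f) x * k x) \<partial>mu)"
    using i1 i2 by simp
  also have "(\<integral>x. Ds (Ds f) x * k x \<partial>mu) = - (\<integral>x. Ds f x * Ds k x \<partial>mu)"
    by (rule integral_Ds_by_parts) (auto intro: DD_C1 DD_Dd f k DD_slab_supp)
  also have "(\<Sum>e\<in>Basis. \<integral>x. L (fst x) * (Xe e (Xe e f) x * k x) \<partial>mu)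
      = (\<Sum>e\<in>Basis. - (\<integral>x. L (fst x) * (Xe e f x * Xe e k x) \<partial>mu))"
    by (intro sum.cong refl integral_Xe_by_parts)
      (auto intro: DD_C1 DD_Xe f k DD_slab_supp L_cont)
  finally show ?thesis
    using i1 i2 by (simp add: sum_distrib_left sum_negf)
qed

lemma Hop_symmetric:
  assumes "DD f" "DD k"
  shows "(\<integral>x. Hop f x * k x \<partial>mu) = (\<integral>x. f x * Hop k x \<partial>mu)"
  using Hop_form[OF assms(1) DD_C1[OF assms(2)]] Hop_form[OF assms(2) DD_C1[OF assms(1)]]
  by (simp add: mult.commute)

lemma Hop_nonneg:
  assumes "DD f"
  shows "(\<integral>x. Hop f x * f x \<partial>mu) \<ge> 0"
  unfolding Hop_form[OF assms DD_C1[OF assms]]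
proof (rule integral_nonneg_AE, rule AE_I2)
  fix x :: point
  have "0 \<le> Ds f x * Ds f x" "0 \<le> V (fst x) * (f x * f x)"
    "0 \<le> L (fst x) * (\<Sum>e\<in>Basis. Xe e f x * Xe e f x)"
    by (simp_all add: V_nonneg L_nonneg sum_nonneg)
  then show "0 \<le> Ds f x * Ds f x + V (fst x) * (f x * f x)
      + L (fst x) * (\<Sum>e\<in>Basis. Xe e f x * Xe e f x)" by linarith
qed

text \<open>By \<open>sph_lap_homog\<close> the spherical Laplacian is triangular on homogeneous polynomials, with diagonal
  entries \<open>- l (l + 1)\<close>; by induction on the degree, each angular mode of \<open>w\<close> is a square integrable weak
  solution of \<open>- y'' + Q y = 0\<close> with \<open>Q \<ge> 0\<close> and hence vanishes.\<close>

lemma orthogonal_range_zero: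
  assumes w: "sq_int w" and orth: "\<And>f. DD f \<Longrightarrow> (\<integral>x. (f x + Hop f x) * w x \<partial>mu) = 0"
  shows "AE x in mu. w x = 0"
proof -
  have wm [measurable]: "w \<in> borel_measurable borel" using w by (rule sq_int_measurable)
  have sw: "slab_int w" by (rule slab_int_sq_int[OF w])
  have "\<forall>p c. homog l p \<longrightarrow> test1 c \<longrightarrow> (\<integral>x. c (fst x) * p (snd x) * w x \<partial>mu) = 0" for l
  proof (induction l rule: less_induct)
    case (less l)
    show ?case
    proof (intro allI impI)
      fix p c assume p: "homog l p" and c: "test1 c"
      obtain q where q: "homog (l - 2) q" "l < 2 \<longrightarrow> q = (\<lambda>y. 0)"
        "\<And>y. sph_lap p y = (y \<bullet> y) * q y - real l * (real l + 1) * p y"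
        using sph_lap_homog[OF p] by blast
      define a where "a s = (\<integral>y. p y * w (s, y) \<partial>sphere_measure)" for s
      \<comment> \<open>The summand 1 stems from testing with f + Hop f, and l (l + 1) L from the
        diagonal entry of the spherical Laplacian.\<close>
      define Q where "Q s = 1 + V s + real l * (real l + 1) * L s" for s
      have pc: "continuous_on A p" for A by (rule homog_continuous[OF p])
      have pm [measurable]: "p \<in> borel_measurable borel" using pc by (rule borel_measurable_continuous_onI)
      have wm2 [measurable]: "w \<in> borel_measurable (borel \<Otimes>\<^sub>M borel)" unfolding borel_prod by (rule wm)
      have pw: "(\<integral>x. k (fst x) * p (snd x) * w x \<partial>mu) = (\<integral>s. k s * a s \<partial>lborel)"
        if k: "continuous_on UNIV k" "\<exists>R. \<forall>s. R \<le> \<bar>s\<bar> \<longrightarrow> k s = 0" for k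
      proof -
        have "integrable mu (\<lambda>x. k (fst x) * p (snd x) * w x)"
        proof (rule slab_int_cont_mult[OF sw])
          show "continuous_on UNIV (\<lambda>x::point. k (fst x) * p (snd x))"
            by (intro continuous_on_mult continuous_on_compose2[OF k(1)] continuous_on_compose2[OF pc[of UNIV]]
                continuous_intros) auto
          show "slab_supp (\<lambda>x. k (fst x) * p (snd x))" using k(2) by (auto simp: slab_supp_def)
        qed
        from integral_mu_fst[OF this] show ?thesis by (simp add: a_def mult.assoc)
      qed
      have am: "a \<in> borel_measurable borel"
      proof -
        have "(\<lambda>s. \<integral>y. p y * w (s, y) \<partial>sphere_measure) \<in> borel_measurable lborel"
          by (rule sphere.borel_measurable_lebesgue_integral) measurable
        then show ?thesis unfolding a_def[abs_def] by simp
      qed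
      have p2: "integrable sphere_measure (\<lambda>y. (p y)\<^sup>2)"
      proof -
        have "compact (p ` sphere 0 1)" by (intro compact_continuous_image pc compact_sphere)
        then obtain B where B: "\<forall>z \<in> p ` sphere 0 1. norm z \<le> B"
          using bounded_iff compact_imp_bounded by blast
        show ?thesis
        proof (rule sphere.integrable_const_bound[of _ "B\<^sup>2"])
          show "AE y in sphere_measure. norm ((p y)\<^sup>2) \<le> B\<^sup>2"
            using AE_sphere_measure
          proof eventually_elim
            fix y :: "real^3" assume "norm y = 1"
            then have "\<bar>p y\<bar> \<le> B" using B by auto
            then show "norm ((p y)\<^sup>2) \<le> B\<^sup>2" by (simp add: abs_le_square_iff[symmetric])
          qed
        qed measurable
      qed
      have a2: "integrable lborel (\<lambda>s. (a s)\<^sup>2)"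
      proof (rule Bochner_Integration.integrable_bound)
        let ?P = "\<integral>y. (p y)\<^sup>2 \<partial>sphere_measure"
        note sw2 = integrable_mu_swap[OF sq_int_integrable[OF w]]
        show "integrable lborel (\<lambda>s. ?P * (\<integral>y. (w (s, y))\<^sup>2 \<partial>sphere_measure))"
          by (rule integrable_mult_right[OF sw2(2)])
        show "(\<lambda>s. (a s)\<^sup>2) \<in> borel_measurable lborel" using am by simp
        show "AE s in lborel. norm ((a s)\<^sup>2) \<le> norm (?P * (\<integral>y. (w (s, y))\<^sup>2 \<partial>sphere_measure))"
          using sw2(1)
        proof eventually_elim
          fix s assume ws: "integrable sphere_measure (\<lambda>y. (w (s, y))\<^sup>2)"
          have wsm: "(\<lambda>y. w (s, y)) \<in> borel_measurable sphere_measure" by measurable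
          have "integrable sphere_measure (\<lambda>y. p y * w (s, y))"
          proof (rule Bochner_Integration.integrable_bound)
            show "integrable sphere_measure (\<lambda>y. (p y)\<^sup>2 + (w (s, y))\<^sup>2)"
              using p2 ws by (rule Bochner_Integration.integrable_add)
            show "(\<lambda>y. p y * w (s, y)) \<in> borel_measurable sphere_measure"
              using wsm pm by (intro borel_measurable_times) auto
            show "AE y in sphere_measure. norm (p y * w (s, y)) \<le> norm ((p y)\<^sup>2 + (w (s, y))\<^sup>2)"
            proof (rule AE_I2)
              fix y
              show "norm (p y * w (s, y)) \<le> norm ((p y)\<^sup>2 + (w (s, y))\<^sup>2)"
                using abs_mult_le_squares[of "p y" "w (s, y)"] by simp
            qed
          qed
          from Cauchy_Schwarz_integral[OF p2 ws this] pm
          have "(a s)\<^sup>2 \<le> ?P * (\<integral>y. (w (s, y))\<^sup>2 \<partial>sphere_measure)" by (simp add: a_def)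
          then show "norm ((a s)\<^sup>2) \<le> norm (?P * (\<integral>y. (w (s, y))\<^sup>2 \<partial>sphere_measure))" by simp
        qed
      qed
      have "AE s in lborel. a s = 0"
      proof (rule weak_ode_zero[OF am a2])
        show "continuous_on UNIV Q" unfolding Q_def by (intro continuous_intros V_cont L_cont)
        show "Q s \<ge> 0" for s unfolding Q_def using V_nonneg L_nonneg by simp
        fix k assume k: "test1 k"
        let ?f = "\<lambda>x. k (fst x) * p (snd x)"
        let ?A = "\<lambda>x. (- deriv (deriv k) (fst x) + Q (fst x) * k (fst x)) * p (snd x) * w x"
        let ?B = "\<lambda>x. L (fst x) * k (fst x) * q (snd x) * w x"
        have f: "DD ?f" by (rule DD_base[OF k p])
        have Dsf: "Ds (\<lambda>x. k (fst x) * p (snd x)) = (\<lambda>x. deriv k (fst x) * p (snd x))" if "test1 k" for k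
          using DD_base_Dd[OF that p] linear_0[OF pd_linear[OF p]] by (auto simp: fun_eq_iff)
        have lap: "lapX ?f x = k (fst x) * sph_lap p (snd x)" for x
          by (simp add: lapX_def sph_lap_def DD_base_Xe[OF k p] DD_base_Xe[OF k homog_ang[OF p]]
              sum_distrib_left)
        have "AE x in mu. (?f x + Hop ?f x) * w x = ?A x - ?B x"
          using AE_mu_sphere
        proof eventually_elim
          fix x :: point assume "norm (snd x) = 1"
          then have "snd x \<bullet> snd x = 1" by (simp add: norm_eq_1)
          then have l: "lapX ?f x = k (fst x) * (q (snd x) - real l * (real l + 1) * p (snd x))"
            unfolding lap q(3) by simp
          have d: "Ds (Ds ?f) x = deriv (deriv k) (fst x) * p (snd x)"
            by (simp only: Dsf[OF k] Dsf[OF test1_deriv[OF k]])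
          show "(?f x + Hop ?f x) * w x = ?A x - ?B x"
            unfolding Hop_def l d Q_def by (simp add: algebra_simps)
        qed
        moreover have Kc: "continuous_on UNIV (\<lambda>s. - deriv (deriv k) s + Q s * k s)"
          unfolding Q_def by (intro continuous_intros test1_continuous test1_deriv k V_cont L_cont)
        moreover obtain R where R: "\<forall>s. R \<le> \<bar>s\<bar> \<longrightarrow> - deriv (deriv k) s + Q s * k s = 0"
        proof -
          obtain R S where "\<forall>s. R \<le> \<bar>s\<bar> \<longrightarrow> k s = 0" "\<forall>s. S \<le> \<bar>s\<bar> \<longrightarrow> deriv (deriv k) s = 0"
            using test1_support[OF k] test1_support[OF test1_deriv[OF test1_deriv[OF k]]] by blast
          then show ?thesis by (intro that[of "max R S"]) auto
        qed
        \<comment> \<open>The induction hypothesis will be applied to the coefficient L k, so this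
          has to be a test function: here smoothness of L is used beyond continuity.\<close>
        have Lk: "test1 (\<lambda>s. L s * k s)" by (rule test1_mult[OF k L_smooth])
        have iA: "integrable mu ?A"
        proof (rule slab_int_cont_mult[OF sw])
          show "continuous_on UNIV (\<lambda>x::point. (- deriv (deriv k) (fst x) + Q (fst x) * k (fst x)) * p (snd x))"
            by (intro continuous_on_mult continuous_on_compose2[OF Kc] continuous_on_compose2[OF pc[of UNIV]]
                continuous_intros) auto
          show "slab_supp (\<lambda>x. (- deriv (deriv k) (fst x) + Q (fst x) * k (fst x)) * p (snd x))"
            unfolding slab_supp_def using R by (intro exI[of _ R]) simp
        qed
        have iB: "integrable mu ?B"
          by (rule slab_int_cont_mult[OF sw DD_continuous DD_slab_supp]) (rule DD_base[OF Lk q(1)])+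
        have "(\<integral>x. ?A x - ?B x \<partial>mu) = (\<integral>x. (?f x + Hop ?f x) * w x \<partial>mu)"
        proof (rule integral_cong_AE)
          show "(\<lambda>x. ?A x - ?B x) \<in> borel_measurable mu" using iA iB by (intro borel_measurable_diff) auto
          show "(\<lambda>x. (?f x + Hop ?f x) * w x) \<in> borel_measurable mu"
            using slab_int_cont_mult[OF sw continuous_on_add[OF DD_continuous[OF f] Hop_continuous[OF f]]
                slab_supp_add[OF DD_slab_supp[OF f] Hop_slab_supp[OF f]]] by auto
        qed (use calculation in \<open>auto elim: AE_mp\<close>)
        then have "(\<integral>x. ?A x \<partial>mu) - (\<integral>x. ?B x \<partial>mu) = 0"
          using orth[OF f] iA iB by simp
        \<comment> \<open>The off-diagonal term involves degree l - 2 only, so it vanishes by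
          induction, or because q = 0 when l < 2.\<close>
        moreover have "(\<integral>x. ?B x \<partial>mu) = 0"
        proof (cases "l < 2")
          case True
          then show ?thesis using q(2) by simp
        next
          case False
          then show ?thesis using less[of "l - 2"] q(1) Lk by auto
        qed
        ultimately have "(\<integral>x. ?A x \<partial>mu) = 0" by simp
        then show "(\<integral>s. (- deriv (deriv k) s + Q s * k s) * a s \<partial>lborel) = 0"
          using pw[OF Kc] R by auto
      qed
      then have "AE s in lborel. c s * a s = 0" by eventually_elim simp
      then have "(\<integral>s. c s * a s \<partial>lborel) = 0" by (rule integral_eq_zero_AE)
      then show "(\<integral>x. c (fst x) * p (snd x) * w x \<partial>mu) = 0"
        using pw[of c] test1_continuous[OF c] c by (auto simp: test1_def)
    qed
  qed
  then have base: "(\<integral>x. c (fst x) * p (snd x) * w x \<partial>mu) = 0" if "test1 c" "homog l p" for c l p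
    using that by blast
  show ?thesis
  proof (rule AE_zero_if_orthogonal_DD[OF sw])
    fix f assume "DD f"
    then show "(\<integral>x. f x * w x \<partial>mu) = 0"
    proof (induction rule: DD.induct)
      case (DD_base c l p)
      then show ?case by (rule base)
    next
      case (DD_add f h)
      have "integrable mu (\<lambda>x. f x * w x)" "integrable mu (\<lambda>x. h x * w x)"
        using DD_add slab_int_cont_mult[OF sw DD_continuous DD_slab_supp] by auto
      then show ?case using DD_add by (simp add: distrib_right)
    qed
  qed
qed

text \<open>Essential self-adjointness in usable form: a pair in the weak relation is a limit of
  core pairs in the graph norm, so identities and inequalities verified on the core extend to the
  whole domain.\<close>

theorem graph_approximation:
  assumes weak: "\<And>f. DD f \<Longrightarrow> inner (cls (Hop f)) u = inner (cls f) w"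
  obtains f where "\<And>n. DD (f n)" "(\<lambda>n. cls (f n)) \<longlonglongrightarrow> u" "(\<lambda>n. cls (Hop (f n))) \<longlonglongrightarrow> w"
proof -
  define Gr where "Gr = {(cls f, cls (Hop f)) | f. DD f}"
  have S: "subspace Gr"
    unfolding subspace_def
  proof (intro conjI ballI allI)
    have "Hop (\<lambda>x. 0) = (\<lambda>x. 0)" using Hop_scale[OF DD_zero, of 0] by (simp add: fun_eq_iff)
    then show "0 \<in> Gr" unfolding Gr_def using DD_zero
      by (auto simp: zero_prod_def cls_zero intro!: exI[of _ "\<lambda>x. 0"])
  next
    fix x y assume "x \<in> Gr" "y \<in> Gr"
    then obtain f k where fk: "DD f" "DD k" "x = (cls f, cls (Hop f))" "y = (cls k, cls (Hop k))"
      by (auto simp: Gr_def)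
    have "Hop (\<lambda>x. f x + k x) = (\<lambda>x. Hop f x + Hop k x)" using Hop_add fk by blast
    then show "x + y \<in> Gr" unfolding Gr_def using fk
      by (auto simp: cls_add DD_sq_int Hop_sq_int DD_add intro!: exI[of _ "\<lambda>x. f x + k x"])
  next
    fix c x assume "x \<in> Gr"
    then obtain f where f: "DD f" "x = (cls f, cls (Hop f))" by (auto simp: Gr_def)
    have "Hop (\<lambda>x. c * f x) = (\<lambda>x. c * Hop f x)" using Hop_scale f by blast
    then show "c *\<^sub>R x \<in> Gr" unfolding Gr_def using f
      by (auto simp: cls_scale DD_sq_int Hop_sq_int DD_scale intro!: exI[of _ "\<lambda>x. c * f x"])
  qed
  have sym: "inner b c = inner a d" if ab: "(a, b) \<in> Gr" and cd: "(c, d) \<in> Gr" for a b c d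
    using ab cd Hop_symmetric by (auto simp: Gr_def inner_cls DD_sq_int Hop_sq_int)
  have pos: "inner b a \<ge> 0" if "(a, b) \<in> Gr" for a b
    using that Hop_nonneg by (auto simp: Gr_def inner_cls DD_sq_int Hop_sq_int)
  have orth: "z = 0" if z: "\<And>a b. (a, b) \<in> Gr \<Longrightarrow> inner z (a + b) = 0" for z
  proof -
    have "AE x in mu. rep z x = 0"
    proof (rule orthogonal_range_zero[OF rep_sq_int])
      fix f assume f: "DD f"
      have "inner z (cls f + cls (Hop f)) = 0" using z f by (auto simp: Gr_def)
      then have "inner (cls (\<lambda>x. f x + Hop f x)) (cls (rep z)) = 0"
        using f by (simp add: cls_add DD_sq_int Hop_sq_int inner_commute)
      then show "(\<integral>x. (f x + Hop f x) * rep z x \<partial>mu) = 0"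
        using f by (subst (asm) inner_cls) (auto intro: sq_int_add DD_sq_int Hop_sq_int rep_sq_int)
    qed
    then have "cls (rep z) = cls (\<lambda>x. 0)"
      using cls_eq_iff[OF rep_sq_int sq_int_zero] by blast
    then show "z = 0" by (simp add: cls_zero)
  qed
  have wk: "inner b u = inner a w" if "(a, b) \<in> Gr" for a b
    using that weak by (auto simp: Gr_def)
  have "\<exists>a b. (\<forall>n. (a n, b n) \<in> Gr) \<and> a \<longlonglongrightarrow> u \<and> b \<longlonglongrightarrow> w"
    by (rule weak_extension_eq_closure[OF S sym pos orth wk]) blast+
  then obtain a b where ab: "\<And>n. (a n, b n) \<in> Gr" "a \<longlonglongrightarrow> u" "b \<longlonglongrightarrow> w" by blast
  have "\<exists>f. DD f \<and> a n = cls f \<and> b n = cls (Hop f)" for n using ab(1)[of n] unfolding Gr_def by blast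
  then obtain f where f: "\<And>n. DD (f n)" "\<And>n. a n = cls (f n)" "\<And>n. b n = cls (Hop (f n))" by metis
  have "a = (\<lambda>n. cls (f n))" "b = (\<lambda>n. cls (Hop (f n)))" using f by (auto simp: fun_eq_iff)
  then show ?thesis using ab(2,3) f(1) that[of f] by simp
qed

end

section \<open>The Morawetz identity\<close>

text \<open>Every radial integration by parts below takes this form: a boundary function F is
  exhibited, and one application of the product rule shows that the integrands differ by its
  derivative.\<close>

lemma integral_eq_by_exact:
  assumes d: "\<And>s y. ((\<lambda>s. F (s, y)) has_real_derivative (A (s, y) - B (s, y))) (at s)"
    and c: "continuous_on UNIV A" "continuous_on UNIV B"
    and s: "slab_supp F" "slab_supp A" "slab_supp B"
  shows "(\<integral>x. A x \<partial>mu) = (\<integral>x. B x \<partial>mu)"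
proof -
  have iA: "integrable mu A" and iB: "integrable mu B"
    using c s by (auto intro: integrable_mu_slab_supp)
  have cAB: "continuous_on UNIV (\<lambda>x. A x - B x)" by (intro continuous_on_diff c)
  obtain R1 R2 where R12: "\<And>s y. R1 \<le> \<bar>s\<bar> \<Longrightarrow> F (s, y) = 0" "\<And>s y. R2 \<le> \<bar>s\<bar> \<Longrightarrow> A (s, y) - B (s, y) = 0"
    using s(1) slab_supp_diff[OF s(2,3)] unfolding slab_supp_def by metis
  have "(\<integral>s. A (s, y) - B (s, y) \<partial>lborel) = 0" for y
  proof (rule integral_deriv_compact_support[of "\<lambda>s. F (s, y)" _ "max R1 R2"])
    show "continuous_on UNIV (\<lambda>s. A (s, y) - B (s, y))"
      by (rule continuous_on_compose2[OF cAB]) (auto intro!: continuous_intros)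
  qed (use R12 d in auto)
  then have "(\<integral>x. A x - B x \<partial>mu) = 0"
    using integral_mu_snd[OF Bochner_Integration.integrable_diff[OF iA iB]] by simp
  then show ?thesis using iA iB by simp
qed

lemma continuous_on_fst_comp: "continuous_on UNIV c \<Longrightarrow> continuous_on A (\<lambda>x::point. c (fst x))"
  for c :: "real \<Rightarrow> real"
  by (rule continuous_on_compose2[of UNIV c]) (auto intro!: continuous_intros)

lemma DD_slice: "DD f \<Longrightarrow> ((\<lambda>s. f (s, y)) has_real_derivative Ds f (s, y)) (at s)"
  by (rule C1_slice[OF DD_C1])

text \<open>Multiplication by P only sees the derivative of P g, up to the exact term P g f^2 / 2.
  It serves both for V with f and for L with a rotation derivative of f.\<close>

lemma potential_identity:
  fixes P P1 g g1 :: "real \<Rightarrow> real"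
  assumes P: "\<And>s. (P has_real_derivative P1 s) (at s)" and P1: "continuous_on UNIV P1"
    and g: "\<And>s. (g has_real_derivative g1 s) (at s)" and g1: "continuous_on UNIV g1"
    and f: "DD f"
  shows "(\<integral>x. P (fst x) * (f x * (g (fst x) * Ds f x + g1 (fst x) * f x / 2)) \<partial>mu)
    = (\<integral>x. - (P1 (fst x) * g (fst x) * (f x)\<^sup>2) / 2 \<partial>mu)"
proof (rule integral_eq_by_exact[where F = "\<lambda>x. P (fst x) * g (fst x) * (f x)\<^sup>2 / 2"])
  note c = continuous_on_fst_comp[OF deriv_continuous_on[OF P]] continuous_on_fst_comp[OF P1]
    continuous_on_fst_comp[OF deriv_continuous_on[OF g]] continuous_on_fst_comp[OF g1]
    DD_continuous[OF f] DD_continuous[OF DD_Dd[OF f]]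
  show "continuous_on UNIV (\<lambda>x. P (fst x) * (f x * (g (fst x) * Ds f x + g1 (fst x) * f x / 2)))"
    "continuous_on UNIV (\<lambda>x. - (P1 (fst x) * g (fst x) * (f x)\<^sup>2) / 2)"
    by (intro continuous_intros c; simp)+
  show "slab_supp (\<lambda>x. P (fst x) * g (fst x) * (f x)\<^sup>2 / 2)"
    "slab_supp (\<lambda>x. - (P1 (fst x) * g (fst x) * (f x)\<^sup>2) / 2)"
    "slab_supp (\<lambda>x. P (fst x) * (f x * (g (fst x) * Ds f x + g1 (fst x) * f x / 2)))"
    using DD_slab_supp[OF f] by (auto simp: slab_supp_def)
  fix s y
  show "((\<lambda>s. P (fst (s, y)) * g (fst (s, y)) * (f (s, y))\<^sup>2 / 2) has_real_derivative
      P (fst (s, y)) * (f (s, y) * (g (fst (s, y)) * Ds f (s, y) + g1 (fst (s, y)) * f (s, y) / 2))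
      - (- (P1 (fst (s, y)) * g (fst (s, y)) * (f (s, y))\<^sup>2) / 2)) (at s)"
    by (auto intro!: derivative_eq_intros P g DD_slice[OF f] simp: field_simps power2_eq_square)
qed

text \<open>The exact derivative of b f^2 is added to a (f')^2 + e f^2 to give a nonnegative
  quadratic form in (f', f). Stating the condition through e instead of b^2 / a avoids division by
  a.\<close>

lemma hardy_identity:
  fixes b b1 a e :: "real \<Rightarrow> real"
  assumes b: "\<And>s. (b has_real_derivative b1 s) (at s)" and b1: "continuous_on UNIV b1"
    and a: "continuous_on UNIV a" and e: "continuous_on UNIV e"
    and quad: "\<And>s x y. a s * x\<^sup>2 + 2 * b s * x * y + e s * y\<^sup>2 \<ge> 0" and f: "DD f"
  shows "0 \<le> (\<integral>x. a (fst x) * (Ds f x)\<^sup>2 - (b1 (fst x) - e (fst x)) * (f x)\<^sup>2 \<partial>mu)"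
proof -
  have "(\<integral>x. a (fst x) * (Ds f x)\<^sup>2 + 2 * b (fst x) * Ds f x * f x + e (fst x) * (f x)\<^sup>2 \<partial>mu)
      = (\<integral>x. a (fst x) * (Ds f x)\<^sup>2 - (b1 (fst x) - e (fst x)) * (f x)\<^sup>2 \<partial>mu)"
  proof (rule integral_eq_by_exact[where F = "\<lambda>x. b (fst x) * (f x)\<^sup>2"])
    note c = continuous_on_fst_comp[OF deriv_continuous_on[OF b]] continuous_on_fst_comp[OF b1]
      continuous_on_fst_comp[OF a] continuous_on_fst_comp[OF e]
      DD_continuous[OF f] DD_continuous[OF DD_Dd[OF f]]
    show "continuous_on UNIV (\<lambda>x. a (fst x) * (Ds f x)\<^sup>2 + 2 * b (fst x) * Ds f x * f x + e (fst x) * (f x)\<^sup>2)"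
      "continuous_on UNIV (\<lambda>x. a (fst x) * (Ds f x)\<^sup>2 - (b1 (fst x) - e (fst x)) * (f x)\<^sup>2)"
      by (intro continuous_intros c; simp)+
    show "slab_supp (\<lambda>x. b (fst x) * (f x)\<^sup>2)"
      "slab_supp (\<lambda>x. a (fst x) * (Ds f x)\<^sup>2 + 2 * b (fst x) * Ds f x * f x + e (fst x) * (f x)\<^sup>2)"
      "slab_supp (\<lambda>x. a (fst x) * (Ds f x)\<^sup>2 - (b1 (fst x) - e (fst x)) * (f x)\<^sup>2)"
      by (intro slab_supp_intros DD_slab_supp f DD_Dd)+
    fix s y
    show "((\<lambda>s. b (fst (s, y)) * (f (s, y))\<^sup>2) has_real_derivative
      a (fst (s, y)) * (Ds f (s, y))\<^sup>2 + 2 * b (fst (s, y)) * Ds f (s, y) * f (s, y) + e (fst (s, y)) * (f (s, y))\<^sup>2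
      - (a (fst (s, y)) * (Ds f (s, y))\<^sup>2 - (b1 (fst (s, y)) - e (fst (s, y))) * (f (s, y))\<^sup>2)) (at s)"
      by (auto intro!: derivative_eq_intros b DD_slice[OF f] simp: field_simps power2_eq_square)
  qed
  moreover have "0 \<le> (\<integral>x. a (fst x) * (Ds f x)\<^sup>2 + 2 * b (fst x) * Ds f x * f x + e (fst x) * (f x)\<^sup>2 \<partial>mu)"
    using quad by (intro integral_nonneg_AE AE_I2) auto
  ultimately show ?thesis by simp
qed

text \<open>\<open>b\<close> and \<open>e\<close> are Hardy weights relative to \<open>g1\<close>
  (assumption \<open>quad\<close>), and the left side of \<open>lower\<close> is the zeroth order
  coefficient after that Hardy step. \<open>c\<close> is a second Hardy weight, relative to 1, for
  bounding \<open>Gm\<close>. \<open>wt\<close> and \<open>wn\<close> are the weights of the two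
  integrals to be estimated. A single K serves for all upper bounds.\<close>

locale morawetz_op = wave_op V L for V L :: "real \<Rightarrow> real" +
  fixes V1 g g1 g2 g3 b b1 e c c1 wt wn :: "real \<Rightarrow> real" and K :: real
  assumes dV: "(V has_real_derivative V1 s) (at s)" and V1_cont: "continuous_on UNIV V1"
    and dg: "(g has_real_derivative g1 s) (at s)" and dg1: "(g1 has_real_derivative g2 s) (at s)"
    and dg2: "(g2 has_real_derivative g3 s) (at s)" and g3_cont: "continuous_on UNIV g3"
    and db: "(b has_real_derivative b1 s) (at s)" and b1_cont: "continuous_on UNIV b1"
    and dc: "(c has_real_derivative c1 s) (at s)" and c1_cont: "continuous_on UNIV c1"
    and e_cont: "continuous_on UNIV e"
    and quad: "g1 s * x\<^sup>2 + 2 * b s * x * y + e s * y\<^sup>2 \<ge> 0"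
    and wt_cont: "continuous_on UNIV wt" and wt_nonneg: "wt s \<ge> 0"
    and wn_cont: "continuous_on UNIV wn" and wn_nonneg: "wn s \<ge> 0"
    and lower: "b1 s - e s - g3 s / 4 - V1 s * g s / 2 \<ge> wt s"
    and trapping: "deriv L s * g s \<le> 0"
    and K_nonneg: "K \<ge> 0" and g_bound: "(g s)\<^sup>2 \<le> K" and g1_bound: "(g1 s)\<^sup>2 \<le> K * (c1 s - (c s)\<^sup>2 + V s)"
    and L2_bound: "\<bar>deriv (deriv L) s\<bar> \<le> K * L s"
    and L_bound: "L s \<le> K"
    and V_bound: "V s \<le> K" and g1_sq: "(g1 s)\<^sup>2 \<le> K" and wt_bound: "wt s \<le> K"
    and wn_bound: "wn s \<le> K" and L_pos: "L s > 0"
    and nonlinear: "L s * g1 s - deriv L s * g s \<ge> wn s"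
begin

definition Gm :: "(point \<Rightarrow> real) \<Rightarrow> point \<Rightarrow> real" where
  "Gm f x = g (fst x) * Ds f x + g1 (fst x) * f x / 2"

definition form :: "(point \<Rightarrow> real) \<Rightarrow> real" where
  "form f = (\<integral>x. Hop f x * f x \<partial>mu)"

lemma g_cont: "continuous_on UNIV g" by (rule deriv_continuous_on[OF dg])
lemma g1_cont: "continuous_on UNIV g1" by (rule deriv_continuous_on[OF dg1])
lemma g2_cont: "continuous_on UNIV g2" by (rule deriv_continuous_on[OF dg2])
lemma c_cont: "continuous_on UNIV c" by (rule deriv_continuous_on[OF dc])
lemma dL: "(L has_real_derivative deriv L s) (at s)" by (rule smooth1_has_deriv[OF L_smooth])
lemma dL1: "(deriv L has_real_derivative deriv (deriv L) s) (at s)"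
  by (rule smooth1_has_deriv[OF smooth1_deriv[OF L_smooth]])
lemma L1_cont: "continuous_on UNIV (deriv L)" by (rule deriv_continuous_on[OF dL1])
lemma L2_cont: "continuous_on UNIV (deriv (deriv L))"
  by (rule smooth1_continuous[OF smooth1_deriv[OF smooth1_deriv[OF L_smooth]]])

lemmas coef_cont = V_cont L_cont[of UNIV] V1_cont g_cont g1_cont g2_cont g3_cont b1_cont c1_cont c_cont
  e_cont wt_cont wn_cont L1_cont L2_cont
lemmas coef_fst_cont = coef_cont[THEN continuous_on_fst_comp]

lemma Gm_continuous: "DD f \<Longrightarrow> continuous_on A (Gm f)"
  unfolding Gm_def[abs_def]
  by (intro continuous_on_add continuous_on_mult continuous_on_divide coef_fst_cont DD_continuous DD_Dd
      continuous_on_const) auto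

lemma Gm_slab_supp: "DD f \<Longrightarrow> slab_supp (Gm f)"
  using DD_slab_supp[of f] DD_slab_supp[OF DD_Dd, of f "(1, 0)"]
    slab_supp_add[OF slab_supp_mult2[of "Ds f" "\<lambda>x. g (fst x)"] slab_supp_mult2[of f "\<lambda>x. g1 (fst x) / 2"]]
  by (simp add: Gm_def[abs_def])

lemma Gm_sq_int: "DD f \<Longrightarrow> sq_int (Gm f)"
  by (intro sq_int_slab_supp Gm_continuous Gm_slab_supp)

lemma C1_g_fst: "C1 (\<lambda>x. g (fst x))" and C1_g1_fst: "C1 (\<lambda>x. g1 (fst x))" and C1_V_fst: "C1 (\<lambda>x. V (fst x))"
  by (rule C1_fst[OF dg g1_cont] C1_fst[OF dg1 g2_cont] C1_fst[OF dV V1_cont])+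

lemma Gm_alt: "Gm f = (\<lambda>x. g (fst x) * Ds f x + g1 (fst x) * (1 / 2 * f x))"
  by (auto simp: Gm_def)

lemma Gm_C1: "DD f \<Longrightarrow> C1 (Gm f)"
  unfolding Gm_alt by (intro C1_add C1_mult C1_g_fst C1_g1_fst DD_C1 DD_Dd DD_scale)

lemma Xe_Gm:
  assumes f: "DD f"
  shows "Xe r (Gm f) x = Gm (Xe r f) x"
proof -
  have h: "Xe r (\<lambda>x. 1 / 2 * f x) x = 1 / 2 * Xe r f x"
    using Xe_mult[OF C1_const[of "1/2"] DD_C1[OF f], of r x] Xe_eq[OF has_derivative_const, of r "1/2" x]
    by simp
  have "Xe r (Gm f) x = Xe r (\<lambda>x. g (fst x) * Ds f x) x + Xe r (\<lambda>x. g1 (fst x) * (1 / 2 * f x)) x"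
    unfolding Gm_alt by (intro Xe_add C1_mult C1_g_fst C1_g1_fst DD_C1[OF DD_Dd[OF f]] DD_C1[OF DD_scale[OF f]])
  also have "Xe r (\<lambda>x. g (fst x) * Ds f x) x = g (fst x) * Ds (Xe r f) x"
    using Xe_mult[OF C1_g_fst DD_C1[OF DD_Dd[OF f]]] Xe_fst[OF dg] DD_Xe_Ds[OF f] by simp
  also have "Xe r (\<lambda>x. g1 (fst x) * (1 / 2 * f x)) x = g1 (fst x) * (1 / 2 * Xe r f x)"
    using Xe_mult[OF C1_g1_fst DD_C1[OF DD_scale[OF f, of "1/2"]]] Xe_fst[OF dg1] h by simp
  finally show ?thesis unfolding Gm_def[of "Xe r f" x] by simp
qed

lemma form_eq:
  assumes f: "DD f"
  shows "form f = (\<integral>x. (Ds f x)\<^sup>2 \<partial>mu) + (\<integral>x. V (fst x) * (f x)\<^sup>2 \<partial>mu)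
    + (\<Sum>r\<in>Basis. \<integral>x. L (fst x) * (Xe r f x)\<^sup>2 \<partial>mu)"
proof -
  have i: "integrable mu (\<lambda>x. (Ds f x)\<^sup>2)" "integrable mu (\<lambda>x. V (fst x) * (f x)\<^sup>2)"
    "integrable mu (\<lambda>x. L (fst x) * (Xe r f x)\<^sup>2)" for r
    by (intro integrable_mu_slab_supp continuous_on_mult continuous_on_power coef_fst_cont DD_continuous
        DD_Dd DD_Xe f slab_supp_mult2 slab_supp_power DD_slab_supp)+
  show ?thesis
    unfolding form_def Hop_form[OF f DD_C1[OF f]]
    using i by (simp add: sum_distrib_left flip: power2_eq_square)
qed

lemma form_parts_nonneg: "(\<integral>x. (Ds f x)\<^sup>2 \<partial>mu) \<ge> 0" "(\<integral>x. V (fst x) * (f x)\<^sup>2 \<partial>mu) \<ge> 0"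
  "(\<integral>x. L (fst x) * (Xe r f x)\<^sup>2 \<partial>mu) \<ge> 0"
  using V_nonneg L_nonneg by (auto intro!: integral_nonneg_AE AE_I2)

lemma Ds_le_form: "DD f \<Longrightarrow> (\<integral>x. (Ds f x)\<^sup>2 \<partial>mu) \<le> form f"
  unfolding form_eq by (simp add: form_parts_nonneg sum_nonneg add_nonneg_nonneg)

lemma Ds_V_le_form: "DD f \<Longrightarrow> (\<integral>x. (Ds f x)\<^sup>2 \<partial>mu) + (\<integral>x. V (fst x) * (f x)\<^sup>2 \<partial>mu) \<le> form f"
  unfolding form_eq by (simp add: form_parts_nonneg sum_nonneg)

lemma L_Xe_le_form: "DD f \<Longrightarrow> (\<Sum>r\<in>Basis. \<integral>x. L (fst x) * (Xe r f x)\<^sup>2 \<partial>mu) \<le> form f"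
  unfolding form_eq by (simp add: form_parts_nonneg)

lemma radial_identity:
  assumes f: "DD f"
  shows "(\<integral>x. - Ds (Ds f) x * Gm f x \<partial>mu)
    = (\<integral>x. g1 (fst x) * (Ds f x)\<^sup>2 - g3 (fst x) / 4 * (f x)\<^sup>2 \<partial>mu)"
proof (rule integral_eq_by_exact[where F = "\<lambda>x. - (g (fst x) * (Ds f x)\<^sup>2 / 2
    + g1 (fst x) * f x * Ds f x / 2 - g2 (fst x) * (f x)\<^sup>2 / 4)"])
  note cs = coef_fst_cont DD_continuous[OF f] DD_continuous[OF DD_Dd[OF f]]
    DD_continuous[OF DD_Dd[OF DD_Dd[OF f]]] Gm_continuous[OF f]
  show "continuous_on UNIV (\<lambda>x. - Ds (Ds f) x * Gm f x)"
    "continuous_on UNIV (\<lambda>x. g1 (fst x) * (Ds f x)\<^sup>2 - g3 (fst x) / 4 * (f x)\<^sup>2)"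
    by (intro continuous_on_mult continuous_on_diff continuous_on_minus continuous_on_power
        continuous_on_divide continuous_on_const cs; simp)+
  show "slab_supp (\<lambda>x. - (g (fst x) * (Ds f x)\<^sup>2 / 2 + g1 (fst x) * f x * Ds f x / 2 - g2 (fst x) * (f x)\<^sup>2 / 4))"
    unfolding divide_inverse by (intro slab_supp_intros DD_slab_supp f DD_Dd)+
  show "slab_supp (\<lambda>x. - Ds (Ds f) x * Gm f x)"
    "slab_supp (\<lambda>x. g1 (fst x) * (Ds f x)\<^sup>2 - g3 (fst x) / 4 * (f x)\<^sup>2)"
    by (intro slab_supp_intros DD_slab_supp f DD_Dd)+
  fix s y
  show "((\<lambda>s. - (g (fst (s, y)) * (Ds f (s, y))\<^sup>2 / 2 + g1 (fst (s, y)) * f (s, y) * Ds f (s, y) / 2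
      - g2 (fst (s, y)) * (f (s, y))\<^sup>2 / 4)) has_real_derivative
      - Ds (Ds f) (s, y) * Gm f (s, y)
      - (g1 (fst (s, y)) * (Ds f (s, y))\<^sup>2 - g3 (fst (s, y)) / 4 * (f (s, y))\<^sup>2)) (at s)"
    by (auto intro!: derivative_eq_intros dg dg1 dg2 DD_slice f DD_Dd
        simp: Gm_def field_simps power2_eq_square)
qed

text \<open>The rotations commute with \<open>Gm\<close>, so the angular part is the potential
  identity for L and the rotation derivatives of f; its sign is decided by \<open>trapping\<close>
  and it may be dropped.\<close>

lemma morawetz_lower:
  assumes f: "DD f"
  shows "(\<integral>x. wt (fst x) * (f x)\<^sup>2 \<partial>mu) \<le> (\<integral>x. Hop f x * Gm f x \<partial>mu)"
proof -
  note cs = coef_fst_cont DD_continuous[OF f] DD_continuous[OF DD_Dd[OF f]]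
    DD_continuous[OF DD_Dd[OF DD_Dd[OF f]]] Gm_continuous[OF f]
  note ii = integrable_mu_slab_supp continuous_on_mult continuous_on_diff continuous_on_minus
    continuous_on_power continuous_on_divide continuous_on_const cs
  have i1: "integrable mu (\<lambda>x. - Ds (Ds f) x * Gm f x)"
    by (intro ii slab_supp_intros DD_slab_supp f DD_Dd)
  have i2: "integrable mu (\<lambda>x. V (fst x) * (f x * Gm f x))"
    by (intro ii slab_supp_intros DD_slab_supp f DD_Dd)
  have i3: "integrable mu (\<lambda>x. L (fst x) * (Xe r (Xe r f) x * Gm f x))" for r
    by (intro ii DD_continuous DD_Xe slab_supp_intros DD_slab_supp f DD_Dd)
  have "(\<integral>x. Hop f x * Gm f x \<partial>mu) = (\<integral>x. - Ds (Ds f) x * Gm f x + V (fst x) * (f x * Gm f x)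
      - (\<Sum>r\<in>Basis. L (fst x) * (Xe r (Xe r f) x * Gm f x)) \<partial>mu)"
    by (rule Bochner_Integration.integral_cong)
      (simp_all add: Hop_def lapX_def algebra_simps sum_distrib_left sum_distrib_right)
  also have "\<dots> = (\<integral>x. - Ds (Ds f) x * Gm f x \<partial>mu) + (\<integral>x. V (fst x) * (f x * Gm f x) \<partial>mu)
      - (\<Sum>r\<in>Basis. \<integral>x. L (fst x) * (Xe r (Xe r f) x * Gm f x) \<partial>mu)"
    using i1 i2 i3 by simp
  also have "(\<Sum>r\<in>Basis. \<integral>x. L (fst x) * (Xe r (Xe r f) x * Gm f x) \<partial>mu)
      = (\<Sum>r\<in>Basis. \<integral>x. deriv L (fst x) * g (fst x) * (Xe r f x)\<^sup>2 / 2 \<partial>mu)"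
  proof (rule sum.cong[OF refl])
    fix r :: "real^3" assume r: "r \<in> Basis"
    have "(\<integral>x. L (fst x) * (Xe r (Xe r f) x * Gm f x) \<partial>mu) = - (\<integral>x. L (fst x) * (Xe r f x * Xe r (Gm f) x) \<partial>mu)"
      using r by (intro integral_Xe_by_parts)
        (auto intro: DD_C1 DD_Xe f Gm_C1 DD_slab_supp L_cont)
    also have "(\<integral>x. L (fst x) * (Xe r f x * Xe r (Gm f) x) \<partial>mu)
        = (\<integral>x. - (deriv L (fst x) * g (fst x) * (Xe r f x)\<^sup>2) / 2 \<partial>mu)"
      unfolding Xe_Gm[OF f] unfolding Gm_def
      by (rule potential_identity[OF dL L1_cont dg g1_cont DD_Xe[OF f]])
    finally show "(\<integral>x. L (fst x) * (Xe r (Xe r f) x * Gm f x) \<partial>mu)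
        = (\<integral>x. deriv L (fst x) * g (fst x) * (Xe r f x)\<^sup>2 / 2 \<partial>mu)" by simp
  qed
  also have "(\<integral>x. V (fst x) * (f x * Gm f x) \<partial>mu) = (\<integral>x. - (V1 (fst x) * g (fst x) * (f x)\<^sup>2) / 2 \<partial>mu)"
    unfolding Gm_def by (rule potential_identity[OF dV V1_cont dg g1_cont f])
  also note radial_identity[OF f]
  finally have eq: "(\<integral>x. Hop f x * Gm f x \<partial>mu)
      = (\<integral>x. g1 (fst x) * (Ds f x)\<^sup>2 - g3 (fst x) / 4 * (f x)\<^sup>2 \<partial>mu)
        + (\<integral>x. - (V1 (fst x) * g (fst x) * (f x)\<^sup>2) / 2 \<partial>mu)
        - (\<Sum>r\<in>Basis. \<integral>x. deriv L (fst x) * g (fst x) * (Xe r f x)\<^sup>2 / 2 \<partial>mu)" .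
  have n3: "(\<integral>x. deriv L (fst x) * g (fst x) * (Xe r f x)\<^sup>2 / 2 \<partial>mu) \<le> 0" for r
  proof -
    have "0 \<le> (\<integral>x. - (deriv L (fst x) * g (fst x)) * (Xe r f x)\<^sup>2 / 2 \<partial>mu)"
    proof (rule integral_nonneg_AE, rule AE_I2)
      fix x :: point
      have "0 \<le> - (deriv L (fst x) * g (fst x))" using trapping[of "fst x"] by simp
      then show "0 \<le> - (deriv L (fst x) * g (fst x)) * (Xe r f x)\<^sup>2 / 2"
        by (intro divide_nonneg_pos mult_nonneg_nonneg) auto
    qed
    then show ?thesis by simp
  qed
  have "(\<Sum>r\<in>Basis. \<integral>x. deriv L (fst x) * g (fst x) * (Xe r f x)\<^sup>2 / 2 \<partial>mu) \<le> 0"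
    by (rule sum_nonpos[OF n3])
  \<comment> \<open>The whole radial term g' (f')^2 is traded for a zeroth order term here;
    \<open>lower\<close> then has to hold without any help from derivatives.\<close>
  have hd: "0 \<le> (\<integral>x. g1 (fst x) * (Ds f x)\<^sup>2 - (b1 (fst x) - e (fst x)) * (f x)\<^sup>2 \<partial>mu)"
    by (rule hardy_identity[OF db b1_cont g1_cont e_cont quad f])
  have j: "integrable mu (\<lambda>x. g1 (fst x) * (Ds f x)\<^sup>2)" "integrable mu (\<lambda>x. g3 (fst x) / 4 * (f x)\<^sup>2)"
    "integrable mu (\<lambda>x. - (V1 (fst x) * g (fst x) * (f x)\<^sup>2) / 2)"
    "integrable mu (\<lambda>x. (b1 (fst x) - e (fst x)) * (f x)\<^sup>2)" "integrable mu (\<lambda>x. wt (fst x) * (f x)\<^sup>2)"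
    unfolding divide_inverse minus_mult_left by (intro ii slab_supp_intros DD_slab_supp f DD_Dd; simp)+
  have "(\<integral>x. wt (fst x) * (f x)\<^sup>2 \<partial>mu) \<le> (\<integral>x. (b1 (fst x) - e (fst x)) * (f x)\<^sup>2
      - g3 (fst x) / 4 * (f x)\<^sup>2 + - (V1 (fst x) * g (fst x) * (f x)\<^sup>2) / 2 \<partial>mu)"
  proof (rule integral_mono)
    fix x :: point
    have "wt (fst x) * (f x)\<^sup>2 \<le> (b1 (fst x) - e (fst x) - g3 (fst x) / 4 - V1 (fst x) * g (fst x) / 2) * (f x)\<^sup>2"
      by (rule mult_right_mono[OF lower]) simp
    then show "wt (fst x) * (f x)\<^sup>2 \<le> (b1 (fst x) - e (fst x)) * (f x)\<^sup>2
      - g3 (fst x) / 4 * (f x)\<^sup>2 + - (V1 (fst x) * g (fst x) * (f x)\<^sup>2) / 2"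
      by (simp add: algebra_simps)
  qed (intro Bochner_Integration.integrable_add Bochner_Integration.integrable_diff j)+
  also have "\<dots> = (\<integral>x. (b1 (fst x) - e (fst x)) * (f x)\<^sup>2 \<partial>mu) - (\<integral>x. g3 (fst x) / 4 * (f x)\<^sup>2 \<partial>mu)
      + (\<integral>x. - (V1 (fst x) * g (fst x) * (f x)\<^sup>2) / 2 \<partial>mu)"
    using j by (simp only: Bochner_Integration.integral_add Bochner_Integration.integral_diff
        Bochner_Integration.integrable_diff)
  finally show ?thesis
    unfolding eq
    using hd \<open>(\<Sum>r\<in>Basis. _ r) \<le> 0\<close> j(1,2,4) by (simp only: Bochner_Integration.integral_diff)
qed

text \<open>The term g1 f / 2 need not be controlled by V alone. The Hardy inequality with weight c,
  from the square (f' + c f)^2, supplies c' - c^2 in addition to V, as anticipated in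
  \<open>g1_bound\<close>.\<close>

lemma Gm_bound:
  assumes f: "DD f"
  shows "(\<integral>x. (Gm f x)\<^sup>2 \<partial>mu) \<le> 3 * K * form f"
proof -
  note cs = coef_fst_cont DD_continuous[OF f] DD_continuous[OF DD_Dd[OF f]] Gm_continuous[OF f]
  note ii = integrable_mu_slab_supp continuous_on_mult continuous_on_diff continuous_on_minus
    continuous_on_power continuous_on_const cs slab_supp_intros DD_slab_supp f DD_Dd Gm_slab_supp
  have i: "integrable mu (\<lambda>x. (Gm f x)\<^sup>2)" "integrable mu (\<lambda>x. (Ds f x)\<^sup>2)"
    "integrable mu (\<lambda>x. V (fst x) * (f x)\<^sup>2)" "integrable mu (\<lambda>x. (c1 (fst x) - (c (fst x))\<^sup>2) * (f x)\<^sup>2)"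
    by (intro ii)+
  have hd: "0 \<le> (\<integral>x. 1 * (Ds f x)\<^sup>2 - (c1 (fst x) - (c (fst x))\<^sup>2) * (f x)\<^sup>2 \<partial>mu)"
  proof (rule hardy_identity[OF dc c1_cont continuous_on_const[of UNIV "1::real"] _ _ f])
    show "continuous_on UNIV (\<lambda>s. (c s)\<^sup>2)" by (intro continuous_intros c_cont)
    fix s x y
    have "1 * x\<^sup>2 + 2 * c s * x * y + (c s)\<^sup>2 * y\<^sup>2 = (x + c s * y)\<^sup>2"
      by (simp add: power2_sum power_mult_distrib)
    then show "0 \<le> 1 * x\<^sup>2 + 2 * c s * x * y + (c s)\<^sup>2 * y\<^sup>2" by simp
  qed
  then have hd: "(\<integral>x. (c1 (fst x) - (c (fst x))\<^sup>2) * (f x)\<^sup>2 \<partial>mu) \<le> (\<integral>x. (Ds f x)\<^sup>2 \<partial>mu)"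
    using i by simp
  have "(\<integral>x. (Gm f x)\<^sup>2 \<partial>mu) \<le> (\<integral>x. 2 * K * (Ds f x)\<^sup>2 + K / 2 * ((c1 (fst x) - (c (fst x))\<^sup>2) * (f x)\<^sup>2)
      + K / 2 * (V (fst x) * (f x)\<^sup>2) \<partial>mu)"
  proof (rule integral_mono)
    fix x :: point
    let ?a = "g (fst x) * Ds f x" and ?b = "g1 (fst x) * f x / 2"
    have "(?a + ?b)\<^sup>2 \<le> 2 * ?a\<^sup>2 + 2 * ?b\<^sup>2"
      using sum_squares_bound[of ?a ?b] by (simp add: power2_sum)
    also have "\<dots> = 2 * ((g (fst x))\<^sup>2 * (Ds f x)\<^sup>2) + (g1 (fst x))\<^sup>2 * (f x)\<^sup>2 / 2"
      by (simp add: power_mult_distrib power_divide)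
    also have "\<dots> \<le> 2 * (K * (Ds f x)\<^sup>2) + K * (c1 (fst x) - (c (fst x))\<^sup>2 + V (fst x)) * (f x)\<^sup>2 / 2"
      by (intro add_mono mult_left_mono divide_right_mono mult_right_mono g_bound g1_bound) auto
    finally show "(Gm f x)\<^sup>2 \<le> 2 * K * (Ds f x)\<^sup>2 + K / 2 * ((c1 (fst x) - (c (fst x))\<^sup>2) * (f x)\<^sup>2)
      + K / 2 * (V (fst x) * (f x)\<^sup>2)"
      by (simp add: Gm_def algebra_simps add_divide_distrib diff_divide_distrib)
  qed (intro Bochner_Integration.integrable_add integrable_mult_right i)+
  also have "\<dots> = 2 * K * (\<integral>x. (Ds f x)\<^sup>2 \<partial>mu) + K / 2 * (\<integral>x. (c1 (fst x) - (c (fst x))\<^sup>2) * (f x)\<^sup>2 \<partial>mu)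
      + K / 2 * (\<integral>x. V (fst x) * (f x)\<^sup>2 \<partial>mu)"
    using i by simp
  also have "\<dots> \<le> 2 * K * (\<integral>x. (Ds f x)\<^sup>2 \<partial>mu) + K / 2 * (\<integral>x. (Ds f x)\<^sup>2 \<partial>mu)
      + K / 2 * (\<integral>x. V (fst x) * (f x)\<^sup>2 \<partial>mu)"
    using mult_left_mono[OF hd, of "K / 2"] K_nonneg by simp
  also have "\<dots> \<le> 3 * K * ((\<integral>x. (Ds f x)\<^sup>2 \<partial>mu) + (\<integral>x. V (fst x) * (f x)\<^sup>2 \<partial>mu))"
    using mult_nonneg_nonneg[OF K_nonneg form_parts_nonneg(1)[of f]]
      mult_nonneg_nonneg[OF K_nonneg form_parts_nonneg(2)[of f]] by (simp add: algebra_simps)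
  also have "\<dots> \<le> 3 * K * form f"
    using Ds_V_le_form[OF f] K_nonneg by (intro mult_left_mono) auto
  finally show ?thesis .
qed

lemma Gm_antisymmetric:
  assumes f: "DD f" and k: "DD k"
  shows "(\<integral>x. Gm f x * k x \<partial>mu) = - (\<integral>x. f x * Gm k x \<partial>mu)"
proof -
  note ii = integrable_mu_slab_supp continuous_on_mult continuous_on_minus Gm_continuous DD_continuous
    slab_supp_intros DD_slab_supp f k
  have "(\<integral>x. Gm f x * k x \<partial>mu) = (\<integral>x. - (f x * Gm k x) \<partial>mu)"
  proof (rule integral_eq_by_exact[where F = "\<lambda>x. g (fst x) * f x * k x"])
    show "slab_supp (\<lambda>x. g (fst x) * f x * k x)" by (intro slab_supp_intros DD_slab_supp f)
    fix s y
    show "((\<lambda>s. g (fst (s, y)) * f (s, y) * k (s, y)) has_real_derivative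
        Gm f (s, y) * k (s, y) - (- (f (s, y) * Gm k (s, y)))) (at s)"
      by (auto intro!: derivative_eq_intros dg DD_slice f k simp: Gm_def field_simps)
  qed (intro ii)+
  then show ?thesis by simp
qed

text \<open>With Hop = B minus the angular part, the square of the angular part is that of Hop minus
  B^2 plus twice the mixed term. Integrating the mixed term by parts leaves only L'' / 2 with an
  unfavourable sign, and L'' is dominated by L. Consequently the angular part of H converges on its
  own along the core.\<close>

lemma angular_bound:
  assumes f: "DD f"
  shows "(\<integral>x. (L (fst x) * lapX f x)\<^sup>2 \<partial>mu) \<le> (\<integral>x. (Hop f x)\<^sup>2 \<partial>mu) + K * form f"
proof -
  define B where "B x = - Ds (Ds f) x + V (fst x) * f x" for x
  have BC: "C1 B"
  proof -
    have "B = (\<lambda>x. (-1) * Ds (Ds f) x + V (fst x) * f x)" by (simp add: B_def fun_eq_iff)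
    then show ?thesis
      by (simp only: C1_add[OF DD_C1[OF DD_scale[OF DD_Dd[OF DD_Dd[OF f]]]] C1_mult[OF C1_V_fst DD_C1[OF f]]])
  qed
  have Bs: "slab_supp B" unfolding B_def[abs_def] by (intro slab_supp_intros DD_slab_supp DD_Dd f)
  have XB: "Xe r B x = - Ds (Ds (Xe r f)) x + V (fst x) * Xe r f x" for r x
  proof -
    have e: "B = (\<lambda>x. (-1) * Ds (Ds f) x + V (fst x) * f x)" by (simp add: B_def fun_eq_iff)
    have "Xe r B x = Xe r (\<lambda>x. (-1) * Ds (Ds f) x) x + Xe r (\<lambda>x. V (fst x) * f x) x"
      unfolding e
      by (rule Xe_add[OF DD_C1[OF DD_scale[OF DD_Dd[OF DD_Dd[OF f]]]] C1_mult[OF C1_V_fst DD_C1[OF f]]])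
    also have "Xe r (\<lambda>x. (-1) * Ds (Ds f) x) x = - Xe r (Ds (Ds f)) x"
    proof -
      have "Xe r (\<lambda>x. - 1) z = 0" for z
        using Xe_eq[OF has_derivative_const, of r "-1" z] by simp
      then show ?thesis
        using Xe_mult[OF C1_const[of "-1"] DD_C1[OF DD_Dd[OF DD_Dd[OF f]]]] by simp
    qed
    also have "Xe r (Ds (Ds f)) x = Ds (Ds (Xe r f)) x"
    proof -
      have "Xe r (Ds f) = Ds (Xe r f)" using DD_Xe_Ds[OF f] by blast
      then show ?thesis using DD_Xe_Ds[OF DD_Dd[OF f]] by simp
    qed
    also have "Xe r (\<lambda>x. V (fst x) * f x) x = V (fst x) * Xe r f x"
      using Xe_mult[OF C1_V_fst DD_C1[OF f]] Xe_fst[OF dV] by simp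
    finally show ?thesis .
  qed
  have cross: "(\<integral>x. L (fst x) * (B x * Xe r (Xe r f) x) \<partial>mu) \<le> K / 2 * (\<integral>x. L (fst x) * (Xe r f x)\<^sup>2 \<partial>mu)"
    if r: "r \<in> Basis" for r
  proof -
    let ?h = "Xe r f"
    have h: "DD ?h" by (rule DD_Xe[OF f])
    note ii = continuous_on_mult continuous_on_minus continuous_on_add continuous_on_diff
      continuous_on_power continuous_on_const coef_fst_cont DD_continuous[OF h] DD_continuous[OF DD_Dd[OF h]]
      DD_continuous[OF DD_Dd[OF DD_Dd[OF h]]]
    have "(\<integral>x. L (fst x) * (Xe r B x * ?h x) \<partial>mu) = - (\<integral>x. L (fst x) * (B x * Xe r ?h x) \<partial>mu)"
      using r by (intro integral_Xe_by_parts) (auto intro: BC DD_C1 h Bs L_cont)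
    then have "(\<integral>x. L (fst x) * (B x * Xe r ?h x) \<partial>mu) = (\<integral>x. - (L (fst x) * (Xe r B x * ?h x)) \<partial>mu)"
      by simp
    also have "\<dots> = (\<integral>x. L (fst x) * (Ds (Ds ?h) x * ?h x) - L (fst x) * V (fst x) * (?h x)\<^sup>2 \<partial>mu)"
      unfolding XB by (rule Bochner_Integration.integral_cong) (simp_all add: algebra_simps power2_eq_square)
    also have "\<dots> = (\<integral>x. (1/2) * deriv (deriv L) (fst x) * (?h x)\<^sup>2 - L (fst x) * (Ds ?h x)\<^sup>2
        - L (fst x) * V (fst x) * (?h x)\<^sup>2 \<partial>mu)"
    proof (rule integral_eq_by_exact[where F = "\<lambda>x. L (fst x) * ?h x * Ds ?h x - (1/2) * deriv L (fst x) * (?h x)\<^sup>2"])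
      fix s y
      show "((\<lambda>s. L (fst (s, y)) * ?h (s, y) * Ds ?h (s, y) - (1/2) * deriv L (fst (s, y)) * (?h (s, y))\<^sup>2)
        has_real_derivative L (fst (s, y)) * (Ds (Ds ?h) (s, y) * ?h (s, y)) - L (fst (s, y)) * V (fst (s, y)) * (?h (s, y))\<^sup>2
        - ((1/2) * deriv (deriv L) (fst (s, y)) * (?h (s, y))\<^sup>2 - L (fst (s, y)) * (Ds ?h (s, y))\<^sup>2
        - L (fst (s, y)) * V (fst (s, y)) * (?h (s, y))\<^sup>2)) (at s)"
        by (auto intro!: derivative_eq_intros dL dL1 DD_slice h DD_Dd simp: field_simps power2_eq_square)
    qed (intro ii slab_supp_intros DD_slab_supp DD_Dd h)+
    also have "\<dots> \<le> (\<integral>x. K / 2 * (L (fst x) * (?h x)\<^sup>2) \<partial>mu)"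
    proof (rule integral_mono)
      show "integrable mu (\<lambda>x. (1/2) * deriv (deriv L) (fst x) * (?h x)\<^sup>2 - L (fst x) * (Ds ?h x)\<^sup>2
        - L (fst x) * V (fst x) * (?h x)\<^sup>2)"
        by (intro integrable_mu_slab_supp ii slab_supp_intros DD_slab_supp DD_Dd h)
      show "integrable mu (\<lambda>x. K / 2 * (L (fst x) * (?h x)\<^sup>2))"
        by (intro integrable_mu_slab_supp ii slab_supp_intros DD_slab_supp DD_Dd h)
      fix x :: point
      have "deriv (deriv L) (fst x) * (?h x)\<^sup>2 \<le> K * L (fst x) * (?h x)\<^sup>2"
        using L2_bound[of "fst x"] by (intro mult_right_mono) auto
      moreover have "0 \<le> L (fst x) * (Ds ?h x)\<^sup>2" "0 \<le> L (fst x) * V (fst x) * (?h x)\<^sup>2"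
        using L_nonneg V_nonneg by simp_all
      ultimately show "(1/2) * deriv (deriv L) (fst x) * (?h x)\<^sup>2 - L (fst x) * (Ds ?h x)\<^sup>2
        - L (fst x) * V (fst x) * (?h x)\<^sup>2 \<le> K / 2 * (L (fst x) * (?h x)\<^sup>2)" by simp
    qed
    also have "\<dots> = K / 2 * (\<integral>x. L (fst x) * (?h x)\<^sup>2 \<partial>mu)" by simp
    finally show ?thesis .
  qed
  have Bc: "continuous_on UNIV B" by (rule C1_continuous[OF BC])
  have i: "integrable mu (\<lambda>x. (B x)\<^sup>2)" "integrable mu (\<lambda>x. (Hop f x)\<^sup>2)"
    "integrable mu (\<lambda>x. L (fst x) * (B x * Xe r (Xe r f) x))" for r
    by (intro integrable_mu_slab_supp continuous_on_mult continuous_on_power Bc Hop_continuous f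
        slab_supp_intros Bs Hop_slab_supp coef_fst_cont DD_continuous DD_Xe)+
  have "(\<integral>x. (L (fst x) * lapX f x)\<^sup>2 \<partial>mu) = (\<integral>x. (Hop f x)\<^sup>2 - (B x)\<^sup>2
      + 2 * (\<Sum>r\<in>Basis. L (fst x) * (B x * Xe r (Xe r f) x)) \<partial>mu)"
  proof (rule Bochner_Integration.integral_cong[OF refl])
    fix x
    have e: "(\<Sum>r\<in>Basis. L (fst x) * (B x * Xe r (Xe r f) x)) = L (fst x) * B x * lapX f x"
      by (simp add: lapX_def sum_distrib_left mult.assoc)
    have h: "Hop f x = B x - L (fst x) * lapX f x" by (simp add: Hop_def B_def)
    show "(L (fst x) * lapX f x)\<^sup>2 = (Hop f x)\<^sup>2 - (B x)\<^sup>2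
      + 2 * (\<Sum>r\<in>Basis. L (fst x) * (B x * Xe r (Xe r f) x))"
      unfolding e h by (simp add: power2_eq_square algebra_simps)
  qed
  also have "\<dots> = (\<integral>x. (Hop f x)\<^sup>2 \<partial>mu) - (\<integral>x. (B x)\<^sup>2 \<partial>mu)
      + 2 * (\<Sum>r\<in>Basis. \<integral>x. L (fst x) * (B x * Xe r (Xe r f) x) \<partial>mu)"
    using i by simp
  also have "\<dots> \<le> (\<integral>x. (Hop f x)\<^sup>2 \<partial>mu) - 0
      + 2 * (\<Sum>r\<in>Basis. K / 2 * (\<integral>x. L (fst x) * (Xe r f x)\<^sup>2 \<partial>mu))"
    using cross by (intro add_mono diff_mono mult_left_mono sum_mono) auto
  also have "2 * (\<Sum>r\<in>Basis. K / 2 * (\<integral>x. L (fst x) * (Xe r f x)\<^sup>2 \<partial>mu))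
      = K * (\<Sum>r\<in>Basis. \<integral>x. L (fst x) * (Xe r f x)\<^sup>2 \<partial>mu)"
    by (simp add: sum_distrib_left)
  also have "\<dots> \<le> K * form f" using L_Xe_le_form[OF f] K_nonneg by (rule mult_left_mono)
  finally show ?thesis by simp
qed

text \<open>For \<beta> z = z^4 the left side pairs the cube with \<open>Gm\<close>. The general
  \<beta> is needed because the cube is replaced by functions of linear growth before the limit
  along the core is taken.\<close>

lemma nonlinear_identity:
  fixes \<beta> \<beta>' :: "real \<Rightarrow> real"
  assumes d: "\<And>z. (\<beta> has_real_derivative \<beta>' z) (at z)" and c: "continuous_on UNIV \<beta>'"
    and z: "\<beta> 0 = 0" "\<beta>' 0 = 0" and f: "DD f"
  shows "(\<integral>x. L (fst x) * (g (fst x) * \<beta>' (f x) / 4 * Ds f x + g1 (fst x) * \<beta> (f x) / 2) \<partial>mu)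
    = (\<integral>x. (L (fst x) * g1 (fst x) - deriv L (fst x) * g (fst x)) * \<beta> (f x) / 4 \<partial>mu)"
proof (rule integral_eq_by_exact[where F = "\<lambda>x. L (fst x) * g (fst x) * \<beta> (f x) / 4"])
  have fc: "continuous_on UNIV (\<lambda>x. \<beta> (f x))" "continuous_on UNIV (\<lambda>x. \<beta>' (f x))"
    by (rule continuous_on_compose2[OF deriv_continuous_on[OF d, of UNIV] DD_continuous[OF f]]
        continuous_on_compose2[OF c DD_continuous[OF f]]; simp)+
  note ii = continuous_on_mult continuous_on_add continuous_on_diff
      continuous_on_divide continuous_on_const coef_fst_cont fc DD_continuous[OF f] DD_continuous[OF DD_Dd[OF f]]
  show "continuous_on UNIV (\<lambda>x. L (fst x) * (g (fst x) * \<beta>' (f x) / 4 * Ds f x + g1 (fst x) * \<beta> (f x) / 2))"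
    "continuous_on UNIV (\<lambda>x. (L (fst x) * g1 (fst x) - deriv L (fst x) * g (fst x)) * \<beta> (f x) / 4)"
    by (intro ii; simp)+
  show "slab_supp (\<lambda>x. L (fst x) * g (fst x) * \<beta> (f x) / 4)"
    "slab_supp (\<lambda>x. L (fst x) * (g (fst x) * \<beta>' (f x) / 4 * Ds f x + g1 (fst x) * \<beta> (f x) / 2))"
    "slab_supp (\<lambda>x. (L (fst x) * g1 (fst x) - deriv L (fst x) * g (fst x)) * \<beta> (f x) / 4)"
  proof -
    obtain R where R: "\<And>s y. R \<le> \<bar>s\<bar> \<Longrightarrow> f (s, y) = 0"
      using DD_slab_supp[OF f] by (auto simp: slab_supp_def)
    show "slab_supp (\<lambda>x. L (fst x) * g (fst x) * \<beta> (f x) / 4)"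
      "slab_supp (\<lambda>x. L (fst x) * (g (fst x) * \<beta>' (f x) / 4 * Ds f x + g1 (fst x) * \<beta> (f x) / 2))"
      "slab_supp (\<lambda>x. (L (fst x) * g1 (fst x) - deriv L (fst x) * g (fst x)) * \<beta> (f x) / 4)"
      unfolding slab_supp_def by (rule exI[of _ R]; simp add: R z)+
  qed
  fix s y
  have "((\<lambda>s. \<beta> (f (s, y))) has_real_derivative \<beta>' (f (s, y)) * Ds f (s, y)) (at s)"
    by (rule DERIV_chain2[OF d DD_slice[OF f]])
  then show "((\<lambda>s. L (fst (s, y)) * g (fst (s, y)) * \<beta> (f (s, y)) / 4) has_real_derivative
      L (fst (s, y)) * (g (fst (s, y)) * \<beta>' (f (s, y)) / 4 * Ds f (s, y) + g1 (fst (s, y)) * \<beta> (f (s, y)) / 2)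
      - (L (fst (s, y)) * g1 (fst (s, y)) - deriv L (fst (s, y)) * g (fst (s, y))) * \<beta> (f (s, y)) / 4) (at s)"
    by (auto intro!: derivative_eq_intros dL dg simp: field_simps)
qed

end

section \<open>Passage to the limit\<close>

definition bdd_coef :: "(real \<Rightarrow> real) \<Rightarrow> bool" where
  "bdd_coef m \<longleftrightarrow> m \<in> borel_measurable borel \<and> (\<exists>B. \<forall>s. \<bar>m s\<bar> \<le> B)"

definition lipschitz0 :: "real \<Rightarrow> (real \<Rightarrow> real) \<Rightarrow> bool" where
  "lipschitz0 B b \<longleftrightarrow> b 0 = 0 \<and> B \<ge> 0 \<and> (\<forall>y z. \<bar>b y - b z\<bar> \<le> B * \<bar>y - z\<bar>)"

definition mulc :: "(real \<Rightarrow> real) \<Rightarrow> l2 \<Rightarrow> l2" where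
  "mulc m u = cls (\<lambda>x. m (fst x) * rep u x)"

text \<open>The superposition (Nemytskii) operator of b; Lipschitz continuity of b with b 0 = 0
  makes it continuous on L2.\<close>

definition nem :: "(real \<Rightarrow> real) \<Rightarrow> l2 \<Rightarrow> l2" where
  "nem b u = cls (\<lambda>x. b (rep u x))"

lemma fst_measurable_point:
  fixes m :: "real \<Rightarrow> real"
  assumes [measurable]: "m \<in> borel_measurable borel"
  shows "(\<lambda>x::point. m (fst x)) \<in> borel_measurable borel"
proof -
  have "(\<lambda>x::point. m (fst x)) \<in> borel_measurable (borel \<Otimes>\<^sub>M borel)" by measurable
  then show ?thesis unfolding borel_prod .
qed

lemma sq_int_bdd_coef:
  assumes m: "bdd_coef m" and f: "sq_int f"
  shows "sq_int (\<lambda>x. m (fst x) * f x)"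
proof -
  obtain B where B: "\<And>s. \<bar>m s\<bar> \<le> B" using m by (auto simp: bdd_coef_def)
  show ?thesis
  proof (rule sq_int_bound[OF f])
    show "(\<lambda>x. m (fst x) * f x) \<in> borel_measurable borel"
      using m f by (intro borel_measurable_times fst_measurable_point sq_int_measurable) (auto simp: bdd_coef_def)
    show "\<bar>m (fst x) * f x\<bar> \<le> B * \<bar>f x\<bar>" for x
      unfolding abs_mult by (rule mult_right_mono[OF B]) simp
  qed
qed

lemma mulc_cls:
  assumes m: "bdd_coef m" and f: "sq_int f"
  shows "mulc m (cls f) = cls (\<lambda>x. m (fst x) * f x)"
  unfolding mulc_def using rep_cls[OF f]
  by (subst cls_eq_iff) (auto intro!: sq_int_bdd_coef m f rep_sq_int elim: AE_mp)

text \<open>Covers bounded multipliers and superposition operators alike, since both are pointwise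
  Lipschitz in the argument.\<close>

lemma tendsto_cls_lipschitz:
  assumes le: "\<And>n x. \<bar>F n x - F0 x\<bar> \<le> B * \<bar>f n x - f0 x\<bar>"
    and s: "\<And>n. sq_int (F n)" "sq_int F0" "\<And>n. sq_int (f n)" "sq_int f0"
    and lim: "(\<lambda>n. cls (f n)) \<longlonglongrightarrow> cls f0"
  shows "(\<lambda>n. cls (F n)) \<longlonglongrightarrow> cls F0"
proof -
  have B: "norm (cls (F n) - cls F0) \<le> \<bar>B\<bar> * norm (cls (f n) - cls f0)" for n
  proof -
    have "(norm (cls (F n) - cls F0))\<^sup>2 = (\<integral>x. (F n x - F0 x)\<^sup>2 \<partial>mu)"
      using norm_cls[OF sq_int_diff[OF s(1,2)]] by (simp add: cls_diff s)
    also have "\<dots> \<le> (\<integral>x. B\<^sup>2 * (f n x - f0 x)\<^sup>2 \<partial>mu)"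
    proof (rule integral_mono)
      show "integrable mu (\<lambda>x. (F n x - F0 x)\<^sup>2)" by (intro sq_int_integrable sq_int_diff s)
      show "integrable mu (\<lambda>x. B\<^sup>2 * (f n x - f0 x)\<^sup>2)"
        by (intro integrable_mult_right sq_int_integrable sq_int_diff s)
      fix x
      have "\<bar>F n x - F0 x\<bar>\<^sup>2 \<le> (B * \<bar>f n x - f0 x\<bar>)\<^sup>2" by (rule power_mono[OF le]) simp
      then show "(F n x - F0 x)\<^sup>2 \<le> B\<^sup>2 * (f n x - f0 x)\<^sup>2" by (simp add: power_mult_distrib)
    qed
    also have "\<dots> = B\<^sup>2 * (norm (cls (f n) - cls f0))\<^sup>2"
      using norm_cls[OF sq_int_diff[OF s(3,4)]] by (simp add: cls_diff s)
    also have "\<dots> = (\<bar>B\<bar> * norm (cls (f n) - cls f0))\<^sup>2" by (simp add: power_mult_distrib)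
    finally show ?thesis by (rule power2_le_imp_le) simp
  qed
  have "(\<lambda>n. \<bar>B\<bar> * norm (cls (f n) - cls f0)) \<longlonglongrightarrow> \<bar>B\<bar> * 0"
    by (rule tendsto_mult[OF tendsto_const tendsto_norm_zero[OF LIM_zero[OF lim]]])
  then have l: "(\<lambda>n. \<bar>B\<bar> * norm (cls (f n) - cls f0)) \<longlonglongrightarrow> 0" by simp
  have "(\<lambda>n. cls (F n) - cls F0) \<longlonglongrightarrow> 0"
    by (rule Lim_null_comparison[OF always_eventually l]) (rule allI, rule B)
  then show ?thesis by (rule LIM_zero_cancel)
qed

lemma tendsto_mulc:
  assumes m: "bdd_coef m" and f: "\<And>n. sq_int (f n)" and lim: "(\<lambda>n. cls (f n)) \<longlonglongrightarrow> u"
  shows "(\<lambda>n. cls (\<lambda>x. m (fst x) * f n x)) \<longlonglongrightarrow> mulc m u"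
proof -
  obtain B where B: "\<And>s. \<bar>m s\<bar> \<le> B" using m by (auto simp: bdd_coef_def)
  show ?thesis unfolding mulc_def
  proof (rule tendsto_cls_lipschitz[where B = B and f = f and ?f0.0 = "rep u"])
    show "\<bar>m (fst x) * f n x - m (fst x) * rep u x\<bar> \<le> B * \<bar>f n x - rep u x\<bar>" for n x
      unfolding right_diff_distrib[symmetric] abs_mult by (rule mult_right_mono[OF B]) simp
  qed (use lim in \<open>auto intro: sq_int_bdd_coef m f rep_sq_int\<close>)
qed

lemma sq_int_lipschitz0:
  assumes b: "lipschitz0 B b" and f: "sq_int f"
  shows "sq_int (\<lambda>x. b (f x))"
proof (rule sq_int_bound[OF f])
  have "continuous_on UNIV b"
  proof (rule lipschitz_on_continuous_on)
    show "B-lipschitz_on UNIV b"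
      using b by (auto simp: lipschitz0_def lipschitz_on_def dist_real_def)
  qed
  then have [measurable]: "b \<in> borel_measurable borel" by (rule borel_measurable_continuous_onI)
  show "(\<lambda>x. b (f x)) \<in> borel_measurable borel"
    using sq_int_measurable[OF f] by measurable
  have "\<bar>b z - b 0\<bar> \<le> B * \<bar>z - 0\<bar>" for z using b unfolding lipschitz0_def by blast
  then show "\<bar>b (f x)\<bar> \<le> B * \<bar>f x\<bar>" for x using b by (simp add: lipschitz0_def)
qed

lemma tendsto_nem:
  assumes b: "lipschitz0 B b" and f: "\<And>n. sq_int (f n)" and lim: "(\<lambda>n. cls (f n)) \<longlonglongrightarrow> u"
  shows "(\<lambda>n. cls (\<lambda>x. b (f n x))) \<longlonglongrightarrow> nem b u"
  unfolding nem_def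
proof (rule tendsto_cls_lipschitz[where B = B and f = f and ?f0.0 = "rep u"])
  show "\<bar>b (f n x) - b (rep u x)\<bar> \<le> B * \<bar>f n x - rep u x\<bar>" for n x
    using b unfolding lipschitz0_def by blast
qed (use lim in \<open>auto intro: sq_int_lipschitz0[OF b] f rep_sq_int\<close>)

lemma bdd_coef_mult: "bdd_coef m \<Longrightarrow> bdd_coef k \<Longrightarrow> bdd_coef (\<lambda>s. m s * k s)"
proof -
  assume m: "bdd_coef m" and k: "bdd_coef k"
  obtain B C where "\<And>s. \<bar>m s\<bar> \<le> B" "\<And>s. \<bar>k s\<bar> \<le> C" using m k by (auto simp: bdd_coef_def)
  then have "\<bar>m s * k s\<bar> \<le> B * C" for s
    unfolding abs_mult using abs_ge_zero order_trans by (intro mult_mono) blast+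
  then show ?thesis using m k by (auto simp: bdd_coef_def intro!: borel_measurable_times)
qed

lemma bdd_coef_continuous: "continuous_on UNIV m \<Longrightarrow> (\<And>s. \<bar>m s\<bar> \<le> B) \<Longrightarrow> bdd_coef m"
  by (auto simp: bdd_coef_def borel_measurable_continuous_onI)

text \<open>\<open>reg_b\<close> is chosen such that \<open>4 * reg_b k z\<close> is the derivative of \<open>z * reg_c k z\<close>, as for \<open>z\<^sup>3\<close> itself.\<close>

definition reg_b :: "real \<Rightarrow> real \<Rightarrow> real" where
  "reg_b k z = (z^3 + k * z^5 / 2) / (1 + k * z\<^sup>2)\<^sup>2"

definition reg_c :: "real \<Rightarrow> real \<Rightarrow> real" where
  "reg_c k z = z^3 / (1 + k * z\<^sup>2)"

lemma lipschitz0I: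
  assumes "\<And>z. (b has_real_derivative b' z) (at z)" "\<And>z. \<bar>b' z\<bar> \<le> B" "b 0 = 0"
  shows "lipschitz0 B b"
proof -
  have "norm (b y - b z) \<le> B * norm (y - z)" for y z
    by (rule field_differentiable_bound[of UNIV b b']) (use assms in \<open>auto intro: has_field_derivative_at_within\<close>)
  moreover have "B \<ge> 0" using assms(2)[of 0] by linarith
  ultimately show ?thesis using assms(3) by (simp add: lipschitz0_def)
qed

lemma reg_pos: "k > 0 \<Longrightarrow> 1 + k * z\<^sup>2 > (0::real)"
  by (smt (verit) mult_nonneg_nonneg zero_le_power2)

lemma reg_b_lipschitz:
  assumes k: "k > 0"
  shows "lipschitz0 (3 / k) (reg_b k)"
proof (rule lipschitz0I)
  fix z :: real
  let ?p = "1 + k * z\<^sup>2"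
  let ?d = "(3 * z\<^sup>2 + 3 / 2 * k * z^4 + k\<^sup>2 * z^6 / 2) / ?p ^ 3"
  have p: "?p > 0" using k by (rule reg_pos)
  have e: "((3 * z\<^sup>2 + k * (5 * z^4) / 2) * ?p\<^sup>2 - (z^3 + k * z^5 / 2) * (2 * ?p * (k * (2 * z)))) / (?p\<^sup>2 * ?p\<^sup>2) = ?d"
  proof -
    have "(3 * z\<^sup>2 + k * (5 * z^4) / 2) * ?p\<^sup>2 - (z^3 + k * z^5 / 2) * (2 * ?p * (k * (2 * z)))
        = ?p * (3 * z\<^sup>2 + 3 / 2 * k * z^4 + k\<^sup>2 * z^6 / 2)"
      by (simp add: power2_eq_square field_simps eval_nat_numeral)
    moreover have "?p\<^sup>2 * ?p\<^sup>2 = ?p * ?p ^ 3" by (simp add: eval_nat_numeral)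
    ultimately show ?thesis using p by simp
  qed
  have "(reg_b k has_real_derivative
      ((3 * z\<^sup>2 + k * (5 * z^4) / 2) * ?p\<^sup>2 - (z^3 + k * z^5 / 2) * (2 * ?p * (k * (2 * z)))) / (?p\<^sup>2 * ?p\<^sup>2)) (at z)"
  proof -
    have n: "((\<lambda>z. z^3 + k * z^5 / 2) has_real_derivative 3 * z\<^sup>2 + k * (5 * z^4) / 2) (at z)"
      and d: "((\<lambda>z. (1 + k * z\<^sup>2)\<^sup>2) has_real_derivative 2 * ?p * (k * (2 * z))) (at z)"
      by (auto intro!: derivative_eq_intros)
    show ?thesis
      unfolding reg_b_def[abs_def] by (rule DERIV_divide[OF n d]) (use p in simp)
  qed
  then show "(reg_b k has_real_derivative ?d) (at z)" unfolding e .
  have n: "0 \<le> 3 * z\<^sup>2 + 3 / 2 * k * z^4 + k\<^sup>2 * z^6 / 2"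
    using k by (intro add_nonneg_nonneg mult_nonneg_nonneg divide_nonneg_pos) auto
  \<comment> \<open>Both sides are polynomials in k z^2 with nonnegative coefficients and are
    compared coefficient by coefficient; this is where the Lipschitz constant 3 / k comes
    from.\<close>
  have "k * (3 * z\<^sup>2 + 3 / 2 * k * z^4 + k\<^sup>2 * z^6 / 2) \<le> 3 * ?p ^ 3"
  proof -
    have "3 * ?p ^ 3 = 3 + 9 * (k * z\<^sup>2) + 9 * (k * z\<^sup>2)^2 + 3 * (k * z\<^sup>2)^3"
      by (simp add: eval_nat_numeral algebra_simps)
    moreover have "k * (3 * z\<^sup>2 + 3 / 2 * k * z^4 + k\<^sup>2 * z^6 / 2)
        = 3 * (k * z\<^sup>2) + 3 / 2 * (k * z\<^sup>2)^2 + (k * z\<^sup>2)^3 / 2"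
      by (simp add: eval_nat_numeral algebra_simps)
    moreover have "0 \<le> k * z\<^sup>2" "0 \<le> (k * z\<^sup>2)^2" "0 \<le> (k * z\<^sup>2)^3" using k by simp_all
    ultimately show ?thesis by linarith
  qed
  then have "3 * z\<^sup>2 + 3 / 2 * k * z^4 + k\<^sup>2 * z^6 / 2 \<le> 3 / k * ?p ^ 3"
    using k by (simp add: field_simps)
  then have "?d \<le> 3 / k" using p by (simp add: pos_divide_le_eq)
  moreover have "0 \<le> ?d" using n p by (intro divide_nonneg_pos) auto
  ultimately show "\<bar>?d\<bar> \<le> 3 / k" by simp
qed (simp add: reg_b_def)

lemma reg_c_deriv:
  assumes k: "k > 0"
  shows "(reg_c k has_real_derivative ((3 * z\<^sup>2) * (1 + k * z\<^sup>2) - z^3 * (k * (2 * z)))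
    / ((1 + k * z\<^sup>2) * (1 + k * z\<^sup>2))) (at z)"
proof -
  have n: "((\<lambda>z. z^3) has_real_derivative 3 * z\<^sup>2) (at z)"
    and d: "((\<lambda>z. 1 + k * z\<^sup>2) has_real_derivative k * (2 * z)) (at z)"
    by (auto intro!: derivative_eq_intros)
  show ?thesis
    unfolding reg_c_def[abs_def] by (rule DERIV_divide[OF n d]) (use reg_pos[OF k, of z] in simp)
qed

lemma reg_c_lipschitz:
  assumes k: "k > 0"
  shows "lipschitz0 (3 / k) (reg_c k)"
proof (rule lipschitz0I)
  fix z :: real
  let ?p = "1 + k * z\<^sup>2"
  let ?d = "(3 * z\<^sup>2 + k * z^4) / ?p\<^sup>2"
  have p: "?p > 0" using k by (rule reg_pos)
  note reg_c_deriv[OF k, of z]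
  moreover have "((3 * z\<^sup>2) * ?p - z^3 * (k * (2 * z))) / (?p * ?p) = ?d"
    by (simp add: eval_nat_numeral algebra_simps)
  ultimately show "(reg_c k has_real_derivative ?d) (at z)" by simp
  have "k * (3 * z\<^sup>2 + k * z^4) \<le> 3 * ?p\<^sup>2"
  proof -
    have "3 * ?p\<^sup>2 = 3 + 6 * (k * z\<^sup>2) + 3 * (k * z\<^sup>2)^2" by (simp add: eval_nat_numeral algebra_simps)
    moreover have "k * (3 * z\<^sup>2 + k * z^4) = 3 * (k * z\<^sup>2) + (k * z\<^sup>2)^2"
      by (simp add: eval_nat_numeral algebra_simps)
    moreover have "0 \<le> k * z\<^sup>2" "0 \<le> (k * z\<^sup>2)^2" using k by simp_all
    ultimately show ?thesis by linarith
  qed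
  then have "3 * z\<^sup>2 + k * z^4 \<le> 3 / k * ?p\<^sup>2" using k by (simp add: field_simps)
  then have "?d \<le> 3 / k" using p by (simp add: pos_divide_le_eq)
  moreover have "0 \<le> ?d" using k by (intro divide_nonneg_nonneg) auto
  ultimately show "\<bar>?d\<bar> \<le> 3 / k" by simp
qed (simp add: reg_c_def)

lemma reg_deriv:
  assumes k: "k > 0"
  shows "((\<lambda>z. z * reg_c k z) has_real_derivative 4 * reg_b k z) (at z)"
proof -
  let ?p = "1 + k * z\<^sup>2"
  have p: "?p \<noteq> 0" using reg_pos[OF k, of z] by simp
  have "1 * reg_c k z + ((3 * z\<^sup>2) * ?p - z^3 * (k * (2 * z))) / (?p * ?p) * z
      = (z^3 * ?p + ((3 * z\<^sup>2) * ?p - z^3 * (k * (2 * z))) * z) / (?p * ?p)"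
    using p by (simp add: reg_c_def add_divide_distrib)
  also have "z^3 * ?p + ((3 * z\<^sup>2) * ?p - z^3 * (k * (2 * z))) * z = 4 * (z^3 + k * z^5 / 2)"
    by (simp add: eval_nat_numeral algebra_simps)
  finally show ?thesis
    by (intro DERIV_cong[OF DERIV_mult[OF DERIV_ident reg_c_deriv[OF k]]])
      (simp only: reg_b_def power2_eq_square[of ?p] times_divide_eq_right)
qed

lemma reg_le: assumes k: "k > 0" shows "\<bar>reg_b k z\<bar> \<le> \<bar>z^3\<bar>" "\<bar>reg_c k z\<bar> \<le> \<bar>z^3\<bar>"
proof -
  have p: "1 + k * z\<^sup>2 \<ge> 1" using k by simp
  have "\<bar>z^3\<bar> \<le> \<bar>z^3\<bar> * (1 + k * z\<^sup>2)" using mult_left_mono[OF p, of "\<bar>z^3\<bar>"] by simp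
  then show "\<bar>reg_c k z\<bar> \<le> \<bar>z^3\<bar>" using p by (simp add: reg_c_def abs_divide divide_le_eq)
  have "\<bar>z^3 + k * z^5 / 2\<bar> = \<bar>z^3\<bar> * (1 + k * z\<^sup>2 / 2)"
  proof -
    have "z^3 + k * z^5 / 2 = z^3 * (1 + k * z\<^sup>2 / 2)" by (simp add: eval_nat_numeral algebra_simps)
    then show ?thesis using k by (simp add: abs_mult)
  qed
  also have "\<dots> \<le> \<bar>z^3\<bar> * (1 + k * z\<^sup>2)\<^sup>2"
  proof (rule mult_left_mono)
    have "1 + k * z\<^sup>2 / 2 \<le> 1 + k * z\<^sup>2" using k by simp
    also have "\<dots> \<le> (1 + k * z\<^sup>2)\<^sup>2" using p by (simp add: self_le_power)
    finally show "1 + k * z\<^sup>2 / 2 \<le> (1 + k * z\<^sup>2)\<^sup>2" .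
  qed simp
  finally show "\<bar>reg_b k z\<bar> \<le> \<bar>z^3\<bar>" using p by (simp add: reg_b_def abs_divide divide_le_eq)
qed

lemma reg_tendsto:
  assumes "k \<longlonglongrightarrow> 0"
  shows "(\<lambda>n. reg_b (k n) z) \<longlonglongrightarrow> z^3" "(\<lambda>n. reg_c (k n) z) \<longlonglongrightarrow> z^3"
proof -
  have "(\<lambda>n. (z^3 + k n * z^5 / 2) / (1 + k n * z\<^sup>2)\<^sup>2) \<longlonglongrightarrow> (z^3 + 0 * z^5 / 2) / (1 + 0 * z\<^sup>2)\<^sup>2"
    by (intro tendsto_intros assms) auto
  then show "(\<lambda>n. reg_b (k n) z) \<longlonglongrightarrow> z^3" by (simp add: reg_b_def)
  have "(\<lambda>n. z^3 / (1 + k n * z\<^sup>2)) \<longlonglongrightarrow> z^3 / (1 + 0 * z\<^sup>2)"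
    by (intro tendsto_intros assms) auto
  then show "(\<lambda>n. reg_c (k n) z) \<longlonglongrightarrow> z^3" by (simp add: reg_c_def)
qed

lemma lipschitz0_continuous: "lipschitz0 B b \<Longrightarrow> continuous_on UNIV b"
  by (rule lipschitz_on_continuous_on[of B]) (auto simp: lipschitz0_def lipschitz_on_def dist_real_def)

lemma Dd_diff: "C1 f \<Longrightarrow> C1 k \<Longrightarrow> Dd w (\<lambda>x. f x - k x) = (\<lambda>x. Dd w f x - Dd w k x)"
  by (rule ext, rule Dd_eq) (auto intro!: derivative_eq_intros C1_has_derivative)

lemma Xe_diff: "C1 f \<Longrightarrow> C1 k \<Longrightarrow> Xe e (\<lambda>x. f x - k x) = (\<lambda>x. Xe e f x - Xe e k x)"
  by (simp add: Xe_Dd[abs_def] Dd_diff)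

lemma lapX_diff: "DD f \<Longrightarrow> DD k \<Longrightarrow> lapX (\<lambda>x. f x - k x) = (\<lambda>x. lapX f x - lapX k x)"
  by (rule ext) (simp add: lapX_def Xe_diff DD_C1 DD_Xe sum_subtractf)

context morawetz_op
begin

lemma Hop_diff: "DD f \<Longrightarrow> DD k \<Longrightarrow> Hop (\<lambda>x. f x - k x) = (\<lambda>x. Hop f x - Hop k x)"
  by (rule ext) (simp add: Hop_def Dd_diff DD_C1 DD_Dd lapX_diff algebra_simps)

lemma Gm_diff: "DD f \<Longrightarrow> DD k \<Longrightarrow> Gm (\<lambda>x. f x - k x) = (\<lambda>x. Gm f x - Gm k x)"
  by (rule ext) (simp add: Gm_def Dd_diff DD_C1 algebra_simps diff_divide_distrib)

lemma bdd_L: "bdd_coef L" and bdd_V: "bdd_coef V" and bdd_g: "bdd_coef g" and bdd_g1: "bdd_coef g1"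
  and bdd_wt: "bdd_coef wt" and bdd_wn: "bdd_coef wn"
proof -
  have sq: "\<bar>x\<bar> \<le> sqrt K" if "x\<^sup>2 \<le> K" for x
    using that by (simp add: real_le_rsqrt)
  show "bdd_coef L" "bdd_coef V" "bdd_coef g" "bdd_coef g1" "bdd_coef wt" "bdd_coef wn"
    using L_nonneg L_bound V_nonneg V_bound g_bound g1_sq wt_nonneg wt_bound wn_nonneg wn_bound sq
    by (auto intro: bdd_coef_continuous[OF L_cont, of K] bdd_coef_continuous[OF V_cont, of K]
        bdd_coef_continuous[OF g_cont, of "sqrt K"] bdd_coef_continuous[OF g1_cont, of "sqrt K"]
        bdd_coef_continuous[OF wt_cont, of K] bdd_coef_continuous[OF wn_cont, of K])
qed

lemma bdd_g1_half: "bdd_coef (\<lambda>s. g1 s / 2)"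
proof -
  have "bdd_coef (\<lambda>_. 1 / 2)" by (auto simp: bdd_coef_def intro!: exI[of _ 1])
  from bdd_coef_mult[OF bdd_g1 this] show ?thesis by simp
qed

text \<open>The weak relation tested on the core only. By essential self-adjointness this already
  determines w as the value of the closed operator at u.\<close>

definition Hrel :: "l2 \<Rightarrow> l2 \<Rightarrow> bool" where
  "Hrel u w \<longleftrightarrow> (\<forall>f. DD f \<longrightarrow> inner (cls (Hop f)) u = inner (cls f) w)"

text \<open>One sequence in the core serves all limits simultaneously: u' for the radial derivative,
  z for G u, and la for L times the spherical Laplacian, all in L2.\<close>

definition approx :: "l2 \<Rightarrow> l2 \<Rightarrow> l2 \<Rightarrow> l2 \<Rightarrow> l2 \<Rightarrow> (nat \<Rightarrow> point \<Rightarrow> real) \<Rightarrow> bool" where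
  "approx u w u' z la f \<longleftrightarrow> (\<forall>n. DD (f n)) \<and> (\<lambda>n. cls (f n)) \<longlonglongrightarrow> u \<and> (\<lambda>n. cls (Hop (f n))) \<longlonglongrightarrow> w
    \<and> (\<lambda>n. cls (Ds (f n))) \<longlonglongrightarrow> u' \<and> (\<lambda>n. cls (Gm (f n))) \<longlonglongrightarrow> z
    \<and> (\<lambda>n. cls (\<lambda>x. L (fst x) * lapX (f n) x)) \<longlonglongrightarrow> la"

lemma L_lapX_sq_int: "DD f \<Longrightarrow> sq_int (\<lambda>x. L (fst x) * lapX f x)"
  by (intro sq_int_bdd_coef bdd_L DD_sq_int DD_lapX)

lemma form_inner: "DD f \<Longrightarrow> form f = inner (cls (Hop f)) (cls f)"
  by (simp add: form_def inner_cls Hop_sq_int DD_sq_int)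

text \<open>A linear operator bounded in the graph norm of H turns a graph-convergent sequence into
  a Cauchy sequence, so the limit exists by completeness; the value of the limit is not identified
  here.\<close>

lemma op_limit:
  assumes lin: "\<And>f k. DD f \<Longrightarrow> DD k \<Longrightarrow> T (\<lambda>x. f x - k x) = (\<lambda>x. T f x - T k x)"
    and sq: "\<And>f. DD f \<Longrightarrow> sq_int (T f)"
    and bound: "\<And>f. DD f \<Longrightarrow> (norm (cls (T f)))\<^sup>2 \<le> C * (norm (cls (Hop f)) + norm (cls f))\<^sup>2"
    and C: "C \<ge> 0" and f: "\<And>n. DD (f n)"
    and lim: "(\<lambda>n. cls (f n)) \<longlonglongrightarrow> u" "(\<lambda>n. cls (Hop (f n))) \<longlonglongrightarrow> w"
  shows "\<exists>t. (\<lambda>n. cls (T (f n))) \<longlonglongrightarrow> t"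
proof -
  have b: "norm (cls (T f)) \<le> sqrt C * (norm (cls (Hop f)) + norm (cls f))" if "DD f" for f
  proof (rule power2_le_imp_le)
    show "(norm (cls (T f)))\<^sup>2 \<le> (sqrt C * (norm (cls (Hop f)) + norm (cls f)))\<^sup>2"
      using bound[OF that] C by (simp add: power_mult_distrib)
  qed (use C in simp)
  have d: "dist (cls (T (f m))) (cls (T (f n)))
      \<le> sqrt C * (dist (cls (Hop (f m))) (cls (Hop (f n))) + dist (cls (f m)) (cls (f n)))" for m n
    using b[OF DD_diff[OF f f], of m n]
    by (simp add: lin f Hop_diff cls_diff sq Hop_sq_int DD_sq_int dist_norm)
  have "Cauchy (\<lambda>n. cls (T (f n)))"
  proof (rule metric_CauchyI)
    fix e :: real assume e: "e > 0"
    define q where "q = sqrt C + 1"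
    have q: "q > 0" using C by (simp add: q_def add_nonneg_pos)
    define r where "r = e / (2 * q)"
    have r: "r > 0" using e q by (simp add: r_def)
    obtain M1 M2 where M: "\<forall>m\<ge>M1. \<forall>n\<ge>M1. dist (cls (f m)) (cls (f n)) < r"
      "\<forall>m\<ge>M2. \<forall>n\<ge>M2. dist (cls (Hop (f m))) (cls (Hop (f n))) < r"
      using metric_CauchyD[OF LIMSEQ_imp_Cauchy[OF lim(1)] r] metric_CauchyD[OF LIMSEQ_imp_Cauchy[OF lim(2)] r]
      by blast
    show "\<exists>M. \<forall>m\<ge>M. \<forall>n\<ge>M. dist (cls (T (f m))) (cls (T (f n))) < e"
    proof (intro exI[of _ "max M1 M2"] allI impI)
      fix m n assume mn: "max M1 M2 \<le> m" "max M1 M2 \<le> n"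
      have "dist (cls (Hop (f m))) (cls (Hop (f n))) + dist (cls (f m)) (cls (f n)) \<le> r + r"
        using M mn by (intro add_mono less_imp_le) auto
      then have "dist (cls (T (f m))) (cls (T (f n))) \<le> sqrt C * (r + r)"
        using d[of m n] C by (meson mult_left_mono order_trans real_sqrt_ge_zero)
      also have "\<dots> < q * (r + r)" using r by (intro mult_strict_right_mono) (auto simp: q_def)
      also have "\<dots> = e" using q by (simp add: r_def)
      finally show "dist (cls (T (f m))) (cls (T (f n))) < e" .
    qed
  qed
  then show ?thesis using Cauchy_convergent convergent_def by blast
qed

lemma form_le:
  assumes "DD f"
  shows "form f \<le> (norm (cls (Hop f)) + norm (cls f))\<^sup>2"
proof -
  have "form f \<le> norm (cls (Hop f)) * norm (cls f)"
    unfolding form_inner[OF assms] by (rule norm_cauchy_schwarz)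
  also have "\<dots> \<le> (norm (cls (Hop f)) + norm (cls f))\<^sup>2"
    by (simp add: power2_sum)
  finally show ?thesis .
qed

lemma Hrel_approx:
  assumes "Hrel u w"
  obtains u' z la f where "approx u w u' z la f"
proof -
  obtain f where f: "\<And>n. DD (f n)" "(\<lambda>n. cls (f n)) \<longlonglongrightarrow> u" "(\<lambda>n. cls (Hop (f n))) \<longlonglongrightarrow> w"
    using graph_approximation[of u w] assms unfolding Hrel_def by blast
  have "\<exists>u'. (\<lambda>n. cls (Ds (f n))) \<longlonglongrightarrow> u'"
  proof (rule op_limit[of Ds 1, OF _ _ _ _ f])
    show "(norm (cls (Ds f)))\<^sup>2 \<le> 1 * (norm (cls (Hop f)) + norm (cls f))\<^sup>2" if "DD f" for f
      using Ds_le_form[OF that] form_le[OF that] norm_cls[OF DD_sq_int[OF DD_Dd[OF that]]] by simp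
  qed (auto simp: Dd_diff DD_C1 intro: DD_sq_int DD_Dd)
  moreover have "\<exists>z. (\<lambda>n. cls (Gm (f n))) \<longlonglongrightarrow> z"
  proof (rule op_limit[of Gm "3 * K", OF _ _ _ _ f])
    show "(norm (cls (Gm f)))\<^sup>2 \<le> 3 * K * (norm (cls (Hop f)) + norm (cls f))\<^sup>2" if "DD f" for f
      using Gm_bound[OF that] mult_left_mono[OF form_le[OF that], of "3 * K"] K_nonneg
        norm_cls[OF Gm_sq_int[OF that]] by simp
  qed (use K_nonneg in \<open>auto simp: Gm_diff intro: Gm_sq_int\<close>)
  moreover have "\<exists>la. (\<lambda>n. cls ((\<lambda>f x. L (fst x) * lapX f x) (f n))) \<longlonglongrightarrow> la"
  proof (rule op_limit[of _ "1 + K", OF _ _ _ _ f])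
    fix f assume f: "DD f"
    have "(\<integral>x. (Hop f x)\<^sup>2 \<partial>mu) \<le> (norm (cls (Hop f)) + norm (cls f))\<^sup>2"
      unfolding norm_cls[OF Hop_sq_int[OF f], symmetric] by (intro power_mono) auto
    then have "(norm (cls (\<lambda>x. L (fst x) * lapX f x)))\<^sup>2
        \<le> (norm (cls (Hop f)) + norm (cls f))\<^sup>2 + K * (norm (cls (Hop f)) + norm (cls f))\<^sup>2"
      using angular_bound[OF f] mult_left_mono[OF form_le[OF f] K_nonneg]
        norm_cls[OF L_lapX_sq_int[OF f]] by simp
    then show "(norm (cls (\<lambda>x. L (fst x) * lapX f x)))\<^sup>2 \<le> (1 + K) * (norm (cls (Hop f)) + norm (cls f))\<^sup>2"
      by (simp add: distrib_right)
  qed (use K_nonneg in \<open>auto simp: lapX_diff right_diff_distrib intro: L_lapX_sq_int\<close>)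
  ultimately show ?thesis using that f unfolding approx_def by blast
qed

lemma approx_Gm_eq:
  assumes "approx u w u' z la f"
  shows "z = mulc g u' + mulc (\<lambda>s. g1 s / 2) u"
proof -
  have f: "\<And>n. DD (f n)" "(\<lambda>n. cls (f n)) \<longlonglongrightarrow> u" "(\<lambda>n. cls (Ds (f n))) \<longlonglongrightarrow> u'" "(\<lambda>n. cls (Gm (f n))) \<longlonglongrightarrow> z"
    using assms by (auto simp: approx_def)
  have b: "bdd_coef (\<lambda>s. g1 s / 2)"
    by (rule bdd_g1_half)
  have "cls (Gm (f n)) = cls (\<lambda>x. g (fst x) * Ds (f n) x) + cls (\<lambda>x. g1 (fst x) / 2 * f n x)" for n
  proof -
    have e: "Gm (f n) = (\<lambda>x. g (fst x) * Ds (f n) x + g1 (fst x) / 2 * f n x)"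
      by (simp add: Gm_def fun_eq_iff)
    show ?thesis
      unfolding e by (intro cls_add sq_int_bdd_coef[OF bdd_g] sq_int_bdd_coef[OF b] DD_sq_int DD_Dd f)
  qed
  moreover have "(\<lambda>n. cls (\<lambda>x. g (fst x) * Ds (f n) x) + cls (\<lambda>x. g1 (fst x) / 2 * f n x))
      \<longlonglongrightarrow> mulc g u' + mulc (\<lambda>s. g1 s / 2) u"
    by (intro tendsto_add tendsto_mulc[OF bdd_g] tendsto_mulc[OF b] f DD_sq_int DD_Dd)
  ultimately show ?thesis using f(4) LIMSEQ_unique by simp
qed

text \<open>The quadratic form of H splits into the three terms that the energy defines separately.
  The split passes to the limit because the radial derivative and the angular part converge
  individually.\<close>

lemma approx_energy:
  assumes "approx u w u' z la f"
  shows "inner w u = (norm u')\<^sup>2 + inner (mulc V u) u - inner la u"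
proof -
  have f: "\<And>n. DD (f n)" and l: "(\<lambda>n. cls (f n)) \<longlonglongrightarrow> u" "(\<lambda>n. cls (Hop (f n))) \<longlonglongrightarrow> w"
    "(\<lambda>n. cls (Ds (f n))) \<longlonglongrightarrow> u'" "(\<lambda>n. cls (\<lambda>x. L (fst x) * lapX (f n) x)) \<longlonglongrightarrow> la"
    using assms by (auto simp: approx_def)
  have e: "inner (cls (Hop f)) (cls f) = (norm (cls (Ds f)))\<^sup>2 + inner (cls (\<lambda>x. V (fst x) * f x)) (cls f)
      - inner (cls (\<lambda>x. L (fst x) * lapX f x)) (cls f)" if f: "DD f" for f
  proof -
    have s: "sq_int (\<lambda>x. V (fst x) * f x)" "sq_int (\<lambda>x. L (fst x) * lapX f x)" "sq_int f" "sq_int (Ds (Ds f))"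
      using f by (auto intro: sq_int_bdd_coef[OF bdd_V] L_lapX_sq_int DD_sq_int DD_Dd)
    have "(\<integral>x. Hop f x * f x \<partial>mu) = (\<integral>x. - (Ds (Ds f) x * f x) + V (fst x) * f x * f x
        - L (fst x) * lapX f x * f x \<partial>mu)"
      by (rule Bochner_Integration.integral_cong) (auto simp: Hop_def algebra_simps)
    also have "\<dots> = - (\<integral>x. Ds (Ds f) x * f x \<partial>mu) + (\<integral>x. V (fst x) * f x * f x \<partial>mu)
        - (\<integral>x. L (fst x) * lapX f x * f x \<partial>mu)"
      using sq_int_mult_integrable[OF s(4,3)] sq_int_mult_integrable[OF s(1,3)] sq_int_mult_integrable[OF s(2,3)]
      by simp
    also have "(\<integral>x. Ds (Ds f) x * f x \<partial>mu) = - (\<integral>x. Ds f x * Ds f x \<partial>mu)"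
      using f by (intro integral_Ds_by_parts) (auto intro: DD_C1 DD_Dd DD_slab_supp)
    finally show ?thesis
      unfolding inner_cls[OF Hop_sq_int[OF f] s(3)] inner_cls[OF s(1,3)] inner_cls[OF s(2,3)]
        norm_cls[OF DD_sq_int[OF DD_Dd[OF f]]]
      by (simp add: power2_eq_square)
  qed
  have "(\<lambda>n. inner (cls (Hop (f n))) (cls (f n))) \<longlonglongrightarrow> inner w u" by (intro tendsto_inner l)
  moreover have "(\<lambda>n. (norm (cls (Ds (f n))))\<^sup>2 + inner (cls (\<lambda>x. V (fst x) * f n x)) (cls (f n))
      - inner (cls (\<lambda>x. L (fst x) * lapX (f n) x)) (cls (f n)))
      \<longlonglongrightarrow> (norm u')\<^sup>2 + inner (mulc V u) u - inner la u"
    by (intro tendsto_add tendsto_diff tendsto_inner tendsto_power tendsto_norm l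
        tendsto_mulc[OF bdd_V DD_sq_int[OF f] l(1)])
  ultimately show ?thesis unfolding e[OF f] using LIMSEQ_unique by blast
qed

lemma approx_morawetz:
  assumes "approx u w u' z la f"
  shows "inner (mulc wt u) u \<le> inner w z"
proof -
  have f: "\<And>n. DD (f n)" and l: "(\<lambda>n. cls (f n)) \<longlonglongrightarrow> u" "(\<lambda>n. cls (Hop (f n))) \<longlonglongrightarrow> w"
    "(\<lambda>n. cls (Gm (f n))) \<longlonglongrightarrow> z"
    using assms by (auto simp: approx_def)
  have "inner (cls (\<lambda>x. wt (fst x) * f n x)) (cls (f n)) \<le> inner (cls (Hop (f n))) (cls (Gm (f n)))" for n
    using morawetz_lower[OF f[of n]]
    by (simp add: inner_cls sq_int_bdd_coef[OF bdd_wt] DD_sq_int f Hop_sq_int Gm_sq_int power2_eq_square mult.assoc)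
  then show ?thesis
    by (intro LIMSEQ_le[OF tendsto_inner[OF tendsto_mulc[OF bdd_wt DD_sq_int[OF f] l(1)] l(1)]
          tendsto_inner[OF l(2,3)]]) auto
qed

lemma approx_Gm_bound:
  assumes "approx u w u' z la f"
  shows "(norm z)\<^sup>2 \<le> 3 * K * inner w u"
proof -
  have f: "\<And>n. DD (f n)" and l: "(\<lambda>n. cls (f n)) \<longlonglongrightarrow> u" "(\<lambda>n. cls (Hop (f n))) \<longlonglongrightarrow> w"
    "(\<lambda>n. cls (Gm (f n))) \<longlonglongrightarrow> z"
    using assms by (auto simp: approx_def)
  have "(norm (cls (Gm (f n))))\<^sup>2 \<le> 3 * K * inner (cls (Hop (f n))) (cls (f n))" for n
    using Gm_bound[OF f[of n]] by (simp add: norm_cls Gm_sq_int f form_inner)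
  then show ?thesis
    by (intro LIMSEQ_le[OF tendsto_power[OF tendsto_norm[OF l(3)]]
          tendsto_mult[OF tendsto_const tendsto_inner[OF l(2,1)]]]) auto
qed

lemma approx_antisymmetric:
  assumes "approx u w u' z la f" "approx v y v' t lb k"
  shows "inner z v = - inner u t"
proof -
  have f: "\<And>n. DD (f n)" "\<And>n. DD (k n)" and l: "(\<lambda>n. cls (f n)) \<longlonglongrightarrow> u" "(\<lambda>n. cls (Gm (f n))) \<longlonglongrightarrow> z"
    "(\<lambda>n. cls (k n)) \<longlonglongrightarrow> v" "(\<lambda>n. cls (Gm (k n))) \<longlonglongrightarrow> t"
    using assms by (auto simp: approx_def)
  have "inner (cls (Gm (f n))) (cls (k n)) = - inner (cls (f n)) (cls (Gm (k n)))" for n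
    using Gm_antisymmetric[OF f, of n n] by (simp add: inner_cls Gm_sq_int f DD_sq_int)
  moreover have "(\<lambda>n. inner (cls (Gm (f n))) (cls (k n))) \<longlonglongrightarrow> inner z v"
    "(\<lambda>n. - inner (cls (f n)) (cls (Gm (k n)))) \<longlonglongrightarrow> - inner u t"
    by (intro tendsto_intros l)+
  ultimately show ?thesis using LIMSEQ_unique by simp
qed

text \<open>Identifies the limit u' as the distributional derivative of u. The test function p is
  any C1 function with slab support, since the definition of the energy tests with more than the
  core.\<close>

lemma approx_weak_Ds:
  assumes a: "approx u w u' z la f" and p: "C1 p" "slab_supp p"
  shows "inner (cls (Ds p)) u = - inner (cls p) u'"
proof -
  have f: "\<And>n. DD (f n)" and l: "(\<lambda>n. cls (f n)) \<longlonglongrightarrow> u" "(\<lambda>n. cls (Ds (f n))) \<longlonglongrightarrow> u'"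
    using a by (auto simp: approx_def)
  have s: "sq_int p" "sq_int (Ds p)"
    using p by (auto intro: sq_int_slab_supp C1_continuous C1_Dd_continuous slab_supp_Dd)
  have "inner (cls (Ds p)) (cls (f n)) = - inner (cls p) (cls (Ds (f n)))" for n
    using integral_Ds_by_parts[OF p(1) DD_C1[OF f[of n]]] p(2)
    by (simp add: inner_cls s f DD_sq_int DD_Dd)
  moreover have "(\<lambda>n. inner (cls (Ds p)) (cls (f n))) \<longlonglongrightarrow> inner (cls (Ds p)) u"
    "(\<lambda>n. - inner (cls p) (cls (Ds (f n)))) \<longlonglongrightarrow> - inner (cls p) u'"
    by (intro tendsto_intros l)+
  ultimately show ?thesis using LIMSEQ_unique by simp
qed

text \<open>Along the core L times the Laplacian converges, not the Laplacian itself, so 1 / L is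
  moved onto the test function, where it is harmless because L is positive and continuous and p has
  slab support.\<close>

lemma approx_weak_lapX:
  assumes a: "approx u w u' z la f" and p: "C1 p" "slab_supp p" "\<And>e. C1 (Xe e p)"
  shows "inner (cls (lapX p)) u = inner (cls (\<lambda>x. p x / L (fst x))) la"
proof -
  have f: "\<And>n. DD (f n)" and l: "(\<lambda>n. cls (f n)) \<longlonglongrightarrow> u" "(\<lambda>n. cls (\<lambda>x. L (fst x) * lapX (f n) x)) \<longlonglongrightarrow> la"
    using a by (auto simp: approx_def)
  have pc: "continuous_on UNIV p" "continuous_on UNIV (lapX p)"
    unfolding lapX_def[abs_def] using p by (auto intro!: continuous_on_sum intro: C1_continuous C1_Xe_continuous)
  have ps: "slab_supp (lapX p)"
    unfolding lapX_def[abs_def] using p by (intro slab_supp_sum slab_supp_Xe)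
  have "continuous_on UNIV (\<lambda>x. p x / L (fst x))"
    using L_pos by (intro continuous_on_divide pc L_fst_cont) (metis less_irrefl)
  moreover have "slab_supp (\<lambda>x. p x / L (fst x))"
    using slab_supp_mult1[OF p(2)] by (simp add: divide_inverse)
  ultimately have s: "sq_int (\<lambda>x. p x / L (fst x))" "sq_int (lapX p)"
    using pc ps by (auto intro: sq_int_slab_supp)
  have "inner (cls (lapX p)) (cls (f n)) = inner (cls (\<lambda>x. p x / L (fst x))) (cls (\<lambda>x. L (fst x) * lapX (f n) x))" for n
  proof -
    have i: "integrable mu (\<lambda>x. Xe e (Xe e p) x * f n x)" "integrable mu (\<lambda>x. p x * Xe e (Xe e (f n)) x)" for e
      by (intro integrable_mu_slab_supp continuous_on_mult slab_supp_mult2 C1_Xe_continuous p DD_continuous f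
          DD_slab_supp DD_Xe C1_continuous[OF p(1)])+
    have by_parts: "(\<integral>x. Xe e (Xe e p) x * f n x \<partial>mu) = (\<integral>x. p x * Xe e (Xe e (f n)) x \<partial>mu)" if "e \<in> Basis" for e
      using integral_Xe_by_parts[OF p(3) DD_C1[OF f], where c = "\<lambda>_. 1" and e = e, of e n]
        integral_Xe_by_parts[OF p(1) DD_C1[OF DD_Xe[OF f]], where c = "\<lambda>_. 1" and e = e, of e n]
        that f p by (simp add: DD_slab_supp)
    have "(\<integral>x. lapX p x * f n x \<partial>mu) = (\<Sum>e\<in>Basis. \<integral>x. Xe e (Xe e p) x * f n x \<partial>mu)"
      using i by (simp add: lapX_def sum_distrib_right)
    also have "\<dots> = (\<Sum>e\<in>Basis. \<integral>x. p x * Xe e (Xe e (f n)) x \<partial>mu)" using by_parts by simp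
    also have "\<dots> = (\<integral>x. p x * lapX (f n) x \<partial>mu)" using i by (simp add: lapX_def sum_distrib_left)
    also have "\<dots> = (\<integral>x. p x / L (fst x) * (L (fst x) * lapX (f n) x) \<partial>mu)"
      using L_pos by (intro Bochner_Integration.integral_cong) (auto simp: less_imp_neq[symmetric])
    finally show ?thesis by (simp add: inner_cls s f DD_sq_int L_lapX_sq_int)
  qed
  moreover have "(\<lambda>n. inner (cls (lapX p)) (cls (f n))) \<longlonglongrightarrow> inner (cls (lapX p)) u"
    "(\<lambda>n. inner (cls (\<lambda>x. p x / L (fst x))) (cls (\<lambda>x. L (fst x) * lapX (f n) x)))
      \<longlonglongrightarrow> inner (cls (\<lambda>x. p x / L (fst x))) la"
    by (intro tendsto_intros l)+
  ultimately show ?thesis using LIMSEQ_unique by simp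
qed

lemma reg_c_nonneg: "k > 0 \<Longrightarrow> z * reg_c k z \<ge> 0"
proof -
  assume k: "k > 0"
  have "z * reg_c k z = z^4 / (1 + k * z\<^sup>2)" by (simp add: reg_c_def eval_nat_numeral)
  then show ?thesis using reg_pos[OF k, of z] by simp
qed

text \<open>On the core this is \<open>nonlinear_identity\<close> for z \<mapsto> z * reg_c k z,
  whose derivative is 4 * reg_b k z. Both functions are Lipschitz, so each inner product is
  continuous along the core.\<close>

lemma approx_regularized:
  assumes a: "approx u w u' z la f" and k: "k > 0"
  shows "(\<integral>x. wn (fst x) * reg_c k (rep u x) * rep u x \<partial>mu) / 4
    \<le> (\<integral>x. L (fst x) * g (fst x) * reg_b k (rep u x) * rep u' x \<partial>mu)
      + (\<integral>x. L (fst x) * (g1 (fst x) / 2) * reg_c k (rep u x) * rep u x \<partial>mu)"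
proof -
  have f: "\<And>n. DD (f n)" and l: "(\<lambda>n. cls (f n)) \<longlonglongrightarrow> u" "(\<lambda>n. cls (Ds (f n))) \<longlonglongrightarrow> u'"
    using a by (auto simp: approx_def)
  note lb = reg_b_lipschitz[OF k] and lc = reg_c_lipschitz[OF k]
  have m1: "bdd_coef (\<lambda>s. L s * g s)" by (rule bdd_coef_mult[OF bdd_L bdd_g])
  have h: "bdd_coef (\<lambda>s. g1 s / 2)"
    by (rule bdd_g1_half)
  have m2: "bdd_coef (\<lambda>s. L s * (g1 s / 2))" by (rule bdd_coef_mult[OF bdd_L h])
  have sb: "sq_int (\<lambda>x. reg_b k (v x))" and sc: "sq_int (\<lambda>x. reg_c k (v x))" if "sq_int v" for v
    using that sq_int_lipschitz0[OF lb] sq_int_lipschitz0[OF lc] by auto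
  have ineq: "inner (cls (\<lambda>x. wn (fst x) * reg_c k (f n x))) (cls (f n)) / 4
      \<le> inner (cls (\<lambda>x. L (fst x) * g (fst x) * reg_b k (f n x))) (cls (Ds (f n)))
        + inner (cls (\<lambda>x. L (fst x) * (g1 (fst x) / 2) * reg_c k (f n x))) (cls (f n))" for n
  proof -
    let ?f = "f n"
    have sf: "sq_int ?f" "sq_int (Ds ?f)" using f by (auto intro: DD_sq_int DD_Dd)
    note s1 = sq_int_bdd_coef[OF m1 sb[OF sf(1)]] and s2 = sq_int_bdd_coef[OF m2 sc[OF sf(1)]]
      and s3 = sq_int_bdd_coef[OF bdd_wn sc[OF sf(1)]]
    have "(\<integral>x. wn (fst x) * reg_c k (?f x) * ?f x \<partial>mu) / 4 = (\<integral>x. wn (fst x) * reg_c k (?f x) * ?f x / 4 \<partial>mu)"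
      by simp
    also have "\<dots> \<le> (\<integral>x. (L (fst x) * g1 (fst x) - deriv L (fst x) * g (fst x)) * (?f x * reg_c k (?f x)) / 4 \<partial>mu)"
    proof (rule integral_mono)
      show "integrable mu (\<lambda>x. wn (fst x) * reg_c k (?f x) * ?f x / 4)"
        using sq_int_mult_integrable[OF s3 sf(1)] by simp
      show "integrable mu (\<lambda>x. (L (fst x) * g1 (fst x) - deriv L (fst x) * g (fst x)) * (?f x * reg_c k (?f x)) / 4)"
      proof (intro integrable_mu_slab_supp continuous_on_mult continuous_on_divide continuous_on_diff
          coef_fst_cont DD_continuous[OF f] continuous_on_const)
        show "continuous_on UNIV (\<lambda>x. reg_c k (?f x))"
          by (rule continuous_on_compose2[OF lipschitz0_continuous[OF lc] DD_continuous[OF f]]) simp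
        show "slab_supp (\<lambda>x. (L (fst x) * g1 (fst x) - deriv L (fst x) * g (fst x)) * (?f x * reg_c k (?f x)) / 4)"
          unfolding divide_inverse by (intro slab_supp_intros DD_slab_supp f)
      qed simp
      fix x :: point
      have "wn (fst x) * (?f x * reg_c k (?f x))
          \<le> (L (fst x) * g1 (fst x) - deriv L (fst x) * g (fst x)) * (?f x * reg_c k (?f x))"
        by (intro mult_right_mono nonlinear reg_c_nonneg k)
      then show "wn (fst x) * reg_c k (?f x) * ?f x / 4
          \<le> (L (fst x) * g1 (fst x) - deriv L (fst x) * g (fst x)) * (?f x * reg_c k (?f x)) / 4"
        by (simp add: mult_ac)
    qed
    also have "\<dots> = (\<integral>x. L (fst x) * (g (fst x) * (4 * reg_b k (?f x)) / 4 * Ds ?f x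
        + g1 (fst x) * (?f x * reg_c k (?f x)) / 2) \<partial>mu)"
    proof (rule nonlinear_identity[symmetric, OF reg_deriv[OF k] _ _ _ f])
      show "continuous_on UNIV (\<lambda>z. 4 * reg_b k z)"
        by (intro continuous_on_mult continuous_on_const lipschitz0_continuous[OF lb])
    qed (simp_all add: reg_b_def)
    also have "\<dots> = (\<integral>x. L (fst x) * g (fst x) * reg_b k (?f x) * Ds ?f x
        + L (fst x) * (g1 (fst x) / 2) * reg_c k (?f x) * ?f x \<partial>mu)"
      by (rule Bochner_Integration.integral_cong) (auto simp: field_simps)
    also have "\<dots> = (\<integral>x. L (fst x) * g (fst x) * reg_b k (?f x) * Ds ?f x \<partial>mu)
        + (\<integral>x. L (fst x) * (g1 (fst x) / 2) * reg_c k (?f x) * ?f x \<partial>mu)"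
      by (rule Bochner_Integration.integral_add[OF sq_int_mult_integrable[OF s1 sf(2)] sq_int_mult_integrable[OF s2 sf(1)]])
    finally show ?thesis
      unfolding inner_cls[OF s1 sf(2)] inner_cls[OF s2 sf(1)] inner_cls[OF s3 sf(1)] .
  qed
  have lim: "(\<lambda>n. cls (\<lambda>x. m (fst x) * b (f n x))) \<longlonglongrightarrow> mulc m (nem b u)"
    if "bdd_coef m" "lipschitz0 B b" for m b B
    using tendsto_mulc[OF that(1) _ tendsto_nem[OF that(2) DD_sq_int[OF f] l(1)]]
      sq_int_lipschitz0[OF that(2) DD_sq_int[OF f]] by blast
  have "inner (mulc wn (nem (reg_c k) u)) u / 4 \<le> inner (mulc (\<lambda>s. L s * g s) (nem (reg_b k) u)) u'
      + inner (mulc (\<lambda>s. L s * (g1 s / 2)) (nem (reg_c k) u)) u"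
  proof (rule LIMSEQ_le)
    show "(\<lambda>n. inner (cls (\<lambda>x. wn (fst x) * reg_c k (f n x))) (cls (f n)) / 4)
        \<longlonglongrightarrow> inner (mulc wn (nem (reg_c k) u)) u / 4"
      by (intro tendsto_divide tendsto_inner lim[OF bdd_wn lc] l tendsto_const) simp
    show "(\<lambda>n. inner (cls (\<lambda>x. L (fst x) * g (fst x) * reg_b k (f n x))) (cls (Ds (f n)))
        + inner (cls (\<lambda>x. L (fst x) * (g1 (fst x) / 2) * reg_c k (f n x))) (cls (f n)))
        \<longlonglongrightarrow> inner (mulc (\<lambda>s. L s * g s) (nem (reg_b k) u)) u'
          + inner (mulc (\<lambda>s. L s * (g1 s / 2)) (nem (reg_c k) u)) u"
      by (intro tendsto_add tendsto_inner lim[OF m1 lb] lim[OF m2 lc] l)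
  qed (use ineq in blast)
  moreover have "inner (mulc m (nem b u)) v = (\<integral>x. m (fst x) * b (rep u x) * rep v x \<partial>mu)"
    if m: "bdd_coef m" and b: "lipschitz0 B b" for m b B v
  proof -
    note s = sq_int_lipschitz0[OF b rep_sq_int[of u]]
    show ?thesis
      unfolding nem_def mulc_cls[OF m s]
      using inner_cls[OF sq_int_bdd_coef[OF m s] rep_sq_int[of v]] by simp
  qed
  ultimately show ?thesis
    using bdd_wn m1 m2 lb lc by simp
qed

text \<open>The map \<open>u \<mapsto> u\<^sup>3\<close> is not continuous on \<open>L\<^sup>2\<close>, so the limit along the core is first taken for the
  Lipschitz functions \<open>reg_b k\<close> and \<open>reg_c k\<close>, and then \<open>k\<close> tends to 0.\<close>

theorem approx_nonlinear:
  assumes a: "approx u w u' z la f" and u3: "sq_int (\<lambda>x. (rep u x)^3)"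
  shows "(\<integral>x. wn (fst x) * (rep u x)^4 \<partial>mu) / 4 \<le> inner (cls (\<lambda>x. L (fst x) * (rep u x)^3)) z"
proof -
  define k where "k n = 1 / real (Suc n)" for n
  have k: "k n > 0" for n by (simp add: k_def)
  have k0: "k \<longlonglongrightarrow> 0" unfolding k_def using LIMSEQ_inverse_real_of_nat by (simp add: inverse_eq_divide)
  have m1: "bdd_coef (\<lambda>s. L s * g s)" by (rule bdd_coef_mult[OF bdd_L bdd_g])
  have h: "bdd_coef (\<lambda>s. g1 s / 2)"
    by (rule bdd_g1_half)
  have m2: "bdd_coef (\<lambda>s. L s * (g1 s / 2))" by (rule bdd_coef_mult[OF bdd_L h])
  have lim: "(\<lambda>n. \<integral>x. m (fst x) * b (k n) (rep u x) * rep v x \<partial>mu) \<longlonglongrightarrow> (\<integral>x. m (fst x) * (rep u x)^3 * rep v x \<partial>mu)"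
    if m: "bdd_coef m" and b: "b = reg_b \<or> b = reg_c" for m b v
  proof -
    obtain B where B: "\<And>s. \<bar>m s\<bar> \<le> B" using m by (auto simp: bdd_coef_def)
    show ?thesis
    proof (rule integral_dominated_convergence)
    have mm: "(\<lambda>x::point. m (fst x)) \<in> borel_measurable mu"
    proof -
      have "(\<lambda>x::point. m (fst x)) \<in> borel_measurable borel"
        using m by (intro fst_measurable_point) (simp add: bdd_coef_def)
      then show ?thesis by simp
    qed
    have um [measurable]: "rep u \<in> borel_measurable borel" "rep v \<in> borel_measurable borel"
      using rep_sq_int sq_int_measurable by blast+
    have "(\<lambda>x. b (k n) (rep u x)) \<in> borel_measurable mu" for n
    proof -
      have "continuous_on UNIV (b (k n))"
        using b lipschitz0_continuous[OF reg_b_lipschitz[OF k]] lipschitz0_continuous[OF reg_c_lipschitz[OF k]] by auto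
      then have [measurable]: "b (k n) \<in> borel_measurable borel" by (rule borel_measurable_continuous_onI)
      show ?thesis by measurable
    qed
    then show "(\<lambda>x. m (fst x) * b (k n) (rep u x) * rep v x) \<in> borel_measurable mu" for n
      using mm by (intro borel_measurable_times) auto
    show "(\<lambda>x. m (fst x) * (rep u x)^3 * rep v x) \<in> borel_measurable mu"
      using mm by (intro borel_measurable_times) auto
    \<comment> \<open>Domination uniform in k: both regularisations are bounded by the cube, and u^3
      is assumed square integrable.\<close>
    show "integrable mu (\<lambda>x. B * \<bar>(rep u x)^3 * rep v x\<bar>)"
      by (intro integrable_mult_right integrable_abs sq_int_mult_integrable u3 rep_sq_int)
    show "AE x in mu. (\<lambda>n. m (fst x) * b (k n) (rep u x) * rep v x) \<longlonglongrightarrow> m (fst x) * (rep u x)^3 * rep v x"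
      using b reg_tendsto[OF k0] by (intro AE_I2 tendsto_mult tendsto_const) auto
    show "AE x in mu. norm (m (fst x) * b (k n) (rep u x) * rep v x) \<le> B * \<bar>(rep u x)^3 * rep v x\<bar>" for n
    proof (rule AE_I2)
      fix x
      have "\<bar>m (fst x)\<bar> * (\<bar>b (k n) (rep u x)\<bar> * \<bar>rep v x\<bar>) \<le> B * (\<bar>(rep u x)^3\<bar> * \<bar>rep v x\<bar>)"
        using b reg_le[OF k] B order_trans[OF abs_ge_zero B]
        by (intro mult_mono mult_nonneg_nonneg) auto
      then show "norm (m (fst x) * b (k n) (rep u x) * rep v x) \<le> B * \<bar>(rep u x)^3 * rep v x\<bar>"
        by (simp add: abs_mult mult.assoc)
    qed
    qed
  qed
  have "(\<integral>x. wn (fst x) * (rep u x)^3 * rep u x \<partial>mu) / 4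
      \<le> (\<integral>x. L (fst x) * g (fst x) * (rep u x)^3 * rep u' x \<partial>mu)
        + (\<integral>x. L (fst x) * (g1 (fst x) / 2) * (rep u x)^3 * rep u x \<partial>mu)"
    by (rule LIMSEQ_le[OF tendsto_divide[OF lim[OF bdd_wn, of reg_c u] tendsto_const]
          tendsto_add[OF lim[OF m1, of reg_b u'] lim[OF m2, of reg_c u]]])
      (use approx_regularized[OF a k] in auto)
  also have "\<dots> = (\<integral>x. L (fst x) * (rep u x)^3 * (g (fst x) * rep u' x + g1 (fst x) / 2 * rep u x) \<partial>mu)"
  proof -
    have "integrable mu (\<lambda>x. m (fst x) * (rep u x)^3 * rep v x)" if "bdd_coef m" for m v
      by (intro sq_int_mult_integrable sq_int_bdd_coef that u3 rep_sq_int)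
    from this[OF m1] this[OF m2] show ?thesis
      by (subst Bochner_Integration.integral_add[symmetric]) (auto simp: algebra_simps)
  qed
  also have "\<dots> = inner (cls (\<lambda>x. L (fst x) * (rep u x)^3)) z"
  proof -
    have s: "sq_int (\<lambda>x. g (fst x) * rep u' x)" "sq_int (\<lambda>x. g1 (fst x) / 2 * rep u x)"
      by (intro sq_int_bdd_coef[OF bdd_g] sq_int_bdd_coef[OF h] rep_sq_int)+
    have "z = cls (\<lambda>x. g (fst x) * rep u' x + g1 (fst x) / 2 * rep u x)"
      unfolding approx_Gm_eq[OF a] mulc_def cls_add[OF s] ..
    then show ?thesis
      using inner_cls[OF sq_int_bdd_coef[OF bdd_L u3] sq_int_add[OF s]] by simp
  qed
  finally show ?thesis by (simp add: eval_nat_numeral mult.assoc)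
qed

end

section \<open>The evolution identity\<close>

lemma has_vector_derivative_iff_norm:
  fixes f :: "real \<Rightarrow> 'a::real_normed_vector"
  shows "(f has_vector_derivative v) (at t within S)
    \<longleftrightarrow> ((\<lambda>s. norm ((f s - f t) /\<^sub>R (s - t) - v)) \<longlongrightarrow> 0) (at t within S)"
proof -
  have e: "norm ((1 / norm (s - t)) *\<^sub>R (f s - (f t + (s - t) *\<^sub>R v))) = norm ((f s - f t) /\<^sub>R (s - t) - v)"
    if "s \<noteq> t" for s
  proof -
    have "(f s - f t) /\<^sub>R (s - t) - v = inverse (s - t) *\<^sub>R (f s - (f t + (s - t) *\<^sub>R v))"
    proof -
      have "s - t \<noteq> 0" using that by simp
      then show ?thesis by (simp add: scaleR_diff_right scaleR_add_right del: right_minus_eq)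
    qed
    then have "norm ((f s - f t) /\<^sub>R (s - t) - v) = \<bar>inverse (s - t)\<bar> * norm (f s - (f t + (s - t) *\<^sub>R v))"
      by simp
    then show ?thesis by (simp add: divide_inverse)
  qed
  have "(f has_vector_derivative v) (at t within S)
    \<longleftrightarrow> ((\<lambda>s. norm ((1 / norm (s - t)) *\<^sub>R (f s - (f t + (s - t) *\<^sub>R v)))) \<longlongrightarrow> 0) (at t within S)"
    unfolding has_vector_derivative_def has_derivative_within tendsto_norm_zero_iff
    by (simp add: bounded_linear_scaleR_left)
  also have "\<dots> \<longleftrightarrow> ((\<lambda>s. norm ((f s - f t) /\<^sub>R (s - t) - v)) \<longlongrightarrow> 0) (at t within S)"
  proof (rule filterlim_cong[OF refl refl])
    show "\<forall>\<^sub>F s in at t within S. norm ((1 / norm (s - t)) *\<^sub>R (f s - (f t + (s - t) *\<^sub>R v)))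
        = norm ((f s - f t) /\<^sub>R (s - t) - v)"
      unfolding eventually_at_filter using e by (intro always_eventually) blast
  qed
  finally show ?thesis .
qed

text \<open>The hypothesis \<open>conv\<close> says that \<open>k\<close> is a subgradient of \<open>F\<close>, which makes the energy
  \<open>\<parallel>v\<parallel>\<^sup>2 + 2 F\<close> constant. The curve \<open>z\<close> need not be differentiable: \<open>anti\<close> makes \<open>u s - u t\<close> orthogonal to
  \<open>z s - z t\<close>, and with the continuity of \<open>z\<close> this gives \<open>\<langle>v, z\<rangle>' = - \<langle>k, z\<rangle>\<close>.\<close>

theorem nn_integral_evolution_bound:
  fixes u v k z :: "real \<Rightarrow> 'a::real_inner" and F :: "real \<Rightarrow> real"
  assumes T: "0 \<le> T"
    and du: "\<And>t. t \<in> {0..T} \<Longrightarrow> (u has_vector_derivative v t) (at t within {0..T})"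
    and dv: "\<And>t. t \<in> {0..T} \<Longrightarrow> (v has_vector_derivative - k t) (at t within {0..T})"
    and kc: "continuous_on {0..T} k"
    and anti: "\<And>s t. s \<in> {0..T} \<Longrightarrow> t \<in> {0..T} \<Longrightarrow> inner (z s) (u t) = - inner (u s) (z t)"
    and zdiff: "\<And>s t. s \<in> {0..T} \<Longrightarrow> t \<in> {0..T} \<Longrightarrow> (norm (z s - z t))\<^sup>2 \<le> C * inner (k s - k t) (u s - u t)"
    and conv: "\<And>s t. s \<in> {0..T} \<Longrightarrow> t \<in> {0..T} \<Longrightarrow> inner (k t) (u s - u t) \<le> F s - F t"
    and zF: "\<And>t. t \<in> {0..T} \<Longrightarrow> (norm (z t))\<^sup>2 \<le> C * F t" and F: "\<And>t. t \<in> {0..T} \<Longrightarrow> 0 \<le> F t"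
    and low: "\<And>t. t \<in> {0..T} \<Longrightarrow> 0 \<le> inner (k t) (z t)" and C: "C \<ge> 0" and d: "d \<ge> 0"
  shows "(\<integral>\<^sup>+t\<in>{0..T}. ennreal (d * inner (k t) (z t)) \<partial>lborel)
    \<le> ennreal (d * ((1 + C) * ((norm (v 0))\<^sup>2 + 2 * F 0)))"
proof -
  let ?I = "{0..T}"
  let ?D = "\<lambda>s t. (u s - u t) /\<^sub>R (s - t)"
  have uc: "continuous_on ?I u" and vc: "continuous_on ?I v"
    using du dv by (meson continuous_on_eq_continuous_within has_vector_derivative_continuous)+
  have klim: "((\<lambda>s. norm (k s - k t)) \<longlongrightarrow> 0) (at t within ?I)"
    and ulim: "((\<lambda>s. norm (u s - u t)) \<longlongrightarrow> 0) (at t within ?I)" if "t \<in> ?I" for t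
    using kc uc that by (auto simp: continuous_on_def tendsto_norm_zero_iff LIM_zero_iff)
  have Dlim: "((\<lambda>s. ?D s t) \<longlongrightarrow> v t) (at t within ?I)" if "t \<in> ?I" for t
    using du[OF that] unfolding has_vector_derivative_iff_norm tendsto_norm_zero_iff by (rule LIM_zero_cancel)
  \<comment> \<open>\<open>zdiff\<close> and Cauchy-Schwarz bound the squared increment of z by the
    product of the increments of k and u, which gives continuity but no derivative.\<close>
  have zlim: "((\<lambda>s. norm (z s - z t)) \<longlongrightarrow> 0) (at t within ?I)" if t: "t \<in> ?I" for t
  proof (rule tendsto_sandwich[OF _ _ tendsto_const])
    have "((\<lambda>s. sqrt (C * (norm (k s - k t) * norm (u s - u t)))) \<longlongrightarrow> sqrt (C * (0 * 0))) (at t within ?I)"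
      by (intro tendsto_intros klim ulim t)
    then show "((\<lambda>s. sqrt (C * (norm (k s - k t) * norm (u s - u t)))) \<longlongrightarrow> 0) (at t within ?I)" by simp
    show "\<forall>\<^sub>F s in at t within ?I. norm (z s - z t) \<le> sqrt (C * (norm (k s - k t) * norm (u s - u t)))"
      unfolding eventually_at_filter
    proof (intro always_eventually allI impI)
      fix s assume "s \<in> ?I"
      then have "(norm (z s - z t))\<^sup>2 \<le> C * inner (k s - k t) (u s - u t)" using zdiff t by blast
      also have "\<dots> \<le> C * (norm (k s - k t) * norm (u s - u t))"
        using C norm_cauchy_schwarz by (rule mult_left_mono[rotated])
      finally show "norm (z s - z t) \<le> sqrt (C * (norm (k s - k t) * norm (u s - u t)))"
        by (rule real_le_rsqrt)
    qed
  qed auto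
  have zc: "continuous_on ?I z"
    using zlim by (auto simp: continuous_on_def tendsto_norm_zero_iff LIM_zero_iff)
  \<comment> \<open>The subgradient inequality at t bounds F s - F t from below, the one at s bounds
    it from above; they differ by the inner product of the increments of k and u, which is o(s -
    t).\<close>
  have dF: "(F has_real_derivative inner (k t) (v t)) (at t within ?I)" if t: "t \<in> ?I" for t
  proof -
    have "((\<lambda>s. (F s - F t) / (s - t) - inner (k t) (?D s t)) \<longlongrightarrow> 0) (at t within ?I)"
    proof (rule Lim_null_comparison)
      have "((\<lambda>s. norm (k s - k t) * norm (?D s t)) \<longlongrightarrow> 0 * norm (v t)) (at t within ?I)"
        by (intro tendsto_intros klim Dlim t)
      then show "((\<lambda>s. norm (k s - k t) * norm (?D s t)) \<longlongrightarrow> 0) (at t within ?I)" by simp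
      show "\<forall>\<^sub>F s in at t within ?I. norm ((F s - F t) / (s - t) - inner (k t) (?D s t))
          \<le> norm (k s - k t) * norm (?D s t)"
        unfolding eventually_at_filter
      proof (intro always_eventually allI impI)
        fix s assume st: "s \<noteq> t" "s \<in> ?I"
        have 1: "0 \<le> F s - F t - inner (k t) (u s - u t)" using conv[OF st(2) t] by simp
        have 2: "F s - F t - inner (k t) (u s - u t) \<le> inner (k s - k t) (u s - u t)"
          using conv[OF t st(2)] by (simp add: inner_diff_left inner_diff_right)
        have "\<bar>F s - F t - inner (k t) (u s - u t)\<bar> \<le> norm (k s - k t) * norm (u s - u t)"
          using 1 2 norm_cauchy_schwarz[of "k s - k t" "u s - u t"] by linarith
        then have "\<bar>F s - F t - inner (k t) (u s - u t)\<bar> / \<bar>s - t\<bar> \<le> norm (k s - k t) * norm (u s - u t) / \<bar>s - t\<bar>"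
          by (rule divide_right_mono) simp
        moreover have "(F s - F t) / (s - t) - inner (k t) (?D s t) = (F s - F t - inner (k t) (u s - u t)) / (s - t)"
          by (simp add: diff_divide_distrib divide_inverse mult.commute right_diff_distrib)
        moreover have "norm (?D s t) = norm (u s - u t) / \<bar>s - t\<bar>" by (simp add: divide_inverse mult.commute)
        ultimately show "norm ((F s - F t) / (s - t) - inner (k t) (?D s t)) \<le> norm (k s - k t) * norm (?D s t)"
          by simp
      qed
    qed
    from tendsto_add[OF this tendsto_inner[OF tendsto_const Dlim[OF t], of "k t"]]
    show ?thesis by (simp add: has_field_derivative_iff)
  qed
  define E where "E t = (norm (v t))\<^sup>2 + 2 * F t" for t
  have "\<exists>c. \<forall>t\<in>?I. E t = c"
  proof (rule has_derivative_zero_constant)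
    have *: "(E has_real_derivative 0) (at s within ?I)" if s: "s \<in> ?I" for s
    proof -
      have "((\<lambda>t. inner (v t) (v t)) has_vector_derivative inner (v s) (- k s) + inner (- k s) (v s)) (at s within ?I)"
        by (rule bounded_bilinear.has_vector_derivative[OF bounded_bilinear_inner dv[OF s] dv[OF s]])
      then have "((\<lambda>t. inner (v t) (v t)) has_real_derivative - 2 * inner (k s) (v s)) (at s within ?I)"
        by (simp add: has_real_derivative_iff_has_vector_derivative inner_commute)
      from DERIV_add[OF this DERIV_cmult[OF dF[OF s], of 2]] show ?thesis
        by (simp add: E_def[abs_def] power2_norm_eq_inner)
    qed
    show "(E has_derivative (\<lambda>h. 0)) (at s within ?I)" if "s \<in> ?I" for s
      unfolding lambda_zero has_field_derivative_def[symmetric] by (rule *[OF that])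
  qed simp
  then have E: "E t = E 0" if "t \<in> ?I" for t using that T by (metis atLeastAtMost_iff order_refl)
  obtain B where B: "B \<ge> 0" "\<And>t. t \<in> ?I \<Longrightarrow> norm (k t) \<le> B"
  proof -
    have "bounded (k ` ?I)" using kc by (intro compact_imp_bounded compact_continuous_image) auto
    then obtain B where "\<forall>x\<in>k ` ?I. norm x \<le> B" unfolding bounded_iff by blast
    then show ?thesis using that[of "max B 0"] by (auto simp: le_max_iff_disj)
  qed
  have vl: "norm (v s - v t) \<le> B * \<bar>s - t\<bar>" if "s \<in> ?I" "t \<in> ?I" for s t
  proof -
    have "norm (v s - v t) \<le> B * norm (s - t)"
    proof (rule differentiable_bound[of ?I v "\<lambda>t h. h *\<^sub>R - k t"])
      show "(v has_derivative (\<lambda>h. h *\<^sub>R - k r)) (at r within ?I)" if "r \<in> ?I" for r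
        using dv[OF that] by (simp add: has_vector_derivative_def)
      show "onorm (\<lambda>h. h *\<^sub>R - k r) \<le> B" if "r \<in> ?I" for r
        by (rule onorm_le) (use B(2)[OF that] in \<open>simp add: mult.commute[of B] mult_left_mono\<close>)
    qed (use that in auto)
    then show ?thesis by simp
  qed
  \<comment> \<open>v is Lipschitz because k is bounded on the compact interval, so the Taylor
    remainder of u is quadratic in s - t.\<close>
  have ul: "norm (u s - u t - (s - t) *\<^sub>R v t) \<le> \<bar>s - t\<bar> * (B * \<bar>s - t\<bar>)" if s: "s \<in> ?I" and t: "t \<in> ?I" for s t
  proof -
    let ?S = "closed_segment t s"
    have S: "?S \<subseteq> ?I" using s t by (auto simp: closed_segment_eq_real_ivl)
    have "norm (u s - u t - (s - t) *\<^sub>R v t) \<le> norm (s - t) * (B * \<bar>s - t\<bar>)"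
    proof (rule vector_differentiable_bound_linearization[of ?S u v])
      show "(u has_vector_derivative v r) (at r within ?S)" if "r \<in> ?S" for r
        using du S that has_vector_derivative_within_subset by blast
      show "norm (v r - v t) \<le> B * \<bar>s - t\<bar>" if r: "r \<in> ?S" for r
      proof -
        have "\<bar>r - t\<bar> \<le> \<bar>s - t\<bar>" using r by (auto simp: closed_segment_eq_real_ivl split: if_splits)
        then show ?thesis
          using vl[of r t] S r t B(1) by (meson mult_left_mono order_trans subsetD)
      qed
    qed auto
    then show ?thesis by simp
  qed
  define A where "A t = inner (v t) (z t)" for t
  have dA: "(A has_real_derivative - inner (k t) (z t)) (at t within ?I)" if t: "t \<in> ?I" for t
  proof -
    let ?V = "\<lambda>s. (v s - v t) /\<^sub>R (s - t)"
    let ?R = "\<lambda>s. (1 / (s - t)) * inner (v t) (z s - z t)"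
    have Vlim: "(?V \<longlongrightarrow> - k t) (at t within ?I)"
      using dv[OF t] unfolding has_vector_derivative_iff_norm tendsto_norm_zero_iff by (rule LIM_zero_cancel)
    have zl: "(z \<longlongrightarrow> z t) (at t within ?I)" using zc t by (auto simp: continuous_on_def)
    \<comment> \<open>Orthogonality of u s - u t and z s - z t replaces (s - t) v t by the Taylor
      remainder. Its quadratic size leaves a bounded multiple of the increment of z, which tends to
      0.\<close>
    have "(?R \<longlongrightarrow> 0) (at t within ?I)"
    proof (rule Lim_null_comparison)
      have "((\<lambda>s. B * norm (z s - z t)) \<longlongrightarrow> B * 0) (at t within ?I)" by (intro tendsto_intros zlim t)
      then show "((\<lambda>s. B * norm (z s - z t)) \<longlongrightarrow> 0) (at t within ?I)" by simp
      show "\<forall>\<^sub>F s in at t within ?I. norm (?R s) \<le> B * norm (z s - z t)"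
        unfolding eventually_at_filter
      proof (intro always_eventually allI impI)
        fix s assume st: "s \<noteq> t" "s \<in> ?I"
        have "inner (u s - u t) (z s - z t) = 0"
          using anti[OF st(2) st(2)] anti[OF t t] anti[OF st(2) t]
          by (simp add: inner_diff_left inner_diff_right inner_commute)
        then have "(s - t) * inner (v t) (z s - z t) = - inner (u s - u t - (s - t) *\<^sub>R v t) (z s - z t)"
          by (simp add: inner_diff_left[of "u s - u t"])
        then have "\<bar>s - t\<bar> * \<bar>inner (v t) (z s - z t)\<bar> = \<bar>inner (u s - u t - (s - t) *\<^sub>R v t) (z s - z t)\<bar>"
          by (metis abs_minus_cancel abs_mult)
        also have "\<dots> \<le> norm (u s - u t - (s - t) *\<^sub>R v t) * norm (z s - z t)"
          by (rule Cauchy_Schwarz_ineq2)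
        also have "\<dots> \<le> \<bar>s - t\<bar> * (B * \<bar>s - t\<bar>) * norm (z s - z t)"
          by (rule mult_right_mono[OF ul[OF st(2) t]]) simp
        finally have "\<bar>s - t\<bar> * \<bar>inner (v t) (z s - z t)\<bar> \<le> \<bar>s - t\<bar> * (B * \<bar>s - t\<bar> * norm (z s - z t))"
          by (simp add: mult.assoc)
        then have "\<bar>inner (v t) (z s - z t)\<bar> \<le> B * \<bar>s - t\<bar> * norm (z s - z t)"
          using st(1) by (subst (asm) mult_le_cancel_left_pos) auto
        then show "norm (?R s) \<le> B * norm (z s - z t)"
          using st(1) by (simp add: abs_mult divide_le_eq mult_ac)
      qed
    qed
    from tendsto_add[OF tendsto_inner[OF Vlim zl] this]
    have "((\<lambda>s. inner (?V s) (z s) + ?R s) \<longlongrightarrow> - inner (k t) (z t)) (at t within ?I)" by simp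
    moreover have "inner (?V s) (z s) + ?R s = (A s - A t) / (s - t)" for s
      by (simp add: A_def inner_diff_left inner_diff_right diff_divide_distrib divide_inverse
          mult.commute right_diff_distrib)
    ultimately show ?thesis by (simp add: has_field_derivative_iff)
  qed
  \<comment> \<open>Extended by 0 to be nonnegative on the whole line, as the passage from a gauge
    integral to a nonnegative Lebesgue integral requires. Measurability in time thus comes from the
    fundamental theorem of calculus.\<close>
  define f where "f t = (if t \<in> ?I then d * inner (k t) (z t) else 0)" for t
  have "(f has_integral (- d * A T - - d * A 0)) ?I"
  proof (rule fundamental_theorem_of_calculus[OF T])
    fix t assume t: "t \<in> ?I"
    show "((\<lambda>t. - d * A t) has_vector_derivative f t) (at t within ?I)"
      using DERIV_cmult[OF dA[OF t], of "- d"] t by (simp add: f_def has_real_derivative_iff_has_vector_derivative)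
  qed
  then have "(\<integral>\<^sup>+t. ennreal (indicator ?I t * f t) \<partial>lborel) = ennreal (- d * A T - - d * A 0)"
  proof (rule nn_integral_has_integral_lebesgue[rotated])
    show "0 \<le> f t" for t using low d by (simp add: f_def)
  qed
  moreover have "(\<integral>\<^sup>+t\<in>?I. ennreal (d * inner (k t) (z t)) \<partial>lborel) = (\<integral>\<^sup>+t. ennreal (indicator ?I t * f t) \<partial>lborel)"
    by (rule nn_integral_cong) (auto simp: f_def indicator_def)
  \<comment> \<open>The arithmetic-geometric mean inequality, \<open>zF\<close> and conservation of
    energy; the two endpoints together give the factor 1 + C.\<close>
  moreover have bnd: "\<bar>A t\<bar> \<le> (1 + C) / 2 * E 0" if t: "t \<in> ?I" for t
  proof -
    have "\<bar>A t\<bar> \<le> norm (v t) * norm (z t)" unfolding A_def by (rule Cauchy_Schwarz_ineq2)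
    also have "\<dots> \<le> ((norm (v t))\<^sup>2 + (norm (z t))\<^sup>2) / 2"
      using sum_squares_bound[of "norm (v t)" "norm (z t)"] by simp
    also have "\<dots> \<le> ((norm (v t))\<^sup>2 + C * F t) / 2" using zF[OF t] by simp
    also have "\<dots> \<le> (1 + C) / 2 * E t"
      using mult_nonneg_nonneg[OF C F[OF t]] F[OF t] mult_nonneg_nonneg[OF C, of "(norm (v t))\<^sup>2"]
      by (simp add: E_def field_simps)
    finally show ?thesis using E[OF t] by simp
  qed
  have "- A T - - A 0 \<le> (1 + C) * E 0"
  proof -
    have "\<bar>A T\<bar> \<le> (1 + C) / 2 * E 0" "\<bar>A 0\<bar> \<le> (1 + C) / 2 * E 0"
      by (rule bnd; use T in simp)+
    moreover have "(1 + C) / 2 * E 0 + (1 + C) / 2 * E 0 = (1 + C) * E 0" by simp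
    ultimately show ?thesis unfolding abs_le_iff by linarith
  qed
  from mult_left_mono[OF this d]
  have "- d * A T - - d * A 0 \<le> d * ((1 + C) * E 0)" by (simp add: algebra_simps)
  ultimately show ?thesis by (simp add: E_def ennreal_leI)
qed

section \<open>The Schwarzschild coefficients\<close>

locale schwarzschild =
  fixes M :: real
  assumes M: "M > 0"
begin

definition tort :: "real \<Rightarrow> real" where
  "tort r = r + 2 * M * ln ((r - 2 * M) / (2 * M))"

lemma tort_deriv:
  assumes "r > 2 * M"
  shows "(tort has_real_derivative r / (r - 2 * M)) (at r)"
  unfolding tort_def[abs_def] using assms M
  by (auto intro!: derivative_eq_intros simp: field_simps)

lemma tort_strict_mono: "2 * M < a \<Longrightarrow> a < b \<Longrightarrow> tort a < tort b"
  unfolding tort_def using M by (intro add_strict_mono mult_strict_left_mono) (auto simp: divide_strict_right_mono)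

lemma tort_surj: "\<exists>r>2 * M. tort r = s"
proof -
  define b where "b = max (4 * M) s"
  \<comment> \<open>The exponential cancels the logarithm in \<open>tort\<close>, so that
    \<open>tort a\<close> is at most 4 M + (s - 4 M); the minimum with 0 keeps a below 4 M and hence
    below b.\<close>
  define a where "a = 2 * M + 2 * M * exp (min 0 ((s - 4 * M) / (2 * M)))"
  have b: "tort b \<ge> s" "b \<ge> 4 * M"
  proof -
    show b4: "b \<ge> 4 * M" by (simp add: b_def)
    have "ln ((b - 2 * M) / (2 * M)) \<ge> 0" using b4 M by (intro ln_ge_zero) (simp add: field_simps)
    then have "tort b \<ge> b" using M by (simp add: tort_def)
    then show "tort b \<ge> s" by (simp add: b_def)
  qed
  have a: "tort a \<le> s" "a > 2 * M" "a \<le> 4 * M"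
  proof -
    show "a > 2 * M" using M by (simp add: a_def)
    have "exp (min 0 ((s - 4 * M) / (2 * M))) \<le> 1" by simp
    then have "2 * M * exp (min 0 ((s - 4 * M) / (2 * M))) \<le> 2 * M * 1" using M by (intro mult_left_mono) auto
    then show a4: "a \<le> 4 * M" by (simp add: a_def)
    have "tort a = a + 2 * M * min 0 ((s - 4 * M) / (2 * M))" using M by (simp add: tort_def a_def)
    also have "\<dots> \<le> 4 * M + 2 * M * ((s - 4 * M) / (2 * M))" using a4 M by (intro add_mono mult_left_mono) auto
    also have "\<dots> = s" using M by simp
    finally show "tort a \<le> s" .
  qed
  have "\<exists>r. a \<le> r \<and> r \<le> b \<and> tort r = s"
  proof (rule IVT[where f = tort, OF a(1) b(1)])
    show "a \<le> b" using a b by simp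
    show "\<forall>r. a \<le> r \<and> r \<le> b \<longrightarrow> isCont tort r"
      using a(2) by (auto intro!: DERIV_isCont[OF tort_deriv])
  qed
  then obtain r where "a \<le> r" "tort r = s" by blast
  then show ?thesis using a(2) by (intro exI[of _ r]) simp
qed

lemma tort_ex1: "\<exists>!r. 2 * M < r \<and> s = tort r"
  using tort_surj[of s] tort_strict_mono by (metis linorder_neqE_linordered_idom order_less_irrefl)

lemma r_of: "2 * M < r_of M s" "tort (r_of M s) = s"
  using theI'[OF tort_ex1[of s]] by (simp_all add: r_of_def tort_def)

lemma r_of_tort: "2 * M < r \<Longrightarrow> r_of M (tort r) = r"
  using r_of tort_ex1 by blast

lemma r_of_strict_mono: "a < b \<Longrightarrow> r_of M a < r_of M b"
  using tort_strict_mono[of "r_of M b" "r_of M a"] r_of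
  by (metis linorder_neqE_linordered_idom order_less_asym order_less_irrefl)

lemma r_of_deriv: "(r_of M has_real_derivative lapse M s) (at s)"
proof -
  define r where "r = r_of M s"
  have r: "r > 2 * M" "tort r = s" using r_of by (simp_all add: r_def)
  have "(r_of M has_derivative (*) (inverse (r / (r - 2 * M)))) (at (tort r))"
  proof (rule has_derivative_inverse_strong[of "{2 * M<..}" r tort "r_of M" "(*) (r / (r - 2 * M))"])
    show "(tort has_derivative (*) (r / (r - 2 * M))) (at r)"
      using tort_deriv[OF r(1)] by (simp add: has_field_derivative_def)
    show "continuous_on {2 * M<..} tort"
      using tort_deriv by (auto intro!: continuous_at_imp_continuous_on DERIV_isCont)
    show "(*) (r / (r - 2 * M)) \<circ> (*) (inverse (r / (r - 2 * M))) = id"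
    proof
      fix x
      have "r / (r - 2 * M) \<noteq> 0" using r M by simp
      then have "r / (r - 2 * M) * inverse (r / (r - 2 * M)) = 1" by (rule right_inverse)
      then show "((*) (r / (r - 2 * M)) \<circ> (*) (inverse (r / (r - 2 * M)))) x = id x"
        unfolding o_def mult.assoc[symmetric] by simp
    qed
  qed (use r r_of_tort in auto)
  then have "(r_of M has_real_derivative inverse (r / (r - 2 * M))) (at (tort r))"
    by (simp add: has_field_derivative_def)
  moreover have "inverse (r / (r - 2 * M)) = lapse M s"
    using r M by (simp add: lapse_def r_def[symmetric] field_simps)
  ultimately show ?thesis using r by simp
qed

text \<open>With \<open>q = 1 / r\<close> all coefficients are polynomials in \<open>q\<close>, and \<open>q' = - q\<^sup>2 (1 - 2 M q)\<close>.\<close>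

definition q :: "real \<Rightarrow> real" where "q s = 1 / r_of M s"

lemma q_pos: "q s > 0" and q_less: "2 * M * q s < 1"
proof -
  show "q s > 0" using r_of(1)[of s] M by (simp add: q_def)
  then show "2 * M * q s < 1" using r_of(1)[of s] M by (simp add: q_def field_simps)
qed

lemma lapse_q: "lapse M s = 1 - 2 * M * q s"
  by (simp add: lapse_def q_def)

lemma potV_q: "potV M s = 2 * M * q s ^ 3 * (1 - 2 * M * q s)"
  by (simp add: potV_def q_def lapse_def power_one_over)

lemma potL_q: "potL M s = q s ^ 2 * (1 - 2 * M * q s)"
  by (simp add: potL_def q_def lapse_def power_one_over)

lemma q_deriv: "(q has_real_derivative - (q s)\<^sup>2 * (1 - 2 * M * q s)) (at s)"
proof -
  have r: "r_of M s \<noteq> 0" using r_of(1)[of s] M by simp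
  have "(q has_real_derivative - lapse M s / (r_of M s * r_of M s)) (at s)"
    unfolding q_def[abs_def] using r r_of_deriv by (auto intro!: derivative_eq_intros)
  then show ?thesis
    by (rule DERIV_cong) (simp add: lapse_q q_def power2_eq_square divide_inverse algebra_simps)
qed

text \<open>The derivative of q is a polynomial in q, so each derivative gained for q yields the
  next one.\<close>

lemma Ck_q: "Ck n q"
proof (induction n)
  case (Suc n)
  have "Ck n (\<lambda>s. - 1 * (q s * q s) * (1 + - 2 * M * q s))"
    by (intro Ck_mult Ck_add Ck_const Suc)
  then have "Ck n (\<lambda>s. - (q s)\<^sup>2 * (1 - 2 * M * q s))" by (simp add: power2_eq_square)
  then show ?case 
    unfolding Ck.simps using q_deriv by (intro exI[of _ "\<lambda>s. - (q s)\<^sup>2 * (1 - 2 * M * q s)"]) blast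
qed simp

lemma smooth1_q: "smooth1 q"
  by (simp add: smooth1_def Ck_q)

lemma q_continuous: "continuous_on A q"
  by (rule smooth1_continuous[OF smooth1_q])

lemma smooth1_potL: "smooth1 (potL M)"
proof -
  have "smooth1 (\<lambda>s. q s * q s * (1 - 2 * M * q s))"
    by (intro smooth1_mult smooth1_diff smooth1_scale smooth1_const smooth1_q)
  then show ?thesis by (simp add: potL_q[abs_def] power2_eq_square)
qed

lemma potL_deriv: "(potL M has_real_derivative - 2 * q s ^ 3 * (1 - 2 * M * q s) * (1 - 3 * M * q s)) (at s)"
proof -
  have "((\<lambda>s. q s ^ 2 * (1 - 2 * M * q s)) has_real_derivative
      - 2 * q s ^ 3 * (1 - 2 * M * q s) * (1 - 3 * M * q s)) (at s)"
    by (auto intro!: derivative_eq_intros q_deriv simp: power2_eq_square power3_eq_cube algebra_simps)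
  then show ?thesis by (simp add: potL_q[abs_def])
qed

lemma deriv_potL: "deriv (potL M) = (\<lambda>s. - 2 * q s ^ 3 * (1 - 2 * M * q s) * (1 - 3 * M * q s))"
  using potL_deriv DERIV_imp_deriv by blast

lemma deriv2_potL: "deriv (deriv (potL M)) s
  = q s ^ 2 * (1 - 2 * M * q s) * (2 * q s ^ 2 * (3 - 20 * M * q s + 30 * M\<^sup>2 * (q s)\<^sup>2))"
  unfolding deriv_potL
proof (rule DERIV_imp_deriv)
  show "((\<lambda>s. - 2 * q s ^ 3 * (1 - 2 * M * q s) * (1 - 3 * M * q s)) has_real_derivative
    q s ^ 2 * (1 - 2 * M * q s) * (2 * q s ^ 2 * (3 - 20 * M * q s + 30 * M\<^sup>2 * (q s)\<^sup>2))) (at s)"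
    by (rule derivative_eq_intros q_deriv refl | simp)+ (simp add: eval_nat_numeral algebra_simps)
qed

lemma potV_deriv: "(potV M has_real_derivative
  - 2 * M * q s ^ 4 * (1 - 2 * M * q s) * (3 - 8 * M * q s)) (at s)"
proof -
  have "((\<lambda>s. 2 * M * q s ^ 3 * (1 - 2 * M * q s)) has_real_derivative
      - 2 * M * q s ^ 4 * (1 - 2 * M * q s) * (3 - 8 * M * q s)) (at s)"
    by (rule derivative_eq_intros q_deriv refl | simp)+ (simp add: eval_nat_numeral algebra_simps)
  then show ?thesis by (simp add: potV_q[abs_def])
qed

lemma alpha_star_tort: "alpha_star M = tort (3 * M)"
  using M by (simp add: alpha_star_def tort_def)

lemma r_of_alpha: "r_of M (alpha_star M) = 3 * M"
  unfolding alpha_star_tort using M by (intro r_of_tort) simp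

lemma q_sign:
  "s > alpha_star M \<Longrightarrow> 3 * M * q s < 1" "s < alpha_star M \<Longrightarrow> 3 * M * q s > 1" "3 * M * q (alpha_star M) = 1"
  using r_of_strict_mono[of "alpha_star M" s] r_of_strict_mono[of s "alpha_star M"] r_of(1)[of s] M
  by (simp_all add: q_def r_of_alpha)

end

section \<open>The multiplier\<close>

text \<open>For x >= 1 the integrand is at most x^(-2a). Adding x^(1-2a) / (2a - 1), whose
  derivative is -x^(-2a), therefore gives a nonincreasing function that lies above Y.\<close>

lemma increasing_primitive_bounded_above:
  assumes Y: "\<And>x. (Y has_real_derivative (1 + x\<^sup>2) powr (- a)) (at x)" and a: "a > 1 / 2"
  shows "\<exists>G. \<forall>x. Y x \<le> G"
proof -
  let ?h = "\<lambda>x. Y x + x powr (1 - 2 * a) / (2 * a - 1)"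
  have mono: "Y x \<le> Y y" if "x \<le> y" for x y
    by (rule DERIV_nonneg_imp_nondecreasing[OF that]) (use Y powr_ge_zero in blast)
  have dec: "?h x \<le> ?h 1" if x: "x \<ge> 1" for x
  proof (rule DERIV_nonpos_imp_nonincreasing[OF x])
    fix y assume y: "1 \<le> y" "y \<le> x"
    have "(?h has_real_derivative (1 + y\<^sup>2) powr (- a) + (1 - 2 * a) * y powr (1 - 2 * a - 1) / (2 * a - 1)) (at y)"
      using y by (intro DERIV_add Y DERIV_cdivide has_real_derivative_powr) auto
    moreover have "(1 - 2 * a) * y powr (1 - 2 * a - 1) / (2 * a - 1) = - (y powr (- 2 * a))"
      using a by (simp add: field_simps)
    moreover have "(1 + y\<^sup>2) powr (- a) \<le> (y\<^sup>2) powr (- a)"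
      using y a by (intro powr_mono2') auto
    moreover have "(y\<^sup>2) powr (- a) = y powr (- 2 * a)"
      using y by (simp add: powr_powr flip: powr_numeral)
    ultimately show "\<exists>d. (?h has_real_derivative d) (at y) \<and> d \<le> 0" by fastforce
  qed
  have "Y x \<le> ?h 1" for x
  proof (cases "x \<ge> 1")
    case True
    have "Y x \<le> ?h x" using a by simp
    then show ?thesis using dec[OF True] by simp
  next
    case False
    then show ?thesis using mono[of x 1] a by (simp add: add_increasing2)
  qed
  then show ?thesis by blast
qed

lemma primitive_bounded:
  assumes Y: "\<And>x. (Y has_real_derivative (1 + x\<^sup>2) powr (- a)) (at x)" and a: "a > 1 / 2"
  shows "\<exists>G. \<forall>x. \<bar>Y x\<bar> \<le> G"
proof -
  obtain G1 where G1: "\<And>x. Y x \<le> G1" using increasing_primitive_bounded_above[OF assms] by blast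
  have "((\<lambda>x. - Y (- x)) has_real_derivative (1 + x\<^sup>2) powr (- a)) (at x)" for x
  proof -
    have "((\<lambda>x. Y (- x)) has_real_derivative (1 + (- x)\<^sup>2) powr (- a) * (-1)) (at x)"
      by (rule DERIV_chain2[OF Y]) (auto intro!: derivative_eq_intros)
    from DERIV_minus[OF this] show ?thesis by simp
  qed
  then obtain G2 where G2: "\<And>x. - Y (- x) \<le> G2" using increasing_primitive_bounded_above[OF _ a] by blast
  have "\<bar>Y x\<bar> \<le> max G1 G2" for x using G1[of x] G2[of "- x"] by (auto simp: abs_le_iff le_max_iff_disj)
  then show ?thesis by blast
qed

locale multiplier = schwarzschild +
  fixes a :: real and Y :: "real \<Rightarrow> real"
  assumes a: "a > 1 / 2" and Y: "(Y has_real_derivative (1 + x\<^sup>2) powr (- a)) (at x)" and Y0: "Y 0 = 0"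
begin

definition m :: real where "m = 1 / (2 * M)"
definition xs :: "real \<Rightarrow> real" where "xs s = (s - alpha_star M) / (2 * M)"
definition ps :: "real \<Rightarrow> real" where "ps s = 1 + (xs s)\<^sup>2"
definition t :: "real \<Rightarrow> real" where "t s = M * q s"
definition W :: "real \<Rightarrow> real" where "W s = q s ^ 4 * (1 - 2 * M * q s)"

lemma m: "m > 0" using M by (simp add: m_def)
lemma ps_ge: "ps s \<ge> 1" and ps_pos: "ps s > 0" by (simp_all add: ps_def add_pos_nonneg)
lemma t_bounds: "t s > 0" "2 * t s < 1" using q_pos q_less M by (simp_all add: t_def mult.assoc)
lemma W_pos: "W s > 0" using q_pos[of s] q_less[of s] by (simp add: W_def)
lemma W_nonneg: "W s \<ge> 0" using W_pos less_imp_le by blast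

lemma xs_deriv: "(xs has_real_derivative m) (at s)"
  unfolding xs_def[abs_def] m_def using M by (auto intro!: derivative_eq_intros)

lemma ps_deriv: "(ps has_real_derivative 2 * xs s * m) (at s)"
  unfolding ps_def[abs_def] by (auto intro!: derivative_eq_intros xs_deriv)

lemma ps_powr_deriv: "((\<lambda>s. ps s powr b) has_real_derivative b * ps s powr (b - 1) * (2 * xs s * m)) (at s)"
  using DERIV_fun_powr[OF ps_deriv ps_pos, of b s] by simp

lemma xs_cont: "continuous_on A xs" by (rule deriv_continuous_on[OF xs_deriv])
lemma ps_cont: "continuous_on A ps" by (rule deriv_continuous_on[OF ps_deriv])
lemma ps_powr_cont: "continuous_on A (\<lambda>s. ps s powr b)" by (rule deriv_continuous_on[OF ps_powr_deriv])

text \<open>The smallest power that occurs. Writing the others as w times a polynomial in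
  \<open>ps\<close> turns the identities for the second multiplier into polynomial algebra.\<close>

definition w :: "real \<Rightarrow> real" where "w s = ps s powr (- a - 2)"

lemma w_powr: "ps s powr (- a - 1) = w s * ps s" "ps s powr (- a) = w s * (ps s)\<^sup>2"
proof -
  have e: "- a - 2 + 1 = - a - 1" "- a - 2 + 2 = - a" by simp_all
  have "ps s powr (- a - 2) * ps s powr 1 = ps s powr (- a - 1)"
    unfolding powr_add[symmetric] e ..
  moreover have "ps s powr (- a - 2) * ps s powr 2 = ps s powr (- a)"
    unfolding powr_add[symmetric] e ..
  ultimately show "ps s powr (- a - 1) = w s * ps s" "ps s powr (- a) = w s * (ps s)\<^sup>2"
    using ps_pos[of s] by (simp_all add: w_def)
qed

lemma w_pos: "w s > 0" using ps_pos[of s] by (simp add: w_def)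

lemma w_le_1: "w s \<le> 1"
  using powr_mono2'[of "- a - 2" 1 "ps s"] a ps_ge[of s] by (simp add: w_def)

text \<open>The suffix \<open>A\<close> marks the multiplier \<open>1 - 3 M / r\<close>, which controls the cubic term and bounded \<open>s\<close>, and
  the suffix \<open>B\<close> the multiplier \<open>Y\<close>, which gives the decay weight at infinity; \<open>b\<close> and \<open>e\<close> are the Hardy
  weights of each, and \<open>VV1\<close> is \<open>V'\<close>. The number 13/10 in \<open>bA\<close> makes the quadratic in \<open>lower_A\<close> positive.\<close>

definition gA :: "real \<Rightarrow> real" where "gA s = 1 - 3 * M * q s"
definition gA1 :: "real \<Rightarrow> real" where "gA1 s = 3 * M * q s ^ 2 * (1 - 2 * M * q s)"
definition gA2 :: "real \<Rightarrow> real" where "gA2 s = - 6 * M * q s ^ 3 * (1 - 3 * M * q s) * (1 - 2 * M * q s)"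
definition gA3 :: "real \<Rightarrow> real" where
  "gA3 s = 6 * M * q s ^ 4 * (1 - 2 * M * q s) * (3 - 20 * M * q s + 30 * M\<^sup>2 * (q s)\<^sup>2)"
definition bA :: "real \<Rightarrow> real" where
  "bA s = 3 * M * q s ^ 2 * (1 - 2 * M * q s) * (- q s / 2 + 13 / 10 * M * (q s)\<^sup>2)"
definition bA1 :: "real \<Rightarrow> real" where
  "bA1 s = 3 * M * q s ^ 4 * (1 - 2 * M * q s) * (3 / 2 - 92 / 10 * M * q s + 13 * M\<^sup>2 * (q s)\<^sup>2)"
definition eA :: "real \<Rightarrow> real" where
  "eA s = 3 * M * q s ^ 2 * (1 - 2 * M * q s) * (- q s / 2 + 13 / 10 * M * (q s)\<^sup>2)\<^sup>2"
definition VV1 :: "real \<Rightarrow> real" where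
  "VV1 s = - 2 * M * q s ^ 4 * (1 - 2 * M * q s) * (3 - 8 * M * q s)"

lemma gA_deriv: "(gA has_real_derivative gA1 s) (at s)"
  unfolding gA_def[abs_def] gA1_def by (auto intro!: derivative_eq_intros q_deriv)

lemma gA1_deriv: "(gA1 has_real_derivative gA2 s) (at s)"
  unfolding gA1_def[abs_def] gA2_def
  by (rule derivative_eq_intros q_deriv refl | simp)+ (simp add: eval_nat_numeral algebra_simps)

lemma gA2_deriv: "(gA2 has_real_derivative gA3 s) (at s)"
  unfolding gA2_def[abs_def] gA3_def
  by (rule derivative_eq_intros q_deriv refl | simp)+ (simp add: eval_nat_numeral algebra_simps)

lemma bA_deriv: "(bA has_real_derivative bA1 s) (at s)"
  unfolding bA_def[abs_def] bA1_def
  by (rule derivative_eq_intros q_deriv refl | simp)+ (simp add: eval_nat_numeral field_simps)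

text \<open>In the variable t = M / r the coefficient is M W times a quadratic with minimum about
  0.036 at t = 535/1293, which lies in the admissible range 0 < t < 1/2. The constant 3/100 sits
  just below that minimum.\<close>

lemma lower_A: "bA1 s - eA s - gA3 s / 4 - VV1 s * gA s / 2 \<ge> 3 / 100 * M * W s"
proof -
  have e: "bA1 s - eA s - gA3 s / 4 - VV1 s * gA s / 2
      = M * W s * (9 / 4 - 107 / 10 * t s + 1293 / 100 * (t s)\<^sup>2)"
    by (simp add: bA1_def eA_def gA3_def VV1_def gA_def W_def t_def eval_nat_numeral field_simps)
  have "9 / 4 - 107 / 10 * t s + 1293 / 100 * (t s)\<^sup>2 - 3 / 100
      = 1293 / 100 * (t s - 535 / 1293)\<^sup>2 + (222 / 100 - 535 * 535 / 129300)"
    by (simp add: power2_eq_square field_simps)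
  moreover have "0 \<le> 1293 / 100 * (t s - 535 / 1293)\<^sup>2" by simp
  ultimately have "9 / 4 - 107 / 10 * t s + 1293 / 100 * (t s)\<^sup>2 \<ge> 3 / 100" by linarith
  from mult_left_mono[OF this, of "M * W s"]
  have "M * W s * (3 / 100) \<le> M * W s * (9 / 4 - 107 / 10 * t s + 1293 / 100 * (t s)\<^sup>2)"
    using M W_nonneg[of s] by simp
  moreover have "3 / 100 * M * W s = M * W s * (3 / 100)" by simp
  ultimately show ?thesis unfolding e by (simp only:)
qed

section \<open>The multiplier that gives the decay weight\<close>

definition gB :: "real \<Rightarrow> real" where "gB s = Y (xs s)"
definition gB1 :: "real \<Rightarrow> real" where "gB1 s = m * ps s powr (- a)"
definition gB2 :: "real \<Rightarrow> real" where "gB2 s = - 2 * m\<^sup>2 * a * xs s * ps s powr (- a - 1)"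
definition gB3 :: "real \<Rightarrow> real" where
  "gB3 s = m ^ 3 * w s * (- 2 * a * ps s + 4 * a * (a + 1) * (xs s)\<^sup>2)"
definition bB :: "real \<Rightarrow> real" where "bB s = - a * m\<^sup>2 * xs s * ps s powr (- a - 1)"
definition bB1 :: "real \<Rightarrow> real" where
  "bB1 s = - a * m ^ 3 * w s * (ps s - 2 * (a + 1) * (xs s)\<^sup>2)"
definition eB :: "real \<Rightarrow> real" where "eB s = a\<^sup>2 * m ^ 3 * (xs s)\<^sup>2 * w s"

lemma gB_deriv: "(gB has_real_derivative gB1 s) (at s)"
  using DERIV_chain2[OF Y xs_deriv, of s] by (simp add: gB_def[abs_def] gB1_def ps_def mult.commute)

lemma gB1_deriv: "(gB1 has_real_derivative gB2 s) (at s)"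
  using DERIV_cmult[OF ps_powr_deriv, of m "- a" s]
  by (simp add: gB1_def[abs_def] gB2_def power2_eq_square mult_ac)

lemma xs_powr_deriv: "((\<lambda>s. xs s * ps s powr (- a - 1)) has_real_derivative
    m * w s * (ps s - 2 * (a + 1) * (xs s)\<^sup>2)) (at s)"
proof -
  have e: "- a - 1 - 1 = - a - 2" by simp
  have "((\<lambda>s. xs s * ps s powr (- a - 1)) has_real_derivative
      m * ps s powr (- a - 1) + ((- a - 1) * ps s powr (- a - 1 - 1) * (2 * xs s * m)) * xs s) (at s)"
    by (rule DERIV_mult[OF xs_deriv ps_powr_deriv])
  then show ?thesis
    unfolding w_powr e unfolding w_def[symmetric]
    by (rule DERIV_cong) (simp add: power2_eq_square algebra_simps)
qed

lemma gB2_deriv: "(gB2 has_real_derivative gB3 s) (at s)"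
proof -
  have "gB2 = (\<lambda>s. (- 2 * m\<^sup>2 * a) * (xs s * ps s powr (- a - 1)))" by (simp add: gB2_def fun_eq_iff)
  then show ?thesis
    using DERIV_cmult[OF xs_powr_deriv, of "- 2 * m\<^sup>2 * a" s]
    by (simp add: gB3_def eval_nat_numeral algebra_simps)
qed

lemma bB_deriv: "(bB has_real_derivative bB1 s) (at s)"
proof -
  have "bB = (\<lambda>s. (- a * m\<^sup>2) * (xs s * ps s powr (- a - 1)))" by (simp add: bB_def fun_eq_iff)
  then show ?thesis
    using DERIV_cmult[OF xs_powr_deriv, of "- a * m\<^sup>2" s]
    by (simp add: bB1_def eval_nat_numeral algebra_simps)
qed

text \<open>Here \<open>bB\<close> is half of \<open>gB2\<close> and \<open>eB\<close> is
  \<open>gB2\<close> squared over 4 \<open>gB1\<close>, so the sum equals \<open>gB3\<close> / 4 -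
  \<open>eB\<close>: the third derivative now enters with a favourable sign for large |x|, and the
  sum is negative only for |x| < 1.\<close>

lemma lower_B: "bB1 s - eB s - gB3 s / 4 = m ^ 3 * w s * (a / 2) * ((xs s)\<^sup>2 - 1)"
  by (simp add: bB1_def eB_def gB3_def ps_def power2_eq_square field_simps)

lemma Y_sign: "x > 0 \<Longrightarrow> Y x > 0" "x < 0 \<Longrightarrow> Y x < 0"
proof -
  have p: "(1 + x\<^sup>2) powr (- a) > 0" for x :: real
    using add_pos_nonneg[OF zero_less_one zero_le_power2[of x]] by simp
  show "Y x > 0" if "x > 0" using DERIV_pos_imp_increasing[OF that, of Y] Y p Y0 by metis
  show "Y x < 0" if "x < 0" using DERIV_pos_imp_increasing[OF that, of Y] Y p Y0 by metis
qed

lemma gB_sign: "3 * t s < 1 \<Longrightarrow> gB s > 0" "3 * t s > 1 \<Longrightarrow> gB s < 0" "3 * t s = 1 \<Longrightarrow> gB s = 0"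
proof -
  have x: "xs s > 0 \<longleftrightarrow> s > alpha_star M" "xs s < 0 \<longleftrightarrow> s < alpha_star M"
    using M by (auto simp: xs_def zero_less_divide_iff divide_less_0_iff)
  have z: "xs (alpha_star M) = 0" by (simp add: xs_def)
  consider "s > alpha_star M" | "s < alpha_star M" | "s = alpha_star M" by linarith
  then have "(3 * t s < 1 \<and> gB s > 0) \<or> (3 * t s > 1 \<and> gB s < 0) \<or> (3 * t s = 1 \<and> gB s = 0)"
    using q_sign(1,2)[of s] q_sign(3) Y_sign[of "xs s"] x z Y0 by cases (auto simp: t_def gB_def mult.assoc)
  then show "3 * t s < 1 \<Longrightarrow> gB s > 0" "3 * t s > 1 \<Longrightarrow> gB s < 0" "3 * t s = 1 \<Longrightarrow> gB s = 0" by auto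
qed

lemma gB_trap: "(1 - 3 * t s) * gB s \<ge> 0"
proof -
  consider "3 * t s < 1" | "3 * t s = 1" | "3 * t s > 1" by linarith
  then show ?thesis
    using gB_sign[of s] by cases (auto intro!: mult_nonneg_nonneg mult_nonpos_nonpos)
qed

text \<open>The product is M W (3 - 8 t) \<open>gB\<close>, and \<open>gB\<close> has the sign of 1
  - 3 t. Hence it is negative only for t between 1/3 and 3/8, where 3 - 8 t is at most 1/3.\<close>

lemma VgB: assumes G: "\<And>s. \<bar>gB s\<bar> \<le> G" shows "- VV1 s * gB s / 2 \<ge> - (G / 3) * (M * W s)"
proof -
  have e: "- VV1 s * gB s / 2 = M * W s * ((3 - 8 * t s) * gB s)"
    by (simp add: VV1_def W_def t_def field_simps)
  have "(3 - 8 * t s) * gB s \<ge> - (G / 3)"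
  proof (cases "3 * t s \<ge> 1 \<and> 8 * t s \<le> 3")
    case True
    have "\<bar>(3 - 8 * t s) * gB s\<bar> \<le> 1 / 3 * G"
      unfolding abs_mult by (rule mult_mono) (use True G in auto)
    then show ?thesis by linarith
  next
    case False
    then consider "3 * t s < 1" | "3 * t s > 1" "8 * t s > 3" by linarith
    then have "(3 - 8 * t s) * gB s \<ge> 0"
      using gB_sign[of s] by cases (auto intro!: mult_nonneg_nonneg mult_nonpos_nonpos)
    moreover have "G \<ge> 0" using G[of s] by linarith
    ultimately show ?thesis by simp
  qed
  from mult_left_mono[OF this, of "M * W s"] show ?thesis
    unfolding e using M W_nonneg[of s] by (simp add: mult_ac)
qed

lemma W_cont: "continuous_on A W"
  unfolding W_def[abs_def] by (intro continuous_intros q_continuous)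

lemma compact_lower:
  fixes f :: "real \<Rightarrow> real"
  assumes f: "continuous_on UNIV f" "\<And>s. f s > 0"
  shows "\<exists>\<kappa>>0. \<forall>s. (xs s)\<^sup>2 < R \<longrightarrow> \<kappa> \<le> f s"
proof -
  let ?S = "{alpha_star M - 2 * M * (\<bar>R\<bar> + 1)..alpha_star M + 2 * M * (\<bar>R\<bar> + 1)}"
  have ne: "?S \<noteq> {}" using M by (auto simp: mult_nonneg_nonneg intro!: order_trans[of _ "alpha_star M"])
  obtain z where z: "z \<in> ?S" "\<And>y. y \<in> ?S \<Longrightarrow> f z \<le> f y"
    using continuous_attains_inf[OF compact_Icc ne continuous_on_subset[OF f(1)]] by blast
  have "s \<in> ?S" if "(xs s)\<^sup>2 < R" for s
  proof -
    have "\<bar>xs s\<bar> \<le> 1 + (xs s)\<^sup>2" using abs_mult_le_squares[of 1 "xs s"] by simp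
    then have "\<bar>xs s\<bar> \<le> \<bar>R\<bar> + 1" using that by linarith
    then have "\<bar>s - alpha_star M\<bar> \<le> 2 * M * (\<bar>R\<bar> + 1)"
      using M by (simp add: xs_def abs_divide divide_le_eq mult_ac)
    then show ?thesis by (auto simp: abs_le_iff)
  qed
  then show ?thesis using f(2)[of z] z(2) by blast
qed

theorem multiplier_exists:
  assumes \<beta>: "\<beta> = a + 1"
  shows "\<exists>V1 g g1 g2 g3 b b1 e c c1 K \<delta>. \<delta> > 0 \<and> morawetz_op (potV M) (potL M) V1 g g1 g2 g3 b b1 e c c1
    (\<lambda>s. \<delta> * ps s powr (- \<beta>)) (\<lambda>s. 5 / 8 * M * W s) K"
proof -
  obtain G where G: "\<And>s. \<bar>gB s\<bar> \<le> G" using primitive_bounded[OF Y a] unfolding gB_def by blast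
  have G0: "G \<ge> 0" using G[of 0] by linarith
  \<comment> \<open>Half of the 3/100 from \<open>lower_A\<close> is used here; the other half pays
    for the loss in \<open>VgB\<close>. The radius 3 is where (xs s)^2 - 1 reaches ps s / 2, so
    beyond it \<open>lower_B\<close> alone yields the weight.\<close>
  obtain \<kappa> where \<kappa>: "\<kappa> > 0" "\<And>s. (xs s)\<^sup>2 < 3 \<Longrightarrow> 3 / 200 * M * W s \<ge> \<kappa>"
  proof -
    have "continuous_on UNIV (\<lambda>s. 3 / 200 * M * W s)" by (intro continuous_intros W_cont)
    moreover have "3 / 200 * M * W s > 0" for s using M W_pos[of s] by simp
    ultimately show ?thesis using compact_lower[of "\<lambda>s. 3 / 200 * M * W s" 3] that by blast
  qed
  \<comment> \<open>The first entry keeps the loss of \<open>VgB\<close> below 3/200; the second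
    keeps the negative part of \<open>lower_B\<close>, which is at most m^3 a / 2 because w <= 1,
    below \<kappa> / 2.\<close>
  define \<epsilon> where "\<epsilon> = min (9 / 200 / (G + 1)) (\<kappa> / (m ^ 3 * a))"
  \<comment> \<open>First entry: what remains of \<kappa> inside the radius. Second entry: the
    coefficient that \<open>lower_B\<close> gives outside.\<close>
  define \<delta> where "\<delta> = min (\<kappa> / 2) (\<epsilon> * m ^ 3 * a / 4)"
  have ma: "m ^ 3 * a > 0" using m a by simp
  have \<epsilon>: "\<epsilon> > 0" "\<epsilon> * (G / 3) \<le> 3 / 200" "\<epsilon> * (m ^ 3 * a / 2) \<le> \<kappa> / 2"
  proof -
    show e: "\<epsilon> > 0" using G0 \<kappa>(1) ma by (simp add: \<epsilon>_def)
    have "\<epsilon> * (G / 3) \<le> 9 / 200 / (G + 1) * (G / 3)" unfolding \<epsilon>_def using G0 by (intro mult_right_mono) auto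
    also have "\<dots> \<le> 3 / 200" using G0 by (simp add: divide_simps)
    finally show "\<epsilon> * (G / 3) \<le> 3 / 200" .
    have "\<epsilon> * (m ^ 3 * a / 2) \<le> \<kappa> / (m ^ 3 * a) * (m ^ 3 * a / 2)"
      unfolding \<epsilon>_def using ma by (intro mult_right_mono) auto
    then show "\<epsilon> * (m ^ 3 * a / 2) \<le> \<kappa> / 2" using ma m a by simp
  qed
  have \<delta>: "\<delta> > 0" "\<delta> \<le> \<kappa> / 2" "\<delta> \<le> \<epsilon> * m ^ 3 * a / 4"
    using \<kappa>(1) \<epsilon>(1) ma m a by (auto simp: \<delta>_def)
  \<comment> \<open>The second Hardy weight is c = - \<eta> m x / (1 + x^2). Then c' - c^2 behaves
    like \<eta> (1 - \<eta>) m^2 / x^2 at infinity, which dominates the square of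
    \<open>gB1\<close>, but it is negative near x = 0, where V >= v compensates. The bound 5 is
    where x^2 / 2 - 1 reaches (1 + x^2) / 4.\<close>
  obtain v where v: "v > 0" "\<And>s. (xs s)\<^sup>2 < 5 \<Longrightarrow> potV M s \<ge> v"
  proof -
    have "potV M s > 0" for s using M q_pos[of s] q_less[of s] by (simp add: potV_q)
    then show ?thesis using compact_lower[OF deriv_continuous_on[OF potV_deriv], of 5] that by blast
  qed
  \<comment> \<open>The negative part of c' - c^2 is at most m^2 \<eta>, hence at most v / 2; \<eta>
    <= 1/2 keeps its leading coefficient 1 - \<eta> away from 0.\<close>
  define \<eta> where "\<eta> = min (1 / 2) (v / (2 * m\<^sup>2))"
  have \<eta>: "\<eta> > 0" "\<eta> \<le> 1 / 2" "m\<^sup>2 * \<eta> \<le> v / 2"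
  proof -
    show "\<eta> > 0" "\<eta> \<le> 1 / 2" using v m by (auto simp: \<eta>_def)
    have "m\<^sup>2 * \<eta> \<le> m\<^sup>2 * (v / (2 * m\<^sup>2))" unfolding \<eta>_def by (intro mult_left_mono) auto
    then show "m\<^sup>2 * \<eta> \<le> v / 2" using m by simp
  qed
  define c where "c s = - (\<eta> * m) * (xs s * ps s powr (- 1))" for s
  define c1 where "c1 s = - (\<eta> * m\<^sup>2) * ((1 - (xs s)\<^sup>2) / (ps s)\<^sup>2)" for s
  have dc: "(c has_real_derivative c1 s) (at s)" for s
  proof -
    have "((\<lambda>s. xs s / ps s) has_real_derivative (m * ps s - xs s * (2 * xs s * m)) / (ps s * ps s)) (at s)"
      by (rule DERIV_divide[OF xs_deriv ps_deriv]) (use ps_pos[of s] in simp)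
    from DERIV_cmult[OF this, of "- (\<eta> * m)"]
    have "((\<lambda>s. - (\<eta> * m) * (xs s / ps s)) has_real_derivative
        - (\<eta> * m) * ((m * ps s - xs s * (2 * xs s * m)) / (ps s * ps s))) (at s)" .
    moreover have "(\<lambda>s. - (\<eta> * m) * (xs s / ps s)) = c"
      using ps_pos by (simp add: c_def fun_eq_iff powr_minus divide_inverse abs_of_pos[OF ps_pos])
    moreover have "- (\<eta> * m) * ((m * ps s - xs s * (2 * xs s * m)) / (ps s * ps s)) = c1 s"
    proof -
      have "m * ps s - xs s * (2 * xs s * m) = m * (1 - (xs s)\<^sup>2)"
        by (simp add: ps_def power2_eq_square algebra_simps)
      then show ?thesis by (simp add: c1_def power2_eq_square)
    qed
    ultimately show ?thesis by simp
  qed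
  define S where "S s = c1 s - (c s)\<^sup>2 + potV M s" for s
  have cc: "c1 s - (c s)\<^sup>2 = m\<^sup>2 * \<eta> * (((1 - \<eta>) * (xs s)\<^sup>2 - 1) / (ps s)\<^sup>2)" for s
  proof -
    have "(c s)\<^sup>2 = \<eta>\<^sup>2 * m\<^sup>2 * ((xs s)\<^sup>2 / (ps s)\<^sup>2)"
      using ps_pos[of s] by (simp add: c_def powr_minus power_mult_distrib divide_inverse power_inverse)
    then show ?thesis by (simp add: c1_def power2_eq_square algebra_simps diff_divide_distrib add_divide_distrib)
  qed
  have Vn: "potV M s \<ge> 0" for s using M q_pos[of s] q_less[of s] by (simp add: potV_q)
  have S: "potV M s \<le> 2 * S s \<and> m\<^sup>2 / ps s \<le> (4 / \<eta> + 2 * m\<^sup>2 / v) * S s" for s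
  proof (cases "(xs s)\<^sup>2 < 5")
    case True
    have "(ps s)\<^sup>2 \<ge> 1" using ps_ge[of s] by simp
    have "((1 - \<eta>) * (xs s)\<^sup>2 - 1) / (ps s)\<^sup>2 \<ge> - 1 / (ps s)\<^sup>2"
      using \<eta> by (intro divide_right_mono) auto
    moreover have "- 1 / (ps s)\<^sup>2 \<ge> - 1" using \<open>(ps s)\<^sup>2 \<ge> 1\<close> ps_pos[of s] by (simp add: pos_divide_le_eq)
    ultimately have "((1 - \<eta>) * (xs s)\<^sup>2 - 1) / (ps s)\<^sup>2 \<ge> - 1" by linarith
    then have "m\<^sup>2 * \<eta> * (((1 - \<eta>) * (xs s)\<^sup>2 - 1) / (ps s)\<^sup>2) \<ge> m\<^sup>2 * \<eta> * (- 1)"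
      using \<eta>(1) by (intro mult_left_mono) auto
    then have "c1 s - (c s)\<^sup>2 \<ge> - (v / 2)" unfolding cc using \<eta>(3) by linarith
    then have s2: "S s \<ge> v / 2" "potV M s \<le> 2 * S s" using v(2)[OF True] by (auto simp: S_def)
    have "m\<^sup>2 / ps s \<le> m\<^sup>2" using mult_left_mono[OF ps_ge[of s], of "m\<^sup>2"] ps_pos[of s] by (simp add: divide_le_eq)
    also have "\<dots> = 2 * m\<^sup>2 / v * (v / 2)" using v(1) by simp
    also have "\<dots> \<le> 2 * m\<^sup>2 / v * S s" using s2 v(1) by (intro mult_left_mono) auto
    also have "\<dots> \<le> (4 / \<eta> + 2 * m\<^sup>2 / v) * S s" using s2 v(1) \<eta>(1) by (intro mult_right_mono) auto
    finally show ?thesis using s2 by simp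
  next
    case False
    have "ps s / 4 \<le> (xs s)\<^sup>2 / 2 - 1" using False by (simp add: ps_def)
    also have "\<dots> \<le> (1 - \<eta>) * (xs s)\<^sup>2 - 1" using mult_right_mono[of "1/2" "1 - \<eta>" "(xs s)\<^sup>2"] \<eta>(2) by simp
    finally have "ps s / 4 / (ps s)\<^sup>2 \<le> ((1 - \<eta>) * (xs s)\<^sup>2 - 1) / (ps s)\<^sup>2" by (rule divide_right_mono) simp
    then have "1 / (4 * ps s) \<le> ((1 - \<eta>) * (xs s)\<^sup>2 - 1) / (ps s)\<^sup>2"
      using ps_pos[of s] by (simp add: power2_eq_square)
    from mult_left_mono[OF this, of "m\<^sup>2 * \<eta>"]
    have C: "m\<^sup>2 * \<eta> / (4 * ps s) \<le> c1 s - (c s)\<^sup>2" unfolding cc using \<eta>(1) by simp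
    moreover have "0 \<le> m\<^sup>2 * \<eta> / (4 * ps s)" using \<eta>(1) ps_pos[of s] by simp
    ultimately have s2: "potV M s \<le> 2 * S s" "m\<^sup>2 * \<eta> / (4 * ps s) \<le> S s" "0 \<le> S s"
      using Vn[of s] by (auto simp: S_def)
    have "m\<^sup>2 / ps s = 4 / \<eta> * (m\<^sup>2 * \<eta> / (4 * ps s))" using \<eta>(1) by simp
    also have "\<dots> \<le> 4 / \<eta> * S s" using s2 \<eta>(1) by (intro mult_left_mono) auto
    also have "\<dots> \<le> (4 / \<eta> + 2 * m\<^sup>2 / v) * S s" using s2 v(1) by (intro mult_right_mono) auto
    finally show ?thesis using s2 by simp
  qed
  have S0: "S s \<ge> 0" for s using S[of s] Vn[of s] by linarith
  define K1 where "K1 = 12 + 2 * \<epsilon>\<^sup>2 * (4 / \<eta> + 2 * m\<^sup>2 / v)"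
  have K1: "K1 \<ge> 0" using \<eta>(1) v(1) by (simp add: K1_def)
  have gA1_sq: "(gA1 s)\<^sup>2 \<le> 3 * potV M s" for s
  proof -
    have "(gA1 s)\<^sup>2 = 9 / 2 * (t s * (1 - 2 * t s)) * potV M s"
      by (simp add: gA1_def t_def potV_q eval_nat_numeral algebra_simps)
    also have "\<dots> \<le> 3 * potV M s"
    proof (rule mult_right_mono[OF _ Vn])
      have "t s * (1 - 2 * t s) \<le> 1 / 2 * 1" using t_bounds[of s] by (intro mult_mono) auto
      then show "9 / 2 * (t s * (1 - 2 * t s)) \<le> 3" by simp
    qed
    finally show ?thesis .
  qed
  have gB1_sq: "(gB1 s)\<^sup>2 \<le> m\<^sup>2 / ps s" for s
  proof -
    have "(ps s powr (- a))\<^sup>2 = ps s powr (- (2 * a))" by (simp add: power2_eq_square flip: powr_add)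
    also have "\<dots> \<le> ps s powr (- 1)" using ps_ge[of s] a by (intro powr_mono) auto
    also have "\<dots> = 1 / ps s" using ps_pos[of s] by (simp add: powr_minus divide_inverse)
    finally show ?thesis using mult_left_mono[of _ "1 / ps s" "m\<^sup>2"] by (simp add: gB1_def power_mult_distrib)
  qed
  have sq2: "(x + y)\<^sup>2 \<le> 2 * x\<^sup>2 + 2 * y\<^sup>2" for x y :: real
    using sum_squares_bound[of x y] by (simp add: power2_sum)
  have g1S: "(gA1 s + \<epsilon> * gB1 s)\<^sup>2 \<le> K1 * S s" for s
  proof -
    have "(gA1 s + \<epsilon> * gB1 s)\<^sup>2 \<le> 2 * (gA1 s)\<^sup>2 + 2 * \<epsilon>\<^sup>2 * (gB1 s)\<^sup>2"
      using sq2[of "gA1 s" "\<epsilon> * gB1 s"] by (simp add: power_mult_distrib)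
    also have "\<dots> \<le> 2 * (3 * (2 * S s)) + 2 * \<epsilon>\<^sup>2 * ((4 / \<eta> + 2 * m\<^sup>2 / v) * S s)"
      using gA1_sq[of s] gB1_sq[of s] S[of s] by (intro add_mono mult_left_mono) auto
    also have "\<dots> = K1 * S s" by (simp add: K1_def algebra_simps)
    finally show ?thesis .
  qed
  define qm where "qm = 1 / (2 * M)"
  have qb: "q s \<le> qm" for s using q_less[of s] M by (simp add: qm_def field_simps)
  have qm: "qm > 0" using M by (simp add: qm_def)
  have l1: "0 < 1 - 2 * M * q s" "1 - 2 * M * q s \<le> 1" for s using q_less[of s] q_pos[of s] M by auto
  have qn: "q s ^ n \<le> qm ^ n" for s n using qb[of s] q_pos[of s] by (intro power_mono) auto
  have Vb: "potV M s \<le> 2 * M * qm ^ 3" for s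
  proof -
    have "2 * M * q s ^ 3 * (1 - 2 * M * q s) \<le> 2 * M * qm ^ 3 * 1"
      using M l1[of s] qn[of s 3] q_pos[of s] qm by (intro mult_mono mult_left_mono) auto
    then show ?thesis by (simp add: potV_q)
  qed
  have Lb: "potL M s \<le> qm ^ 2" for s
  proof -
    have "q s ^ 2 * (1 - 2 * M * q s) \<le> qm ^ 2 * 1"
      using l1[of s] qn[of s 2] by (intro mult_mono) auto
    then show ?thesis by (simp add: potL_q)
  qed
  have Wb: "W s \<le> qm ^ 4" for s
  proof -
    have "q s ^ 4 * (1 - 2 * M * q s) \<le> qm ^ 4 * 1"
      using l1[of s] qn[of s 4] by (intro mult_mono) auto
    then show ?thesis by (simp add: W_def)
  qed
  have L2b: "\<bar>deriv (deriv (potL M)) s\<bar> \<le> 50 * qm\<^sup>2 * potL M s" for s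
  proof -
    have tt: "\<bar>3 - 20 * t s + 30 * (t s)\<^sup>2\<bar> \<le> 25"
    proof -
      have "(t s)\<^sup>2 \<le> (1 / 2)\<^sup>2" using t_bounds[of s] by (intro power_mono) auto
      then have "(t s)\<^sup>2 \<le> 1 / 4" by (simp add: power2_eq_square)
      moreover have "0 \<le> (t s)\<^sup>2" by simp
      ultimately show ?thesis unfolding abs_le_iff using t_bounds[of s] by (intro conjI) linarith+
    qed
    have "deriv (deriv (potL M)) s = potL M s * (2 * (q s)\<^sup>2 * (3 - 20 * t s + 30 * (t s)\<^sup>2))"
      unfolding deriv2_potL potL_q t_def by (simp add: power_mult_distrib)
    then have "\<bar>deriv (deriv (potL M)) s\<bar> = potL M s * (2 * (q s)\<^sup>2 * \<bar>3 - 20 * t s + 30 * (t s)\<^sup>2\<bar>)"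
      using l1[of s] q_pos[of s] by (simp add: abs_mult potL_q)
    also have "\<dots> \<le> potL M s * (2 * qm\<^sup>2 * 25)"
      using l1[of s] q_pos[of s] qn[of s 2] tt by (intro mult_left_mono mult_mono) (auto simp: potL_q)
    finally show ?thesis by (simp add: mult_ac)
  qed
  \<comment> \<open>A sum of nonnegative terms that contains a bound for each requirement on
    K.\<close>
  define K where "K = 2 * (1 + \<epsilon> * G)\<^sup>2 + 2 + K1 * (1 + 2 * M * qm ^ 3 + m\<^sup>2) + 2 * M * qm ^ 3 + qm ^ 2
    + 5 / 8 * M * qm ^ 4 + 50 * qm\<^sup>2 + \<delta> + 6 * (2 * M * qm ^ 3) + 2 * \<epsilon>\<^sup>2 * m\<^sup>2"
  have Kparts: "0 \<le> 2 * (1 + \<epsilon> * G)\<^sup>2" "0 \<le> K1 * (1 + 2 * M * qm ^ 3 + m\<^sup>2)" "0 \<le> 2 * M * qm ^ 3" "0 \<le> qm ^ 2"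
    "0 \<le> 5 / 8 * M * qm ^ 4" "0 \<le> 50 * qm\<^sup>2" "0 \<le> \<delta>" "0 \<le> 2 * \<epsilon>\<^sup>2 * m\<^sup>2"
    using K1 M qm \<delta> by (simp_all add: add_nonneg_nonneg)
  have K1K: "K1 \<le> K1 * (1 + 2 * M * qm ^ 3 + m\<^sup>2)"
    using mult_left_mono[of 1 "1 + 2 * M * qm ^ 3 + m\<^sup>2" K1] K1 M qm by simp
  have part_le_sum: "x1 \<le> S \<and> x2 \<le> S \<and> x3 \<le> S \<and> x4 \<le> S \<and> x5 \<le> S \<and> x6 \<le> S \<and> x7 \<le> S \<and> 6 * x3 + x8 \<le> S"
    if "0 \<le> x1" "0 \<le> x2" "0 \<le> x3" "0 \<le> x4" "0 \<le> x5" "0 \<le> x6" "0 \<le> x7" "0 \<le> x8"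
      "S = x1 + 2 + x2 + x3 + x4 + x5 + x6 + x7 + 6 * x3 + x8" for x1 x2 x3 x4 x5 x6 x7 x8 S :: real
    using that by auto
  note KK' = part_le_sum[OF Kparts K_def]
  have "(1 + \<epsilon> * G)\<^sup>2 \<le> 2 * (1 + \<epsilon> * G)\<^sup>2" by simp
  then have KK: "0 \<le> K" "(1 + \<epsilon> * G)\<^sup>2 \<le> K" "K1 \<le> K" "2 * M * qm ^ 3 \<le> K" "qm ^ 2 \<le> K" "5 / 8 * M * qm ^ 4 \<le> K"
    "50 * qm\<^sup>2 \<le> K" "\<delta> \<le> K" "6 * (2 * M * qm ^ 3) + 2 * \<epsilon>\<^sup>2 * m\<^sup>2 \<le> K"
    using KK' K1K Kparts(4) by (blast intro: order_trans)+
  have "morawetz_op (potV M) (potL M) VV1 (\<lambda>s. gA s + \<epsilon> * gB s) (\<lambda>s. gA1 s + \<epsilon> * gB1 s)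
      (\<lambda>s. gA2 s + \<epsilon> * gB2 s) (\<lambda>s. gA3 s + \<epsilon> * gB3 s) (\<lambda>s. bA s + \<epsilon> * bB s) (\<lambda>s. bA1 s + \<epsilon> * bB1 s)
      (\<lambda>s. eA s + \<epsilon> * eB s) c c1 (\<lambda>s. \<delta> * ps s powr (- \<beta>)) (\<lambda>s. 5 / 8 * M * W s) K"
  proof unfold_locales
    show "continuous_on UNIV (potV M)" by (rule deriv_continuous_on[OF potV_deriv])
    show "smooth1 (potL M)" by (rule smooth1_potL)
    have cq: "continuous_on UNIV (\<lambda>s. q s ^ n)" "continuous_on UNIV (\<lambda>s. xs s ^ n)"
      "continuous_on UNIV (\<lambda>s. t s ^ n)" "continuous_on UNIV (\<lambda>s. q s)" "continuous_on UNIV (\<lambda>s. xs s)"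
      "continuous_on UNIV (\<lambda>s. t s)" "continuous_on UNIV (\<lambda>s. W s)" for n
      unfolding t_def by (intro continuous_on_power continuous_on_mult continuous_on_const q_continuous xs_cont W_cont)+
    note ci = cq continuous_on_add continuous_on_diff continuous_on_minus continuous_on_const ps_powr_cont
      ps_cont continuous_on_mult continuous_on_power
    have cd: "continuous_on UNIV (\<lambda>s. f s / k)" if "continuous_on UNIV f" for f :: "real \<Rightarrow> real" and k
      unfolding divide_inverse by (intro continuous_on_mult that continuous_on_const)
    show "continuous_on UNIV VV1" unfolding VV1_def[abs_def] by (intro ci cd)
    have "continuous_on UNIV gA3" unfolding gA3_def[abs_def] by (intro ci cd)
    moreover have "continuous_on UNIV gB3" unfolding gB3_def[abs_def] w_def by (intro ci cd)
    ultimately show "continuous_on UNIV (\<lambda>s. gA3 s + \<epsilon> * gB3 s)"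
      by (intro continuous_on_add continuous_on_mult continuous_on_const)
    have "continuous_on UNIV bA1" unfolding bA1_def[abs_def] by (intro ci cd)
    moreover have "continuous_on UNIV bB1" unfolding bB1_def[abs_def] w_def by (intro ci cd)
    ultimately show "continuous_on UNIV (\<lambda>s. bA1 s + \<epsilon> * bB1 s)"
      by (intro continuous_on_add continuous_on_mult continuous_on_const)
    have "continuous_on UNIV eA" unfolding eA_def[abs_def] gA1_def by (intro ci cd)
    moreover have "continuous_on UNIV eB" unfolding eB_def[abs_def] w_def by (intro ci cd)
    ultimately show "continuous_on UNIV (\<lambda>s. eA s + \<epsilon> * eB s)"
      by (intro continuous_on_add continuous_on_mult continuous_on_const)
    show "continuous_on UNIV (\<lambda>s. 5 / 8 * M * W s)" by (intro ci)
    show "continuous_on UNIV (\<lambda>s. \<delta> * ps s powr (- \<beta>))"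
      by (intro continuous_on_mult continuous_on_const ps_powr_cont)
    show "continuous_on UNIV c1"
      unfolding c1_def[abs_def] using ps_pos
      by (intro continuous_intros xs_cont ps_cont) (auto simp: less_imp_neq[symmetric])
    fix s :: real
    show "0 \<le> potV M s" by (rule Vn)
    show Ln: "0 < potL M s" using l1[of s] q_pos[of s] by (simp add: potL_q)
    then show "0 \<le> potL M s" by simp
    show "(potV M has_real_derivative VV1 s) (at s)" unfolding VV1_def by (rule potV_deriv)
    show "((\<lambda>s. gA s + \<epsilon> * gB s) has_real_derivative gA1 s + \<epsilon> * gB1 s) (at s)"
      "((\<lambda>s. gA1 s + \<epsilon> * gB1 s) has_real_derivative gA2 s + \<epsilon> * gB2 s) (at s)"
      "((\<lambda>s. gA2 s + \<epsilon> * gB2 s) has_real_derivative gA3 s + \<epsilon> * gB3 s) (at s)"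
      "((\<lambda>s. bA s + \<epsilon> * bB s) has_real_derivative bA1 s + \<epsilon> * bB1 s) (at s)"
      by (intro DERIV_add DERIV_cmult gA_deriv gB_deriv gA1_deriv gB1_deriv gA2_deriv gB2_deriv bA_deriv bB_deriv)+
    show "(c has_real_derivative c1 s) (at s)" by (rule dc)
    fix x y :: real
    show "0 \<le> (gA1 s + \<epsilon> * gB1 s) * x\<^sup>2 + 2 * (bA s + \<epsilon> * bB s) * x * y + (eA s + \<epsilon> * eB s) * y\<^sup>2"
    proof -
      \<comment> \<open>Each Hardy form is a multiple of a perfect square: \<open>bA\<close> and
        \<open>eA\<close> are \<open>gA1\<close> times h and h^2 for h = - q / 2 + 13/10 M q^2, and
        similarly \<open>bB\<close> and \<open>eB\<close> for h = - a m x / (1 + x^2).\<close>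
      have "gA1 s * x\<^sup>2 + 2 * bA s * x * y + eA s * y\<^sup>2
          = gA1 s * (x + (- q s / 2 + 13 / 10 * M * (q s)\<^sup>2) * y)\<^sup>2"
        by (simp add: gA1_def bA_def eA_def power2_eq_square algebra_simps)
      moreover have "gB1 s * x\<^sup>2 + 2 * bB s * x * y + eB s * y\<^sup>2
          = m * w s * (ps s * x - a * m * xs s * y)\<^sup>2"
        unfolding gB1_def bB_def eB_def w_powr by (simp add: power2_eq_square eval_nat_numeral algebra_simps)
      moreover have "0 \<le> gA1 s * (x + (- q s / 2 + 13 / 10 * M * (q s)\<^sup>2) * y)\<^sup>2"
        using M q_pos[of s] l1[of s] by (simp add: gA1_def)
      moreover have "0 \<le> \<epsilon> * (m * w s * (ps s * x - a * m * xs s * y)\<^sup>2)"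
        using \<epsilon>(1) m w_pos[of s] by simp
      moreover have "(gA1 s + \<epsilon> * gB1 s) * x\<^sup>2 + 2 * (bA s + \<epsilon> * bB s) * x * y + (eA s + \<epsilon> * eB s) * y\<^sup>2
          = (gA1 s * x\<^sup>2 + 2 * bA s * x * y + eA s * y\<^sup>2)
            + \<epsilon> * (gB1 s * x\<^sup>2 + 2 * bB s * x * y + eB s * y\<^sup>2)"
        by (simp add: algebra_simps)
      ultimately show ?thesis by (simp only: add_nonneg_nonneg)
    qed
    show "0 \<le> \<delta> * ps s powr (- \<beta>)" using \<delta> by simp
    show "0 \<le> 5 / 8 * M * W s" using M W_nonneg by simp
    show "\<delta> * ps s powr (- \<beta>) \<le> bA1 s + \<epsilon> * bB1 s - (eA s + \<epsilon> * eB s) - (gA3 s + \<epsilon> * gB3 s) / 4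
        - VV1 s * (gA s + \<epsilon> * gB s) / 2"
    proof -
      let ?PA = "bA1 s - eA s - gA3 s / 4 - VV1 s * gA s / 2"
      let ?PB = "m ^ 3 * w s * (a / 2) * ((xs s)\<^sup>2 - 1)"
      have total: "bA1 s + \<epsilon> * bB1 s - (eA s + \<epsilon> * eB s) - (gA3 s + \<epsilon> * gB3 s) / 4
          - VV1 s * (gA s + \<epsilon> * gB s) / 2 = ?PA + \<epsilon> * ?PB + \<epsilon> * (- VV1 s * gB s / 2)"
        unfolding lower_B[symmetric] by (simp add: algebra_simps add_divide_distrib)
      have MW: "M * W s \<ge> 0" using M W_nonneg by simp
      have "\<epsilon> * (- VV1 s * gB s / 2) \<ge> \<epsilon> * (- (G / 3) * (M * W s))"
        using VgB[OF G, of s] \<epsilon>(1) by (intro mult_left_mono) auto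
      moreover have "\<epsilon> * (G / 3) * (M * W s) \<le> 3 / 200 * (M * W s)"
        by (rule mult_right_mono[OF \<epsilon>(2) MW])
      ultimately have 1: "?PA + \<epsilon> * (- VV1 s * gB s / 2) \<ge> 3 / 200 * M * W s"
        using lower_A[of s] by simp
      have pb: "ps s powr (- \<beta>) = w s * ps s"
        using w_powr(1)[of s] by (simp add: \<beta>)
      have "\<delta> * (w s * ps s) \<le> 3 / 200 * M * W s + \<epsilon> * ?PB"
      proof (cases "(xs s)\<^sup>2 < 3")
        case True
        have "w s * ps s = ps s powr (- a - 1)" by (simp add: w_powr)
        also have "\<dots> \<le> 1" using powr_mono2'[of "- a - 1" 1 "ps s"] a ps_ge[of s] by simp
        finally have "\<delta> * (w s * ps s) \<le> \<delta> * 1" using \<delta>(1) by (intro mult_left_mono) auto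
        then have "\<delta> * (w s * ps s) \<le> \<kappa> / 2" using \<delta>(2) by simp
        moreover have "\<epsilon> * ?PB \<ge> - (\<kappa> / 2)"
        proof -
          have "w s * ((xs s)\<^sup>2 - 1) \<ge> - 1"
            using mult_left_mono[of "- 1" "(xs s)\<^sup>2 - 1" "w s"] w_pos[of s] w_le_1[of s] by simp
          then have "\<epsilon> * (m ^ 3 * a / 2) * (w s * ((xs s)\<^sup>2 - 1)) \<ge> \<epsilon> * (m ^ 3 * a / 2) * (- 1)"
            using \<epsilon>(1) ma by (intro mult_left_mono) auto
          then show ?thesis using \<epsilon>(3) by (simp add: mult_ac)
        qed
        ultimately show ?thesis using \<kappa>(2)[OF True] by simp
      next
        case False
        have "\<delta> * (w s * ps s) \<le> \<epsilon> * m ^ 3 * a / 4 * (w s * ps s)"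
          using \<delta>(3) w_pos[of s] ps_pos[of s] by (intro mult_right_mono) auto
        also have "\<dots> = \<epsilon> * (m ^ 3 * a / 2) * w s * (ps s / 2)" by simp
        also have "\<dots> \<le> \<epsilon> * (m ^ 3 * a / 2) * w s * ((xs s)\<^sup>2 - 1)"
          using False \<epsilon>(1) ma w_pos[of s] by (intro mult_left_mono) (auto simp: ps_def)
        also have "\<dots> = \<epsilon> * ?PB" by simp
        finally show ?thesis using MW by simp
      qed
      then show ?thesis unfolding total pb using 1 by linarith
    qed
    have qL: "deriv (potL M) s = - (2 * q s ^ 3 * (1 - 2 * M * q s)) * (1 - 3 * t s)"
      by (simp add: deriv_potL t_def mult.assoc)
    have q3: "2 * q s ^ 3 * (1 - 2 * M * q s) \<ge> 0" using q_pos[of s] l1[of s] by simp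
    \<comment> \<open>The factor 1 - 3 t equals \<open>gA\<close> and has the sign of
      \<open>gB\<close>, so adding the second multiplier can only improve the trapping condition and
      the cubic coefficient.\<close>
    have tr: "(1 - 3 * t s) * (gA s + \<epsilon> * gB s) \<ge> (1 - 3 * t s)\<^sup>2"
    proof -
      have "(1 - 3 * t s) * (gA s + \<epsilon> * gB s) = (1 - 3 * t s)\<^sup>2 + \<epsilon> * ((1 - 3 * t s) * gB s)"
        by (simp add: gA_def t_def power2_eq_square algebra_simps)
      then show ?thesis using mult_nonneg_nonneg[OF less_imp_le[OF \<epsilon>(1)] gB_trap[of s]] by simp
    qed
    show "deriv (potL M) s * (gA s + \<epsilon> * gB s) \<le> 0"
      unfolding qL using mult_nonneg_nonneg[OF q3 order_trans[OF zero_le_power2 tr]] by (simp add: mult.assoc)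
    show "5 / 8 * M * W s \<le> potL M s * (gA1 s + \<epsilon> * gB1 s) - deriv (potL M) s * (gA s + \<epsilon> * gB s)"
    proof -
      have "gB1 s \<ge> 0" using m by (simp add: gB1_def)
      then have "potL M s * (gA1 s + \<epsilon> * gB1 s) \<ge> potL M s * gA1 s"
        using Ln \<epsilon>(1) by (intro mult_left_mono) auto
      moreover have "- deriv (potL M) s * (gA s + \<epsilon> * gB s) \<ge> 2 * q s ^ 3 * (1 - 2 * M * q s) * (1 - 3 * t s)\<^sup>2"
        unfolding qL using mult_left_mono[OF tr q3] by (simp add: mult.assoc)
      moreover have "potL M s * gA1 s + 2 * q s ^ 3 * (1 - 2 * M * q s) * (1 - 3 * t s)\<^sup>2
          = q s ^ 3 * (1 - 2 * M * q s) * (12 * (t s)\<^sup>2 - 9 * t s + 2)"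
        by (simp add: potL_q gA1_def t_def eval_nat_numeral algebra_simps)
      \<comment> \<open>Origin of 5/8: the quadratic is at least 5/16, and t < 1/2 turns this into a
        multiple of t, supplying the fourth factor q of W.\<close>
      moreover have "12 * (t s)\<^sup>2 - 9 * t s + 2 \<ge> 5 / 8 * t s"
      proof -
        have "12 * (t s)\<^sup>2 - 9 * t s + 2 = 12 * (t s - 3 / 8)\<^sup>2 + 5 / 16"
          by (simp add: power2_eq_square field_simps)
        moreover have "0 \<le> 12 * (t s - 3 / 8)\<^sup>2" by simp
        ultimately show ?thesis using t_bounds(2)[of s] by linarith
      qed
      then have "q s ^ 3 * (1 - 2 * M * q s) * (12 * (t s)\<^sup>2 - 9 * t s + 2) \<ge> q s ^ 3 * (1 - 2 * M * q s) * (5 / 8 * t s)"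
        using q3 by (intro mult_left_mono) auto
      moreover have "q s ^ 3 * (1 - 2 * M * q s) * (5 / 8 * t s) = 5 / 8 * M * W s"
        by (simp add: W_def t_def eval_nat_numeral algebra_simps)
      ultimately show ?thesis by linarith
    qed
    show "0 \<le> K" by (rule KK)
    show "(gA s + \<epsilon> * gB s)\<^sup>2 \<le> K"
    proof -
      have "\<bar>gA s\<bar> \<le> 1" using t_bounds[of s] by (simp add: gA_def t_def abs_le_iff mult.assoc)
      moreover have "\<bar>\<epsilon> * gB s\<bar> \<le> \<epsilon> * G" using G[of s] \<epsilon>(1) by (simp add: abs_mult)
      ultimately have "\<bar>gA s + \<epsilon> * gB s\<bar> \<le> 1 + \<epsilon> * G" by linarith
      then have "\<bar>gA s + \<epsilon> * gB s\<bar>\<^sup>2 \<le> (1 + \<epsilon> * G)\<^sup>2" by (intro power_mono) auto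
      then show ?thesis using KK(2) by simp
    qed
    have "K1 * S s \<le> K * S s" by (rule mult_right_mono[OF KK(3) S0])
    then show "(gA1 s + \<epsilon> * gB1 s)\<^sup>2 \<le> K * (c1 s - (c s)\<^sup>2 + potV M s)"
      using g1S[of s] by (simp add: S_def)
    show "\<bar>deriv (deriv (potL M)) s\<bar> \<le> K * potL M s"
      by (rule order_trans[OF L2b mult_right_mono[OF KK(7) less_imp_le[OF Ln]]])
    show "potL M s \<le> K" "potV M s \<le> K" using Lb[of s] Vb[of s] KK by linarith+
    show "(gA1 s + \<epsilon> * gB1 s)\<^sup>2 \<le> K"
    proof -
      have "(gA1 s + \<epsilon> * gB1 s)\<^sup>2 \<le> 2 * (gA1 s)\<^sup>2 + 2 * \<epsilon>\<^sup>2 * (gB1 s)\<^sup>2"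
        using sq2[of "gA1 s" "\<epsilon> * gB1 s"] by (simp add: power_mult_distrib)
      also have "\<dots> \<le> 2 * (3 * (2 * M * qm ^ 3)) + 2 * \<epsilon>\<^sup>2 * m\<^sup>2"
      proof (intro add_mono mult_left_mono)
        show "(gA1 s)\<^sup>2 \<le> 3 * (2 * M * qm ^ 3)" using gA1_sq[of s] Vb[of s] by linarith
        have "m\<^sup>2 / ps s \<le> m\<^sup>2" using mult_left_mono[OF ps_ge[of s], of "m\<^sup>2"] ps_pos[of s] by (simp add: divide_le_eq)
        then show "(gB1 s)\<^sup>2 \<le> m\<^sup>2" using gB1_sq[of s] by linarith
      qed auto
      finally show ?thesis using KK(9) by simp
    qed
    show "\<delta> * ps s powr (- \<beta>) \<le> K"
    proof -
      have "ps s powr (- \<beta>) \<le> 1" using powr_mono2'[of "- \<beta>" 1 "ps s"] a \<beta> ps_ge[of s] by simp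
      then have "\<delta> * ps s powr (- \<beta>) \<le> \<delta> * 1" using \<delta>(1) by (intro mult_left_mono) auto
      then show ?thesis using KK(8) by simp
    qed
    show "5 / 8 * M * W s \<le> K" by (rule order_trans[OF mult_left_mono[OF Wb] KK(6)]) (use M in simp)
  qed
  then show ?thesis using \<delta>(1) by blast
qed

end

section \<open>Complex fields and their real parts\<close>

definition cpx :: "(point \<Rightarrow> real) \<Rightarrow> (point \<Rightarrow> real) \<Rightarrow> field" where
  "cpx a b = (\<lambda>x. Complex (a x) (b x))"

lemma cpx_Re_Im: "cpx (\<lambda>x. Re (f x)) (\<lambda>x. Im (f x)) = f"
  by (simp add: cpx_def)

lemma has_derivative_cpx:
  assumes "(a has_derivative a') (at x)" "(b has_derivative b') (at x)"
  shows "(cpx a b has_derivative (\<lambda>w. Complex (a' w) (b' w))) (at x)"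
  using assms unfolding cpx_def
  by (subst has_derivative_componentwise_within) (auto simp: Basis_complex_def inner_complex_def)

lemma dir_deriv_cpx:
  assumes "C1 a" "C1 b"
  shows "dir_deriv w (cpx a b) = cpx (Dd w a) (Dd w b)"
proof
  fix x
  from has_derivative_cpx[OF C1_has_derivative[OF assms(1), of x] C1_has_derivative[OF assms(2)]]
  show "dir_deriv w (cpx a b) x = cpx (Dd w a) (Dd w b) x"
    using fun_cong[OF frechet_derivative_at, of "cpx a b" _ x w] by (simp add: dir_deriv_def cpx_def)
qed

lemma d_rs_cpx: "C1 a \<Longrightarrow> C1 b \<Longrightarrow> d_rs (cpx a b) = cpx (Ds a) (Ds b)"
  by (simp add: d_rs_def dir_deriv_cpx)

lemma rot_deriv_cpx: "C1 a \<Longrightarrow> C1 b \<Longrightarrow> rot_deriv e (cpx a b) = cpx (Xe e a) (Xe e b)"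
  by (rule ext) (simp add: rot_deriv_def dir_deriv_cpx split: prod.split, simp add: cpx_def Xe_Dd)

text \<open>What real and imaginary parts of a test function must satisfy for two integrations by
  parts. General test functions are not in \<open>DD\<close>, yet the weak derivatives in the energy
  are tested with them.\<close>

definition test2 :: "(point \<Rightarrow> real) \<Rightarrow> bool" where
  "test2 a \<longleftrightarrow> C1 a \<and> slab_supp a \<and> (\<forall>e. C1 (Xe e a)) \<and> C1 (Ds a)"

lemma lap_S2_cpx:
  assumes "test2 a" "test2 b"
  shows "lap_S2 (cpx a b) = cpx (lapX a) (lapX b)"
proof
  fix x
  have "rot_deriv e (rot_deriv e (cpx a b)) = cpx (Xe e (Xe e a)) (Xe e (Xe e b))" for e
    using assms by (simp add: rot_deriv_cpx test2_def)
  then show "lap_S2 (cpx a b) x = cpx (lapX a) (lapX b) x"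
    by (simp add: lap_S2_def lapX_def cpx_def complex_eq_iff)
qed

lemma C1_sum: "(\<And>i. i \<in> I \<Longrightarrow> C1 (f i)) \<Longrightarrow> C1 (\<lambda>x. \<Sum>i\<in>I. f i x)"
  by (induction I rule: infinite_finite_induct) (auto intro: C1_add C1_const)

lemma C1_cross_coord: "C1 (\<lambda>x::point. cross3 e (snd x) $ i)"
proof -
  have "linear (\<lambda>x::point. cross3 e (snd x) $ i)"
    by (rule linearI) (simp_all add: cross_add_right cross_mult_right)
  then have "((\<lambda>x::point. cross3 e (snd x) $ i) has_derivative (\<lambda>w. cross3 e (snd w) $ i)) (at x)" for x
    by (rule linear_imp_has_derivative)
  then show ?thesis by (rule C1I[where f' = "\<lambda>w x. cross3 e (snd w) $ i"]) simp
qed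

lemma test2_DD: "DD f \<Longrightarrow> test2 f"
  by (simp add: test2_def DD_C1 DD_slab_supp DD_Xe DD_Dd)

text \<open>Composing the iterated derivatives with a bounded linear functional treats real and
  imaginary part by one argument.\<close>

lemma test2_test_functions:
  assumes p: "p \<in> test_functions"
  shows "test2 (\<lambda>x. Re (p x))" "test2 (\<lambda>x. Im (p x))"
proof -
  have sm: "foldr dir_deriv ws p differentiable_on UNIV" for ws
    using p by (simp add: test_functions_def smooth_def)
  obtain R where R: "\<And>s y. R \<le> \<bar>s\<bar> \<Longrightarrow> p (s, y) = 0" using p by (auto simp: test_functions_def)
  have test: "test2 (\<lambda>x. h (p x))" if h: "bounded_linear h" for h :: "complex \<Rightarrow> real"
  proof -
    have D: "((\<lambda>x. h (foldr dir_deriv ws p x)) has_derivative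
        (\<lambda>w. h (foldr dir_deriv (w # ws) p x))) (at x)" for ws x
    proof -
      have "(foldr dir_deriv ws p has_derivative frechet_derivative (foldr dir_deriv ws p) (at x)) (at x)"
        unfolding frechet_derivative_works[symmetric] using sm[of ws] unfolding differentiable_on_def by blast
      from bounded_linear.has_derivative[OF h this] show ?thesis by (simp add: dir_deriv_def)
    qed
    have c: "continuous_on UNIV (\<lambda>x. h (foldr dir_deriv ws p x))" for ws
      by (rule has_derivative_continuous_on[OF D])
    have C: "C1 (\<lambda>x. h (foldr dir_deriv ws p x))" for ws
      by (rule C1I[where f' = "\<lambda>w x. h (foldr dir_deriv (w # ws) p x)", OF D c])
    have Dd: "Dd w (\<lambda>x. h (p x)) = (\<lambda>x. h (dir_deriv w p x))" for w
      using Dd_eq[OF D[of "[]"]] by (simp add: fun_eq_iff)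
    have C0: "C1 (\<lambda>x. h (p x))" using C[of "[]"] by simp
    have CD: "C1 (Dd w (\<lambda>x. h (p x)))" for w using C[of "[w]"] by (simp add: Dd)
    have "C1 (Xe e (\<lambda>x. h (p x)))" for e
    proof -
      have "C1 (\<lambda>x. \<Sum>i\<in>UNIV. cross3 e (snd x) $ i * Dd (0, axis i 1) (\<lambda>x. h (p x)) x)"
        by (intro C1_sum C1_mult C1_cross_coord CD)
      then show ?thesis using Xe_sum_Dd[OF C0, of e] by presburger
    qed
    moreover have "slab_supp (\<lambda>x. h (p x))"
      unfolding slab_supp_def using R h by (intro exI[of _ R]) (simp add: linear_simps)
    ultimately show ?thesis using C0 CD by (simp add: test2_def)
  qed
  show "test2 (\<lambda>x. Re (p x))" "test2 (\<lambda>x. Im (p x))"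
    by (rule test[OF bounded_linear_Re] test[OF bounded_linear_Im])+
qed

lemma L2_measurable: "f \<in> L2 \<Longrightarrow> f \<in> borel_measurable borel"
  by (simp add: L2_def measurable_cong_sets[OF sets_mu refl])

lemma sq_int_Re_Im:
  assumes f: "f \<in> L2"
  shows "sq_int (\<lambda>x. Re (f x))" "sq_int (\<lambda>x. Im (f x))"
proof -
  have [measurable]: "f \<in> borel_measurable borel" by (rule L2_measurable[OF f])
  have i: "integrable mu (\<lambda>x. (norm (f x))\<^sup>2)" using f by (simp add: L2_def)
  have "integrable mu (\<lambda>x. (Re (f x))\<^sup>2)" "integrable mu (\<lambda>x. (Im (f x))\<^sup>2)"
    by (rule Bochner_Integration.integrable_bound[OF i];
        simp add: measurable_cong_sets[OF sets_mu refl] cmod_power2)+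
  then show "sq_int (\<lambda>x. Re (f x))" "sq_int (\<lambda>x. Im (f x))" by (simp_all add: sq_int_def)
qed

lemma L2_iff: "f \<in> L2 \<longleftrightarrow> sq_int (\<lambda>x. Re (f x)) \<and> sq_int (\<lambda>x. Im (f x))"
proof
  assume s: "sq_int (\<lambda>x. Re (f x)) \<and> sq_int (\<lambda>x. Im (f x))"
  then have "(\<lambda>x. Complex (Re (f x)) (Im (f x))) \<in> borel_measurable borel"
    by (intro borel_measurable_complex_iff[THEN iffD2]) (auto simp: sq_int_def)
  then have "f \<in> borel_measurable mu" by (simp add: measurable_cong_sets[OF sets_mu refl])
  moreover have "integrable mu (\<lambda>x. (norm (f x))\<^sup>2)"
    using s by (simp add: cmod_power2 sq_int_def)
  ultimately show "f \<in> L2" by (simp add: L2_def)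
qed (simp add: sq_int_Re_Im)

lemma L2_norm_sq:
  assumes f: "f \<in> L2"
  shows "(L2_norm f)\<^sup>2 = (norm (cls (\<lambda>x. Re (f x))))\<^sup>2 + (norm (cls (\<lambda>x. Im (f x))))\<^sup>2"
  using sq_int_Re_Im[OF f, THEN sq_int_integrable] norm_cls[OF sq_int_Re_Im(1)[OF f]] norm_cls[OF sq_int_Re_Im(2)[OF f]]
  by (simp add: L2_norm_def cmod_power2)

lemma L2_norm_nonneg: "L2_norm f \<ge> 0"
  by (simp add: L2_norm_def)

lemma norm_cls_Re_le: "f \<in> L2 \<Longrightarrow> norm (cls (\<lambda>x. Re (f x))) \<le> L2_norm f"
  by (rule power2_le_imp_le) (simp_all add: L2_norm_sq L2_norm_nonneg)

lemma L2_inner_cpx: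
  assumes "integrable mu (\<lambda>x. a x * Re (f x))" "integrable mu (\<lambda>x. a x * Im (f x))"
    "integrable mu (\<lambda>x. b x * Re (f x))" "integrable mu (\<lambda>x. b x * Im (f x))"
  shows "L2_inner (cpx a b) f = Complex ((\<integral>x. a x * Re (f x) \<partial>mu) + (\<integral>x. b x * Im (f x) \<partial>mu))
    ((\<integral>x. a x * Im (f x) \<partial>mu) - (\<integral>x. b x * Re (f x) \<partial>mu))"
proof -
  have e: "cnj (cpx a b x) * f x
      = Complex (a x * Re (f x) + b x * Im (f x)) (a x * Im (f x) - b x * Re (f x))" for x
    by (simp add: cpx_def complex_eq_iff)
  have "integrable mu (\<lambda>x. complex_of_real (a x * Re (f x) + b x * Im (f x))
      + \<i> * complex_of_real (a x * Im (f x) - b x * Re (f x)))"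
    using assms
    by (intro Bochner_Integration.integrable_add integrable_mult_right integrable_of_real
        Bochner_Integration.integrable_diff) auto
  then have i: "integrable mu (\<lambda>x. cnj (cpx a b x) * f x)" unfolding e Complex_eq .
  show ?thesis
    using integral_Re[OF i] integral_Im[OF i] assms
    by (simp add: L2_inner_def complex_eq_iff e)
qed

lemma L2_inner_cpx_L2:
  assumes "sq_int a" "sq_int b" "f \<in> L2"
  shows "L2_inner (cpx a b) f
    = Complex (inner (cls a) (cls (\<lambda>x. Re (f x))) + inner (cls b) (cls (\<lambda>x. Im (f x))))
        (inner (cls a) (cls (\<lambda>x. Im (f x))) - inner (cls b) (cls (\<lambda>x. Re (f x))))"
  using assms sq_int_Re_Im[OF assms(3)]
  by (subst L2_inner_cpx) (auto intro: sq_int_mult_integrable simp: inner_cls)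

lemma loc_integrable_slab_int:
  assumes "loc_integrable v"
  shows "slab_int (\<lambda>x. Re (v x))" "slab_int (\<lambda>x. Im (v x))"
proof -
  have m: "v \<in> borel_measurable borel"
    using assms by (simp add: loc_integrable_def measurable_cong_sets[OF sets_mu refl])
  have "integrable mu (\<lambda>x. indicator ({-R..R} \<times> UNIV) x *\<^sub>R v x)" for R
    using assms by (simp add: loc_integrable_def set_integrable_def)
  from integrable_Re[OF this] integrable_Im[OF this]
  show "slab_int (\<lambda>x. Re (v x))" "slab_int (\<lambda>x. Im (v x))"
    using m by (auto simp: slab_int_def)
qed

lemma loc_integrable_of_slab_int:
  assumes "slab_int v"
  shows "loc_integrable (\<lambda>x. complex_of_real (v x))"
  unfolding loc_integrable_def set_integrable_def
proof (intro conjI allI)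
  show "(\<lambda>x. complex_of_real (v x)) \<in> borel_measurable mu"
  proof -
    have "v \<in> borel_measurable mu" using assms by (simp add: slab_int_def measurable_cong_sets[OF sets_mu refl])
    then show ?thesis by simp
  qed
  fix R
  have "integrable mu (\<lambda>x. complex_of_real (indicator ({-R..R} \<times> UNIV) x * v x))"
    using assms unfolding slab_int_def by (intro integrable_of_real) auto
  then show "integrable mu (\<lambda>x. indicator ({-R..R} \<times> UNIV) x *\<^sub>R complex_of_real (v x))"
    by (simp add: scaleR_conv_of_real)
qed

text \<open>Core functions are test functions, so two locally integrable candidates have the same
  integrals against the core. This makes the value picked by a choice operator computable almost
  everywhere.\<close>

lemma weak_rel_unique:
  assumes v: "loc_integrable v1" "loc_integrable v2" and w: "weak_rel B u v1" "weak_rel B u v2"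
  shows "AE x in mu. v1 x = v2 x"
proof -
  note s = loc_integrable_slab_int[OF v(1)] loc_integrable_slab_int[OF v(2)]
  have i: "integrable mu (\<lambda>x. f x * Re (v1 x))" "integrable mu (\<lambda>x. f x * Im (v1 x))"
    "integrable mu (\<lambda>x. f x * Re (v2 x))" "integrable mu (\<lambda>x. f x * Im (v2 x))" if "DD f" for f
    by (intro slab_int_cont_mult s DD_continuous DD_slab_supp that)+
  have eq: "(\<integral>x. f x * Re (v1 x) \<partial>mu) = (\<integral>x. f x * Re (v2 x) \<partial>mu)
      \<and> (\<integral>x. f x * Im (v1 x) \<partial>mu) = (\<integral>x. f x * Im (v2 x) \<partial>mu)" if f: "DD f" for f
  proof -
    have "(\<lambda>x. of_real (f x)) = cpx f (\<lambda>x. 0)" by (auto simp: cpx_def complex_eq_iff)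
    then have "cpx f (\<lambda>x. 0) \<in> test_functions" using smooth_of_DD[OF f] by simp
    then have "L2_inner (cpx f (\<lambda>x. 0)) v1 = L2_inner (cpx f (\<lambda>x. 0)) v2"
      using w by (metis weak_rel_def)
    then show ?thesis using i[OF f] by (simp add: L2_inner_cpx)
  qed
  have "AE x in mu. Re (v1 x) - Re (v2 x) = 0"
  proof (rule AE_zero_if_orthogonal_DD)
    show "slab_int (\<lambda>x. Re (v1 x) - Re (v2 x))"
      using s by (auto simp: slab_int_def right_diff_distrib intro!: borel_measurable_diff)
    show "(\<integral>x. f x * (Re (v1 x) - Re (v2 x)) \<partial>mu) = 0" if "DD f" for f
      using i[OF that] eq[OF that] by (simp add: right_diff_distrib)
  qed
  moreover have "AE x in mu. Im (v1 x) - Im (v2 x) = 0"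
  proof (rule AE_zero_if_orthogonal_DD)
    show "slab_int (\<lambda>x. Im (v1 x) - Im (v2 x))"
      using s by (auto simp: slab_int_def right_diff_distrib intro!: borel_measurable_diff)
    show "(\<integral>x. f x * (Im (v1 x) - Im (v2 x)) \<partial>mu) = 0" if "DD f" for f
      using i[OF that] eq[OF that] by (simp add: right_diff_distrib)
  qed
  ultimately show ?thesis by eventually_elim (simp add: complex_eq_iff)
qed

lemma L2_real_inner_cong:
  assumes g: "sq_int a" "sq_int b" and u: "u \<in> L2" "AE x in mu. u x \<in> \<real>"
  shows "L2_inner (cpx a b) u = Complex (inner (cls a) (cls (\<lambda>x. Re (u x)))) (- inner (cls b) (cls (\<lambda>x. Re (u x))))"
proof -
  have "cls (\<lambda>x. Im (u x)) = cls (\<lambda>x. 0)"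
    using u(2) by (subst cls_eq_iff) (auto intro: sq_int_Re_Im u sq_int_zero simp: complex_is_Real_iff)
  then show ?thesis using L2_inner_cpx_L2[OF g u(1)] by (simp add: cls_zero)
qed

context morawetz_op
begin

text \<open>The representative of u' is a witness for the choice in \<open>weak_d_rs\<close>, and
  uniqueness transfers it to the chosen function.\<close>

lemma weak_d_rs_eq:
  assumes a: "approx (cls (\<lambda>x. Re (u x))) w u' z la f" and u: "u \<in> L2" "AE x in mu. u x \<in> \<real>"
  shows "loc_integrable (weak_d_rs u)" "AE x in mu. weak_d_rs u x = of_real (rep u' x)"
proof -
  let ?v = "\<lambda>x. complex_of_real (rep u' x)"
  have l: "loc_integrable ?v" by (intro loc_integrable_of_slab_int slab_int_sq_int rep_sq_int)
  have v: "?v \<in> L2" "AE x in mu. ?v x \<in> \<real>" by (auto simp: L2_iff rep_sq_int sq_int_zero)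
  have wk: "weak_rel (\<lambda>\<phi> x. - d_rs \<phi> x) u ?v"
    unfolding weak_rel_def
  proof
    fix p assume p: "p \<in> test_functions"
    let ?a = "\<lambda>x. Re (p x)" and ?b = "\<lambda>x. Im (p x)"
    have t: "C1 ?a" "slab_supp ?a" "C1 ?b" "slab_supp ?b"
      using test2_test_functions[OF p] by (auto simp: test2_def)
    have s: "sq_int ?a" "sq_int ?b" "sq_int (Ds ?a)" "sq_int (Ds ?b)"
      using t by (auto intro: sq_int_slab_supp C1_continuous C1_Dd_continuous slab_supp_Dd)
    have e: "(\<lambda>x. - d_rs p x) = cpx (\<lambda>x. - Ds ?a x) (\<lambda>x. - Ds ?b x)"
      using d_rs_cpx[OF t(1,3)] unfolding cpx_Re_Im by (auto simp: cpx_def fun_eq_iff complex_eq_iff)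
    show "L2_inner (\<lambda>x. - d_rs p x) u = L2_inner p ?v"
      unfolding e L2_real_inner_cong[OF sq_int_minus[OF s(3)] sq_int_minus[OF s(4)] u]
      using L2_real_inner_cong[OF s(1,2) v, unfolded cpx_Re_Im]
        approx_weak_Ds[OF a t(1,2)] approx_weak_Ds[OF a t(3,4)]
      by (simp add: cls_minus s)
  qed
  have "loc_integrable (weak_d_rs u) \<and> weak_rel (\<lambda>\<phi> x. - d_rs \<phi> x) u (weak_d_rs u)"
    unfolding weak_d_rs_def by (rule someI[of _ ?v]) (use l wk in blast)
  then show "loc_integrable (weak_d_rs u)" "AE x in mu. weak_d_rs u x = of_real (rep u' x)"
    using weak_rel_unique l wk by blast+
qed

text \<open>Dividing by L may destroy square integrability, since no positive lower bound for L on
  the whole line is assumed. On each slab 1 / L is bounded, so the quotient is locally integrable,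
  which is the class the weak Laplacian lives in.\<close>

lemma slab_int_div_L:
  assumes "sq_int v"
  shows "slab_int (\<lambda>x. v x / L (fst x))"
proof -
  have v: "slab_int v" by (rule slab_int_sq_int[OF assms])
  have c: "continuous_on UNIV (\<lambda>s. 1 / L s)"
    using L_pos by (intro continuous_intros L_cont) (metis less_irrefl)
  have cm: "(\<lambda>x::point. 1 / L (fst x)) \<in> borel_measurable borel"
    by (rule borel_measurable_continuous_onI[OF continuous_on_fst_comp[OF c]])
  have "integrable mu (\<lambda>x. (indicator ({-R..R} \<times> UNIV) x * (1 / L (fst x))) * v x)" for R
  proof -
    obtain B where B: "B \<ge> 0" "\<And>s y. \<bar>s\<bar> \<le> R \<Longrightarrow> norm y = 1 \<Longrightarrow> \<bar>1 / L (fst (s, y :: real^3))\<bar> \<le> B"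
      using slab_bounded[OF continuous_on_fst_comp[OF c], of R] by auto
    show ?thesis
    proof (rule slab_int_bounded_mult[OF v])
      show "(\<lambda>x::point. indicator ({-R..R} \<times> UNIV) x * (1 / L (fst x))) \<in> borel_measurable borel"
        by (intro borel_measurable_times cm borel_measurable_indicator borel_closed closed_Times) auto
      show "\<bar>indicator ({-R..R} \<times> UNIV) (s, y) * (1 / L (fst (s, y)))\<bar> \<le> B * indicator ({-R..R} \<times> UNIV) (s, y)"
        if "norm y = 1" for s and y :: "real^3"
        using B(2)[OF _ that, of s] by (auto simp: indicator_def abs_le_iff)
    qed
  qed
  moreover have "(\<lambda>x. v x / L (fst x)) \<in> borel_measurable borel"
    using borel_measurable_times[OF sq_int_measurable[OF assms] cm] by (simp add: divide_inverse)
  ultimately show ?thesis by (simp add: slab_int_def divide_inverse mult_ac)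
qed

lemma weak_lap_S2_eq:
  assumes a: "approx (cls (\<lambda>x. Re (u x))) w u' z la f" and u: "u \<in> L2" "AE x in mu. u x \<in> \<real>"
  shows "loc_integrable (weak_lap_S2 u)" "AE x in mu. weak_lap_S2 u x = of_real (rep la x / L (fst x))"
proof -
  let ?r = "\<lambda>x. rep la x / L (fst x)"
  let ?v = "\<lambda>x. complex_of_real (?r x)"
  have sr: "slab_int ?r" by (rule slab_int_div_L[OF rep_sq_int])
  have l: "loc_integrable ?v" by (rule loc_integrable_of_slab_int[OF sr])
  have wk: "weak_rel lap_S2 u ?v"
    unfolding weak_rel_def
  proof
    fix p assume p: "p \<in> test_functions"
    let ?a = "\<lambda>x. Re (p x)" and ?b = "\<lambda>x. Im (p x)"
    note t2 = test2_test_functions[OF p]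
    have lap: "lap_S2 p = cpx (lapX ?a) (lapX ?b)"
      using lap_S2_cpx[OF t2] unfolding cpx_Re_Im .
    have key: "inner (cls (lapX q)) (cls (\<lambda>x. Re (u x))) = (\<integral>x. q x * ?r x \<partial>mu)
        \<and> sq_int (lapX q) \<and> integrable mu (\<lambda>x. q x * ?r x)" if q: "test2 q" for q
    proof -
      have t: "C1 q" "slab_supp q" "\<And>e. C1 (Xe e q)" using q by (auto simp: test2_def)
      have qc: "continuous_on UNIV q" by (rule C1_continuous[OF t(1)])
      have "continuous_on UNIV (lapX q)" "slab_supp (lapX q)"
        unfolding lapX_def[abs_def] using t
        by (auto intro!: continuous_on_sum slab_supp_sum intro: C1_Xe_continuous slab_supp_Xe)
      then have sl: "sq_int (lapX q)" by (rule sq_int_slab_supp)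
      have "continuous_on UNIV (\<lambda>x. q x / L (fst x))"
        using L_pos by (intro continuous_on_divide qc L_fst_cont) (metis less_irrefl)
      moreover have "slab_supp (\<lambda>x. q x / L (fst x))"
        using slab_supp_mult1[OF t(2)] by (simp add: divide_inverse)
      ultimately have "sq_int (\<lambda>x. q x / L (fst x))" by (rule sq_int_slab_supp)
      from approx_weak_lapX[OF a t] inner_cls[OF this rep_sq_int[of la]]
      show ?thesis using sl slab_int_cont_mult[OF sr qc t(2)] by simp
    qed
    have z: "integrable mu (\<lambda>x. 0 :: real)" by simp
    show "L2_inner (lap_S2 p) u = L2_inner p ?v"
      unfolding lap L2_real_inner_cong[OF key[OF t2(1), THEN conjunct2, THEN conjunct1]
          key[OF t2(2), THEN conjunct2, THEN conjunct1] u]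
      using key[OF t2(1)] key[OF t2(2)] L2_inner_cpx[of ?a ?v ?b, unfolded cpx_Re_Im] by simp
  qed
  have "loc_integrable (weak_lap_S2 u) \<and> weak_rel lap_S2 u (weak_lap_S2 u)"
    unfolding weak_lap_S2_def by (rule someI[of _ ?v]) (use l wk in blast)
  then show "loc_integrable (weak_lap_S2 u)" "AE x in mu. weak_lap_S2 u x = of_real (rep la x / L (fst x))"
    using weak_rel_unique l wk by blast+
qed

text \<open>Lets the bounds for \<open>Gm\<close> and for the form of H be applied to differences of
  two times, which is how continuity of z in time is obtained.\<close>

lemma approx_diff:
  assumes "approx u1 w1 d1 z1 l1 f1" "approx u2 w2 d2 z2 l2 f2"
  shows "approx (u1 - u2) (w1 - w2) (d1 - d2) (z1 - z2) (l1 - l2) (\<lambda>n x. f1 n x - f2 n x)"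
proof -
  have f: "DD (f1 n)" "DD (f2 n)" for n using assms by (auto simp: approx_def)
  have e: "(\<lambda>x. L (fst x) * lapX (\<lambda>x. f1 n x - f2 n x) x)
      = (\<lambda>x. L (fst x) * lapX (f1 n) x - L (fst x) * lapX (f2 n) x)" for n
    by (simp add: lapX_diff[OF f] right_diff_distrib)
  show ?thesis
    unfolding approx_def e Hop_diff[OF f] Gm_diff[OF f] Dd_diff[OF DD_C1[OF f(1)] DD_C1[OF f(2)]]
      cls_diff[OF DD_sq_int[OF f(1)] DD_sq_int[OF f(2)]]
      cls_diff[OF Hop_sq_int[OF f(1)] Hop_sq_int[OF f(2)]]
      cls_diff[OF Gm_sq_int[OF f(1)] Gm_sq_int[OF f(2)]]
      cls_diff[OF DD_sq_int[OF DD_Dd[OF f(1)]] DD_sq_int[OF DD_Dd[OF f(2)]]]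
      cls_diff[OF L_lapX_sq_int[OF f(1)] L_lapX_sq_int[OF f(2)]]
    using assms by (auto simp: approx_def intro: DD_diff tendsto_diff)
qed

lemma approx_symmetric:
  assumes "approx u1 w1 d1 z1 l1 f1" "approx u2 w2 d2 z2 l2 f2"
  shows "inner w1 u2 = inner w2 u1"
proof -
  have f: "DD (f1 n)" "DD (f2 n)" for n using assms by (auto simp: approx_def)
  have l: "(\<lambda>n. cls (f1 n)) \<longlonglongrightarrow> u1" "(\<lambda>n. cls (Hop (f1 n))) \<longlonglongrightarrow> w1"
    "(\<lambda>n. cls (f2 n)) \<longlonglongrightarrow> u2" "(\<lambda>n. cls (Hop (f2 n))) \<longlonglongrightarrow> w2"
    using assms by (auto simp: approx_def)
  have "inner (cls (Hop (f1 n))) (cls (f2 n)) = inner (cls (Hop (f2 n))) (cls (f1 n))" for n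
    using Hop_symmetric[OF f, of n n] by (simp add: inner_cls Hop_sq_int f DD_sq_int mult.commute)
  then show ?thesis
    using LIMSEQ_unique[OF tendsto_inner[OF l(2,3)]] tendsto_inner[OF l(4,1)] by simp
qed

lemma approx_nonneg:
  assumes "approx u w d z la f"
  shows "0 \<le> inner w u"
proof -
  have f: "DD (f n)" for n using assms by (auto simp: approx_def)
  have l: "(\<lambda>n. cls (f n)) \<longlonglongrightarrow> u" "(\<lambda>n. cls (Hop (f n))) \<longlonglongrightarrow> w" using assms by (auto simp: approx_def)
  have "0 \<le> inner (cls (Hop (f n))) (cls (f n))" for n
    using Hop_nonneg[OF f[of n]] by (simp add: inner_cls Hop_sq_int f DD_sq_int)
  then show ?thesis by (intro LIMSEQ_le_const[OF tendsto_inner[OF l(2,1)]]) auto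
qed

end

section \<open>The cubic wave equation\<close>

lemma sq_int_cong_AE:
  assumes f: "sq_int f" and k: "k \<in> borel_measurable borel" and e: "AE x in mu. f x = k x"
  shows "sq_int k"
  unfolding sq_int_def
proof
  show "integrable mu (\<lambda>x. (k x)\<^sup>2)"
    by (rule integrable_cong_AE_imp[OF sq_int_integrable[OF f]])
      (use k e in \<open>auto simp: measurable_cong_sets[OF sets_mu refl] elim!: AE_mp\<close>)
qed (rule k)

lemma quartic_tangent: "4 * (b ^ 3 * (a - b)) \<le> a ^ 4 - (b::real) ^ 4"
proof -
  have "a ^ 4 - b ^ 4 - 4 * (b ^ 3 * (a - b)) = (a - b)\<^sup>2 * ((a + b)\<^sup>2 + 2 * b\<^sup>2)"
    by (simp add: eval_nat_numeral algebra_simps)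
  moreover have "0 \<le> (a - b)\<^sup>2 * ((a + b)\<^sup>2 + 2 * b\<^sup>2)" by simp
  ultimately show ?thesis by linarith
qed

context morawetz_op
begin

section \<open>The cubic term, its convexity and the flux\<close>

definition cub :: "l2 \<Rightarrow> l2" where
  "cub u = cls (\<lambda>x. L (fst x) * (rep u x) ^ 3)"

lemma cub_sq_int: "sq_int (\<lambda>x. (rep u x) ^ 3) \<Longrightarrow> sq_int (\<lambda>x. L (fst x) * (rep u x) ^ 3)"
  by (rule sq_int_bdd_coef[OF bdd_L])

lemma inner_cub:
  assumes "sq_int (\<lambda>x. (rep u x) ^ 3)"
  shows "inner (cub u) v = (\<integral>x. L (fst x) * (rep u x) ^ 3 * rep v x \<partial>mu)"
    and "integrable mu (\<lambda>x. L (fst x) * (rep u x) ^ 3 * rep v x)"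
  using inner_cls[OF cub_sq_int[OF assms] rep_sq_int[of v]]
    sq_int_mult_integrable[OF cub_sq_int[OF assms] rep_sq_int[of v]]
  by (simp_all add: cub_def)

text \<open>Integrated form of the tangent inequality for z^4: \<open>cub v\<close> is a subgradient
  of the quartic energy. Only integrability of u^3 v type products enters, so no continuity of the
  cube on L2 is required.\<close>

lemma cub_convex:
  assumes u: "sq_int (\<lambda>x. (rep u x) ^ 3)" and v: "sq_int (\<lambda>x. (rep v x) ^ 3)"
  shows "4 * inner (cub v) (u - v) \<le> inner (cub u) u - inner (cub v) v"
proof -
  note i = inner_cub(2)[OF u, of u] inner_cub(2)[OF v, of u] inner_cub(2)[OF v, of v]
  have "(\<integral>x. 4 * (L (fst x) * (rep v x) ^ 3 * rep u x - L (fst x) * (rep v x) ^ 3 * rep v x) \<partial>mu)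
      \<le> (\<integral>x. L (fst x) * (rep u x) ^ 3 * rep u x - L (fst x) * (rep v x) ^ 3 * rep v x \<partial>mu)"
  proof (rule integral_mono)
    fix x
    show "4 * (L (fst x) * (rep v x) ^ 3 * rep u x - L (fst x) * (rep v x) ^ 3 * rep v x)
      \<le> L (fst x) * (rep u x) ^ 3 * rep u x - L (fst x) * (rep v x) ^ 3 * rep v x"
      using mult_left_mono[OF quartic_tangent[of "rep v x" "rep u x"] L_nonneg[of "fst x"]]
      by (simp add: eval_nat_numeral algebra_simps)
  qed (intro integrable_mult_right Bochner_Integration.integrable_diff i)+
  then show ?thesis
    using i by (simp add: inner_diff_right inner_cub(1) u v)
qed

lemma cub_monotone:
  assumes u: "sq_int (\<lambda>x. (rep u x) ^ 3)" and v: "sq_int (\<lambda>x. (rep v x) ^ 3)"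
  shows "0 \<le> inner (cub u - cub v) (u - v)"
  using cub_convex[OF u v] cub_convex[OF v u] by (simp add: inner_diff_left inner_diff_right)

lemma cub_nonneg:
  assumes u: "sq_int (\<lambda>x. (rep u x) ^ 3)"
  shows "0 \<le> inner (cub u) u"
proof -
  have "L (fst x) * (rep u x) ^ 3 * rep u x = L (fst x) * ((rep u x)\<^sup>2)\<^sup>2" for x
    by (simp add: eval_nat_numeral mult.assoc)
  then have "0 \<le> L (fst x) * (rep u x) ^ 3 * rep u x" for x
    using L_nonneg by (simp only: mult_nonneg_nonneg zero_le_power2)
  then show ?thesis unfolding inner_cub(1)[OF u] by simp
qed

text \<open>A lower bound, at fixed time, for the pairing of the full operator with G u; its two
  nonnegative summands are the integrands of the two estimates up to constants.\<close>

definition flux :: "real \<Rightarrow> l2 \<Rightarrow> real" where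
  "flux lam u = inner (mulc wt u) u + lam * ((\<integral>x. wn (fst x) * (rep u x) ^ 4 \<partial>mu) / 4)"

lemma flux_nonneg:
  assumes "lam \<ge> 0"
  shows "0 \<le> inner (mulc wt u) u" "0 \<le> (\<integral>x. wn (fst x) * (rep u x) ^ 4 \<partial>mu)" "0 \<le> flux lam u"
proof -
  have "inner (mulc wt u) u = (\<integral>x. wt (fst x) * rep u x * rep u x \<partial>mu)"
    using inner_cls[OF sq_int_bdd_coef[OF bdd_wt rep_sq_int[of u]] rep_sq_int[of u]] by (simp add: mulc_def)
  then show 1: "0 \<le> inner (mulc wt u) u" using wt_nonneg by (simp add: mult.assoc)
  show 2: "0 \<le> (\<integral>x. wn (fst x) * (rep u x) ^ 4 \<partial>mu)" using wn_nonneg by simp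
  show "0 \<le> flux lam u" using 1 2 assms by (simp add: flux_def)
qed

text \<open>The factors 1/2 and 1/4 make w + lam * cub u its gradient, so it plays the role of F in
  the evolution identity.\<close>

definition potential_energy :: "real \<Rightarrow> l2 \<Rightarrow> l2 \<Rightarrow> real" where
  "potential_energy lam u w = inner w u / 2 + lam * (inner (cub u) u / 4)"

theorem flux_bound:
  fixes u v w :: "real \<Rightarrow> l2"
  assumes T: "0 \<le> T" and lam: "lam \<ge> 0" and d: "d \<ge> 0"
    and Hr: "\<And>t. t \<in> {0..T} \<Longrightarrow> Hrel (u t) (w t)"
    and u3: "\<And>t. t \<in> {0..T} \<Longrightarrow> sq_int (\<lambda>x. (rep (u t) x) ^ 3)"
    and du: "\<And>t. t \<in> {0..T} \<Longrightarrow> (u has_vector_derivative v t) (at t within {0..T})"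
    and dv: "\<And>t. t \<in> {0..T} \<Longrightarrow> (v has_vector_derivative - (w t + lam *\<^sub>R cub (u t))) (at t within {0..T})"
    and kc: "continuous_on {0..T} (\<lambda>t. w t + lam *\<^sub>R cub (u t))"
  shows "(\<integral>\<^sup>+t\<in>{0..T}. ennreal (d * flux lam (u t)) \<partial>lborel)
    \<le> ennreal (d * ((1 + 6 * K) * ((norm (v 0))\<^sup>2 + 2 * potential_energy lam (u 0) (w 0))))"
proof -
  \<comment> \<open>The core sequences at different times are chosen independently; continuity of z
    in time comes afterwards from the pairwise estimates.\<close>
  have "\<forall>t. \<exists>u' z la f. t \<in> {0..T} \<longrightarrow> approx (u t) (w t) u' z la f"
    using Hrel_approx[OF Hr] by metis
  then obtain u' z la f where a: "\<And>t. t \<in> {0..T} \<Longrightarrow> approx (u t) (w t) (u' t) (z t) (la t) (f t)"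
    by metis
  let ?k = "\<lambda>t. w t + lam *\<^sub>R cub (u t)"
  let ?F = "\<lambda>t. potential_energy lam (u t) (w t)"
  have low: "flux lam (u t) \<le> inner (?k t) (z t)" if t: "t \<in> {0..T}" for t
    using approx_morawetz[OF a[OF t]] mult_left_mono[OF approx_nonlinear[OF a[OF t] u3[OF t]] lam]
    unfolding flux_def cub_def[symmetric] inner_add_left inner_scaleR_left by linarith
  have "(\<integral>\<^sup>+t\<in>{0..T}. ennreal (d * inner (?k t) (z t)) \<partial>lborel)
    \<le> ennreal (d * ((1 + 6 * K) * ((norm (v 0))\<^sup>2 + 2 * ?F 0)))"
  \<comment> \<open>The constant is C = 6 K: the bound on \<open>Gm\<close> is 3 K times the form of
    H, of which the potential energy contains one half. For differences, monotonicity of the cubic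
    term allows w to be replaced by the full operator.\<close>
  proof (rule nn_integral_evolution_bound[OF T du dv kc])
    fix s t assume s: "s \<in> {0..T}" and t: "t \<in> {0..T}"
    show "inner (z s) (u t) = - inner (u s) (z t)" by (rule approx_antisymmetric[OF a[OF s] a[OF t]])
    have ds: "approx (u s - u t) (w s - w t) (u' s - u' t) (z s - z t) (la s - la t) (\<lambda>n x. f s n x - f t n x)"
      by (rule approx_diff[OF a[OF s] a[OF t]])
    have n0: "0 \<le> inner (w s - w t) (u s - u t)" by (rule approx_nonneg[OF ds])
    have m0: "0 \<le> lam * inner (cub (u s) - cub (u t)) (u s - u t)"
      using lam cub_monotone[OF u3[OF s] u3[OF t]] by (rule mult_nonneg_nonneg)
    have "?k s - ?k t = (w s - w t) + lam *\<^sub>R (cub (u s) - cub (u t))" by (simp add: scaleR_diff_right)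
    then have "inner (?k s - ?k t) (u s - u t)
        = inner (w s - w t) (u s - u t) + lam * inner (cub (u s) - cub (u t)) (u s - u t)"
      by (simp only: inner_add_left inner_scaleR_left)
    then have "3 * K * inner (w s - w t) (u s - u t) \<le> 6 * K * inner (?k s - ?k t) (u s - u t)"
      using n0 m0 K_nonneg by (intro mult_mono) auto
    then show "(norm (z s - z t))\<^sup>2 \<le> 6 * K * inner (?k s - ?k t) (u s - u t)"
      using approx_Gm_bound[OF ds] by linarith
    have sy: "inner (w s) (u t) = inner (w t) (u s)" by (rule approx_symmetric[OF a[OF s] a[OF t]])
    have "inner (w t) (u s - u t) \<le> inner (w s) (u s) / 2 - inner (w t) (u t) / 2"
      using n0 sy by (simp add: inner_diff_left inner_diff_right)
    moreover have "lam * inner (cub (u t)) (u s - u t)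
        \<le> lam * ((inner (cub (u s)) (u s) - inner (cub (u t)) (u t)) / 4)"
      using cub_convex[OF u3[OF s] u3[OF t]] by (intro mult_left_mono lam) simp
    ultimately show "inner (?k t) (u s - u t) \<le> ?F s - ?F t"
      unfolding potential_energy_def inner_add_left inner_scaleR_left
      by (simp add: diff_divide_distrib right_diff_distrib)
  next
    fix t assume t: "t \<in> {0..T}"
    have n: "0 \<le> inner (w t) (u t)" by (rule approx_nonneg[OF a[OF t]])
    have c: "0 \<le> lam * (inner (cub (u t)) (u t) / 4)" using lam cub_nonneg[OF u3[OF t]] by simp
    show "0 \<le> ?F t" using n c by (simp add: potential_energy_def)
    have "3 * K * inner (w t) (u t) = 6 * K * (inner (w t) (u t) / 2)" by simp
    also have "\<dots> \<le> 6 * K * ?F t"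
      using c K_nonneg unfolding potential_energy_def by (intro mult_left_mono) auto
    finally show "(norm (z t))\<^sup>2 \<le> 6 * K * ?F t" using approx_Gm_bound[OF a[OF t]] by linarith
    show "0 \<le> inner (?k t) (z t)" using low[OF t] flux_nonneg(3)[OF lam, of "u t"] by linarith
  qed (use K_nonneg d in auto)
  moreover have "(\<integral>\<^sup>+t\<in>{0..T}. ennreal (d * flux lam (u t)) \<partial>lborel)
      \<le> (\<integral>\<^sup>+t\<in>{0..T}. ennreal (d * inner (?k t) (z t)) \<partial>lborel)"
    using low d
    by (intro nn_integral_mono) (auto simp: indicator_def intro!: ennreal_leI mult_left_mono)
  ultimately show ?thesis by (rule order_trans[rotated])
qed

end

section \<open>From curves of complex fields to curves in the real Hilbert space\<close>

lemma L2_quotient: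
  assumes "f \<in> L2" "k \<in> L2" "l \<in> L2"
  shows "(\<lambda>x. (f x - k x) / of_real c - l x) \<in> L2"
proof -
  have s: "sq_int (\<lambda>x. (a x - b x) / c - d x)" if "sq_int a" "sq_int b" "sq_int d" for a b d
    using sq_int_diff[OF sq_int_scale[OF sq_int_diff[OF that(1,2)], of "1 / c"] that(3)] by simp
  show ?thesis using assms by (simp add: L2_iff s Re_divide_of_real Im_divide_of_real)
qed

lemma L2_diff: "f \<in> L2 \<Longrightarrow> k \<in> L2 \<Longrightarrow> (\<lambda>x. f x - k x) \<in> L2"
  by (simp add: L2_iff sq_int_diff)

text \<open>Taking real parts does not increase the norm, so the real part inherits the
  derivative.\<close>

lemma L2_deriv_cls:
  assumes d: "L2_deriv I u v' t" and u: "\<And>s. s \<in> I \<Longrightarrow> u s \<in> L2" and v: "v' \<in> L2" and t: "t \<in> I" and S: "S \<subseteq> I"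
  shows "((\<lambda>s. cls (\<lambda>x. Re (u s x))) has_vector_derivative cls (\<lambda>x. Re (v' x))) (at t within S)"
  unfolding has_vector_derivative_iff_norm
proof (rule Lim_null_comparison)
  show "((\<lambda>s. L2_norm (\<lambda>x. (u s x - u t x) / of_real (s - t) - v' x)) \<longlongrightarrow> 0) (at t within S)"
    using d unfolding L2_deriv_def by (rule tendsto_within_subset[OF _ S])
  show "\<forall>\<^sub>F s in at t within S. norm (norm ((cls (\<lambda>x. Re (u s x)) - cls (\<lambda>x. Re (u t x))) /\<^sub>R (s - t) - cls (\<lambda>x. Re (v' x))))
      \<le> L2_norm (\<lambda>x. (u s x - u t x) / of_real (s - t) - v' x)"
    unfolding eventually_at_filter
  proof (intro always_eventually allI impI)
    fix s assume "s \<noteq> t" "s \<in> S"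
    then have us: "u s \<in> L2" and ut: "u t \<in> L2" using S u t by auto
    note r = sq_int_Re_Im(1)[OF us] sq_int_Re_Im(1)[OF ut] sq_int_Re_Im(1)[OF v]
    have "(cls (\<lambda>x. Re (u s x)) - cls (\<lambda>x. Re (u t x))) /\<^sub>R (s - t) - cls (\<lambda>x. Re (v' x))
        = cls (\<lambda>x. inverse (s - t) * (Re (u s x) - Re (u t x)) - Re (v' x))"
      using r by (simp add: cls_diff cls_scale sq_int_diff sq_int_scale)
    also have "(\<lambda>x. inverse (s - t) * (Re (u s x) - Re (u t x)) - Re (v' x))
        = (\<lambda>x. Re ((u s x - u t x) / of_real (s - t) - v' x))"
      unfolding minus_complex.sel Re_divide_of_real by (simp add: divide_inverse mult.commute)
    finally show "norm (norm ((cls (\<lambda>x. Re (u s x)) - cls (\<lambda>x. Re (u t x))) /\<^sub>R (s - t) - cls (\<lambda>x. Re (v' x))))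
        \<le> L2_norm (\<lambda>x. (u s x - u t x) / of_real (s - t) - v' x)"
      using norm_cls_Re_le[OF L2_quotient[OF us ut v, of "s - t"]] by simp
  qed
qed

lemma L2_continuous_cls:
  assumes c: "L2_continuous I k" and k: "\<And>s. s \<in> I \<Longrightarrow> k s \<in> L2" and S: "S \<subseteq> I"
  shows "continuous_on S (\<lambda>s. cls (\<lambda>x. Re (k s x)))"
  unfolding continuous_on_def
proof (intro ballI)
  fix t assume t: "t \<in> S"
  have "((\<lambda>s. cls (\<lambda>x. Re (k s x)) - cls (\<lambda>x. Re (k t x))) \<longlongrightarrow> 0) (at t within S)"
  proof (rule Lim_null_comparison)
    show "((\<lambda>s. L2_norm (\<lambda>x. k s x - k t x)) \<longlongrightarrow> 0) (at t within S)"
      using c t S unfolding L2_continuous_def by (blast intro: tendsto_within_subset)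
    show "\<forall>\<^sub>F s in at t within S. norm (cls (\<lambda>x. Re (k s x)) - cls (\<lambda>x. Re (k t x))) \<le> L2_norm (\<lambda>x. k s x - k t x)"
      unfolding eventually_at_filter
    proof (intro always_eventually allI impI)
      fix s assume "s \<noteq> t" "s \<in> S"
      then have ks: "k s \<in> L2" and kt: "k t \<in> L2" using S k t by auto
      show "norm (cls (\<lambda>x. Re (k s x)) - cls (\<lambda>x. Re (k t x))) \<le> L2_norm (\<lambda>x. k s x - k t x)"
        using norm_cls_Re_le[OF L2_diff[OF ks kt]] cls_diff[OF sq_int_Re_Im(1)[OF ks] sq_int_Re_Im(1)[OF kt]] by simp
    qed
  qed
  then show "((\<lambda>s. cls (\<lambda>x. Re (k s x))) \<longlongrightarrow> cls (\<lambda>x. Re (k t x))) (at t within S)"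
    by (rule LIM_zero_cancel)
qed

lemma L2_inner_AE_real:
  assumes m: "a \<in> borel_measurable borel" "b \<in> borel_measurable borel"
      "\<alpha> \<in> borel_measurable borel" "\<gamma> \<in> borel_measurable borel"
    and e: "AE x in mu. a x = of_real (\<alpha> x)" "AE x in mu. b x = of_real (\<gamma> x)"
  shows "L2_inner a b = of_real (\<integral>x. \<alpha> x * \<gamma> x \<partial>mu)"
proof -
  note [measurable] = m
  have [measurable]: "(\<lambda>x. cnj (a x)) \<in> borel_measurable borel"
    by (rule measurable_compose[OF m(1)]) (auto intro!: borel_measurable_continuous_onI continuous_intros)
  have "L2_inner a b = (\<integral>x. complex_of_real (\<alpha> x * \<gamma> x) \<partial>mu)"
    unfolding L2_inner_def
  proof (rule integral_cong_AE)
    show "(\<lambda>x. cnj (a x) * b x) \<in> borel_measurable mu" "(\<lambda>x. complex_of_real (\<alpha> x * \<gamma> x)) \<in> borel_measurable mu"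
      unfolding measurable_cong_sets[OF sets_mu refl] by measurable
    show "AE x in mu. cnj (a x) * b x = complex_of_real (\<alpha> x * \<gamma> x)" using e by eventually_elim simp
  qed
  then show ?thesis unfolding integral_complex_of_real .
qed

locale schwarzschild_morawetz = schwarzschild M + morawetz_op "potV M" "potL M" V1 g g1 g2 g3 b b1 e c c1 wt wn K
  for M :: real and V1 g g1 g2 g3 b b1 e c c1 wt wn K
begin

lemma H_expr_cpx:
  assumes f: "DD f"
  shows "H_expr M (cpx f (\<lambda>x. 0)) = cpx (Hop f) (\<lambda>x. 0)"
proof -
  have z: "Ds (\<lambda>x. 0) = (\<lambda>x. 0)" "Xe w (\<lambda>x. 0) = (\<lambda>x. 0)" for w
    by (auto simp: Dd_def Xe_def frechet_derivative_const)
  have t0: "test2 (\<lambda>x. 0)" by (simp add: test2_def z C1_const slab_supp_def)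
  have l0: "lapX (\<lambda>x. 0) = (\<lambda>x. 0)" by (rule ext) (simp add: lapX_def z)
  have "d_rs (d_rs (cpx f (\<lambda>x. 0))) = cpx (Ds (Ds f)) (\<lambda>x. 0)"
    by (simp add: d_rs_cpx z C1_const DD_C1 DD_Dd f)
  then show ?thesis
    unfolding H_expr_def Hop_def lap_S2_cpx[OF test2_DD[OF f] t0] l0
    by (simp add: cpx_def fun_eq_iff complex_eq_iff)
qed

lemma dom_HD:
  assumes "u \<in> dom_H M"
  shows "u \<in> L2" "H M u \<in> L2" "weak_rel (H_expr M) u (H M u)"
proof -
  obtain y where y: "y \<in> L2 \<and> weak_rel (H_expr M) u y" and "u \<in> L2"
    using assms by (auto simp: dom_H_def op_dom_def)
  then show "u \<in> L2" by simp
  have "H M u \<in> L2 \<and> weak_rel (H_expr M) u (H M u)"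
    unfolding H_def op_app_def by (rule someI[of "\<lambda>v. v \<in> L2 \<and> weak_rel (H_expr M) u v", OF y])
  then show "H M u \<in> L2" "weak_rel (H_expr M) u (H M u)" by auto
qed

text \<open>Core functions are test functions, and the operator maps real functions to real
  functions, so the real part of the distributional relation involves real parts only.\<close>

lemma Hrel_dom_H:
  assumes u: "u \<in> dom_H M"
  shows "Hrel (cls (\<lambda>x. Re (u x))) (cls (\<lambda>x. Re (H M u x)))"
  unfolding Hrel_def
proof (intro allI impI)
  fix f assume f: "DD f"
  have "(\<lambda>x. of_real (f x)) = cpx f (\<lambda>x. 0)" by (auto simp: cpx_def complex_eq_iff)
  then have "cpx f (\<lambda>x. 0) \<in> test_functions" using smooth_of_DD[OF f] by simp
  then have "L2_inner (H_expr M (cpx f (\<lambda>x. 0))) u = L2_inner (cpx f (\<lambda>x. 0)) (H M u)"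
    using dom_HD(3)[OF u] by (simp add: weak_rel_def)
  then show "inner (cls (Hop f)) (cls (\<lambda>x. Re (u x))) = inner (cls f) (cls (\<lambda>x. Re (H M u x)))"
    unfolding H_expr_cpx[OF f]
      L2_inner_cpx_L2[OF Hop_sq_int[OF f] sq_int_zero dom_HD(1)[OF u]]
      L2_inner_cpx_L2[OF DD_sq_int[OF f] sq_int_zero dom_HD(2)[OF u]]
    by (simp add: cls_zero)
qed

text \<open>For p = 3 the weight (1 - 2 M / r) r^(1 - p) is exactly the coefficient of the spherical
  Laplacian, which is why the condition \<open>nonlinear\<close> on the cubic term is expressed
  through L.\<close>

lemma nonlin_eq: "nonlin M lam 3 u = (\<lambda>x. of_real (lam * potL M (fst x) * (norm (u x))\<^sup>2) * u x)"
proof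
  fix x :: point
  have "r_of M (fst x) > 0" using r_of(1)[of "fst x"] M by linarith
  then have "r_of M (fst x) powr (1 - real 3) = 1 / (r_of M (fst x))\<^sup>2"
    using powr_realpow[of "r_of M (fst x)" 2] powr_minus_divide[of "r_of M (fst x)" 2] by simp
  then show "nonlin M lam 3 u x = of_real (lam * potL M (fst x) * (norm (u x))\<^sup>2) * u x"
    by (simp add: nonlin_def potL_def)
qed

lemma rep_cube:
  assumes u: "u \<in> L2" and r: "AE x in mu. u x \<in> \<real>" and u3: "(\<lambda>x. u x ^ 3) \<in> L2"
  shows "AE x in mu. u x = of_real (rep (cls (\<lambda>x. Re (u x))) x)"
    and "sq_int (\<lambda>x. (rep (cls (\<lambda>x. Re (u x))) x) ^ 3)"
proof -
  let ?U = "cls (\<lambda>x. Re (u x))"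
  show e: "AE x in mu. u x = of_real (rep ?U x)"
    using rep_cls[OF sq_int_Re_Im(1)[OF u]] r by eventually_elim (simp add: of_real_Re)
  show "sq_int (\<lambda>x. (rep ?U x) ^ 3)"
  proof (rule sq_int_cong_AE[OF sq_int_Re_Im(1)[OF u3]])
    show "(\<lambda>x. (rep ?U x) ^ 3) \<in> borel_measurable borel"
      by (intro borel_measurable_power sq_int_measurable rep_sq_int)
    show "AE x in mu. Re (u x ^ 3) = (rep ?U x) ^ 3"
      using e by eventually_elim (simp flip: of_real_power)
  qed
qed

lemma cls_Hp:
  assumes u: "u \<in> dom_H M" and r: "AE x in mu. u x \<in> \<real>" and u3: "(\<lambda>x. u x ^ 3) \<in> L2" and Hp: "Hp M lam 3 u \<in> L2"
  shows "cls (\<lambda>x. Re (Hp M lam 3 u x)) = cls (\<lambda>x. Re (H M u x)) + lam *\<^sub>R cub (cls (\<lambda>x. Re (u x)))"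
proof -
  let ?U = "cls (\<lambda>x. Re (u x))"
  note rc = rep_cube[OF dom_HD(1)[OF u] r u3]
  note s = sq_int_Re_Im(1)[OF dom_HD(2)[OF u]] cub_sq_int[OF rc(2)]
  have "cls (\<lambda>x. Re (H M u x)) + lam *\<^sub>R cub ?U = cls (\<lambda>x. Re (H M u x) + lam * (potL M (fst x) * (rep ?U x) ^ 3))"
    using s by (simp add: cub_def cls_add cls_scale sq_int_scale)
  also have "\<dots> = cls (\<lambda>x. Re (Hp M lam 3 u x))"
  proof (subst cls_eq_iff)
    show "AE x in mu. Re (H M u x) + lam * (potL M (fst x) * (rep ?U x) ^ 3) = Re (Hp M lam 3 u x)"
      using rc(1)
    proof eventually_elim
      case (elim x)
      have "nonlin M lam 3 u x = of_real (lam * (potL M (fst x) * (rep ?U x) ^ 3))"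
        unfolding nonlin_eq using elim by (simp add: eval_nat_numeral)
      then show ?case by (simp add: Hp_def)
    qed
  qed (use s Hp in \<open>auto intro: sq_int_add sq_int_scale sq_int_Re_Im\<close>)
  finally show ?thesis ..
qed

end

context schwarzschild_morawetz
begin

text \<open>Each term of \<open>energy\<close> is identified with a term of
  \<open>approx_energy\<close> by the a.e. formulas for the chosen weak derivatives. It is an
  inequality because the left side keeps only the real part of h.\<close>

lemma potential_energy_le:
  assumes u: "u \<in> dom_H M" and r: "AE x in mu. u x \<in> \<real>" and u3: "(\<lambda>x. u x ^ 3) \<in> L2" and h: "h \<in> L2"
  shows "(norm (cls (\<lambda>x. Re (h x))))\<^sup>2
      + 2 * potential_energy lam (cls (\<lambda>x. Re (u x))) (cls (\<lambda>x. Re (H M u x))) \<le> energy M lam 3 u h"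
proof -
  define U where "U = cls (\<lambda>x. Re (u x))"
  define w where "w = cls (\<lambda>x. Re (H M u x))"
  note L2u = dom_HD(1)[OF u]
  note e = rep_cube(1)[OF L2u r u3, folded U_def] and c3 = rep_cube(2)[OF L2u r u3, folded U_def]
  obtain u' z la f where a: "approx (cls (\<lambda>x. Re (u x))) w u' z la f"
    using Hrel_approx[OF Hrel_dom_H[OF u]] unfolding w_def by blast
  note ds = weak_d_rs_eq[OF a L2u r] and lp = weak_lap_S2_eq[OF a L2u r]
  have um [measurable]: "u \<in> borel_measurable borel" by (rule L2_measurable[OF L2u])
  have rm [measurable]: "rep y \<in> borel_measurable borel" for y by (rule sq_int_measurable[OF rep_sq_int])
  have lm [measurable]: "weak_lap_S2 u \<in> borel_measurable borel" "weak_d_rs u \<in> borel_measurable borel"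
    using ds(1) lp(1) by (simp_all add: loc_integrable_def measurable_cong_sets[OF sets_mu refl])
  have Lm [measurable]: "(\<lambda>x::point. potL M (fst x)) \<in> borel_measurable borel"
      "(\<lambda>x::point. potV M (fst x)) \<in> borel_measurable borel"
    by (rule borel_measurable_continuous_onI, rule L_fst_cont V_fst_cont)+
  have "(L2_norm (weak_d_rs u))\<^sup>2 = (\<integral>x. (norm (weak_d_rs u x))\<^sup>2 \<partial>mu)"
    by (simp add: L2_norm_def)
  also have "\<dots> = (\<integral>x. (rep u' x)\<^sup>2 \<partial>mu)"
  proof (rule integral_cong_AE)
    show "(\<lambda>x. (norm (weak_d_rs u x))\<^sup>2) \<in> borel_measurable mu" "(\<lambda>x. (rep u' x)\<^sup>2) \<in> borel_measurable mu"
      unfolding measurable_cong_sets[OF sets_mu refl] by measurable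
    show "AE x in mu. (norm (weak_d_rs u x))\<^sup>2 = (rep u' x)\<^sup>2" using ds(2) by eventually_elim simp
  qed
  also have "\<dots> = (norm u')\<^sup>2" by (rule norm_rep[symmetric])
  finally have 1: "(L2_norm (weak_d_rs u))\<^sup>2 = (norm u')\<^sup>2" .
  have "L2_inner u (\<lambda>x. of_real (potV M (fst x)) * u x) = of_real (\<integral>x. rep U x * (potV M (fst x) * rep U x) \<partial>mu)"
  proof (rule L2_inner_AE_real)
    show "AE x in mu. of_real (potV M (fst x)) * u x = of_real (potV M (fst x) * rep U x)"
      using e by eventually_elim simp
  qed (use e in \<open>measurable\<close>)
  also have "(\<integral>x. rep U x * (potV M (fst x) * rep U x) \<partial>mu) = inner (mulc (potV M) U) U"
    using inner_cls[OF sq_int_bdd_coef[OF bdd_V rep_sq_int[of U]] rep_sq_int[of U]] by (simp add: mulc_def mult_ac)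
  finally have 2: "Re (L2_inner u (\<lambda>x. of_real (potV M (fst x)) * u x)) = inner (mulc (potV M) U) U" by simp
  have "L2_inner u (\<lambda>x. - of_real (potL M (fst x)) * weak_lap_S2 u x) = of_real (\<integral>x. rep U x * - rep la x \<partial>mu)"
  proof (rule L2_inner_AE_real)
    show "AE x in mu. - of_real (potL M (fst x)) * weak_lap_S2 u x = of_real (- rep la x)"
      using lp(2)
    proof eventually_elim
      case (elim x)
      then show ?case using L_pos[of "fst x"] by (simp add: complex_eq_iff)
    qed
  qed (use e in \<open>measurable\<close>)
  then have 3: "Re (L2_inner u (\<lambda>x. - of_real (potL M (fst x)) * weak_lap_S2 u x)) = - inner la U"
    by (simp add: inner_rep mult.commute)
  have "L2_inner u (nonlin M lam 3 u) = of_real (\<integral>x. rep U x * (lam * (potL M (fst x) * (rep U x) ^ 3)) \<partial>mu)"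
    unfolding nonlin_eq
  proof (rule L2_inner_AE_real)
    show "AE x in mu. of_real (lam * potL M (fst x) * (norm (u x))\<^sup>2) * u x
        = of_real (lam * (potL M (fst x) * (rep U x) ^ 3))"
      using e
    proof eventually_elim
      case (elim x)
      show ?case unfolding elim by (simp add: eval_nat_numeral)
    qed
  qed (use e in \<open>measurable\<close>)
  also have "(\<integral>x. rep U x * (lam * (potL M (fst x) * (rep U x) ^ 3)) \<partial>mu)
      = (\<integral>x. lam * (potL M (fst x) * (rep U x) ^ 3 * rep U x) \<partial>mu)" by (simp add: mult_ac)
  also have "\<dots> = lam * inner (cub U) U" by (simp add: inner_cub(1)[OF c3])
  finally have 4: "Re (L2_inner u (nonlin M lam 3 u)) = lam * inner (cub U) U" by simp
  have "(norm (cls (\<lambda>x. Re (h x))))\<^sup>2 \<le> (L2_norm h)\<^sup>2"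
    using norm_cls_Re_le[OF h] by (intro power_mono) auto
  moreover have "energy M lam 3 u h = (L2_norm h)\<^sup>2 + (norm u')\<^sup>2 + inner (mulc (potV M) U) U - inner la U
      + lam * inner (cub U) U / 2"
    unfolding energy_def 1 2 3 4 by simp
  moreover have "2 * potential_energy lam U w = inner w U + lam * inner (cub U) U / 2"
    by (simp add: potential_energy_def)
  moreover have "inner w U = (norm u')\<^sup>2 + inner (mulc (potV M) U) U - inner la U"
    using approx_energy[OF a] by (simp only: U_def)
  ultimately show ?thesis unfolding U_def[symmetric] w_def[symmetric] by linarith
qed

theorem solution_flux_bound:
  assumes I: "is_interval I" "0 \<in> I" and T: "T \<in> I" "0 \<le> T" and lam: "lam \<ge> 0" and d: "d \<ge> 0"
    and sol: "wave_solution M lam 3 I u v" and r: "\<And>t. t \<in> I \<Longrightarrow> AE x in mu. u t x \<in> \<real>"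
    and u3: "\<And>t. t \<in> I \<Longrightarrow> (\<lambda>x. u t x ^ 3) \<in> L2"
  shows "(\<integral>\<^sup>+t\<in>{0..T}. ennreal (d * flux lam (cls (\<lambda>x. Re (u t x)))) \<partial>lborel)
    \<le> ennreal (d * ((1 + 6 * K) * energy M lam 3 (u 0) (v 0)))"
    and "0 \<le> energy M lam 3 (u 0) (v 0)"
proof -
  have S: "{0..T} \<subseteq> I"
    using mem_is_interval_1_I[OF I T(1)] by auto
  have s: "u t \<in> dom_H M" "Hp M lam 3 (u t) \<in> L2" "v t \<in> L2"
      "L2_deriv I u (v t) t" "L2_deriv I v (\<lambda>x. - Hp M lam 3 (u t) x) t" if "t \<in> I" for t
    using sol that by (auto simp: wave_solution_def)
  let ?U = "\<lambda>t. cls (\<lambda>x. Re (u t x))" and ?V = "\<lambda>t. cls (\<lambda>x. Re (v t x))"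
    and ?w = "\<lambda>t. cls (\<lambda>x. Re (H M (u t) x))"
  have k: "cls (\<lambda>x. Re (Hp M lam 3 (u t) x)) = ?w t + lam *\<^sub>R cub (?U t)" if "t \<in> I" for t
    by (rule cls_Hp[OF s(1) r u3 s(2)]) (use that in auto)
  have "(\<integral>\<^sup>+t\<in>{0..T}. ennreal (d * flux lam (?U t)) \<partial>lborel)
      \<le> ennreal (d * ((1 + 6 * K) * ((norm (?V 0))\<^sup>2 + 2 * potential_energy lam (?U 0) (?w 0))))"
  proof (rule flux_bound[OF T(2) lam d])
    fix t assume "t \<in> {0..T}"
    then have t: "t \<in> I" using S by auto
    show "Hrel (?U t) (?w t)" by (rule Hrel_dom_H[OF s(1)[OF t]])
    show "sq_int (\<lambda>x. (rep (?U t) x) ^ 3)"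
      by (rule rep_cube(2)[OF dom_HD(1)[OF s(1)[OF t]] r[OF t] u3[OF t]])
    show "(?U has_vector_derivative ?V t) (at t within {0..T})"
      by (rule L2_deriv_cls[OF s(4)[OF t] dom_HD(1)[OF s(1)] s(3)[OF t] t S])
    have "(\<lambda>x. - Hp M lam 3 (u t) x) \<in> L2" using s(2)[OF t] by (simp add: L2_iff sq_int_minus)
    from L2_deriv_cls[OF s(5)[OF t] s(3) this t S]
    show "(?V has_vector_derivative - (?w t + lam *\<^sub>R cub (?U t))) (at t within {0..T})"
      unfolding k[OF t, symmetric] using cls_minus[OF sq_int_Re_Im(1)[OF s(2)[OF t]]] by simp
  next
    have "continuous_on {0..T} (\<lambda>t. cls (\<lambda>x. Re (Hp M lam 3 (u t) x)))"
      using sol s(2) S unfolding wave_solution_def by (intro L2_continuous_cls[where I = I]) auto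
    then show "continuous_on {0..T} (\<lambda>t. ?w t + lam *\<^sub>R cub (?U t))"
      by (rule continuous_on_eq) (use k S in blast)
  qed
  moreover have b: "(norm (?V 0))\<^sup>2 + 2 * potential_energy lam (?U 0) (?w 0) \<le> energy M lam 3 (u 0) (v 0)"
    by (rule potential_energy_le[OF s(1) r u3 s(3)]) (use I in auto)
  moreover have "0 \<le> potential_energy lam (?U 0) (?w 0)"
  proof -
    obtain u' z la f where a: "approx (?U 0) (?w 0) u' z la f"
      using Hrel_approx[OF Hrel_dom_H[OF s(1)[OF I(2)]]] by blast
    show ?thesis
      using approx_nonneg[OF a] lam
        cub_nonneg[OF rep_cube(2)[OF dom_HD(1)[OF s(1)[OF I(2)]] r[OF I(2)] u3[OF I(2)]]]
      by (simp add: potential_energy_def)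
  qed
  ultimately show "0 \<le> energy M lam 3 (u 0) (v 0)"
    and "(\<integral>\<^sup>+t\<in>{0..T}. ennreal (d * flux lam (?U t)) \<partial>lborel) \<le> ennreal (d * ((1 + 6 * K) * energy M lam 3 (u 0) (v 0)))"
    using K_nonneg d
    by (smt (verit) zero_le_power2, elim order_trans) (intro ennreal_leI mult_left_mono, auto)
qed

lemma weighted_norm_eq:
  assumes u: "u \<in> L2" and e: "AE x in mu. u x = of_real (rep U x)" and k: "continuous_on UNIV k"
    and kw: "\<And>s. wt s = d * (k s)\<^sup>2"
  shows "d * (L2_norm (\<lambda>x. of_real (k (fst x)) * u x))\<^sup>2 = inner (mulc wt U) U"
proof -
  have um [measurable]: "u \<in> borel_measurable borel" by (rule L2_measurable[OF u])
  have rm [measurable]: "rep y \<in> borel_measurable borel" for y by (rule sq_int_measurable[OF rep_sq_int])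
  have km [measurable]: "(\<lambda>x::point. k (fst x)) \<in> borel_measurable borel"
    by (rule borel_measurable_continuous_onI[OF continuous_on_fst_comp[OF k]])
  have "(L2_norm (\<lambda>x. of_real (k (fst x)) * u x))\<^sup>2 = (\<integral>x. (norm (of_real (k (fst x)) * u x))\<^sup>2 \<partial>mu)"
    by (simp add: L2_norm_def)
  also have "\<dots> = (\<integral>x. (k (fst x) * rep U x)\<^sup>2 \<partial>mu)"
  proof (rule integral_cong_AE)
    show "(\<lambda>x. (norm (of_real (k (fst x)) * u x))\<^sup>2) \<in> borel_measurable mu"
      "(\<lambda>x. (k (fst x) * rep U x)\<^sup>2) \<in> borel_measurable mu"
      unfolding measurable_cong_sets[OF sets_mu refl] by measurable
    show "AE x in mu. (norm (of_real (k (fst x)) * u x))\<^sup>2 = (k (fst x) * rep U x)\<^sup>2"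
      using e by eventually_elim (simp add: norm_mult power_mult_distrib)
  qed
  finally have "d * (L2_norm (\<lambda>x. of_real (k (fst x)) * u x))\<^sup>2 = (\<integral>x. d * (k (fst x) * rep U x)\<^sup>2 \<partial>mu)"
    by simp
  also have "\<dots> = (\<integral>x. wt (fst x) * rep U x * rep U x \<partial>mu)" by (simp add: kw power2_eq_square mult_ac)
  also have "\<dots> = inner (mulc wt U) U"
    using inner_cls[OF sq_int_bdd_coef[OF bdd_wt rep_sq_int[of U]] rep_sq_int[of U]] by (simp add: mulc_def)
  finally show ?thesis .
qed

text \<open>u^4 is the product of u^3 and u, both square integrable, so the nonnegative integral is
  finite and agrees with the Bochner integral in the flux.\<close>

lemma quartic_nn_integral:
  fixes u :: field
  assumes e: "AE x in mu. u x = of_real (rep U x)" and c: "sq_int (\<lambda>x. (rep U x) ^ 3)"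
    and lam: "lam \<ge> 0" and kw: "\<And>s. d * (lapse M s * r_of M s powr (- 4)) = wn s" and d: "d > 0"
  shows "(\<integral>\<^sup>+x. ennreal (lam * lapse M (fst x) * r_of M (fst x) powr (- 4) * norm (u x) ^ 4) \<partial>mu)
    = ennreal (lam / d * (\<integral>x. wn (fst x) * (rep U x) ^ 4 \<partial>mu))"
proof -
  have "(\<integral>\<^sup>+x. ennreal (lam * lapse M (fst x) * r_of M (fst x) powr (- 4) * norm (u x) ^ 4) \<partial>mu)
      = (\<integral>\<^sup>+x. ennreal (lam / d * (wn (fst x) * (rep U x) ^ 4)) \<partial>mu)"
  proof (rule nn_integral_cong_AE)
    show "AE x in mu. ennreal (lam * lapse M (fst x) * r_of M (fst x) powr (- 4) * norm (u x) ^ 4)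
        = ennreal (lam / d * (wn (fst x) * (rep U x) ^ 4))"
      using e
    proof eventually_elim
      case (elim x)
      have "norm (u x) ^ 4 = (rep U x) ^ 4" unfolding elim norm_of_real by simp
      then show ?case using d by (simp add: mult.assoc flip: kw)
    qed
  qed
  also have "\<dots> = ennreal (\<integral>x. lam / d * (wn (fst x) * (rep U x) ^ 4) \<partial>mu)"
  proof (rule nn_integral_eq_integral)
    have "integrable mu (\<lambda>x. wn (fst x) * (rep U x) ^ 3 * rep U x)"
      by (rule sq_int_mult_integrable[OF sq_int_bdd_coef[OF bdd_wn c] rep_sq_int])
    also have "(\<lambda>x. wn (fst x) * (rep U x) ^ 3 * rep U x) = (\<lambda>x. wn (fst x) * (rep U x) ^ 4)"
      by (simp add: eval_nat_numeral mult_ac)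
    finally show "integrable mu (\<lambda>x. lam / d * (wn (fst x) * (rep U x) ^ 4))" by (rule integrable_mult_right)
    show "AE x in mu. 0 \<le> lam / d * (wn (fst x) * (rep U x) ^ 4)"
      using lam d wn_nonneg by (intro always_eventually allI mult_nonneg_nonneg) auto
  qed
  finally show ?thesis by simp
qed

end

theorem theorem26:
  fixes M lam \<beta> \<sigma> :: real and p :: nat
  assumes "M > 0" and "p = 3" and "lam \<ge> 0" and "\<beta> > 3 / 2"
    and "1 / 2 < \<sigma>" and "\<sigma> < 3 / 2"
  shows "\<exists>C1 C2 :: real.
    \<forall>(I :: real set) (u :: real \<Rightarrow> field) (v :: real \<Rightarrow> field) (f :: field) (h :: field) (E :: real).
      is_interval I \<and> 0 \<in> I \<and>
      wave_solution M lam p I u v \<and>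
      (\<forall>t\<in>I. AE x in mu. u t x \<in> \<real>) \<and>
      (\<forall>t\<in>I. u t \<in> dom_Hp_gamma M lam p \<sigma>) \<and>
      u 0 = f \<and> v 0 = h \<and> E = energy M lam p f h \<longrightarrow>
      (\<forall>T\<in>I. T \<ge> 0 \<longrightarrow>
        (\<integral>\<^sup>+ t\<in>{0..T}.
            ennreal ((L2_norm (\<lambda>x. of_real
              ((1 + ((fst x - alpha_star M) / (2 * M))\<^sup>2) powr (- \<beta> / 2)) * u t x))\<^sup>2) \<partial>lborel)
          \<le> ennreal (C1 * sqrt E * (sqrt E + L2_norm f)) \<and>
        (\<integral>\<^sup>+ t\<in>{0..T}.
            (\<integral>\<^sup>+ x. ennreal (lam * lapse M (fst x) * r_of M (fst x) powr (- 1 - real p)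
                      * norm (u t x) ^ (p + 1)) \<partial>mu) \<partial>lborel)
          \<le> ennreal (C2 * sqrt E * (sqrt E + L2_norm f)))"
proof -
  \<comment> \<open>The hypothesis \<beta> > 3/2 becomes a > 1/2, the condition for a bounded
    primitive.\<close>
  define a where "a = \<beta> - 1"
  have "continuous_on UNIV (\<lambda>x::real. (1 + x\<^sup>2) powr (- a))"
    by (intro continuous_intros) (metis add_pos_nonneg less_irrefl zero_le_power2 zero_less_one)
  then obtain Z where Z: "\<And>x. (Z has_real_derivative (1 + x\<^sup>2) powr (- a)) (at x)"
    using antiderivative_exists by blast
  \<comment> \<open>Subtracting Z 0 places the change of sign at x = 0, the photon sphere.\<close>
  interpret multiplier M a "\<lambda>x. Z x - Z 0"
  proof
    show "M > 0" "a > 1 / 2" using assms by (simp_all add: a_def)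
    show "((\<lambda>x. Z x - Z 0) has_real_derivative (1 + x\<^sup>2) powr (- a)) (at x)" for x
      using DERIV_diff[OF Z DERIV_const[of "Z 0"], of x] by simp
  qed simp
  obtain V1 g g1 g2 g3 b b1 e c c1 K \<delta> where \<delta>: "\<delta> > 0"
    and mo: "morawetz_op (potV M) (potL M) V1 g g1 g2 g3 b b1 e c c1
      (\<lambda>s. \<delta> * ps s powr (- \<beta>)) (\<lambda>s. 5 / 8 * M * W s) K"
    using multiplier_exists[of \<beta>] by (auto simp: a_def)
  interpret mo: schwarzschild_morawetz M V1 g g1 g2 g3 b b1 e c c1 "\<lambda>s. \<delta> * ps s powr (- \<beta>)" "\<lambda>s. 5 / 8 * M * W s" K
    by (rule schwarzschild_morawetz.intro[OF schwarzschild_axioms mo])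
  have wt: "\<delta> * ps s powr (- \<beta>) = \<delta> * (ps s powr (- \<beta> / 2))\<^sup>2" for s
    by (simp add: power2_eq_square flip: powr_add)
  have wn: "5 / 8 * M * (lapse M s * r_of M s powr (- 4)) = 5 / 8 * M * W s" for s
  proof -
    have "r_of M s powr (- 4) = q s ^ 4"
      using powr_realpow[of "r_of M s" 4] r_of(1)[of s] M
      by (simp add: powr_minus_divide q_def power_one_over)
    then show ?thesis by (simp add: W_def lapse_q)
  qed
  \<comment> \<open>d1 undoes the factor \<delta> of the weight; d2 is 4 divided by 5/8 M, where the
    4 is the denominator of the quartic term in the flux.\<close>
  define d1 d2 where "d1 = 1 / \<delta>" and "d2 = 32 / (5 * M)"
  have d: "d1 \<ge> 0" "d2 \<ge> 0" "5 / 8 * M > 0" using \<delta> M by (simp_all add: d1_def d2_def)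
  let ?C1 = "d1 * (1 + 6 * K)" and ?C2 = "d2 * (1 + 6 * K)"
  show ?thesis
  proof (rule exI[of _ ?C1], rule exI[of _ ?C2], intro allI impI ballI)
    fix I u v f h E T
    assume "is_interval I \<and> 0 \<in> I \<and> wave_solution M lam p I u v \<and> (\<forall>t\<in>I. AE x in mu. u t x \<in> \<real>) \<and>
      (\<forall>t\<in>I. u t \<in> dom_Hp_gamma M lam p \<sigma>) \<and> u 0 = f \<and> v 0 = h \<and> E = energy M lam p f h"
    then have I: "is_interval I" "0 \<in> I" and sol: "wave_solution M lam 3 I u v"
      and r: "\<And>t. t \<in> I \<Longrightarrow> AE x in mu. u t x \<in> \<real>" and dom: "\<And>t. t \<in> I \<Longrightarrow> u t \<in> dom_H M \<and> (\<lambda>x. u t x ^ 3) \<in> L2"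
      and E: "E = energy M lam 3 (u 0) (v 0)"
      using assms(2) by (auto simp: dom_Hp_gamma_def)
    assume T: "T \<in> I" "0 \<le> T"
    let ?U = "\<lambda>t. cls (\<lambda>x. Re (u t x))"
    have S: "t \<in> I" if "t \<in> {0..T}" for t using mem_is_interval_1_I[OF I T(1)] that by auto
    have rc: "AE x in mu. u t x = of_real (rep (?U t) x)" "sq_int (\<lambda>x. (rep (?U t) x) ^ 3)" "u t \<in> L2"
      if "t \<in> {0..T}" for t
      using mo.rep_cube[OF mo.dom_HD(1) r] dom S[OF that] mo.dom_HD(1) by blast+
    have main: "(\<integral>\<^sup>+t\<in>{0..T}. ennreal (d * mo.flux lam (?U t)) \<partial>lborel) \<le> ennreal (d * ((1 + 6 * K) * E))"
      if "d \<ge> 0" for d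
      unfolding E by (rule mo.solution_flux_bound(1)[OF I T assms(3) that sol r]) (use dom in auto)
    have E0: "0 \<le> E"
      unfolding E by (rule mo.solution_flux_bound(2)[OF I T assms(3) d(1) sol r]) (use dom in auto)
    \<comment> \<open>The proof yields a multiple of E; the asserted form is weaker, by E = sqrt E *
      sqrt E and nonnegativity of the norm of f.\<close>
    have const: "ennreal (d * ((1 + 6 * K) * E)) \<le> ennreal (d * (1 + 6 * K) * sqrt E * (sqrt E + L2_norm f))"
      if "d \<ge> 0" for d
    proof (rule ennreal_leI)
      have "d * ((1 + 6 * K) * E) = d * (1 + 6 * K) * (sqrt E * sqrt E)" using E0 by simp
      also have "\<dots> \<le> d * (1 + 6 * K) * (sqrt E * (sqrt E + L2_norm f))"
        using E0 that mo.K_nonneg L2_norm_nonneg by (intro mult_left_mono) auto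
      finally show "d * ((1 + 6 * K) * E) \<le> d * (1 + 6 * K) * sqrt E * (sqrt E + L2_norm f)"
        by (simp add: mult.assoc)
    qed
    let ?Q = "\<lambda>t. \<integral>x. 5 / 8 * M * W (fst x) * (rep (?U t) x) ^ 4 \<partial>mu"
    note nn = mo.flux_nonneg[OF assms(3)]
    have "(L2_norm (\<lambda>x. of_real ((1 + ((fst x - alpha_star M) / (2 * M))\<^sup>2) powr (- \<beta> / 2)) * u t x))\<^sup>2
        \<le> d1 * mo.flux lam (?U t)" if t: "t \<in> {0..T}" for t
    proof -
      have "\<delta> * (L2_norm (\<lambda>x. of_real (ps (fst x) powr (- \<beta> / 2)) * u t x))\<^sup>2
          = inner (mulc (\<lambda>s. \<delta> * ps s powr (- \<beta>)) (?U t)) (?U t)"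
        by (rule mo.weighted_norm_eq[OF rc(3,1)[OF t] ps_powr_cont wt])
      also have "\<dots> \<le> mo.flux lam (?U t)"
        unfolding mo.flux_def using nn(2)[of "?U t"] assms(3) by simp
      finally have "(L2_norm (\<lambda>x. of_real (ps (fst x) powr (- \<beta> / 2)) * u t x))\<^sup>2 \<le> d1 * mo.flux lam (?U t)"
        using \<delta> by (simp add: d1_def field_simps)
      then show ?thesis by (simp only: ps_def xs_def)
    qed
    then have "(\<integral>\<^sup>+ t\<in>{0..T}. ennreal ((L2_norm (\<lambda>x. of_real
          ((1 + ((fst x - alpha_star M) / (2 * M))\<^sup>2) powr (- \<beta> / 2)) * u t x))\<^sup>2) \<partial>lborel)
        \<le> (\<integral>\<^sup>+t\<in>{0..T}. ennreal (d1 * mo.flux lam (?U t)) \<partial>lborel)"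
      by (intro nn_integral_mono) (auto simp: indicator_def intro!: ennreal_leI)
    also note main[OF d(1)]
    also note const[OF d(1)]
    finally have 1: "(\<integral>\<^sup>+ t\<in>{0..T}. ennreal ((L2_norm (\<lambda>x. of_real
          ((1 + ((fst x - alpha_star M) / (2 * M))\<^sup>2) powr (- \<beta> / 2)) * u t x))\<^sup>2) \<partial>lborel)
        \<le> ennreal (?C1 * sqrt E * (sqrt E + L2_norm f))" .
    have "(\<integral>\<^sup>+ x. ennreal (lam * lapse M (fst x) * r_of M (fst x) powr (- 1 - real p)
          * norm (u t x) ^ (p + 1)) \<partial>mu) \<le> ennreal (d2 * mo.flux lam (?U t))" if t: "t \<in> {0..T}" for t
    proof -
      have "(\<integral>\<^sup>+ x. ennreal (lam * lapse M (fst x) * r_of M (fst x) powr (- 4) * norm (u t x) ^ 4) \<partial>mu)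
          = ennreal (lam / (5 / 8 * M) * ?Q t)"
        by (rule mo.quartic_nn_integral[OF rc(1,2)[OF t] assms(3) wn d(3)])
      also have "lam / (5 / 8 * M) * ?Q t = d2 * (lam * (?Q t / 4))" using M by (simp add: d2_def field_simps)
      also have "ennreal \<dots> \<le> ennreal (d2 * mo.flux lam (?U t))"
        unfolding mo.flux_def using nn(1)[of "?U t"] d(2) by (intro ennreal_leI mult_left_mono) auto
      finally show ?thesis using assms(2) by simp
    qed
    then have "(\<integral>\<^sup>+ t\<in>{0..T}. (\<integral>\<^sup>+ x. ennreal (lam * lapse M (fst x) * r_of M (fst x) powr (- 1 - real p)
          * norm (u t x) ^ (p + 1)) \<partial>mu) \<partial>lborel)
        \<le> (\<integral>\<^sup>+t\<in>{0..T}. ennreal (d2 * mo.flux lam (?U t)) \<partial>lborel)"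
      by (intro nn_integral_mono) (auto simp: indicator_def)
    also note main[OF d(2)]
    also note const[OF d(2)]
    finally show "(\<integral>\<^sup>+ t\<in>{0..T}. ennreal ((L2_norm (\<lambda>x. of_real
          ((1 + ((fst x - alpha_star M) / (2 * M))\<^sup>2) powr (- \<beta> / 2)) * u t x))\<^sup>2) \<partial>lborel)
        \<le> ennreal (?C1 * sqrt E * (sqrt E + L2_norm f)) \<and>
        (\<integral>\<^sup>+ t\<in>{0..T}. (\<integral>\<^sup>+ x. ennreal (lam * lapse M (fst x) * r_of M (fst x) powr (- 1 - real p)
          * norm (u t x) ^ (p + 1)) \<partial>mu) \<partial>lborel)
        \<le> ennreal (?C2 * sqrt E * (sqrt E + L2_norm f))"
      using 1 by blast
  qed
qed

end
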